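(* Let $\mathcal{T}$ be a connected triangulated category with a Serre functor $\mathbb{S}$ and let $\mathcal{X}$ be a contravariantly finite rigid subcategory of $\mathcal{T}$. Then the following are equivalent. (i) $\mathcal{X}$ is $2$-cluster tilting. (ii) The pretriangulated category $\mathcal{T}/\mathcal{X}$ is abelian and $\mathbb{S}(\mathcal{X})=\mathcal{X}[2]$.
   Context: $\mathcal{T}$ is a Hom-finite $k$-linear triangulated category over a field $k$ with split idempotents and shift $[1]$; a Serre functor is a triangulated equivalence $\mathbb{S}:\mathcal{T}\to\mathcal{T}$ with natural bifunctorial isomorphisms $\mathrm{Hom}_k(\mathcal{T}(A,B),k)\cong\mathcal{T}(B,\mathbb{S}(A))$. Connected: $\mathcal{T}$ is not a direct product of two non-zero triangulated categories. Subcategories are full, additive, closed under isomorphisms and direct summands. $\mathcal{X}$ is contravariantly finite if every $A\in\mathcal{T}$ admits a map $X_A\to A$, $X_A\in\mathcal{X}$, with $\mathcal{T}(\mathcal{X},X_A)\to\mathcal{T}(\mathcal{X},A)$ surjective; covariantly finite is dual; functorially finite means both. $\mathcal{X}$ is rigid if $\mathcal{T}(\mathcal{X},\mathcal{X}[1])=0$. $\mathcal{X}$ is $2$-cluster tilting if it is functorially finite and $\{A\mid\mathcal{T}(\mathcal{X},A[1])=0\}=\mathcal{X}=\{A\mid\mathcal{T}(A,\mathcal{X}[1])=0\}$. $\mathcal{T}/\mathcal{X}$ is the factor category with the objects of $\mathcal{T}$ and morphisms those of $\mathcal{T}$ modulo maps factoring through an object of $\mathcal{X}$ (it carries a natural pretriangulated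 structure when $\mathcal{X}$ is functorially finite, but only its underlying additive category matters for being abelian).
   Formalization: The formal theorem also assumes that X is non-zero unless T is zero; without this the claim fails, e.g. for T = D^b(k) and X = 0, where (ii) holds (T is semisimple abelian and S(0) = 0[2]) but X is not 2-cluster tilting. *)

theory Defs
  imports "HOL-Algebra.Module" "HOL-Algebra.AbelCoset"
begin

section \<open>Vector spaces as modules over a field\<close>

definition linear_map ::
  "('k, 'r) ring_scheme \<Rightarrow> ('k, 'v, 's) module_scheme \<Rightarrow> ('k, 'w, 't) module_scheme \<Rightarrow> ('v \<Rightarrow> 'w) \<Rightarrow> bool"
  where "linear_map K V W h \<longleftrightarrow>
    h \<in> carrier V \<rightarrow> carrier W \<and>
    (\<forall>x\<in>carrier V. \<forall>y\<in>carrier V. h (x \<oplus>\<^bsub>V\<^esub> y) = h x \<oplus>\<^bsub>W\<^esub> h y) \<and>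
    (\<forall>a\<in>carrier K. \<forall>x\<in>carrier V. h (a \<odot>\<^bsub>V\<^esub> x) = a \<odot>\<^bsub>W\<^esub> h x)"

definition linear_iso ::
  "('k, 'r) ring_scheme \<Rightarrow> ('k, 'v, 's) module_scheme \<Rightarrow> ('k, 'w, 't) module_scheme \<Rightarrow> ('v \<Rightarrow> 'w) \<Rightarrow> bool"
  where "linear_iso K V W h \<longleftrightarrow> linear_map K V W h \<and> bij_betw h (carrier V) (carrier W)"

definition finite_dim :: "('k, 'r) ring_scheme \<Rightarrow> ('k, 'v, 's) module_scheme \<Rightarrow> bool"
  where "finite_dim K V \<longleftrightarrow>
    (\<exists>S. finite S \<and> S \<subseteq> carrier V \<and>
      (\<forall>v\<in>carrier V. \<exists>c\<in>S \<rightarrow> carrier K. v = finsum V (\<lambda>s. c s \<odot>\<^bsub>V\<^esub> s) S))"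

definition ring_as_module :: "('k, 'r) ring_scheme \<Rightarrow> ('k, 'k) module"
  where "ring_as_module K =
    \<lparr>carrier = carrier K, mult = mult K, one = one K, zero = zero K, add = add K,
     smult = mult K\<rparr>"

text \<open>The dual space. Functionals are made extensional on the carrier, so that HOL equality of
  functions is equality of functionals. The multiplicative fields of the record are irrelevant
  for modules.\<close>

definition dual_space :: "('k, 'r) ring_scheme \<Rightarrow> ('k, 'v, 's) module_scheme \<Rightarrow> ('k, 'v \<Rightarrow> 'k) module"
  where "dual_space K V =
    \<lparr>carrier = {\<xi> \<in> extensional (carrier V). linear_map K V (ring_as_module K) \<xi>},
     mult = undefined, one = undefined,
     zero = (\<lambda>x\<in>carrier V. \<zero>\<^bsub>K\<^esub>),
     add = (\<lambda>\<xi> \<eta>. \<lambda>x\<in>carrier V. \<xi> x \<oplus>\<^bsub>K\<^esub> \<eta> x),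
     smult = (\<lambda>a \<xi>. \<lambda>x\<in>carrier V. a \<otimes>\<^bsub>K\<^esub> \<xi> x)\<rparr>"


section \<open>Linear categories\<close>

text \<open>Addition and scalar multiplication are total functions on the type of arrows, meaningful on
  parallel arrows only; \<open>Cmp C g f\<close> is "g after f", meaningful if the codomain of \<open>f\<close> is the
  domain of \<open>g\<close>.\<close>

record ('k, 'o, 'm) lincat =
  Obj :: "'o set"
  Arr :: "'m set"
  Dom :: "'m \<Rightarrow> 'o"
  Cod :: "'m \<Rightarrow> 'o"
  Idn :: "'o \<Rightarrow> 'm"
  Cmp :: "'m \<Rightarrow> 'm \<Rightarrow> 'm"  (infixr "\<cdot>\<index>" 70)
  Zer :: "'o \<Rightarrow> 'o \<Rightarrow> 'm"
  Add :: "'m \<Rightarrow> 'm \<Rightarrow> 'm"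
  Scl :: "'k \<Rightarrow> 'm \<Rightarrow> 'm"

definition homset :: "('k, 'o, 'm, 'z) lincat_scheme \<Rightarrow> 'o \<Rightarrow> 'o \<Rightarrow> 'm set"
  where "homset C A B = {f \<in> Arr C. Dom C f = A \<and> Cod C f = B}"

definition Hom :: "('k, 'o, 'm, 'z) lincat_scheme \<Rightarrow> 'o \<Rightarrow> 'o \<Rightarrow> ('k, 'm) module"
  where "Hom C A B =
    \<lparr>carrier = homset C A B, mult = undefined, one = undefined,
     zero = Zer C A B, add = Add C, smult = Scl C\<rparr>"

locale linear_category = field K
  for K :: "('k, 'r) ring_scheme" (structure) and C :: "('k, 'o, 'm, 'z) lincat_scheme" +
  assumes Dom_in_Obj: "f \<in> Arr C \<Longrightarrow> Dom C f \<in> Obj C"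
    and Cod_in_Obj: "f \<in> Arr C \<Longrightarrow> Cod C f \<in> Obj C"
    and Idn_in_hom: "A \<in> Obj C \<Longrightarrow> Idn C A \<in> homset C A A"
    and Cmp_in_hom: "f \<in> homset C A B \<Longrightarrow> g \<in> homset C B D \<Longrightarrow> g \<cdot>\<^bsub>C\<^esub> f \<in> homset C A D"
    and Cmp_Idn_right: "f \<in> homset C A B \<Longrightarrow> f \<cdot>\<^bsub>C\<^esub> Idn C A = f"
    and Cmp_Idn_left: "f \<in> homset C A B \<Longrightarrow> Idn C B \<cdot>\<^bsub>C\<^esub> f = f"
    and Cmp_assoc: "f \<in> homset C A B \<Longrightarrow> g \<in> homset C B D \<Longrightarrow> h \<in> homset C D E
      \<Longrightarrow> (h \<cdot>\<^bsub>C\<^esub> g) \<cdot>\<^bsub>C\<^esub> f = h \<cdot>\<^bsub>C\<^esub> (g \<cdot>\<^bsub>C\<^esub> f)"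
    and Hom_module: "A \<in> Obj C \<Longrightarrow> B \<in> Obj C \<Longrightarrow> module K (Hom C A B)"
    and post_linear: "g \<in> homset C B D \<Longrightarrow> A \<in> Obj C
      \<Longrightarrow> linear_map K (Hom C A B) (Hom C A D) (\<lambda>f. g \<cdot>\<^bsub>C\<^esub> f)"
    and pre_linear: "f \<in> homset C A B \<Longrightarrow> D \<in> Obj C
      \<Longrightarrow> linear_map K (Hom C B D) (Hom C A D) (\<lambda>g. g \<cdot>\<^bsub>C\<^esub> f)"

definition iso_arr :: "('k, 'o, 'm, 'z) lincat_scheme \<Rightarrow> 'o \<Rightarrow> 'o \<Rightarrow> 'm \<Rightarrow> bool"
  where "iso_arr C A B f \<longleftrightarrow> f \<in> homset C A B \<and>
    (\<exists>g\<in>homset C B A. g \<cdot>\<^bsub>C\<^esub> f = Idn C A \<and> f \<cdot>\<^bsub>C\<^esub> g = Idn C B)"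

definition isomorphic :: "('k, 'o, 'm, 'z) lincat_scheme \<Rightarrow> 'o \<Rightarrow> 'o \<Rightarrow> bool"
  where "isomorphic C A B \<longleftrightarrow> A \<in> Obj C \<and> B \<in> Obj C \<and> (\<exists>f. iso_arr C A B f)"

definition zero_object :: "('k, 'o, 'm, 'z) lincat_scheme \<Rightarrow> 'o \<Rightarrow> bool"
  where "zero_object C Z \<longleftrightarrow> Z \<in> Obj C \<and>
    (\<forall>A\<in>Obj C. (\<exists>!f. f \<in> homset C A Z) \<and> (\<exists>!f. f \<in> homset C Z A))"

definition biproduct :: "('k, 'o, 'm, 'z) lincat_scheme \<Rightarrow> 'o \<Rightarrow> 'o \<Rightarrow> 'o \<Rightarrow> bool"
  where "biproduct C A B P \<longleftrightarrow> A \<in> Obj C \<and> B \<in> Obj C \<and> P \<in> Obj C \<and>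
    (\<exists>i\<in>homset C A P. \<exists>j\<in>homset C B P. \<exists>p\<in>homset C P A. \<exists>q\<in>homset C P B.
      p \<cdot>\<^bsub>C\<^esub> i = Idn C A \<and> q \<cdot>\<^bsub>C\<^esub> j = Idn C B \<and>
      p \<cdot>\<^bsub>C\<^esub> j = Zer C B A \<and> q \<cdot>\<^bsub>C\<^esub> i = Zer C A B \<and>
      Add C (i \<cdot>\<^bsub>C\<^esub> p) (j \<cdot>\<^bsub>C\<^esub> q) = Idn C P)"

locale additive_category = linear_category +
  assumes ex_zero_object: "\<exists>Z. zero_object C Z"
    and ex_biproduct: "A \<in> Obj C \<Longrightarrow> B \<in> Obj C \<Longrightarrow> \<exists>P. biproduct C A B P"

definition hom_finite :: "('k, 'r) ring_scheme \<Rightarrow> ('k, 'o, 'm, 'z) lincat_scheme \<Rightarrow> bool"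
  where "hom_finite K C \<longleftrightarrow> (\<forall>A\<in>Obj C. \<forall>B\<in>Obj C. finite_dim K (Hom C A B))"

definition split_idempotents :: "('k, 'o, 'm, 'z) lincat_scheme \<Rightarrow> bool"
  where "split_idempotents C \<longleftrightarrow>
    (\<forall>A\<in>Obj C. \<forall>e\<in>homset C A A. e \<cdot>\<^bsub>C\<^esub> e = e \<longrightarrow>
      (\<exists>B\<in>Obj C. \<exists>p\<in>homset C A B. \<exists>i\<in>homset C B A.
        i \<cdot>\<^bsub>C\<^esub> p = e \<and> p \<cdot>\<^bsub>C\<^esub> i = Idn C B))"


section \<open>Abelian categories\<close>

definition mono_arr :: "('k, 'o, 'm, 'z) lincat_scheme \<Rightarrow> 'm \<Rightarrow> bool"
  where "mono_arr C f \<longleftrightarrow> f \<in> Arr C \<and>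
    (\<forall>W\<in>Obj C. \<forall>g\<in>homset C W (Dom C f). \<forall>h\<in>homset C W (Dom C f).
      f \<cdot>\<^bsub>C\<^esub> g = f \<cdot>\<^bsub>C\<^esub> h \<longrightarrow> g = h)"

definition epi_arr :: "('k, 'o, 'm, 'z) lincat_scheme \<Rightarrow> 'm \<Rightarrow> bool"
  where "epi_arr C f \<longleftrightarrow> f \<in> Arr C \<and>
    (\<forall>W\<in>Obj C. \<forall>g\<in>homset C (Cod C f) W. \<forall>h\<in>homset C (Cod C f) W.
      g \<cdot>\<^bsub>C\<^esub> f = h \<cdot>\<^bsub>C\<^esub> f \<longrightarrow> g = h)"

definition kernel_of :: "('k, 'o, 'm, 'z) lincat_scheme \<Rightarrow> 'm \<Rightarrow> 'm \<Rightarrow> bool"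
  where "kernel_of C f k \<longleftrightarrow> f \<in> Arr C \<and> k \<in> Arr C \<and> Cod C k = Dom C f \<and>
    f \<cdot>\<^bsub>C\<^esub> k = Zer C (Dom C k) (Cod C f) \<and>
    (\<forall>W\<in>Obj C. \<forall>g\<in>homset C W (Dom C f). f \<cdot>\<^bsub>C\<^esub> g = Zer C W (Cod C f) \<longrightarrow>
      (\<exists>!u. u \<in> homset C W (Dom C k) \<and> k \<cdot>\<^bsub>C\<^esub> u = g))"

definition cokernel_of :: "('k, 'o, 'm, 'z) lincat_scheme \<Rightarrow> 'm \<Rightarrow> 'm \<Rightarrow> bool"
  where "cokernel_of C f c \<longleftrightarrow> f \<in> Arr C \<and> c \<in> Arr C \<and> Dom C c = Cod C f \<and>
    c \<cdot>\<^bsub>C\<^esub> f = Zer C (Dom C f) (Cod C c) \<and>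
    (\<forall>W\<in>Obj C. \<forall>g\<in>homset C (Cod C f) W. g \<cdot>\<^bsub>C\<^esub> f = Zer C (Dom C f) W \<longrightarrow>
      (\<exists>!u. u \<in> homset C (Cod C c) W \<and> u \<cdot>\<^bsub>C\<^esub> c = g))"

locale abelian_category = additive_category +
  assumes ex_kernel: "f \<in> Arr C \<Longrightarrow> \<exists>k. kernel_of C f k"
    and ex_cokernel: "f \<in> Arr C \<Longrightarrow> \<exists>c. cokernel_of C f c"
    and mono_is_kernel: "mono_arr C f \<Longrightarrow> \<exists>g. kernel_of C g f"
    and epi_is_cokernel: "epi_arr C f \<Longrightarrow> \<exists>g. cokernel_of C g f"


section \<open>Functors\<close>

record ('o, 'm, 'p, 'n) fctr =
  FO :: "'o \<Rightarrow> 'p"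
  FA :: "'m \<Rightarrow> 'n"

definition fctr_id :: "('o, 'm, 'o, 'm) fctr"
  where "fctr_id = \<lparr>FO = (\<lambda>A. A), FA = (\<lambda>f. f)\<rparr>"

definition fctr_comp :: "('p, 'n, 'q, 'l) fctr \<Rightarrow> ('o, 'm, 'p, 'n) fctr \<Rightarrow> ('o, 'm, 'q, 'l) fctr"
  where "fctr_comp G F = \<lparr>FO = (\<lambda>A. FO G (FO F A)), FA = (\<lambda>f. FA G (FA F f))\<rparr>"

definition linear_functor ::
  "('k, 'r) ring_scheme \<Rightarrow> ('k, 'o, 'm, 'z) lincat_scheme \<Rightarrow> ('k, 'p, 'n, 'y) lincat_scheme
    \<Rightarrow> ('o, 'm, 'p, 'n) fctr \<Rightarrow> bool"
  where "linear_functor K C D F \<longleftrightarrow>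
    (\<forall>A\<in>Obj C. FO F A \<in> Obj D \<and> FA F (Idn C A) = Idn D (FO F A)) \<and>
    (\<forall>A\<in>Obj C. \<forall>B\<in>Obj C.
      linear_map K (Hom C A B) (Hom D (FO F A) (FO F B)) (FA F)) \<and>
    (\<forall>A\<in>Obj C. \<forall>B\<in>Obj C. \<forall>E\<in>Obj C. \<forall>f\<in>homset C A B. \<forall>g\<in>homset C B E.
      FA F (g \<cdot>\<^bsub>C\<^esub> f) = FA F g \<cdot>\<^bsub>D\<^esub> FA F f)"

definition natural_iso ::
  "('k, 'o, 'm, 'z) lincat_scheme \<Rightarrow> ('k, 'p, 'n, 'y) lincat_scheme
    \<Rightarrow> ('o, 'm, 'p, 'n) fctr \<Rightarrow> ('o, 'm, 'p, 'n) fctr \<Rightarrow> ('o \<Rightarrow> 'n) \<Rightarrow> bool"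
  where "natural_iso C D F G \<eta> \<longleftrightarrow>
    (\<forall>A\<in>Obj C. iso_arr D (FO F A) (FO G A) (\<eta> A)) \<and>
    (\<forall>A\<in>Obj C. \<forall>B\<in>Obj C. \<forall>f\<in>homset C A B. \<eta> B \<cdot>\<^bsub>D\<^esub> FA F f = FA G f \<cdot>\<^bsub>D\<^esub> \<eta> A)"

definition linear_equivalence ::
  "('k, 'r) ring_scheme \<Rightarrow> ('k, 'o, 'm, 'z) lincat_scheme \<Rightarrow> ('k, 'p, 'n, 'y) lincat_scheme
    \<Rightarrow> ('o, 'm, 'p, 'n) fctr \<Rightarrow> bool"
  where "linear_equivalence K C D F \<longleftrightarrow> linear_functor K C D F \<and>
    (\<exists>G \<eta> \<epsilon>. linear_functor K D C G \<and>
      natural_iso C C fctr_id (fctr_comp G F) \<eta> \<and>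
      natural_iso D D (fctr_comp F G) fctr_id \<epsilon>)"


section \<open>Triangulated categories\<close>

text \<open>A triangle \<open>A \<rightarrow> B \<rightarrow> C \<rightarrow> A[1]\<close> is given by its three arrows. The shift is only required to be
  an autoequivalence, which includes the case of an automorphism.\<close>

record ('k, 'o, 'm) tricat = "('k, 'o, 'm) lincat" +
  Shift :: "('o, 'm, 'o, 'm) fctr"
  Dist :: "('m \<times> 'm \<times> 'm) set"

definition sh :: "('k, 'o, 'm, 'z) tricat_scheme \<Rightarrow> 'o \<Rightarrow> 'o"
  where "sh T A = FO (Shift T) A"

definition shA :: "('k, 'o, 'm, 'z) tricat_scheme \<Rightarrow> 'm \<Rightarrow> 'm"
  where "shA T f = FA (Shift T) f"

definition triangle ::
  "('k, 'o, 'm, 'z) tricat_scheme \<Rightarrow> 'o \<Rightarrow> 'o \<Rightarrow> 'o \<Rightarrow> 'm \<times> 'm \<times> 'm \<Rightarrow> bool"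
  where "triangle T A B C t \<longleftrightarrow> (case t of (f, g, h) \<Rightarrow>
    A \<in> Obj T \<and> B \<in> Obj T \<and> C \<in> Obj T \<and>
    f \<in> homset T A B \<and> g \<in> homset T B C \<and> h \<in> homset T C (sh T A))"

definition dtriangle ::
  "('k, 'o, 'm, 'z) tricat_scheme \<Rightarrow> 'o \<Rightarrow> 'o \<Rightarrow> 'o \<Rightarrow> 'm \<Rightarrow> 'm \<Rightarrow> 'm \<Rightarrow> bool"
  where "dtriangle T A B C f g h \<longleftrightarrow> triangle T A B C (f, g, h) \<and> (f, g, h) \<in> Dist T"

locale triangulated_category = additive_category K T
  for K :: "('k, 'r) ring_scheme" (structure) and T :: "('k, 'o, 'm, 'z) tricat_scheme" +
  assumes shift_equivalence: "linear_equivalence K T T (Shift T)"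
    and Dist_triangle: "t \<in> Dist T \<Longrightarrow> \<exists>A B C. triangle T A B C t"
    and Dist_iso: "\<lbrakk>dtriangle T A B C f g h; triangle T A' B' C' (f', g', h');
        iso_arr T A A' a; iso_arr T B B' b; iso_arr T C C' c;
        b \<cdot>\<^bsub>T\<^esub> f = f' \<cdot>\<^bsub>T\<^esub> a; c \<cdot>\<^bsub>T\<^esub> g = g' \<cdot>\<^bsub>T\<^esub> b; shA T a \<cdot>\<^bsub>T\<^esub> h = h' \<cdot>\<^bsub>T\<^esub> c\<rbrakk>
      \<Longrightarrow> (f', g', h') \<in> Dist T"
    and TR1_id: "A \<in> Obj T \<Longrightarrow> zero_object T Z \<Longrightarrow> (Idn T A, Zer T A Z, Zer T Z (sh T A)) \<in> Dist T"
    and TR1_cone: "f \<in> homset T A B \<Longrightarrow> \<exists>C g h. dtriangle T A B C f g h"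
    and TR2: "triangle T A B C (f, g, h) \<Longrightarrow>
      (f, g, h) \<in> Dist T \<longleftrightarrow> (g, h, \<ominus>\<^bsub>Hom T (sh T A) (sh T B)\<^esub> shA T f) \<in> Dist T"
    and TR3: "\<lbrakk>dtriangle T A B C f g h; dtriangle T A' B' C' f' g' h';
        a \<in> homset T A A'; b \<in> homset T B B'; b \<cdot>\<^bsub>T\<^esub> f = f' \<cdot>\<^bsub>T\<^esub> a\<rbrakk>
      \<Longrightarrow> \<exists>c\<in>homset T C C'. c \<cdot>\<^bsub>T\<^esub> g = g' \<cdot>\<^bsub>T\<^esub> b \<and> shA T a \<cdot>\<^bsub>T\<^esub> h = h' \<cdot>\<^bsub>T\<^esub> c"
    and TR4: "\<lbrakk>dtriangle T A B D f f' f''; dtriangle T B C F g g' g'';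
        dtriangle T A C E (g \<cdot>\<^bsub>T\<^esub> f) h' h''\<rbrakk>
      \<Longrightarrow> \<exists>u v. dtriangle T D E F u v (shA T f' \<cdot>\<^bsub>T\<^esub> g'') \<and>
          u \<cdot>\<^bsub>T\<^esub> f' = h' \<cdot>\<^bsub>T\<^esub> g \<and> h'' \<cdot>\<^bsub>T\<^esub> u = f'' \<and>
          v \<cdot>\<^bsub>T\<^esub> h' = g' \<and> g'' \<cdot>\<^bsub>T\<^esub> v = shA T f \<cdot>\<^bsub>T\<^esub> h''"

definition triangle_functor ::
  "('k, 'r) ring_scheme \<Rightarrow> ('k, 'o, 'm, 'z) tricat_scheme \<Rightarrow> ('k, 'p, 'n, 'y) tricat_scheme
    \<Rightarrow> ('o, 'm, 'p, 'n) fctr \<Rightarrow> bool"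
  where "triangle_functor K T U F \<longleftrightarrow> linear_functor K T U F \<and>
    (\<exists>\<theta>. natural_iso T U (fctr_comp F (Shift T)) (fctr_comp (Shift U) F) \<theta> \<and>
      (\<forall>A B C f g h. dtriangle T A B C f g h \<longrightarrow>
        (FA F f, FA F g, \<theta> A \<cdot>\<^bsub>U\<^esub> FA F h) \<in> Dist U))"

definition triangle_equivalence ::
  "('k, 'r) ring_scheme \<Rightarrow> ('k, 'o, 'm, 'z) tricat_scheme \<Rightarrow> ('k, 'p, 'n, 'y) tricat_scheme
    \<Rightarrow> ('o, 'm, 'p, 'n) fctr \<Rightarrow> bool"
  where "triangle_equivalence K T U F \<longleftrightarrow> triangle_functor K T U F \<and> linear_equivalence K T U F"

definition product_tricat ::
  "('k, 'o, 'm) tricat \<Rightarrow> ('k, 'p, 'n) tricat \<Rightarrow> ('k, 'o \<times> 'p, 'm \<times> 'n) tricat"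
  where "product_tricat T U =
    \<lparr>Obj = Obj T \<times> Obj U,
     Arr = Arr T \<times> Arr U,
     Dom = map_prod (Dom T) (Dom U),
     Cod = map_prod (Cod T) (Cod U),
     Idn = map_prod (Idn T) (Idn U),
     Cmp = (\<lambda>(g, g') (f, f'). (g \<cdot>\<^bsub>T\<^esub> f, g' \<cdot>\<^bsub>U\<^esub> f')),
     Zer = (\<lambda>(A, A') (B, B'). (Zer T A B, Zer U A' B')),
     Add = (\<lambda>(f, f') (g, g'). (Add T f g, Add U f' g')),
     Scl = (\<lambda>a. map_prod (Scl T a) (Scl U a)),
     Shift = \<lparr>FO = map_prod (sh T) (sh U), FA = map_prod (shA T) (shA U)\<rparr>,
     Dist = {((f, f'), (g, g'), (h, h')) | f f' g g' h h'.
       (f, g, h) \<in> Dist T \<and> (f', g', h') \<in> Dist U}\<rparr>"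

definition nonzero_category :: "('k, 'o, 'm, 'z) lincat_scheme \<Rightarrow> bool"
  where "nonzero_category C \<longleftrightarrow> (\<exists>A\<in>Obj C. \<not> zero_object C A)"

text \<open>HOL cannot quantify over the types of the two factors. Taking them to be the types of \<open>T\<close> loses
  nothing, since each factor of \<open>T\<close> is equivalent to a full subcategory of \<open>T\<close>.\<close>

definition connected_tricat :: "('k, 'r) ring_scheme \<Rightarrow> ('k, 'o, 'm) tricat \<Rightarrow> bool"
  where "connected_tricat K T \<longleftrightarrow>
    \<not> (\<exists>(T1 :: ('k, 'o, 'm) tricat) (T2 :: ('k, 'o, 'm) tricat) F.
        triangulated_category K T1 \<and> nonzero_category T1 \<and>
        triangulated_category K T2 \<and> nonzero_category T2 \<and>
        triangle_equivalence K (product_tricat T1 T2) T F)"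

definition serre_functor ::
  "('k, 'r) ring_scheme \<Rightarrow> ('k, 'o, 'm, 'z) tricat_scheme \<Rightarrow> ('o, 'm, 'o, 'm) fctr \<Rightarrow> bool"
  where "serre_functor K T S \<longleftrightarrow> triangle_equivalence K T T S \<and>
    (\<exists>\<phi>.
      (\<forall>A\<in>Obj T. \<forall>B\<in>Obj T.
        linear_iso K (dual_space K (Hom T A B)) (Hom T B (FO S A)) (\<phi> A B)) \<and>
      (\<forall>A\<in>Obj T. \<forall>A'\<in>Obj T. \<forall>B\<in>Obj T. \<forall>a\<in>homset T A A'.
        \<forall>\<xi>\<in>carrier (dual_space K (Hom T A B)).
          \<phi> A' B (\<lambda>f\<in>homset T A' B. \<xi> (f \<cdot>\<^bsub>T\<^esub> a)) = FA S a \<cdot>\<^bsub>T\<^esub> \<phi> A B \<xi>) \<and>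
      (\<forall>A\<in>Obj T. \<forall>B\<in>Obj T. \<forall>B'\<in>Obj T. \<forall>b\<in>homset T B B'.
        \<forall>\<xi>\<in>carrier (dual_space K (Hom T A B')).
          \<phi> A B (\<lambda>f\<in>homset T A B. \<xi> (b \<cdot>\<^bsub>T\<^esub> f)) = \<phi> A B' \<xi> \<cdot>\<^bsub>T\<^esub> b))"


section \<open>Subcategories\<close>

text \<open>A full subcategory is given by its set of objects.\<close>

definition subcategory :: "('k, 'o, 'm, 'z) lincat_scheme \<Rightarrow> 'o set \<Rightarrow> bool"
  where "subcategory C XX \<longleftrightarrow> XX \<subseteq> Obj C \<and>
    (\<exists>Z\<in>XX. zero_object C Z) \<and>
    (\<forall>A\<in>XX. \<forall>B\<in>XX. \<forall>P. biproduct C A B P \<longrightarrow> P \<in> XX) \<and>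
    (\<forall>A\<in>XX. \<forall>B. isomorphic C A B \<longrightarrow> B \<in> XX) \<and>
    (\<forall>P\<in>XX. \<forall>A B. biproduct C A B P \<longrightarrow> A \<in> XX)"

definition contravariantly_finite :: "('k, 'o, 'm, 'z) lincat_scheme \<Rightarrow> 'o set \<Rightarrow> bool"
  where "contravariantly_finite C XX \<longleftrightarrow>
    (\<forall>A\<in>Obj C. \<exists>XA\<in>XX. \<exists>f\<in>homset C XA A.
      \<forall>Y\<in>XX. (\<lambda>u. f \<cdot>\<^bsub>C\<^esub> u) ` homset C Y XA = homset C Y A)"

definition covariantly_finite :: "('k, 'o, 'm, 'z) lincat_scheme \<Rightarrow> 'o set \<Rightarrow> bool"
  where "covariantly_finite C XX \<longleftrightarrow>
    (\<forall>A\<in>Obj C. \<exists>XA\<in>XX. \<exists>f\<in>homset C A XA.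
      \<forall>Y\<in>XX. (\<lambda>u. u \<cdot>\<^bsub>C\<^esub> f) ` homset C XA Y = homset C A Y)"

definition functorially_finite :: "('k, 'o, 'm, 'z) lincat_scheme \<Rightarrow> 'o set \<Rightarrow> bool"
  where "functorially_finite C XX \<longleftrightarrow> contravariantly_finite C XX \<and> covariantly_finite C XX"

definition rigid :: "('k, 'o, 'm, 'z) tricat_scheme \<Rightarrow> 'o set \<Rightarrow> bool"
  where "rigid T XX \<longleftrightarrow> (\<forall>A\<in>XX. \<forall>B\<in>XX. homset T A (sh T B) = {Zer T A (sh T B)})"

definition two_cluster_tilting :: "('k, 'o, 'm, 'z) tricat_scheme \<Rightarrow> 'o set \<Rightarrow> bool"
  where "two_cluster_tilting T XX \<longleftrightarrow> functorially_finite T XX \<and>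
    {A \<in> Obj T. \<forall>Y\<in>XX. homset T Y (sh T A) = {Zer T Y (sh T A)}} = XX \<and>
    {A \<in> Obj T. \<forall>Y\<in>XX. homset T A (sh T Y) = {Zer T A (sh T Y)}} = XX"

text \<open>The closure under isomorphisms of the image of a class of objects.\<close>

definition essential_image :: "('k, 'o, 'm, 'z) lincat_scheme \<Rightarrow> ('o \<Rightarrow> 'o) \<Rightarrow> 'o set \<Rightarrow> 'o set"
  where "essential_image C F XX = {B. \<exists>A\<in>XX. isomorphic C (F A) B}"


section \<open>Factor categories\<close>

definition factor_ideal :: "('k, 'o, 'm, 'z) lincat_scheme \<Rightarrow> 'o set \<Rightarrow> 'o \<Rightarrow> 'o \<Rightarrow> 'm set"
  where "factor_ideal C XX A B =
    {h \<cdot>\<^bsub>C\<^esub> g | g h. \<exists>Y\<in>XX. g \<in> homset C A Y \<and> h \<in> homset C Y B}"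

definition factor_class :: "('k, 'o, 'm, 'z) lincat_scheme \<Rightarrow> 'o set \<Rightarrow> 'm \<Rightarrow> 'm set"
  where "factor_class C XX f =
    factor_ideal C XX (Dom C f) (Cod C f) +>\<^bsub>Hom C (Dom C f) (Cod C f)\<^esub> f"

text \<open>As with the products of cosets in the library (cf. \<open>rcoset_mult\<close>), the operations
  are unions over all representatives; on composable resp. parallel classes
  all members of the union coincide.\<close>

definition factor_category ::
  "('k, 'o, 'm, 'z) lincat_scheme \<Rightarrow> 'o set \<Rightarrow> ('k, 'o, 'm set) lincat"
  where "factor_category C XX =
    \<lparr>Obj = Obj C,
     Arr = factor_class C XX ` Arr C,
     Dom = (\<lambda>F. the_elem (Dom C ` F)),
     Cod = (\<lambda>F. the_elem (Cod C ` F)),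
     Idn = (\<lambda>A. factor_class C XX (Idn C A)),
     Cmp = (\<lambda>G F. \<Union>g\<in>G. \<Union>f\<in>F. factor_class C XX (g \<cdot>\<^bsub>C\<^esub> f)),
     Zer = (\<lambda>A B. factor_class C XX (Zer C A B)),
     Add = (\<lambda>F G. \<Union>f\<in>F. \<Union>g\<in>G. factor_class C XX (Add C f g)),
     Scl = (\<lambda>a F. \<Union>f\<in>F. factor_class C XX (Scl C a f))\<rparr>"

end

theory Submission
  imports Defs
begin

text \<open>
  Write \<open>U\<close> for the objects \<open>M\<close> with \<open>T(X, M[1]) = 0\<close>. Since \<open>S(X) = X[2]\<close>, Serre duality turns this into
  \<open>T(M, X[1]) = 0\<close>, and shows that an arrow which is epi modulo \<open>X\<close> induces a surjection on \<open>T(X[-1], -)\<close>.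
  Every \<open>A\<close> has a triangle \<open>P \<rightarrow> A \<rightarrow> M \<rightarrow> P[1]\<close> with \<open>P\<close> in \<open>X[-1]\<close> and \<open>M\<close> in \<open>U\<close>, and between objects without
  arrows to \<open>U\<close> modulo \<open>X\<close> the functor \<open>T(X[-1], -)\<close> detects isomorphisms modulo \<open>X\<close>.

  If \<open>X\<close> is cluster tilting, then \<open>U = X\<close>, so \<open>T(X[-1], -)\<close> detects isomorphisms everywhere; weak kernels and
  cokernels obtained from cones along \<open>X\<close>-approximations are kernels and cokernels modulo \<open>X\<close>, and comparing
  a monomorphism with the kernel of its cokernel shows that it is a kernel (dually for epimorphisms).

  Conversely, let \<open>T/X\<close> be abelian. Image factorisations show that modulo \<open>X\<close> there are no arrows to \<open>U\<close> from
  \<open>X[1]\<close> or from the cone of an arrow of \<open>X\<close>, and none from \<open>U\<close> to \<open>X[-1]\<close>. By Serre duality the last fact places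
  \<open>X[-1]\<close> in \<open>X * X[1]\<close>. It follows that each \<open>M\<close> in \<open>U\<close> is a direct sum of an
  object of \<open>X\<close> and an object orthogonal to all shifts of \<open>X\<close>: the first summand is split off the
  \<open>X\<close>-approximation of \<open>M\<close> by an idempotent. Therefore \<open>T\<close> is the product of the category \<open>Z\<close> of objects
  orthogonal to all \<open>X[i]\<close> and of its perpendicular category, which contains \<open>X\<close>. As \<open>T\<close> is connected, \<open>Z\<close> is zero
  and \<open>U = X\<close>.
\<close>

section \<open>Separating functionals and linear categories\<close>

text \<open>Rigidity makes T(X[-1], -) vanish on X, so it is defined on T/X; \<open>U\<close> is
  what it kills, and both directions turn on whether \<open>U\<close> is zero modulo X. Cluster
  tilting says so by definition. An abelian T/X does not: objects orthogonal to every shift of X are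
  invisible to X, and only connectedness removes them. The hypothesis that X has a nonzero object
  unless T is zero belongs here, as it makes the complementary factor nonzero. For X = 0 and T the
  bounded derived category of a field, T/X = T is abelian and S(X) = X[2], yet 0 is not cluster
  tilting. Minimal approximations are avoided. By rigidity any approximation by X or X[-1] sits in a
  triangle whose remaining object is in \<open>U\<close>. The surplus of an X-approximation X0 of M
  in \<open>U\<close> is cut off by hand: in the triangle L, X0, M present L by some X1 in X. The
  cone C of X1 -> X0 has no arrows to \<open>U\<close> modulo X, so C -> M lifts to X0, and X0 -> C
  -> X0 is the idempotent.\<close>

lemma (in module) separating_functional:
  assumes K: "field R" and v: "v \<in> carrier M" "v \<noteq> \<zero>\<^bsub>M\<^esub>"
  shows "\<exists>\<xi>\<in>carrier (dual_space R M). \<xi> v \<noteq> \<zero>"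
proof -
  interpret field R by (rule K)
  define sub where "sub W \<longleftrightarrow> W \<subseteq> carrier M \<and> \<zero>\<^bsub>M\<^esub> \<in> W \<and> (\<forall>x\<in>W. \<forall>y\<in>W. x \<oplus>\<^bsub>M\<^esub> y \<in> W) \<and>
      (\<forall>a\<in>carrier R. \<forall>x\<in>W. a \<odot>\<^bsub>M\<^esub> x \<in> W)" for W
  define \<A> where "\<A> = {W. sub W \<and> v \<notin> W}"
  \<comment> \<open>Zorn's lemma yields a subspace W maximal among those that avoid v. It is a
    complement of the line through v, and the functional sought is the coefficient of v along
    W.\<close>
  have "\<exists>W\<in>\<A>. \<forall>X\<in>\<A>. W \<subseteq> X \<longrightarrow> X = W"
  proof (rule subset_Zorn_nonempty)
    have "{\<zero>\<^bsub>M\<^esub>} \<in> \<A>"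
      using v by (auto simp: \<A>_def sub_def)
    then show "\<A> \<noteq> {}" by blast
  next
    fix \<C> assume ne: "\<C> \<noteq> {}" and ch: "subset.chain \<A> \<C>"
    have sb: "sub W" "v \<notin> W" if "W \<in> \<C>" for W
      using ch that by (auto simp: subset.chain_def \<A>_def)
    have "x \<oplus>\<^bsub>M\<^esub> y \<in> \<Union>\<C>" if xy: "x \<in> \<Union>\<C>" "y \<in> \<Union>\<C>" for x y
    proof -
      obtain V W where VW: "V \<in> \<C>" "x \<in> V" "W \<in> \<C>" "y \<in> W" using xy by blast
      then have "V \<subseteq> W \<or> W \<subseteq> V" using ch by (auto simp: subset.chain_def)
      then show ?thesis using VW sb(1) unfolding sub_def by (meson UnionI subsetD)
    qed
    moreover have "\<Union>\<C> \<subseteq> carrier M" "\<zero>\<^bsub>M\<^esub> \<in> \<Union>\<C>" "v \<notin> \<Union>\<C>"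
      "\<forall>a\<in>carrier R. \<forall>x\<in>\<Union>\<C>. a \<odot>\<^bsub>M\<^esub> x \<in> \<Union>\<C>"
      using ne sb unfolding sub_def by blast+
    ultimately show "\<Union>\<C> \<in> \<A>" unfolding \<A>_def sub_def by blast
  qed
  then obtain W where W: "sub W" "v \<notin> W" and mx: "\<And>X. sub X \<Longrightarrow> v \<notin> X \<Longrightarrow> W \<subseteq> X \<Longrightarrow> X = W"
    unfolding \<A>_def by blast
  have Wc: "\<And>x. x \<in> W \<Longrightarrow> x \<in> carrier M" and W0: "\<zero>\<^bsub>M\<^esub> \<in> W"
    and Wa: "\<And>x y. x \<in> W \<Longrightarrow> y \<in> W \<Longrightarrow> x \<oplus>\<^bsub>M\<^esub> y \<in> W"
    and Ws: "\<And>a x. a \<in> carrier R \<Longrightarrow> x \<in> W \<Longrightarrow> a \<odot>\<^bsub>M\<^esub> x \<in> W"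
    using W(1) unfolding sub_def by auto
  have Wn: "\<ominus>\<^bsub>M\<^esub> x \<in> W" if "x \<in> W" for x
  proof -
    have "\<ominus>\<^bsub>M\<^esub> x = (\<ominus> \<one>) \<odot>\<^bsub>M\<^esub> x" using Wc[OF that] by (simp add: smult_l_minus)
    then show ?thesis using Ws[OF _ that] by simp
  qed
  have Kv: "a = \<zero>" if "a \<in> carrier R" "a \<odot>\<^bsub>M\<^esub> v \<in> W" for a
  proof (rule ccontr)
    assume "a \<noteq> \<zero>"
    then have a: "a \<in> Units R" using that field_Units by blast
    have "inv a \<odot>\<^bsub>M\<^esub> (a \<odot>\<^bsub>M\<^esub> v) = v"
      using smult_assoc1[of "inv a" a v] a v(1) Units_inv_closed[of a] Units_closed[of a] by simp
    then show False using Ws[OF Units_inv_closed[OF a] that(2)] W(2) by simp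
  qed
  \<comment> \<open>If x lies outside W, the span of W and x contains v by maximality. In that
    relation the coefficient of x is nonzero because v is not in W, so it can be solved for
    x.\<close>
  have dec: "\<exists>a\<in>carrier R. \<exists>w\<in>W. x = a \<odot>\<^bsub>M\<^esub> v \<oplus>\<^bsub>M\<^esub> w" if x: "x \<in> carrier M" for x
  proof (cases "x \<in> W")
    case True
    then show ?thesis using Wc v by (intro bexI[of _ \<zero>] bexI[of _ x]) auto
  next
    case False
    define X where "X = {a \<odot>\<^bsub>M\<^esub> x \<oplus>\<^bsub>M\<^esub> w | a w. a \<in> carrier R \<and> w \<in> W}"
    have "sub X"
      unfolding sub_def
    proof (intro conjI ballI)
      show "X \<subseteq> carrier M" using x Wc by (auto simp: X_def)
      show "\<zero>\<^bsub>M\<^esub> \<in> X" unfolding X_def using x W0 by (auto intro!: exI[of _ \<zero>] exI[of _ "\<zero>\<^bsub>M\<^esub>"])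
    next
      fix y z assume "y \<in> X" "z \<in> X"
      then obtain a b w u where h: "y = a \<odot>\<^bsub>M\<^esub> x \<oplus>\<^bsub>M\<^esub> w" "z = b \<odot>\<^bsub>M\<^esub> x \<oplus>\<^bsub>M\<^esub> u"
        "a \<in> carrier R" "b \<in> carrier R" "w \<in> W" "u \<in> W" unfolding X_def by blast
      then have "y \<oplus>\<^bsub>M\<^esub> z = (a \<oplus> b) \<odot>\<^bsub>M\<^esub> x \<oplus>\<^bsub>M\<^esub> (w \<oplus>\<^bsub>M\<^esub> u)"
        using x Wc by (simp add: smult_l_distr M.a_ac)
      then show "y \<oplus>\<^bsub>M\<^esub> z \<in> X" unfolding X_def using h Wa by blast
    next
      fix c y assume c: "c \<in> carrier R" and "y \<in> X"
      then obtain a w where h: "y = a \<odot>\<^bsub>M\<^esub> x \<oplus>\<^bsub>M\<^esub> w" "a \<in> carrier R" "w \<in> W" unfolding X_def by blast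
      then have "c \<odot>\<^bsub>M\<^esub> y = (c \<otimes> a) \<odot>\<^bsub>M\<^esub> x \<oplus>\<^bsub>M\<^esub> (c \<odot>\<^bsub>M\<^esub> w)"
        using x c Wc by (simp add: smult_r_distr smult_assoc1)
      then show "c \<odot>\<^bsub>M\<^esub> y \<in> X" unfolding X_def using h Ws c by blast
    qed
    moreover have "W \<subseteq> X"
    proof
      fix w assume "w \<in> W"
      then have "w = \<zero> \<odot>\<^bsub>M\<^esub> x \<oplus>\<^bsub>M\<^esub> w" using x Wc by simp
      then show "w \<in> X" unfolding X_def using \<open>w \<in> W\<close> by blast
    qed
    moreover have "X \<noteq> W"
    proof -
      have "x = \<one> \<odot>\<^bsub>M\<^esub> x \<oplus>\<^bsub>M\<^esub> \<zero>\<^bsub>M\<^esub>" using x by simp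
      then have "x \<in> X" unfolding X_def using W0 by blast
      then show ?thesis using False by blast
    qed
    ultimately have "v \<in> X" using mx by blast
    then obtain a w where h: "v = a \<odot>\<^bsub>M\<^esub> x \<oplus>\<^bsub>M\<^esub> w" "a \<in> carrier R" "w \<in> W" unfolding X_def by blast
    have "a \<noteq> \<zero>" using h W(2) x Wc by auto
    then have a: "a \<in> Units R" using h field_Units by blast
    have "inv a \<odot>\<^bsub>M\<^esub> v = x \<oplus>\<^bsub>M\<^esub> (inv a \<odot>\<^bsub>M\<^esub> w)"
      unfolding h(1) using a x h(2,3) Wc by (simp add: smult_r_distr flip: smult_assoc1)
    then have "x = inv a \<odot>\<^bsub>M\<^esub> v \<oplus>\<^bsub>M\<^esub> (\<ominus>\<^bsub>M\<^esub> (inv a \<odot>\<^bsub>M\<^esub> w))"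
      using x h(3) Wc a by (simp add: M.a_assoc M.r_neg)
    then show ?thesis using a h(3) Ws Wn by blast
  qed
  have uniq: "a = b" if "a \<in> carrier R" "b \<in> carrier R" "w \<in> W" "u \<in> W"
    "a \<odot>\<^bsub>M\<^esub> v \<oplus>\<^bsub>M\<^esub> w = b \<odot>\<^bsub>M\<^esub> v \<oplus>\<^bsub>M\<^esub> u" for a b w u
  proof -
    have "(a \<ominus> b) \<odot>\<^bsub>M\<^esub> v = (a \<odot>\<^bsub>M\<^esub> v \<oplus>\<^bsub>M\<^esub> w) \<oplus>\<^bsub>M\<^esub> (\<ominus>\<^bsub>M\<^esub> w \<oplus>\<^bsub>M\<^esub> \<ominus>\<^bsub>M\<^esub> (b \<odot>\<^bsub>M\<^esub> v))"
      using that(1-4) v Wc by (simp add: R.minus_eq smult_l_distr smult_l_minus M.a_assoc M.r_neg1 M.r_neg2)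
    also have "\<dots> = u \<oplus>\<^bsub>M\<^esub> \<ominus>\<^bsub>M\<^esub> w"
      unfolding that(5) using that(1-4) v Wc by (simp add: M.a_ac M.r_neg1 M.r_neg2 M.r_neg M.l_neg)
    finally have "(a \<ominus> b) \<odot>\<^bsub>M\<^esub> v \<in> W" using that Wa Wn by simp
    then have "a \<ominus> b = \<zero>" using Kv that by auto
    then show ?thesis using R.minus_equality[of a "\<ominus> b"] that by (simp add: R.minus_eq)
  qed
  \<comment> \<open>\<open>dec\<close> and \<open>uniq\<close> make the coefficient a function; the
    restriction to the carrier is the extensionality that \<open>dual_space\<close>
    requires.\<close>
  define \<xi> where "\<xi> = (\<lambda>x\<in>carrier M. THE a. a \<in> carrier R \<and> (\<exists>w\<in>W. x = a \<odot>\<^bsub>M\<^esub> v \<oplus>\<^bsub>M\<^esub> w))"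
  have val: "\<xi> (a \<odot>\<^bsub>M\<^esub> v \<oplus>\<^bsub>M\<^esub> w) = a" if "a \<in> carrier R" "w \<in> W" for a w
  proof -
    have "a \<odot>\<^bsub>M\<^esub> v \<oplus>\<^bsub>M\<^esub> w \<in> carrier M" using that v Wc by simp
    then show ?thesis unfolding \<xi>_def using that uniq by (auto intro!: the_equality)
  qed
  have "linear_map R M (ring_as_module R) \<xi>"
    unfolding linear_map_def
  proof (intro conjI ballI)
    show "\<xi> \<in> carrier M \<rightarrow> carrier (ring_as_module R)"
      using dec val by (fastforce simp: ring_as_module_def)
  next
    fix x y assume "x \<in> carrier M" "y \<in> carrier M"
    then obtain a w b u where h: "a \<in> carrier R" "w \<in> W" "x = a \<odot>\<^bsub>M\<^esub> v \<oplus>\<^bsub>M\<^esub> w"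
      "b \<in> carrier R" "u \<in> W" "y = b \<odot>\<^bsub>M\<^esub> v \<oplus>\<^bsub>M\<^esub> u" using dec by meson
    have "x \<oplus>\<^bsub>M\<^esub> y = (a \<oplus> b) \<odot>\<^bsub>M\<^esub> v \<oplus>\<^bsub>M\<^esub> (w \<oplus>\<^bsub>M\<^esub> u)"
      using h v Wc by (simp add: smult_l_distr M.a_ac)
    then show "\<xi> (x \<oplus>\<^bsub>M\<^esub> y) = \<xi> x \<oplus>\<^bsub>ring_as_module R\<^esub> \<xi> y"
      using val Wa h by (simp add: ring_as_module_def)
  next
    fix c x assume c: "c \<in> carrier R" and "x \<in> carrier M"
    then obtain a w where h: "a \<in> carrier R" "w \<in> W" "x = a \<odot>\<^bsub>M\<^esub> v \<oplus>\<^bsub>M\<^esub> w" using dec by meson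
    have "c \<odot>\<^bsub>M\<^esub> x = (c \<otimes> a) \<odot>\<^bsub>M\<^esub> v \<oplus>\<^bsub>M\<^esub> (c \<odot>\<^bsub>M\<^esub> w)"
      using h c v Wc by (simp add: smult_r_distr smult_assoc1)
    then show "\<xi> (c \<odot>\<^bsub>M\<^esub> x) = c \<odot>\<^bsub>ring_as_module R\<^esub> \<xi> x"
      using val Ws h c by (simp add: ring_as_module_def)
  qed
  moreover have "\<xi> v = \<one>" using val[of \<one> "\<zero>\<^bsub>M\<^esub>"] W0 v by simp
  ultimately show ?thesis
    by (intro bexI[of _ \<xi>]) (auto simp: dual_space_def \<xi>_def)
qed

text \<open>The hom-module is recovered from the arrow itself, so that terms need no annotation with
  domain and codomain.\<close>

definition Neg :: "('k, 'o, 'm, 'z) lincat_scheme \<Rightarrow> 'm \<Rightarrow> 'm"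
  where "Neg C f = a_inv (Hom C (Dom C f) (Cod C f)) f"

section \<open>Calculus of arrows in a linear category\<close>

context linear_category
begin

abbreviation cmp (infixr "\<bullet>" 70) where "g \<bullet> f \<equiv> Cmp C g f"
abbreviation pls (infixl "\<boxplus>" 65) where "f \<boxplus> g \<equiv> Add C f g"
abbreviation mns (infixl "\<boxminus>" 65) where "f \<boxminus> g \<equiv> Add C f (Neg C g)"
abbreviation hom where "hom \<equiv> homset C"
abbreviation Z0 where "Z0 \<equiv> Zer C"
abbreviation I1 where "I1 \<equiv> Idn C"

lemma homD:
  assumes "f \<in> hom A B"
  shows "f \<in> Arr C" "Dom C f = A" "Cod C f = B" "A \<in> Obj C" "B \<in> Obj C"
  using assms Dom_in_Obj Cod_in_Obj by (auto simp: homset_def)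

lemma arr_hom: "f \<in> Arr C \<Longrightarrow> f \<in> hom (Dom C f) (Cod C f)"
  by (simp add: homset_def)

lemma Hom_simps [simp]:
  "carrier (Hom C A B) = hom A B" "zero (Hom C A B) = Z0 A B" "add (Hom C A B) = Add C"
  "smult (Hom C A B) = Scl C"
  by (simp_all add: Hom_def)

lemma Neg_hom: "f \<in> hom A B \<Longrightarrow> Neg C f = \<ominus>\<^bsub>Hom C A B\<^esub> f"
  by (auto simp: Neg_def dest: homD)

lemma Zer_in_hom [simp]: "A \<in> Obj C \<Longrightarrow> B \<in> Obj C \<Longrightarrow> Z0 A B \<in> hom A B"
proof -
  assume "A \<in> Obj C" "B \<in> Obj C"
  then interpret module K "Hom C A B" by (rule Hom_module)
  show ?thesis using M.zero_closed by simp
qed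

lemma Add_in_hom [intro]: "f \<in> hom A B \<Longrightarrow> g \<in> hom A B \<Longrightarrow> f \<boxplus> g \<in> hom A B"
proof -
  assume h: "f \<in> hom A B" "g \<in> hom A B"
  then interpret module K "Hom C A B" using homD Hom_module by metis
  show ?thesis using M.a_closed[of f g] h by simp
qed

lemma Neg_in_hom [intro]: "f \<in> hom A B \<Longrightarrow> Neg C f \<in> hom A B"
proof -
  assume h: "f \<in> hom A B"
  then interpret module K "Hom C A B" using homD Hom_module by metis
  show ?thesis using M.a_inv_closed[of f] h by (simp add: Neg_hom)
qed

lemma Scl_in_hom [intro]: "a \<in> carrier K \<Longrightarrow> f \<in> hom A B \<Longrightarrow> Scl C a f \<in> hom A B"
proof -
  assume h: "a \<in> carrier K" "f \<in> hom A B"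
  then interpret module K "Hom C A B" using homD Hom_module by metis
  show ?thesis using smult_closed[of a f] h by simp
qed

lemma
  assumes "f \<in> hom A B" "g \<in> hom A B" "h \<in> hom A B"
  shows Add_assoc: "(f \<boxplus> g) \<boxplus> h = f \<boxplus> (g \<boxplus> h)"
    and Add_commute: "f \<boxplus> g = g \<boxplus> f"
    and Add_left_commute: "f \<boxplus> (g \<boxplus> h) = g \<boxplus> (f \<boxplus> h)"
    and Add_cancel: "f \<boxplus> g = f \<boxplus> h \<longleftrightarrow> g = h"
    and Add_mns_eq: "f \<boxminus> g = h \<longleftrightarrow> f = g \<boxplus> h"
proof -
  interpret module K "Hom C A B" using homD assms Hom_module by metis
  note c = assms[folded Hom_simps(1)]
  have n: "\<ominus>\<^bsub>Hom C A B\<^esub> g \<in> carrier (Hom C A B)" using c(2) by (rule M.a_inv_closed)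
  show "(f \<boxplus> g) \<boxplus> h = f \<boxplus> (g \<boxplus> h)" using M.a_assoc[OF c] by (simp only: Hom_simps)
  show "f \<boxplus> g = g \<boxplus> f" using M.a_comm[OF c(1,2)] by (simp only: Hom_simps)
  show "f \<boxplus> (g \<boxplus> h) = g \<boxplus> (f \<boxplus> h)" using M.a_lcomm[OF c] by (simp only: Hom_simps)
  show "f \<boxplus> g = f \<boxplus> h \<longleftrightarrow> g = h"
    using M.r_neg1[OF c(1,2)] M.r_neg1[OF c(1,3)] by (simp only: Hom_simps) metis
  have "f = g \<oplus>\<^bsub>Hom C A B\<^esub> h \<Longrightarrow> f \<oplus>\<^bsub>Hom C A B\<^esub> \<ominus>\<^bsub>Hom C A B\<^esub> g = h"
    using M.a_comm[OF c(2,3)] M.a_assoc[OF c(3,2) n] M.r_neg[OF c(2)] M.r_zero[OF c(3)] by metis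
  moreover have "f \<oplus>\<^bsub>Hom C A B\<^esub> \<ominus>\<^bsub>Hom C A B\<^esub> g = h \<Longrightarrow> f = g \<oplus>\<^bsub>Hom C A B\<^esub> h"
    using M.a_comm[OF c(2,3)] M.a_assoc[OF c(1) n c(2)] M.l_neg[OF c(2)] M.r_zero[OF c(1)] by metis
  ultimately show "f \<boxminus> g = h \<longleftrightarrow> f = g \<boxplus> h"
    unfolding Neg_hom[OF assms(2)] Hom_simps by blast
qed

lemma
  assumes "f \<in> hom A B"
  shows Add_Zer_right: "f \<boxplus> Z0 A B = f" and Add_Zer_left: "Z0 A B \<boxplus> f = f"
    and mns_self: "f \<boxminus> f = Z0 A B" and mns_self': "Neg C f \<boxplus> f = Z0 A B"
    and Neg_Neg: "Neg C (Neg C f) = f"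
proof -
  interpret module K "Hom C A B" using homD assms Hom_module by metis
  show "f \<boxplus> Z0 A B = f" using M.r_zero[of f] assms by simp
  show "Z0 A B \<boxplus> f = f" using M.l_zero[of f] assms by simp
  show "f \<boxminus> f = Z0 A B" using M.r_neg[of f] assms by (simp add: Neg_hom)
  show "Neg C f \<boxplus> f = Z0 A B" using M.l_neg[of f] assms by (simp add: Neg_hom)
  show "Neg C (Neg C f) = f"
    using M.minus_minus[of f] assms Neg_in_hom[OF assms] by (simp add: Neg_hom)
qed

lemma mns_eq_Zer: "f \<in> hom A B \<Longrightarrow> g \<in> hom A B \<Longrightarrow> f \<boxminus> g = Z0 A B \<longleftrightarrow> f = g"
  using Add_mns_eq[of f A B g "Z0 A B"] by (simp add: Add_Zer_right homD)

lemma Cmp_Add_right: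
  assumes "g \<in> hom B D" "f \<in> hom A B" "f' \<in> hom A B"
  shows "g \<bullet> (f \<boxplus> f') = (g \<bullet> f) \<boxplus> (g \<bullet> f')"
  using post_linear[OF assms(1), of A] assms homD by (auto simp: linear_map_def)

lemma Cmp_Add_left:
  assumes "f \<in> hom A B" "g \<in> hom B D" "g' \<in> hom B D"
  shows "(g \<boxplus> g') \<bullet> f = (g \<bullet> f) \<boxplus> (g' \<bullet> f)"
  using pre_linear[OF assms(1), of D] assms homD by (auto simp: linear_map_def)

lemma Cmp_Scl_right:
  assumes "g \<in> hom B D" "f \<in> hom A B" "a \<in> carrier K"
  shows "g \<bullet> Scl C a f = Scl C a (g \<bullet> f)"
  using post_linear[OF assms(1), of A] assms homD by (auto simp: linear_map_def)

lemma Cmp_Scl_left: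
  assumes "f \<in> hom A B" "g \<in> hom B D" "a \<in> carrier K"
  shows "Scl C a g \<bullet> f = Scl C a (g \<bullet> f)"
  using pre_linear[OF assms(1), of D] assms homD by (auto simp: linear_map_def)

lemma Cmp_Zer_right: "g \<in> hom B D \<Longrightarrow> A \<in> Obj C \<Longrightarrow> g \<bullet> Z0 A B = Z0 A D"
proof -
  assume h: "g \<in> hom B D" "A \<in> Obj C"
  then have z: "Z0 A B \<in> hom A B" "g \<bullet> Z0 A B \<in> hom A D" using homD Cmp_in_hom Zer_in_hom by metis+
  have "(g \<bullet> Z0 A B) \<boxplus> (g \<bullet> Z0 A B) = (g \<bullet> Z0 A B) \<boxplus> Z0 A D"
    using Cmp_Add_right[OF h(1) z(1) z(1)] z by (simp add: Add_Zer_right)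
  then show ?thesis using Add_cancel z homD by (metis Zer_in_hom)
qed

lemma Cmp_Zer_left: "f \<in> hom A B \<Longrightarrow> D \<in> Obj C \<Longrightarrow> Z0 B D \<bullet> f = Z0 A D"
proof -
  assume h: "f \<in> hom A B" "D \<in> Obj C"
  then have z: "Z0 B D \<in> hom B D" "Z0 B D \<bullet> f \<in> hom A D" using homD Cmp_in_hom Zer_in_hom by metis+
  have "(Z0 B D \<bullet> f) \<boxplus> (Z0 B D \<bullet> f) = (Z0 B D \<bullet> f) \<boxplus> Z0 A D"
    using Cmp_Add_left[OF h(1) z(1) z(1)] z by (simp add: Add_Zer_right)
  then show ?thesis using Add_cancel z homD by (metis Zer_in_hom)
qed

lemma Neg_unique: "f \<in> hom A B \<Longrightarrow> g \<in> hom A B \<Longrightarrow> f \<boxplus> g = Z0 A B \<Longrightarrow> g = Neg C f"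
  by (metis Add_cancel Neg_in_hom mns_self)

lemma Cmp_Neg_right:
  assumes "g \<in> hom B D" "f \<in> hom A B"
  shows "g \<bullet> Neg C f = Neg C (g \<bullet> f)"
proof (rule Neg_unique[of _ A D])
  have n: "Neg C f \<in> hom A B" using assms by blast
  show "(g \<bullet> f) \<boxplus> (g \<bullet> Neg C f) = Z0 A D"
    using Cmp_Add_right[OF assms n] mns_self[OF assms(2)] Cmp_Zer_right[OF assms(1)] homD(4)[OF assms(2)] by simp
  show "g \<bullet> f \<in> hom A D" "g \<bullet> Neg C f \<in> hom A D" using assms n Cmp_in_hom by blast+
qed

lemma Cmp_Neg_left:
  assumes "g \<in> hom B D" "f \<in> hom A B"
  shows "Neg C g \<bullet> f = Neg C (g \<bullet> f)"
proof (rule Neg_unique[of _ A D])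
  have n: "Neg C g \<in> hom B D" using assms by blast
  show "(g \<bullet> f) \<boxplus> (Neg C g \<bullet> f) = Z0 A D"
    using Cmp_Add_left[OF assms(2,1) n] mns_self[OF assms(1)] Cmp_Zer_left[OF assms(2)] homD(5)[OF assms(1)] by simp
  show "g \<bullet> f \<in> hom A D" "Neg C g \<bullet> f \<in> hom A D" using assms n Cmp_in_hom by blast+
qed

lemma Neg_Zer: "A \<in> Obj C \<Longrightarrow> B \<in> Obj C \<Longrightarrow> Neg C (Z0 A B) = Z0 A B"
  by (metis Add_Zer_left Neg_in_hom Zer_in_hom mns_self)

lemma Cmp_mns_right: "g \<in> hom B D \<Longrightarrow> f \<in> hom A B \<Longrightarrow> f' \<in> hom A B \<Longrightarrow> g \<bullet> (f \<boxminus> f') = (g \<bullet> f) \<boxminus> (g \<bullet> f')"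
  by (metis Cmp_Add_right Cmp_Neg_right Neg_in_hom)

lemma Cmp_mns_left: "f \<in> hom A B \<Longrightarrow> g \<in> hom B D \<Longrightarrow> g' \<in> hom B D \<Longrightarrow> (g \<boxminus> g') \<bullet> f = (g \<bullet> f) \<boxminus> (g' \<bullet> f)"
  by (metis Cmp_Add_left Cmp_Neg_left Neg_in_hom)

lemma mns_in_hom [intro]: "f \<in> hom A B \<Longrightarrow> g \<in> hom A B \<Longrightarrow> f \<boxminus> g \<in> hom A B"
  by auto

text \<open>The rewrite rules below have side conditions on domains and codomains only, so the simplifier
  can discharge them.\<close>

lemma arr_simps:
  "A \<in> Obj C \<Longrightarrow> I1 A \<in> Arr C" "A \<in> Obj C \<Longrightarrow> Dom C (I1 A) = A" "A \<in> Obj C \<Longrightarrow> Cod C (I1 A) = A"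
  "A \<in> Obj C \<Longrightarrow> B \<in> Obj C \<Longrightarrow> Z0 A B \<in> Arr C"
  "A \<in> Obj C \<Longrightarrow> B \<in> Obj C \<Longrightarrow> Dom C (Z0 A B) = A" "A \<in> Obj C \<Longrightarrow> B \<in> Obj C \<Longrightarrow> Cod C (Z0 A B) = B"
  "f \<in> Arr C \<Longrightarrow> g \<in> Arr C \<Longrightarrow> Cod C f = Dom C g \<Longrightarrow> g \<bullet> f \<in> Arr C"
  "f \<in> Arr C \<Longrightarrow> g \<in> Arr C \<Longrightarrow> Cod C f = Dom C g \<Longrightarrow> Dom C (g \<bullet> f) = Dom C f"
  "f \<in> Arr C \<Longrightarrow> g \<in> Arr C \<Longrightarrow> Cod C f = Dom C g \<Longrightarrow> Cod C (g \<bullet> f) = Cod C g"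
  "f \<in> Arr C \<Longrightarrow> g \<in> Arr C \<Longrightarrow> Dom C f = Dom C g \<Longrightarrow> Cod C f = Cod C g \<Longrightarrow> f \<boxplus> g \<in> Arr C"
  "f \<in> Arr C \<Longrightarrow> g \<in> Arr C \<Longrightarrow> Dom C f = Dom C g \<Longrightarrow> Cod C f = Cod C g \<Longrightarrow> Dom C (f \<boxplus> g) = Dom C f"
  "f \<in> Arr C \<Longrightarrow> g \<in> Arr C \<Longrightarrow> Dom C f = Dom C g \<Longrightarrow> Cod C f = Cod C g \<Longrightarrow> Cod C (f \<boxplus> g) = Cod C f"
  "f \<in> Arr C \<Longrightarrow> Neg C f \<in> Arr C" "f \<in> Arr C \<Longrightarrow> Dom C (Neg C f) = Dom C f"
  "f \<in> Arr C \<Longrightarrow> Cod C (Neg C f) = Cod C f"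
  using Idn_in_hom[of A] Zer_in_hom[of A B] Cmp_in_hom[of f "Dom C f" "Cod C f" g "Cod C g"]
    Add_in_hom[of f "Dom C f" "Cod C f" g] Neg_in_hom[of f "Dom C f" "Cod C f"]
  by (simp_all add: homset_def)

lemma cmp_simps:
  "f \<in> Arr C \<Longrightarrow> g \<in> Arr C \<Longrightarrow> h \<in> Arr C \<Longrightarrow> Cod C f = Dom C g \<Longrightarrow> Cod C g = Dom C h
    \<Longrightarrow> (h \<bullet> g) \<bullet> f = h \<bullet> (g \<bullet> f)"
  "f \<in> Arr C \<Longrightarrow> Dom C f = A \<Longrightarrow> f \<bullet> I1 A = f"
  "f \<in> Arr C \<Longrightarrow> Cod C f = A \<Longrightarrow> I1 A \<bullet> f = f"
  "f \<in> Arr C \<Longrightarrow> A \<in> Obj C \<Longrightarrow> Dom C f = B \<Longrightarrow> f \<bullet> Z0 A B = Z0 A (Cod C f)"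
  "f \<in> Arr C \<Longrightarrow> A \<in> Obj C \<Longrightarrow> Cod C f = B \<Longrightarrow> Z0 B A \<bullet> f = Z0 (Dom C f) A"
  "f \<in> Arr C \<Longrightarrow> f' \<in> Arr C \<Longrightarrow> g \<in> Arr C \<Longrightarrow> Cod C f = Dom C g \<Longrightarrow> Cod C f' = Dom C g \<Longrightarrow> Dom C f = Dom C f'
    \<Longrightarrow> g \<bullet> (f \<boxplus> f') = (g \<bullet> f) \<boxplus> (g \<bullet> f')"
  "g \<in> Arr C \<Longrightarrow> g' \<in> Arr C \<Longrightarrow> f \<in> Arr C \<Longrightarrow> Cod C f = Dom C g \<Longrightarrow> Cod C f = Dom C g' \<Longrightarrow> Cod C g = Cod C g'
    \<Longrightarrow> (g \<boxplus> g') \<bullet> f = (g \<bullet> f) \<boxplus> (g' \<bullet> f)"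
  "f \<in> Arr C \<Longrightarrow> g \<in> Arr C \<Longrightarrow> Cod C f = Dom C g \<Longrightarrow> g \<bullet> Neg C f = Neg C (g \<bullet> f)"
  "f \<in> Arr C \<Longrightarrow> g \<in> Arr C \<Longrightarrow> Cod C f = Dom C g \<Longrightarrow> Neg C g \<bullet> f = Neg C (g \<bullet> f)"
  "f \<in> Arr C \<Longrightarrow> Neg C (Neg C f) = f"
  "A \<in> Obj C \<Longrightarrow> B \<in> Obj C \<Longrightarrow> Neg C (Z0 A B) = Z0 A B"
  "f \<in> Arr C \<Longrightarrow> Dom C f = A \<Longrightarrow> Cod C f = B \<Longrightarrow> f \<boxplus> Z0 A B = f"
  "f \<in> Arr C \<Longrightarrow> Dom C f = A \<Longrightarrow> Cod C f = B \<Longrightarrow> Z0 A B \<boxplus> f = f"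
  "f \<in> Arr C \<Longrightarrow> f \<boxminus> f = Z0 (Dom C f) (Cod C f)"
  "f \<in> Arr C \<Longrightarrow> Neg C f \<boxplus> f = Z0 (Dom C f) (Cod C f)"
  subgoal by (rule Cmp_assoc) (simp_all add: homset_def)
  subgoal by (rule Cmp_Idn_right) (simp add: homset_def)
  subgoal by (rule Cmp_Idn_left) (simp add: homset_def)
  subgoal by (rule Cmp_Zer_right) (simp_all add: homset_def)
  subgoal by (rule Cmp_Zer_left) (simp_all add: homset_def)
  subgoal by (rule Cmp_Add_right) (simp_all add: homset_def)
  subgoal by (rule Cmp_Add_left) (simp_all add: homset_def)
  subgoal by (rule Cmp_Neg_right) (simp_all add: homset_def)
  subgoal by (rule Cmp_Neg_left) (simp_all add: homset_def)
  subgoal by (rule Neg_Neg) (simp add: homset_def)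
  subgoal by (rule Neg_Zer)
  subgoal by (rule Add_Zer_right) (simp add: homset_def)
  subgoal by (rule Add_Zer_left) (simp add: homset_def)
  subgoal by (rule mns_self) (simp add: homset_def)
  subgoal by (rule mns_self') (simp add: homset_def)
  done

lemmas cat = homset_def arr_simps cmp_simps Dom_in_Obj Cod_in_Obj

text \<open>Permutative rules, kept apart from \<open>cat\<close> and added only where summands must
  be reordered.\<close>

lemma add_simps:
  "f \<in> Arr C \<Longrightarrow> g \<in> Arr C \<Longrightarrow> h \<in> Arr C \<Longrightarrow> Dom C f = Dom C g \<Longrightarrow> Cod C f = Cod C g \<Longrightarrow> Dom C g = Dom C h
    \<Longrightarrow> Cod C g = Cod C h \<Longrightarrow> (f \<boxplus> g) \<boxplus> h = f \<boxplus> (g \<boxplus> h)"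
  "f \<in> Arr C \<Longrightarrow> g \<in> Arr C \<Longrightarrow> Dom C f = Dom C g \<Longrightarrow> Cod C f = Cod C g \<Longrightarrow> f \<boxplus> g = g \<boxplus> f"
  "f \<in> Arr C \<Longrightarrow> g \<in> Arr C \<Longrightarrow> h \<in> Arr C \<Longrightarrow> Dom C f = Dom C g \<Longrightarrow> Cod C f = Cod C g \<Longrightarrow> Dom C g = Dom C h
    \<Longrightarrow> Cod C g = Cod C h \<Longrightarrow> f \<boxplus> (g \<boxplus> h) = g \<boxplus> (f \<boxplus> h)"
  subgoal by (rule Add_assoc) (simp_all add: homset_def)
  subgoal by (rule Add_commute) (simp_all add: homset_def)
  subgoal by (rule Add_left_commute) (simp_all add: homset_def)
  done

text \<open>Rewriting with \<open>cat\<close> associates to the right, which hides the left side of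
  an equation \<open>g \<bullet> f = h\<close>; this is the form in which it still occurs.\<close>

lemma cmp_ext:
  "g \<bullet> f = h \<Longrightarrow> f \<in> hom A B \<Longrightarrow> g \<in> hom B D \<Longrightarrow> x \<in> hom W A \<Longrightarrow> g \<bullet> (f \<bullet> x) = h \<bullet> x"
  using Cmp_assoc by metis

lemma zero_object_iff: "zero_object C Z \<longleftrightarrow> Z \<in> Obj C \<and> I1 Z = Z0 Z Z"
proof
  assume "zero_object C Z"
  then show "Z \<in> Obj C \<and> I1 Z = Z0 Z Z"
    unfolding zero_object_def using Idn_in_hom Zer_in_hom by metis
next
  assume h: "Z \<in> Obj C \<and> I1 Z = Z0 Z Z"
  have "f = Z0 A Z" if "f \<in> hom A Z" for f A
    using Cmp_Idn_left[OF that] Cmp_Zer_left[OF that] h by auto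
  moreover have "f = Z0 Z A" if "f \<in> hom Z A" for f A
    using Cmp_Idn_right[OF that] Cmp_Zer_right[OF that] h by auto
  ultimately show "zero_object C Z" unfolding zero_object_def using h Zer_in_hom by metis
qed

text \<open>Orthogonality of A and B. The set equations in \<open>rigid\<close> and
  \<open>two_cluster_tilting\<close> also assert that the zero arrow is present, which is automatic
  for objects (\<open>van_eq\<close>).\<close>

definition van :: "'o \<Rightarrow> 'o \<Rightarrow> bool"
  where "van A B \<longleftrightarrow> (\<forall>f\<in>hom A B. f = Z0 A B)"

lemma van_eq: "A \<in> Obj C \<Longrightarrow> B \<in> Obj C \<Longrightarrow> homset C A B = {Zer C A B} \<longleftrightarrow> van A B"
  unfolding van_def using Zer_in_hom[of A B] by blast

lemma vanD: "van A B \<Longrightarrow> f \<in> hom A B \<Longrightarrow> f = Z0 A B"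
  by (simp add: van_def)

lemma van_retract_left:
  assumes "van A B" "i \<in> hom A' A" "r \<in> hom A A'" "r \<bullet> i = I1 A'"
  shows "van A' B"
  unfolding van_def
proof
  fix f assume f: "f \<in> hom A' B"
  have "f = (f \<bullet> r) \<bullet> i" using f assms Cmp_assoc Cmp_Idn_right by metis
  also have "\<dots> = Z0 A' B" using vanD[OF assms(1) Cmp_in_hom[OF assms(3) f]] Cmp_Zer_left[OF assms(2)] homD(5)[OF f] by simp
  finally show "f = Z0 A' B" .
qed

lemma van_retract_right:
  assumes "van A B" "i \<in> hom B' B" "r \<in> hom B B'" "r \<bullet> i = I1 B'"
  shows "van A B'"
  unfolding van_def
proof
  fix f assume f: "f \<in> hom A B'"
  have "f = r \<bullet> (i \<bullet> f)" using f assms Cmp_assoc Cmp_Idn_left by metis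
  also have "\<dots> = Z0 A B'" using vanD[OF assms(1) Cmp_in_hom[OF f assms(2)]] Cmp_Zer_right[OF assms(3)] homD(4)[OF f] by simp
  finally show "f = Z0 A B'" .
qed

lemma isomorphicE:
  assumes "isomorphic C A B"
  obtains f g where "f \<in> hom A B" "g \<in> hom B A" "g \<bullet> f = I1 A" "f \<bullet> g = I1 B"
  using assms unfolding isomorphic_def iso_arr_def by blast

lemma isomorphicI:
  assumes "f \<in> hom A B" "g \<in> hom B A" "g \<bullet> f = I1 A" "f \<bullet> g = I1 B"
  shows "isomorphic C A B"
  using assms homD(4,5)[OF assms(1)] unfolding isomorphic_def iso_arr_def by blast

lemma isomorphic_sym: "isomorphic C A B \<Longrightarrow> isomorphic C B A"
  by (erule isomorphicE) (rule isomorphicI)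

lemma isomorphic_refl: "A \<in> Obj C \<Longrightarrow> isomorphic C A A"
  using isomorphicI Idn_in_hom Cmp_Idn_left by metis

lemma iso_arr_comp:
  assumes "iso_arr C A B f" "iso_arr C B D g"
  shows "iso_arr C A D (g \<bullet> f)"
proof -
  obtain f' g' where h: "f' \<in> hom B A" "f' \<bullet> f = I1 A" "f \<bullet> f' = I1 B"
    "g' \<in> hom D B" "g' \<bullet> g = I1 B" "g \<bullet> g' = I1 D" "f \<in> hom A B" "g \<in> hom B D"
    using assms unfolding iso_arr_def by blast
  have "(f' \<bullet> g') \<bullet> (g \<bullet> f) = f' \<bullet> ((g' \<bullet> g) \<bullet> f)"
    using h(1,4,7,8) by (simp add: cat)
  then have 1: "(f' \<bullet> g') \<bullet> (g \<bullet> f) = I1 A" unfolding h(5) using h(2,7) by (simp add: Cmp_Idn_left)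
  have "(g \<bullet> f) \<bullet> (f' \<bullet> g') = g \<bullet> ((f \<bullet> f') \<bullet> g')"
    using h(1,4,7,8) by (simp add: cat)
  then have 2: "(g \<bullet> f) \<bullet> (f' \<bullet> g') = I1 D" unfolding h(3) using h(4,6) by (simp add: Cmp_Idn_left)
  show ?thesis unfolding iso_arr_def
    using 1 2 Cmp_in_hom[OF h(7,8)] Cmp_in_hom[OF h(4,1)] by blast
qed

lemma isomorphic_trans: "isomorphic C A B \<Longrightarrow> isomorphic C B D \<Longrightarrow> isomorphic C A D"
  unfolding isomorphic_def using iso_arr_comp by blast

lemma van_iso:
  assumes "isomorphic C A A'" "isomorphic C B B'" "van A B"
  shows "van A' B'"
proof -
  obtain f g where h: "f \<in> hom A' A" "g \<in> hom A A'" "g \<bullet> f = I1 A'"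
    using assms(1) by (rule isomorphicE)
  obtain f' g' where h': "f' \<in> hom B' B" "g' \<in> hom B B'" "g' \<bullet> f' = I1 B'"
    using assms(2) by (rule isomorphicE)
  show ?thesis
    by (rule van_retract_right[OF van_retract_left[OF assms(3) h] h'])
qed

lemma zero_object_van: "zero_object C Z \<Longrightarrow> van Z A \<and> van A Z"
  unfolding van_def
proof (intro conjI ballI)
  assume "zero_object C Z"
  then have h: "Z \<in> Obj C" "I1 Z = Z0 Z Z" using zero_object_iff by auto
  show "f = Z0 Z A" if "f \<in> hom Z A" for f
    using Cmp_Idn_right[OF that] Cmp_Zer_right[OF that h(1)] h by simp
  show "f = Z0 A Z" if "f \<in> hom A Z" for f
    using Cmp_Idn_left[OF that] Cmp_Zer_left[OF that h(1)] h by simp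
qed

lemma biproductE:
  assumes "biproduct C A B P"
  obtains i j p q where "i \<in> hom A P" "j \<in> hom B P" "p \<in> hom P A" "q \<in> hom P B"
    "p \<bullet> i = I1 A" "q \<bullet> j = I1 B" "p \<bullet> j = Z0 B A" "q \<bullet> i = Z0 A B" "(i \<bullet> p) \<boxplus> (j \<bullet> q) = I1 P"
  using assms unfolding biproduct_def by blast

lemma biproductI:
  assumes "i \<in> hom A P" "j \<in> hom B P" "p \<in> hom P A" "q \<in> hom P B"
    "p \<bullet> i = I1 A" "q \<bullet> j = I1 B" "p \<bullet> j = Z0 B A" "q \<bullet> i = Z0 A B" "(i \<bullet> p) \<boxplus> (j \<bullet> q) = I1 P"
  shows "biproduct C A B P"
  using assms homD(4,5)[OF assms(1)] homD(4)[OF assms(2)] unfolding biproduct_def by blast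

text \<open>The complement of a retract is the image of the idempotent e = 1 - i r.\<close>

lemma split_summand:
  assumes "split_idempotents C" "i \<in> hom A P" "r \<in> hom P A" "r \<bullet> i = I1 A"
  obtains B j q where "j \<in> hom B P" "q \<in> hom P B" "q \<bullet> j = I1 B" "r \<bullet> j = Z0 B A" "q \<bullet> i = Z0 A B"
    "(i \<bullet> r) \<boxplus> (j \<bullet> q) = I1 P"
proof -
  define e where "e = I1 P \<boxminus> (i \<bullet> r)"
  have P: "P \<in> Obj C" "A \<in> Obj C" using assms homD by auto
  have ir: "i \<bullet> r \<in> hom P P" using assms Cmp_in_hom by blast
  have e: "e \<in> hom P P" unfolding e_def using ir P Idn_in_hom by blast
  have ie: "e \<bullet> i = Z0 A P"
    unfolding e_def using assms(2-4) P by (simp add: cat)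
  have re: "r \<bullet> e = Z0 P A"
    unfolding e_def using assms(2-4) P cmp_ext[OF assms(4,2,3,3)] by (simp add: cat)
  have "e \<bullet> (I1 P \<boxminus> (i \<bullet> r)) = e \<boxminus> ((e \<bullet> i) \<bullet> r)"
    using e assms(2,3) P by (simp add: cat)
  note this[folded e_def]
  then have ee: "e \<bullet> e = e" using ie assms e P by (simp add: cat)
  from assms(1)[unfolded split_idempotents_def, rule_format, OF P(1) e ee]
  obtain B q j where B: "B \<in> Obj C" "q \<in> hom P B" "j \<in> hom B P" "j \<bullet> q = e" "q \<bullet> j = I1 B" by blast
  have jE: "e \<bullet> j = j" and qE: "q \<bullet> e = q"
    using B by (auto simp: B(4)[symmetric] cat cmp_ext[OF B(5,3,2,2)])
  have "r \<bullet> j = (r \<bullet> e) \<bullet> j" using jE assms(3) e B(3) Cmp_assoc by metis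
  then have 1: "r \<bullet> j = Z0 B A" using re B P by (simp add: cat)
  have "q \<bullet> i = q \<bullet> (e \<bullet> i)" using qE assms(2) e B(2) Cmp_assoc by metis
  then have 2: "q \<bullet> i = Z0 A B" using ie B P by (simp add: cat)
  have "(i \<bullet> r) \<boxplus> e = I1 P"
    using Add_mns_eq[OF Idn_in_hom[OF P(1)] ir e] by (simp add: e_def)
  then show thesis using that[OF B(3,2,5) 1 2] B(4) by simp
qed

end

section \<open>Triangulated categories\<close>

context linear_category
begin

section \<open>Linear autoequivalences, applied later to the shift and to the Serre functor\<close>

context
  fixes F
  assumes F: "linear_equivalence K C C F"
begin

lemma
  shows equivalence_Obj: "A \<in> Obj C \<Longrightarrow> FO F A \<in> Obj C"
    and equivalence_Idn: "A \<in> Obj C \<Longrightarrow> FA F (I1 A) = I1 (FO F A)"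
    and equivalence_hom: "f \<in> hom A B \<Longrightarrow> FA F f \<in> hom (FO F A) (FO F B)"
    and equivalence_Add: "f \<in> hom A B \<Longrightarrow> g \<in> hom A B \<Longrightarrow> FA F (f \<boxplus> g) = FA F f \<boxplus> FA F g"
    and equivalence_Cmp: "f \<in> hom A B \<Longrightarrow> g \<in> hom B D \<Longrightarrow> FA F (g \<bullet> f) = FA F g \<bullet> FA F f"
proof -
  have L: "linear_functor K C C F" using F by (simp add: linear_equivalence_def)
  note L1 = L[unfolded linear_functor_def, THEN conjunct1, rule_format]
  note L2 = L[unfolded linear_functor_def, THEN conjunct2, THEN conjunct1, rule_format, unfolded linear_map_def]
  note L3 = L[unfolded linear_functor_def, THEN conjunct2, THEN conjunct2, rule_format]
  show "A \<in> Obj C \<Longrightarrow> FO F A \<in> Obj C" "A \<in> Obj C \<Longrightarrow> FA F (I1 A) = I1 (FO F A)" using L1 by auto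
  show "FA F f \<in> hom (FO F A) (FO F B)" if "f \<in> hom A B"
    using L2[OF homD(4,5)[OF that]] that by (auto dest: funcset_mem)
  show "FA F (f \<boxplus> g) = FA F f \<boxplus> FA F g" if "f \<in> hom A B" "g \<in> hom A B"
    using L2[OF homD(4,5)[OF that(1)]] that by auto
  show "FA F (g \<bullet> f) = FA F g \<bullet> FA F f" if "f \<in> hom A B" "g \<in> hom B D"
    using L3[OF homD(4,5)[OF that(1)] homD(5)[OF that(2)] that] .
qed

lemma equivalence_Zer: "A \<in> Obj C \<Longrightarrow> B \<in> Obj C \<Longrightarrow> FA F (Z0 A B) = Z0 (FO F A) (FO F B)"
proof -
  assume h: "A \<in> Obj C" "B \<in> Obj C"
  note z = Zer_in_hom[OF h]
  have "FA F (Z0 A B) \<boxplus> FA F (Z0 A B) = FA F (Z0 A B) \<boxplus> Z0 (FO F A) (FO F B)"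
    using equivalence_Add[OF z z] Add_Zer_right[OF z] Add_Zer_right[OF equivalence_hom[OF z]] by simp
  then show ?thesis
    using Add_cancel[OF equivalence_hom[OF z] equivalence_hom[OF z] Zer_in_hom] h equivalence_Obj by blast
qed

lemma equivalence_Neg: "f \<in> hom A B \<Longrightarrow> FA F (Neg C f) = Neg C (FA F f)"
proof -
  assume f: "f \<in> hom A B"
  have "FA F f \<boxplus> FA F (Neg C f) = Z0 (FO F A) (FO F B)"
    using equivalence_Add[OF f Neg_in_hom[OF f]] mns_self[OF f] equivalence_Zer homD[OF f] by simp
  then show ?thesis using Neg_unique equivalence_hom f Neg_in_hom by blast
qed

lemma equivalence_faithful:
  assumes f: "f \<in> hom A B" and g: "g \<in> hom A B" and e: "FA F f = FA F g"
  shows "f = g"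
proof -
  obtain G \<eta> where n: "natural_iso C C fctr_id (fctr_comp G F) \<eta>"
    using F unfolding linear_equivalence_def by blast
  note n' = n[unfolded natural_iso_def fctr_id_def fctr_comp_def, simplified]
  have B: "A \<in> Obj C" "B \<in> Obj C" using f homD by auto
  obtain r where r: "\<eta> B \<in> hom B (FO G (FO F B))" "r \<in> hom (FO G (FO F B)) B" "r \<bullet> \<eta> B = I1 B"
    using n'[THEN conjunct1, rule_format, OF B(2)] unfolding iso_arr_def by blast
  have "\<eta> B \<bullet> f = \<eta> B \<bullet> g" using n'[THEN conjunct2, rule_format, OF B] f g e by simp
  then have "(r \<bullet> \<eta> B) \<bullet> f = (r \<bullet> \<eta> B) \<bullet> g" using Cmp_assoc[OF f r(1,2)] Cmp_assoc[OF g r(1,2)] by simp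
  then show ?thesis using r(3) Cmp_Idn_left f g by simp
qed

text \<open>The preimage f is G h carried along the unit. Unit and counit are not related by
  triangle identities, so F f = h is not immediate: naturality of the unit gives G (F f) = G h, and
  naturality of the counit turns this into F f = h.\<close>

lemma equivalence_full:
  assumes A: "A \<in> Obj C" "B \<in> Obj C" and h: "h \<in> hom (FO F A) (FO F B)"
  obtains f where "f \<in> hom A B" "FA F f = h"
proof -
  obtain G \<eta> \<epsilon> where G: "linear_functor K C C G" and n: "natural_iso C C fctr_id (fctr_comp G F) \<eta>"
    and m: "natural_iso C C (fctr_comp F G) fctr_id \<epsilon>"
    using F unfolding linear_equivalence_def by blast
  note n' = n[unfolded natural_iso_def fctr_id_def fctr_comp_def, simplified]
  note m' = m[unfolded natural_iso_def fctr_id_def fctr_comp_def, simplified]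
  have Gh: "FA G x \<in> hom (FO G X) (FO G Y)" if "x \<in> hom X Y" for x X Y
    using funcset_mem[of "FA G" "hom X Y"] G homD(4,5)[OF that] that
    unfolding linear_functor_def linear_map_def by simp
  obtain r where r: "\<eta> B \<in> hom B (FO G (FO F B))" "r \<in> hom (FO G (FO F B)) B" "r \<bullet> \<eta> B = I1 B" "\<eta> B \<bullet> r = I1 (FO G (FO F B))"
    using n'[THEN conjunct1, rule_format, OF A(2)] unfolding iso_arr_def by blast
  obtain s where s: "\<eta> A \<in> hom A (FO G (FO F A))" "s \<in> hom (FO G (FO F A)) A" "\<eta> A \<bullet> s = I1 (FO G (FO F A))"
    using n'[THEN conjunct1, rule_format, OF A(1)] unfolding iso_arr_def by blast
  define f where "f = r \<bullet> (FA G h \<bullet> \<eta> A)"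
  have x: "FA G h \<bullet> \<eta> A \<in> hom A (FO G (FO F B))" using Cmp_in_hom s(1) Gh[OF h] by blast
  have f: "f \<in> hom A B" unfolding f_def using x r Cmp_in_hom by blast
  have 1: "\<eta> B \<bullet> f = FA G h \<bullet> \<eta> A"
    unfolding f_def Cmp_assoc[OF x r(2,1), symmetric] r(4) using Cmp_Idn_left[OF x] .
  have Ff: "FA F f \<in> hom (FO F A) (FO F B)" using equivalence_hom[OF f] .
  have "\<eta> B \<bullet> f = FA G (FA F f) \<bullet> \<eta> A" using n'[THEN conjunct2, rule_format, OF A f] .
  then have "(FA G h \<bullet> \<eta> A) \<bullet> s = (FA G (FA F f) \<bullet> \<eta> A) \<bullet> s" using 1 by simp
  then have 2: "FA G h = FA G (FA F f)"
    unfolding Cmp_assoc[OF s(2,1) Gh[OF h]] Cmp_assoc[OF s(2,1) Gh[OF Ff]] s(3)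
    using Cmp_Idn_right Gh[OF h] Gh[OF Ff] by simp
  have O: "FO F A \<in> Obj C" "FO F B \<in> Obj C" using A equivalence_Obj by auto
  obtain t where t: "\<epsilon> (FO F A) \<in> hom (FO F (FO G (FO F A))) (FO F A)"
    "t \<in> hom (FO F A) (FO F (FO G (FO F A)))" "\<epsilon> (FO F A) \<bullet> t = I1 (FO F A)"
    using m'[THEN conjunct1, rule_format, OF O(1)] unfolding iso_arr_def by blast
  have "h \<bullet> \<epsilon> (FO F A) = FA F f \<bullet> \<epsilon> (FO F A)"
    using m'[THEN conjunct2, rule_format, OF O h] m'[THEN conjunct2, rule_format, OF O Ff] 2 by simp
  then have "h \<bullet> (\<epsilon> (FO F A) \<bullet> t) = FA F f \<bullet> (\<epsilon> (FO F A) \<bullet> t)"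
    using Cmp_assoc[OF t(2,1) h] Cmp_assoc[OF t(2,1) Ff] by simp
  then have "FA F f = h" using t(3) Cmp_Idn_right h Ff by simp
  then show thesis using that f by blast
qed

lemma equivalence_surj:
  assumes "B \<in> Obj C"
  obtains A where "A \<in> Obj C" "isomorphic C (FO F A) B"
proof -
  obtain G \<epsilon> where G: "linear_functor K C C G" and m: "natural_iso C C (fctr_comp F G) fctr_id \<epsilon>"
    using F unfolding linear_equivalence_def by blast
  have "FO G B \<in> Obj C" using G assms unfolding linear_functor_def by blast
  moreover have "iso_arr C (FO F (FO G B)) B (\<epsilon> B)"
    using m[unfolded natural_iso_def fctr_id_def fctr_comp_def] assms by simp
  ultimately show thesis using that equivalence_Obj assms unfolding isomorphic_def by blast
qed

lemma equivalence_iso: "isomorphic C A B \<longleftrightarrow> isomorphic C (FO F A) (FO F B)" if ab: "A \<in> Obj C" "B \<in> Obj C"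
proof
  assume "isomorphic C A B"
  then obtain f g where h: "f \<in> hom A B" "g \<in> hom B A" "g \<bullet> f = I1 A" "f \<bullet> g = I1 B" by (rule isomorphicE)
  show "isomorphic C (FO F A) (FO F B)"
    by (rule isomorphicI[of "FA F f" _ _ "FA F g"])
      (use h equivalence_hom that in \<open>simp_all add: equivalence_Cmp[symmetric] equivalence_Idn\<close>)
next
  assume "isomorphic C (FO F A) (FO F B)"
  then obtain f' g' where h': "f' \<in> hom (FO F A) (FO F B)" "g' \<in> hom (FO F B) (FO F A)"
    "g' \<bullet> f' = I1 (FO F A)" "f' \<bullet> g' = I1 (FO F B)" by (rule isomorphicE)
  obtain f where f: "f \<in> hom A B" "FA F f = f'" using equivalence_full[OF ab h'(1)] .
  obtain g where g: "g \<in> hom B A" "FA F g = g'" using equivalence_full[OF ab(2,1) h'(2)] .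
  show "isomorphic C A B"
  proof (rule isomorphicI[OF f(1) g(1)])
    show "g \<bullet> f = I1 A"
      by (rule equivalence_faithful[OF Cmp_in_hom[OF f(1) g(1)] Idn_in_hom[OF that(1)]])
        (use equivalence_Cmp[OF f(1) g(1)] f g h' that equivalence_Idn in simp)
    show "f \<bullet> g = I1 B"
      by (rule equivalence_faithful[OF Cmp_in_hom[OF g(1) f(1)] Idn_in_hom[OF that(2)]])
        (use equivalence_Cmp[OF g(1) f(1)] f g h' that equivalence_Idn in simp)
  qed
qed

lemma equivalence_van: "van A B \<longleftrightarrow> van (FO F A) (FO F B)" if ab: "A \<in> Obj C" "B \<in> Obj C"
proof
  assume v: "van A B"
  show "van (FO F A) (FO F B)" unfolding van_def
  proof
    fix h assume h: "h \<in> hom (FO F A) (FO F B)"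
    obtain f where f: "f \<in> hom A B" "FA F f = h" using equivalence_full[OF ab h] .
    show "h = Z0 (FO F A) (FO F B)" using vanD[OF v f(1)] f equivalence_Zer that by simp
  qed
next
  assume v: "van (FO F A) (FO F B)"
  show "van A B" unfolding van_def
  proof
    fix f assume f: "f \<in> hom A B"
    show "f = Z0 A B"
      by (rule equivalence_faithful[OF f Zer_in_hom[OF that]])
       (use vanD[OF v equivalence_hom[OF f]] equivalence_Zer that in simp)
  qed
qed

end

lemma neg_simps_aux:
  assumes "f \<in> Arr C" "g \<in> Arr C" "Dom C f = Dom C g" "Cod C f = Cod C g"
  shows "f \<boxplus> (g \<boxminus> f) = g"
  using assms add_simps(1)[of f "Neg C f" g] add_simps(2)[of g "Neg C f"] by (simp add: cat)

lemma neg_simps: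
  assumes "f \<in> Arr C" "g \<in> Arr C" "Dom C f = Dom C g" "Cod C f = Cod C g"
  shows "f \<boxplus> (Neg C f \<boxplus> g) = g" "Neg C f \<boxplus> (f \<boxplus> g) = g" "f \<boxplus> (g \<boxminus> f) = g"
    "Neg C f \<boxplus> (g \<boxplus> f) = g" "Neg C (f \<boxplus> g) = Neg C f \<boxminus> g"
proof -
  have 1: "f \<boxplus> (Neg C f \<boxplus> g) = g" "Neg C f \<boxplus> (f \<boxplus> g) = g"
    using assms add_simps(1)[of f "Neg C f" g] add_simps(1)[of "Neg C f" f g] by (simp_all add: cat)
  then show "f \<boxplus> (Neg C f \<boxplus> g) = g" "Neg C f \<boxplus> (f \<boxplus> g) = g" by blast+
  show 2: "f \<boxplus> (g \<boxminus> f) = g" "Neg C f \<boxplus> (g \<boxplus> f) = g"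
    using assms 1 add_simps(2)[of g "Neg C f"] add_simps(2)[of g f] by (simp_all add: arr_simps)
  have h: "f \<in> hom (Dom C f) (Cod C f)" "g \<in> hom (Dom C f) (Cod C f)" using assms by (simp_all add: homset_def)
  have "(f \<boxplus> g) \<boxplus> (Neg C f \<boxminus> g) = f \<boxplus> (g \<boxplus> (Neg C f \<boxminus> g))"
    using assms by (simp add: cat add_simps(1))
  also have "\<dots> = f \<boxplus> Neg C f"
    using neg_simps_aux[of g "Neg C f"] assms by (simp add: cat)
  finally show "Neg C (f \<boxplus> g) = Neg C f \<boxminus> g"
    using Neg_unique[OF Add_in_hom[OF h], of "Neg C f \<boxminus> g"] h assms mns_self[OF h(1)] by (metis Neg_in_hom Add_in_hom)
qed

text \<open>With u = x - 1 of square zero, the inverse of 1 + u is 1 - u. Comparison maps between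
  cones will be of this kind.\<close>

lemma unipotent_iso:
  assumes x: "x \<in> hom A A" and sq: "(x \<boxminus> I1 A) \<bullet> (x \<boxminus> I1 A) = Z0 A A"
  obtains y where "y \<in> hom A A" "y \<bullet> x = I1 A" "x \<bullet> y = I1 A"
proof -
  define u where "u = x \<boxminus> I1 A"
  have A: "A \<in> Obj C" using homD x by auto
  have u: "u \<in> hom A A" unfolding u_def using x Idn_in_hom[OF A] by blast
  have xu: "x = I1 A \<boxplus> u" using Add_mns_eq[OF x Idn_in_hom[OF A] u] u_def by blast
  have uu: "u \<bullet> u = Z0 A A" using sq u_def by simp
  have y: "I1 A \<boxminus> u \<in> hom A A" using u Idn_in_hom[OF A] by blast
  have "(I1 A \<boxminus> u) \<bullet> (I1 A \<boxplus> u) = I1 A" "(I1 A \<boxplus> u) \<bullet> (I1 A \<boxminus> u) = I1 A"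
    using u A by (simp_all add: cat uu add_simps neg_simps)
  then show thesis using that[OF y] xu by simp
qed

end

context triangulated_category
begin

notation cmp (infixr "\<bullet>" 70)
notation pls (infixl "\<boxplus>" 65)
notation mns (infixl "\<boxminus>" 65)
abbreviation s where "s \<equiv> sh T"
abbreviation sa where "sa \<equiv> shA T"

lemmas sh_Obj = equivalence_Obj[OF shift_equivalence, folded sh_def]
lemmas sa_Idn = equivalence_Idn[OF shift_equivalence, folded sh_def shA_def]
lemmas sa_hom = equivalence_hom[OF shift_equivalence, folded sh_def shA_def]
lemmas sa_Add = equivalence_Add[OF shift_equivalence, folded sh_def shA_def]
lemmas sa_Cmp = equivalence_Cmp[OF shift_equivalence, folded sh_def shA_def]
lemmas sa_Zer = equivalence_Zer[OF shift_equivalence, folded sh_def shA_def]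
lemmas sa_Neg = equivalence_Neg[OF shift_equivalence, folded sh_def shA_def]
lemmas sa_faithful = equivalence_faithful[OF shift_equivalence, folded sh_def shA_def]
lemmas sa_full = equivalence_full[OF shift_equivalence, folded sh_def shA_def]
lemmas sh_surj = equivalence_surj[OF shift_equivalence, folded sh_def shA_def]
lemmas sh_iso = equivalence_iso[OF shift_equivalence, folded sh_def shA_def]
lemmas sh_van = equivalence_van[OF shift_equivalence, folded sh_def shA_def]

lemma sa_simps:
  "f \<in> Arr T \<Longrightarrow> sa f \<in> Arr T" "f \<in> Arr T \<Longrightarrow> Dom T (sa f) = s (Dom T f)" "f \<in> Arr T \<Longrightarrow> Cod T (sa f) = s (Cod T f)"
  "f \<in> Arr T \<Longrightarrow> g \<in> Arr T \<Longrightarrow> Cod T f = Dom T g \<Longrightarrow> sa (g \<bullet> f) = sa g \<bullet> sa f"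
  "f \<in> Arr T \<Longrightarrow> g \<in> Arr T \<Longrightarrow> Dom T f = Dom T g \<Longrightarrow> Cod T f = Cod T g \<Longrightarrow> sa (f \<boxplus> g) = sa f \<boxplus> sa g"
  "f \<in> Arr T \<Longrightarrow> sa (Neg T f) = Neg T (sa f)"
  using sa_hom[OF arr_hom, of f] sa_Cmp[OF arr_hom, of f g] sa_Add[OF arr_hom, of f g] sa_Neg[OF arr_hom, of f]
  by (simp_all add: homset_def)

lemma zero_object_sh: "zero_object T Z \<Longrightarrow> zero_object T (s Z)"
  unfolding zero_object_iff by (metis sh_Obj sa_Idn sa_Zer)

lemma dtD:
  assumes "dtriangle T A B D f g h"
  shows "f \<in> hom A B" "g \<in> hom B D" "h \<in> hom D (s A)" "A \<in> Obj T" "B \<in> Obj T" "D \<in> Obj T" "(f, g, h) \<in> Dist T"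
  using assms by (auto simp: dtriangle_def triangle_def)

lemma dtI: "f \<in> hom A B \<Longrightarrow> g \<in> hom B D \<Longrightarrow> h \<in> hom D (s A) \<Longrightarrow> (f, g, h) \<in> Dist T \<Longrightarrow> dtriangle T A B D f g h"
  using homD(4,5)[of f A B] homD(5)[of g B D] by (simp add: dtriangle_def triangle_def)

section \<open>Rotation of triangles and long exact sequences\<close>

lemma rotate:
  assumes "dtriangle T A B D f g h"
  shows "dtriangle T B D (s A) g h (Neg T (sa f))"
proof (rule dtI)
  show "(g, h, Neg T (sa f)) \<in> Dist T"
    using TR2[of A B D f g h] assms Neg_hom[OF sa_hom[OF dtD(1)[OF assms]]] by (simp add: dtriangle_def)
qed (use dtD[OF assms] sa_hom in blast)+

lemma unrotate:
  assumes "dtriangle T B D (s A) g h (Neg T (sa f))" "f \<in> hom A B"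
  shows "dtriangle T A B D f g h"
proof -
  have "triangle T A B D (f, g, h)" using dtD[OF assms(1)] assms(2) homD(4)[OF assms(2)] by (simp add: triangle_def)
  then show ?thesis
    using TR2[of A B D f g h] dtD(7)[OF assms(1)] Neg_hom[OF sa_hom[OF assms(2)]] by (simp add: dtriangle_def)
qed

lemma shift_dtriangle:
  assumes "dtriangle T A B D f g h"
  shows "dtriangle T (s A) (s B) (s D) (Neg T (sa f)) (Neg T (sa g)) (Neg T (sa h))"
  by (intro rotate assms)

lemma triangle_id:
  assumes "A \<in> Obj T" "zero_object T Z"
  shows "dtriangle T A A Z (I1 A) (Z0 A Z) (Z0 Z (s A))"
proof -
  have "Z \<in> Obj T" using assms zero_object_iff by blast
  then show ?thesis using assms TR1_id Idn_in_hom Zer_in_hom sh_Obj by (intro dtI) simp_all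
qed

lemma triangle_id':
  assumes "A \<in> Obj T" "zero_object T Z"
  shows "dtriangle T Z A A (Z0 Z A) (I1 A) (Z0 A (s Z))"
proof (rule unrotate)
  have Z: "Z \<in> Obj T" using assms zero_object_iff by blast
  show "Z0 Z A \<in> hom Z A" using assms Z by simp
  show "dtriangle T A A (s Z) (I1 A) (Z0 A (s Z)) (Neg T (sa (Z0 Z A)))"
    using triangle_id[OF assms(1) zero_object_sh[OF assms(2)]] Z assms(1) by (simp add: sa_Zer Neg_Zer sh_Obj)
qed

text \<open>TR3 maps the triangle on the identity of A into the given one; its third arrow starts at
  a zero object, and g f factors through it.\<close>

lemma dt_zero1:
  assumes "dtriangle T A B D f g h"
  shows "g \<bullet> f = Z0 A D"
proof -
  note d = dtD[OF assms]
  obtain Z where Z: "zero_object T Z" using ex_zero_object by blast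
  have "f \<bullet> I1 A = f \<bullet> I1 A" ..
  from TR3[OF triangle_id[OF d(4) Z] assms Idn_in_hom[OF d(4)] d(1) this]
  obtain c where c: "c \<in> hom Z D" "c \<bullet> Z0 A Z = g \<bullet> f" by blast
  then show ?thesis using Cmp_Zer_right[OF c(1) d(4)] by simp
qed

lemma dt_zero2: "dtriangle T A B D f g h \<Longrightarrow> h \<bullet> g = Z0 B (s A)"
  by (rule dt_zero1[OF rotate])

lemma dt_zero3:
  assumes "dtriangle T A B D f g h"
  shows "sa f \<bullet> h = Z0 D (s B)"
proof -
  note d = dtD[OF assms]
  have "Neg T (sa f) \<bullet> h = Z0 D (s B)" by (rule dt_zero1[OF rotate[OF rotate[OF assms]]])
  then have "Neg T (sa f \<bullet> h) = Z0 D (s B)" using Cmp_Neg_left[OF sa_hom[OF d(1)] d(3)] by simp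
  then show ?thesis
    by (metis Cmp_in_hom Neg_Neg Neg_Zer d(1,3,5,6) sa_hom sh_Obj)
qed

lemma Neg_inj: "f \<in> hom A B \<Longrightarrow> g \<in> hom A B \<Longrightarrow> Neg T f = Neg T g \<Longrightarrow> f = g"
  by (metis Neg_Neg)

text \<open>The digit in this and the following names counts the term of A, B, D, A[1] at which the
  hom sequence is exact. TR3 completes third arrows only, so the triangle on the identity of W and
  the given one are rotated first, and the arrow obtained between shifts is desuspended.\<close>

lemma exact_cov2:
  assumes t: "dtriangle T A B D f g h" and u: "u \<in> hom W B" and gu: "g \<bullet> u = Z0 W D"
  obtains v where "v \<in> hom W A" "f \<bullet> v = u"
proof -
  note d = dtD[OF t]
  obtain Z where Z: "zero_object T Z" using ex_zero_object by blast
  then have Zo: "Z \<in> Obj T" using zero_object_iff by blast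
  have W: "W \<in> Obj T" using u homD by auto
  have "Z0 Z D \<bullet> Z0 W Z = g \<bullet> u" using gu Zo W d by (simp add: cat)
  from TR3[OF rotate[OF triangle_id[OF W Z]] rotate[OF t] u Zer_in_hom[OF Zo d(6)] this]
  obtain c where c: "c \<in> hom (s W) (s A)" "sa u \<bullet> Neg T (sa (I1 W)) = Neg T (sa f) \<bullet> c" by blast
  obtain v where v: "v \<in> hom W A" "sa v = c" using sa_full[OF W d(4) c(1)] .
  have "Neg T (sa u) = Neg T (sa (f \<bullet> v))"
    using c(2) u v d W sa_hom[OF u] sa_hom[OF v(1)] sa_hom[OF d(1)]
    by (simp add: sa_Idn sa_Cmp[OF v(1) d(1)] cat sh_Obj)
  then have "sa u = sa (f \<bullet> v)" using Neg_inj sa_hom u v Cmp_in_hom[OF v(1) d(1)] by blast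
  then have "f \<bullet> v = u" using sa_faithful u v Cmp_in_hom[OF v(1) d(1)] by metis
  then show thesis using that v by blast
qed

lemma exact_contra2:
  assumes t: "dtriangle T A B D f g h" and u: "u \<in> hom B W" and uf: "u \<bullet> f = Z0 A W"
  obtains v where "v \<in> hom D W" "v \<bullet> g = u"
proof -
  note d = dtD[OF t]
  obtain Z where Z: "zero_object T Z" using ex_zero_object by blast
  then have Zo: "Z \<in> Obj T" using zero_object_iff by blast
  have W: "W \<in> Obj T" using u homD by auto
  have "u \<bullet> f = Z0 Z W \<bullet> Z0 A Z" using uf Zo W d by (simp add: cat)
  from TR3[OF t triangle_id'[OF W Z] Zer_in_hom[OF d(4) Zo] u this]
  obtain c where "c \<in> hom D W" "c \<bullet> g = I1 W \<bullet> u" by blast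
  then show thesis using that Cmp_Idn_left[OF u] by simp
qed

lemma exact_cov3:
  assumes "dtriangle T A B D f g h" "u \<in> hom W D" "h \<bullet> u = Z0 W (s A)"
  obtains v where "v \<in> hom W B" "g \<bullet> v = u"
  using exact_cov2[OF rotate[OF assms(1)] assms(2,3)] .

lemma exact_contra3:
  assumes "dtriangle T A B D f g h" "u \<in> hom D W" "u \<bullet> g = Z0 B W"
  obtains v where "v \<in> hom (s A) W" "v \<bullet> h = u"
  using exact_contra2[OF rotate[OF assms(1)] assms(2,3)] .

text \<open>Rotation puts a sign on the shifted first arrow, which does not affect the vanishing of
  a composite.\<close>

lemma exact_cov4:
  assumes t: "dtriangle T A B D f g h" and u: "u \<in> hom W (s A)" "sa f \<bullet> u = Z0 W (s B)"
  obtains v where "v \<in> hom W D" "h \<bullet> v = u"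
proof -
  have "Neg T (sa f) \<bullet> u = Z0 W (s B)"
    using Cmp_Neg_left[OF sa_hom[OF dtD(1)[OF t]] u(1)] u(2) Neg_Zer homD(4)[OF u(1)] sh_Obj dtD[OF t] by simp
  then show thesis using exact_cov3[OF rotate[OF t] u(1)] that by blast
qed

lemma exact_contra4:
  assumes t: "dtriangle T A B D f g h" and u: "u \<in> hom (s A) W" "u \<bullet> h = Z0 D W"
  obtains v where "v \<in> hom (s B) W" "v \<bullet> sa f = u"
proof -
  obtain v where v: "v \<in> hom (s B) W" "v \<bullet> Neg T (sa f) = u" using exact_contra3[OF rotate[OF t] u] .
  have "Neg T v \<bullet> sa f = u"
    using v(2) Cmp_Neg_left[OF v(1) sa_hom[OF dtD(1)[OF t]]] Cmp_Neg_right[OF v(1) sa_hom[OF dtD(1)[OF t]]] by simp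
  then show thesis using that v(1) by blast
qed

lemma third_iso:
  assumes t: "dtriangle T A B D f g h" and i: "i \<in> hom D D'" "j \<in> hom D' D" "j \<bullet> i = I1 D" "i \<bullet> j = I1 D'"
  shows "dtriangle T A B D' f (i \<bullet> g) (h \<bullet> j)"
proof (rule dtI)
  note d = dtD[OF t]
  have D': "D' \<in> Obj T" using i homD by auto
  show 1: "f \<in> hom A B" "i \<bullet> g \<in> hom B D'" "h \<bullet> j \<in> hom D' (s A)" using d i Cmp_in_hom by blast+
  show "(f, i \<bullet> g, h \<bullet> j) \<in> Dist T"
  proof (rule Dist_iso[OF t])
    show "triangle T A B D' (f, i \<bullet> g, h \<bullet> j)" using 1 d D' by (simp add: triangle_def)
    show "iso_arr T D D' i" using i unfolding iso_arr_def by blast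
    show "iso_arr T A A (I1 A)" "iso_arr T B B (I1 B)"
      using d Idn_in_hom Cmp_Idn_left unfolding iso_arr_def by blast+
    show "I1 B \<bullet> f = f \<bullet> I1 A" "i \<bullet> g = (i \<bullet> g) \<bullet> I1 B"
      using d 1 by (simp_all add: Cmp_Idn_left Cmp_Idn_right)
    have "(h \<bullet> j) \<bullet> i = h" using Cmp_assoc[OF i(1,2) d(3)] i(3) Cmp_Idn_right[OF d(3)] by simp
    then show "sa (I1 A) \<bullet> h = (h \<bullet> j) \<bullet> i" using d by (simp add: sa_Idn Cmp_Idn_left)
  qed
qed

text \<open>The shift is only an equivalence, so the cone is exchanged for an isomorphic object of
  the form D[1]; such a triangle can be rotated backwards.\<close>

lemma cone_shifted:
  assumes "f \<in> hom A B"
  obtains D g h where "D \<in> Obj T" "dtriangle T A B (s D) f g h"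
proof -
  obtain E g h where t: "dtriangle T A B E f g h" using TR1_cone[OF assms] by blast
  obtain D where D: "D \<in> Obj T" "isomorphic T (s D) E" using sh_surj[OF dtD(6)[OF t]] .
  obtain i j where "i \<in> hom E (s D)" "j \<in> hom (s D) E" "j \<bullet> i = I1 E" "i \<bullet> j = I1 (s D)"
    using isomorphic_sym[OF D(2)] by (rule isomorphicE)
  then show thesis using that[OF D(1)] third_iso[OF t] by blast
qed

lemma neg_sa_full:
  assumes "A \<in> Obj T" "B \<in> Obj T" "g \<in> hom (s A) (s B)"
  obtains f where "f \<in> hom A B" "g = Neg T (sa f)"
proof -
  obtain f where f: "f \<in> hom A B" "sa f = Neg T g" using sa_full[OF assms(1,2) Neg_in_hom[OF assms(3)]] .
  then show thesis using that[OF f(1)] Neg_Neg[OF assms(3)] by simp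
qed

lemma cocone:
  assumes "g \<in> hom B D"
  obtains A f h where "dtriangle T A B D f g h"
proof -
  obtain A h k where t: "A \<in> Obj T" "dtriangle T B D (s A) g h k" using cone_shifted[OF assms] .
  obtain f where "f \<in> hom A B" "k = Neg T (sa f)"
    using neg_sa_full[OF t(1) _ dtD(3)[OF t(2)]] homD(4)[OF assms] by blast
  then show thesis using that unrotate t(2) by blast
qed

text \<open>Prescribing the third arrow means rotating the triangle on h backwards twice, which
  needs its cone to be a shift B[1].\<close>

lemma complete_third:
  assumes "h \<in> hom D (s A)" "A \<in> Obj T"
  obtains B f g where "dtriangle T A B D f g h"
proof -
  obtain B k l where t: "B \<in> Obj T" "dtriangle T D (s A) (s B) h k l" using cone_shifted[OF assms(1)] .
  obtain f where f: "f \<in> hom A B" "k = Neg T (sa f)" using neg_sa_full[OF assms(2) t(1) dtD(2)[OF t(2)]] .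
  obtain g where g: "g \<in> hom B D" "l = Neg T (sa g)"
    using neg_sa_full[OF t(1) homD(4)[OF assms(1)] dtD(3)[OF t(2)]] .
  have "dtriangle T B D (s A) g h (Neg T (sa f))" by (rule unrotate) (use t f g in auto)
  then show thesis using that unrotate f(1) by blast
qed

lemma van_mid_left:
  assumes t: "dtriangle T A B D f g h" and v: "van A W" "van D W"
  shows "van B W"
  unfolding van_def
proof
  fix u assume u: "u \<in> hom B W"
  obtain w where w: "w \<in> hom D W" "w \<bullet> g = u"
    using exact_contra2[OF t u] vanD[OF v(1)] Cmp_in_hom[OF dtD(1)[OF t] u] by blast
  show "u = Z0 B W" using w vanD[OF v(2) w(1)] Cmp_Zer_left[OF dtD(2)[OF t] homD(5)[OF u]] by simp
qed

lemma van_mid_right: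
  assumes t: "dtriangle T A B D f g h" and v: "van W A" "van W D"
  shows "van W B"
  unfolding van_def
proof
  fix u assume u: "u \<in> hom W B"
  obtain w where w: "w \<in> hom W A" "f \<bullet> w = u"
    using exact_cov2[OF t u] vanD[OF v(2)] Cmp_in_hom[OF u dtD(2)[OF t]] by blast
  show "u = Z0 W B" using w vanD[OF v(1) w(1)] Cmp_Zer_right[OF dtD(1)[OF t] homD(4)[OF u]] by simp
qed

lemma third_zero_split:
  assumes t: "dtriangle T A B D f g h" and h: "h = Z0 D (s A)"
  obtains w where "w \<in> hom D B" "g \<bullet> w = I1 D"
proof -
  note d = dtD[OF t]
  have "h \<bullet> I1 D = Z0 D (s A)" using Cmp_Idn_right[OF d(3)] h by simp
  then show thesis using exact_cov3[OF t Idn_in_hom[OF d(6)]] that by blast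
qed


end

section \<open>Arrows modulo a subcategory\<close>

locale factor_setting = additive_category K C
  for K :: "('k, 'r) ring_scheme" (structure) and C :: "('k, 'o, 'm, 'z) lincat_scheme" +
  fixes XX :: "'o set"
  assumes XX: "subcategory C XX"
begin

notation cmp (infixr "\<bullet>" 70)
notation pls (infixl "\<boxplus>" 65)
notation mns (infixl "\<boxminus>" 65)

text \<open>The arrows that become zero in the factor category. Computing with representatives
  modulo this ideal keeps the arguments in the ambient category, where the triangles live; classes
  enter only in the final comparison.\<close>

definition nul :: "'m \<Rightarrow> bool"
  where "nul f \<longleftrightarrow> f \<in> Arr C \<and> f \<in> factor_ideal C XX (Dom C f) (Cod C f)"

definition eqv :: "'m \<Rightarrow> 'm \<Rightarrow> bool"  (infix "\<approx>" 50)
  where "f \<approx> g \<longleftrightarrow> f \<in> Arr C \<and> g \<in> Arr C \<and> Dom C f = Dom C g \<and> Cod C f = Cod C g \<and> nul (f \<boxminus> g)"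

lemma XX_Obj: "Y \<in> XX \<Longrightarrow> Y \<in> Obj C"
  using XX unfolding subcategory_def by blast

lemma XX_iso: "Y \<in> XX \<Longrightarrow> isomorphic C Y Y' \<Longrightarrow> Y' \<in> XX"
  using XX unfolding subcategory_def by blast

lemma XX_biproduct: "Y \<in> XX \<Longrightarrow> Y' \<in> XX \<Longrightarrow> biproduct C Y Y' P \<Longrightarrow> P \<in> XX"
  using XX unfolding subcategory_def by blast

lemma XX_summand: "P \<in> XX \<Longrightarrow> biproduct C Y Y' P \<Longrightarrow> Y \<in> XX"
  using XX unfolding subcategory_def by blast

lemma XX_zero: "zero_object C Z \<Longrightarrow> Z \<in> XX"
proof -
  assume Z: "zero_object C Z"
  obtain Z' where Z': "Z' \<in> XX" "zero_object C Z'" using XX unfolding subcategory_def by blast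
  have o: "Z \<in> Obj C" "Z' \<in> Obj C" using Z Z' zero_object_iff by auto
  have "isomorphic C Z' Z"
    by (rule isomorphicI[of "Z0 Z' Z" _ _ "Z0 Z Z'"])
      (use o Z Z' zero_object_iff in \<open>simp_all add: Cmp_Zer_left[OF Zer_in_hom]\<close>)
  then show ?thesis using XX_iso Z' by blast
qed

text \<open>\<open>subcategory\<close> is closed under biproduct summands; the complement that turns
  a retract into such a summand comes from splitting an idempotent.\<close>

lemma XX_retract:
  assumes "split_idempotents C" "Y \<in> XX" "i \<in> hom A Y" "r \<in> hom Y A" "r \<bullet> i = I1 A"
  shows "A \<in> XX"
proof -
  obtain B j q where h: "j \<in> hom B Y" "q \<in> hom Y B" "q \<bullet> j = I1 B" "r \<bullet> j = Z0 B A" "q \<bullet> i = Z0 A B"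
    "(i \<bullet> r) \<boxplus> (j \<bullet> q) = I1 Y"
    by (rule split_summand[OF assms(1,3-5)])
  have "biproduct C A B Y" by (rule biproductI[OF assms(3) h(1) assms(4) h(2) assms(5) h(3-6)])
  then show ?thesis using XX_summand assms(2) by blast
qed

lemma factor_idealE:
  assumes "f \<in> factor_ideal C XX A B"
  obtains Y g h where "Y \<in> XX" "g \<in> hom A Y" "h \<in> hom Y B" "f = h \<bullet> g"
  using assms unfolding factor_ideal_def by blast

lemma nul_iff: "f \<in> hom A B \<Longrightarrow> nul f \<longleftrightarrow> f \<in> factor_ideal C XX A B"
  unfolding nul_def by (auto simp: homset_def)

lemma factor_ideal_hom: "f \<in> factor_ideal C XX A B \<Longrightarrow> f \<in> hom A B"
  using factor_idealE Cmp_in_hom by metis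

lemma nulI: "Y \<in> XX \<Longrightarrow> g \<in> hom A Y \<Longrightarrow> h \<in> hom Y B \<Longrightarrow> nul (h \<bullet> g)"
  using nul_iff[of "h \<bullet> g" A B] Cmp_in_hom unfolding factor_ideal_def by blast

lemma nulE:
  assumes "nul f" "f \<in> hom A B"
  obtains Y g h where "Y \<in> XX" "g \<in> hom A Y" "h \<in> hom Y B" "f = h \<bullet> g"
  using assms factor_idealE nul_iff by metis

lemma nul_hom: "nul f \<Longrightarrow> f \<in> hom (Dom C f) (Cod C f)"
  by (simp add: nul_def arr_hom)

lemma nul_post:
  assumes "nul f" "f \<in> hom A B" "g \<in> hom B D"
  shows "nul (g \<bullet> f)"
proof -
  obtain Y x y where h: "Y \<in> XX" "x \<in> hom A Y" "y \<in> hom Y B" "f = y \<bullet> x" using nulE assms by blast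
  have "g \<bullet> f = (g \<bullet> y) \<bullet> x" using h assms Cmp_assoc by metis
  then show ?thesis using nulI[OF h(1,2) Cmp_in_hom[OF h(3) assms(3)]] by simp
qed

lemma nul_pre:
  assumes "nul g" "f \<in> hom A B" "g \<in> hom B D"
  shows "nul (g \<bullet> f)"
proof -
  obtain Y x y where h: "Y \<in> XX" "x \<in> hom B Y" "y \<in> hom Y D" "g = y \<bullet> x" using nulE assms by blast
  have "g \<bullet> f = y \<bullet> (x \<bullet> f)" using h assms Cmp_assoc by metis
  then show ?thesis using nulI[OF h(1) Cmp_in_hom[OF assms(2) h(2)] h(3)] by simp
qed

lemma nul_Zer: "A \<in> Obj C \<Longrightarrow> B \<in> Obj C \<Longrightarrow> nul (Z0 A B)"
proof -
  assume h: "A \<in> Obj C" "B \<in> Obj C"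
  obtain Z where Z: "zero_object C Z" using ex_zero_object by blast
  then have o: "Z \<in> Obj C" using zero_object_iff by blast
  have "nul (Z0 Z B \<bullet> Z0 A Z)" by (rule nulI[OF XX_zero[OF Z] Zer_in_hom[OF h(1) o] Zer_in_hom[OF o h(2)]])
  then show ?thesis using Cmp_Zer_left[OF Zer_in_hom[OF h(1) o] h(2)] by simp
qed

lemma nul_object_left: "Y \<in> XX \<Longrightarrow> f \<in> hom Y B \<Longrightarrow> nul f"
  using nulI[of Y "I1 Y" Y f B] Idn_in_hom XX_Obj Cmp_Idn_right by metis

lemma nul_object_right: "Y \<in> XX \<Longrightarrow> f \<in> hom A Y \<Longrightarrow> nul f"
  using nulI[of Y f A "I1 Y" Y] Idn_in_hom XX_Obj Cmp_Idn_left by metis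

lemma nul_Neg: "nul f \<Longrightarrow> nul (Neg C f)"
proof -
  assume n: "nul f"
  note f = nul_hom[OF n]
  have i: "I1 (Cod C f) \<in> hom (Cod C f) (Cod C f)" using Idn_in_hom homD(5)[OF f] by blast
  have "Neg C (I1 (Cod C f)) \<bullet> f = Neg C f" using Cmp_Neg_left[OF i f] Cmp_Idn_left[OF f] by simp
  then show ?thesis using nul_post[OF n f Neg_in_hom[OF i]] by simp
qed

text \<open>The sum factors through the biproduct of the two intermediate objects.\<close>

lemma nul_Add:
  assumes n: "nul f" "nul f'" and h: "f \<in> hom A B" "f' \<in> hom A B"
  shows "nul (f \<boxplus> f')"
proof -
  obtain Y x y where 1: "Y \<in> XX" "x \<in> hom A Y" "y \<in> hom Y B" "f = y \<bullet> x" using nulE n h by blast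
  obtain Y' x' y' where 2: "Y' \<in> XX" "x' \<in> hom A Y'" "y' \<in> hom Y' B" "f' = y' \<bullet> x'" using nulE n h by blast
  obtain P where P: "biproduct C Y Y' P" using ex_biproduct XX_Obj 1 2 by blast
  obtain i j p q where b: "i \<in> hom Y P" "j \<in> hom Y' P" "p \<in> hom P Y" "q \<in> hom P Y'"
    "p \<bullet> i = I1 Y" "q \<bullet> j = I1 Y'" "p \<bullet> j = Z0 Y' Y" "q \<bullet> i = Z0 Y Y'" "(i \<bullet> p) \<boxplus> (j \<bullet> q) = I1 P"
    using P by (rule biproductE)
  have u: "(i \<bullet> x) \<boxplus> (j \<bullet> x') \<in> hom A P" "(y \<bullet> p) \<boxplus> (y' \<bullet> q) \<in> hom P B"
    using b 1 2 by (auto intro!: Add_in_hom intro: Cmp_in_hom)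
  have "((y \<bullet> p) \<boxplus> (y' \<bullet> q)) \<bullet> ((i \<bullet> x) \<boxplus> (j \<bullet> x'))
      = ((y \<bullet> ((p \<bullet> i) \<bullet> x)) \<boxplus> (y' \<bullet> ((q \<bullet> i) \<bullet> x))) \<boxplus> ((y \<bullet> ((p \<bullet> j) \<bullet> x')) \<boxplus> (y' \<bullet> ((q \<bullet> j) \<bullet> x')))"
    using b(1-4) 1(2,3) 2(2,3) by (simp add: cat)
  also have "\<dots> = (y \<bullet> x) \<boxplus> (y' \<bullet> x')"
    unfolding b(5-8) using b(1-4) 1(2,3) 2(2,3) XX_Obj[OF 1(1)] XX_Obj[OF 2(1)] homD(4,5)[OF h(1)]
    by (simp add: cat)
  finally show ?thesis using nulI[OF XX_biproduct[OF 1(1) 2(1) P] u] 1(4) 2(4) by simp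
qed

lemma eqvD: "f \<approx> g \<Longrightarrow> f \<in> hom A B \<Longrightarrow> g \<in> hom A B"
  "f \<approx> g \<Longrightarrow> g \<in> hom A B \<Longrightarrow> f \<in> hom A B"
  by (auto simp: eqv_def homset_def)

lemma eqv_hom: "f \<in> hom A B \<Longrightarrow> g \<in> hom A B \<Longrightarrow> f \<approx> g \<longleftrightarrow> nul (f \<boxminus> g)"
  by (auto simp: eqv_def homset_def)

lemma eqv_refl: "f \<in> hom A B \<Longrightarrow> f \<approx> f"
  by (simp add: eqv_hom mns_self nul_Zer homD)

lemma eqv_arr: "f \<approx> g \<Longrightarrow> f \<in> hom (Dom C f) (Cod C f) \<and> g \<in> hom (Dom C f) (Cod C f)"
  by (auto simp: eqv_def homset_def)

lemma eqv_sym: "f \<approx> g \<Longrightarrow> g \<approx> f"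
proof -
  assume e: "f \<approx> g"
  then have h: "f \<in> hom (Dom C f) (Cod C f)" "g \<in> hom (Dom C f) (Cod C f)" using eqv_arr by auto
  have "nul (Neg C (f \<boxminus> g))" using e nul_Neg by (simp add: eqv_def)
  also have "Neg C (f \<boxminus> g) = g \<boxminus> f"
    using h by (simp add: cat neg_simps add_simps(2)[of "Neg C f" g])
  finally show ?thesis using eqv_hom[OF h(2,1)] by simp
qed

lemma eqv_trans [trans]: "f \<approx> g \<Longrightarrow> g \<approx> h \<Longrightarrow> f \<approx> h"
proof -
  assume e: "f \<approx> g" "g \<approx> h"
  then have h: "f \<in> hom (Dom C f) (Cod C f)" "g \<in> hom (Dom C f) (Cod C f)" "h \<in> hom (Dom C f) (Cod C f)"
    by (auto simp: eqv_def homset_def)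
  have "(f \<boxminus> g) \<boxplus> (g \<boxminus> h) = f \<boxminus> h"
    using h by (simp add: cat neg_simps add_simps)
  then show ?thesis using nul_Add[OF _ _ mns_in_hom[OF h(1,2)] mns_in_hom[OF h(2,3)]] e h eqv_hom by metis
qed

lemma eqv_eq_trans [trans]: "f \<approx> g \<Longrightarrow> g = h \<Longrightarrow> f \<approx> h" "f = g \<Longrightarrow> g \<approx> h \<Longrightarrow> f \<approx> h"
  by auto

lemma eqv_Zer: "f \<in> hom A B \<Longrightarrow> f \<approx> Z0 A B \<longleftrightarrow> nul f"
  by (simp add: eqv_hom homD Neg_Zer Add_Zer_right)

lemma eqv_nul: "f \<approx> g \<Longrightarrow> nul f \<longleftrightarrow> nul g"
proof -
  assume e: "f \<approx> g"
  then have h: "f \<in> hom (Dom C f) (Cod C f)" "g \<in> hom (Dom C f) (Cod C f)" using eqv_arr by auto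
  show ?thesis
    unfolding eqv_Zer[OF h(1), symmetric] eqv_Zer[OF h(2), symmetric]
    using eqv_trans[OF e] eqv_trans[OF eqv_sym[OF e]] by blast
qed

lemma eqv_Cmp_left:
  assumes "g \<approx> g'" "f \<in> hom A B" "g \<in> hom B D"
  shows "g \<bullet> f \<approx> g' \<bullet> f"
proof -
  have g': "g' \<in> hom B D" using eqvD assms by blast
  have "nul ((g \<boxminus> g') \<bullet> f)"
    using nul_pre[OF _ assms(2) mns_in_hom[OF assms(3) g']] assms(1) eqv_hom[OF assms(3) g'] by blast
  then show ?thesis
    using Cmp_mns_left[OF assms(2,3) g'] eqv_hom[OF Cmp_in_hom[OF assms(2,3)] Cmp_in_hom[OF assms(2) g']] by simp
qed

lemma eqv_Cmp_right:
  assumes "f \<approx> f'" "f \<in> hom A B" "g \<in> hom B D"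
  shows "g \<bullet> f \<approx> g \<bullet> f'"
proof -
  have f': "f' \<in> hom A B" using eqvD assms by blast
  have "nul (g \<bullet> (f \<boxminus> f'))"
    using nul_post[OF _ mns_in_hom[OF assms(2) f'] assms(3)] assms(1) eqv_hom[OF assms(2) f'] by blast
  then show ?thesis
    using Cmp_mns_right[OF assms(3,2) f'] eqv_hom[OF Cmp_in_hom[OF assms(2,3)] Cmp_in_hom[OF f' assms(3)]] by simp
qed

lemma eqv_Cmp:
  assumes "f \<approx> f'" "g \<approx> g'" "f \<in> hom A B" "g \<in> hom B D"
  shows "g \<bullet> f \<approx> g' \<bullet> f'"
  using eqv_Cmp_left[OF assms(2,3,4)] eqv_Cmp_right[OF assms(1,3), of g' D] eqvD(1)[OF assms(2,4)] eqv_trans by blast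

lemma eqv_Add:
  assumes "f \<approx> f'" "g \<approx> g'" "f \<in> hom A B" "g \<in> hom A B"
  shows "f \<boxplus> g \<approx> f' \<boxplus> g'"
proof -
  have h: "f' \<in> hom A B" "g' \<in> hom A B" using eqvD assms by blast+
  have "nul ((f \<boxminus> f') \<boxplus> (g \<boxminus> g'))"
    using nul_Add[OF _ _ mns_in_hom[OF assms(3) h(1)] mns_in_hom[OF assms(4) h(2)]] assms
      eqv_hom[OF assms(3) h(1)] eqv_hom[OF assms(4) h(2)] by blast
  also have "(f \<boxminus> f') \<boxplus> (g \<boxminus> g') = (f \<boxplus> g) \<boxminus> (f' \<boxplus> g')"
    using assms(3,4) h by (simp add: cat neg_simps add_simps)
  finally show ?thesis
    using eqv_hom[OF Add_in_hom[OF assms(3,4)] Add_in_hom[OF h]] by simp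
qed

lemma eqv_Scl:
  assumes "f \<approx> f'" "a \<in> carrier K" "f \<in> hom A B"
  shows "Scl C a f \<approx> Scl C a f'"
proof -
  have f': "f' \<in> hom A B" using eqvD assms by blast
  have B: "I1 B \<in> hom B B" using Idn_in_hom homD(5)[OF assms(3)] by blast
  have "Scl C a (I1 B) \<bullet> f \<approx> Scl C a (I1 B) \<bullet> f'"
    by (rule eqv_Cmp_right[OF assms(1,3) Scl_in_hom[OF assms(2) B]])
  then show ?thesis
    using Cmp_Scl_left[OF assms(3) B assms(2)] Cmp_Scl_left[OF f' B assms(2)] Cmp_Idn_left f' assms(3) by simp
qed

text \<open>This and the next three definitions read monomorphisms, epimorphisms, kernels and
  cokernels of the factor category on representatives. By linearity only arrows with zero composite
  need be tested, and for kernels the uniqueness of the factorisation is replaced by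
  \<open>imono\<close> of the kernel arrow.\<close>

definition imono :: "'m \<Rightarrow> bool"
  where "imono f \<longleftrightarrow> f \<in> Arr C \<and> (\<forall>W\<in>Obj C. \<forall>g\<in>hom W (Dom C f). nul (f \<bullet> g) \<longrightarrow> nul g)"

definition iepi :: "'m \<Rightarrow> bool"
  where "iepi f \<longleftrightarrow> f \<in> Arr C \<and> (\<forall>W\<in>Obj C. \<forall>g\<in>hom (Cod C f) W. nul (g \<bullet> f) \<longrightarrow> nul g)"

definition ikernel :: "'m \<Rightarrow> 'm \<Rightarrow> bool"
  where "ikernel f k \<longleftrightarrow> f \<in> Arr C \<and> k \<in> Arr C \<and> Cod C k = Dom C f \<and> nul (f \<bullet> k) \<and> imono k \<and>
    (\<forall>W\<in>Obj C. \<forall>g\<in>hom W (Dom C f). nul (f \<bullet> g) \<longrightarrow> (\<exists>u\<in>hom W (Dom C k). k \<bullet> u \<approx> g))"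

definition icokernel :: "'m \<Rightarrow> 'm \<Rightarrow> bool"
  where "icokernel f c \<longleftrightarrow> f \<in> Arr C \<and> c \<in> Arr C \<and> Dom C c = Cod C f \<and> nul (c \<bullet> f) \<and> iepi c \<and>
    (\<forall>W\<in>Obj C. \<forall>g\<in>hom (Cod C f) W. nul (g \<bullet> f) \<longrightarrow> (\<exists>u\<in>hom (Cod C c) W. u \<bullet> c \<approx> g))"

lemma imonoD: "imono f \<Longrightarrow> f \<in> hom A B \<Longrightarrow> g \<in> hom W A \<Longrightarrow> nul (f \<bullet> g) \<Longrightarrow> nul g"
  unfolding imono_def using homD by metis

lemma iepiD: "iepi f \<Longrightarrow> f \<in> hom A B \<Longrightarrow> g \<in> hom B W \<Longrightarrow> nul (g \<bullet> f) \<Longrightarrow> nul g"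
  unfolding iepi_def using homD by metis

lemma imonoI: "f \<in> hom A B \<Longrightarrow> (\<And>W g. g \<in> hom W A \<Longrightarrow> nul (f \<bullet> g) \<Longrightarrow> nul g) \<Longrightarrow> imono f"
  unfolding imono_def using homD by metis

lemma iepiI: "f \<in> hom A B \<Longrightarrow> (\<And>W g. g \<in> hom B W \<Longrightarrow> nul (g \<bullet> f) \<Longrightarrow> nul g) \<Longrightarrow> iepi f"
  unfolding iepi_def using homD by metis

lemma imono_cancel:
  assumes "imono f" "f \<in> hom A B" "g \<in> hom W A" "h \<in> hom W A" "f \<bullet> g \<approx> f \<bullet> h"
  shows "g \<approx> h"
proof -
  have "nul (f \<bullet> (g \<boxminus> h))"
    using assms(5) eqv_hom[OF Cmp_in_hom[OF assms(3,2)] Cmp_in_hom[OF assms(4,2)]] Cmp_mns_right[OF assms(2-4)] by simp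
  then show ?thesis using imonoD[OF assms(1,2) mns_in_hom[OF assms(3,4)]] eqv_hom[OF assms(3,4)] by blast
qed

lemma iepi_cancel:
  assumes "iepi f" "f \<in> hom A B" "g \<in> hom B W" "h \<in> hom B W" "g \<bullet> f \<approx> h \<bullet> f"
  shows "g \<approx> h"
proof -
  have "nul ((g \<boxminus> h) \<bullet> f)"
    using assms(5) eqv_hom[OF Cmp_in_hom[OF assms(2,3)] Cmp_in_hom[OF assms(2,4)]] Cmp_mns_left[OF assms(2-4)] by simp
  then show ?thesis using iepiD[OF assms(1,2) mns_in_hom[OF assms(3,4)]] eqv_hom[OF assms(3,4)] by blast
qed

lemma ikernelE:
  assumes "ikernel f k" "f \<in> hom A B"
  obtains W where "k \<in> hom W A" "nul (f \<bullet> k)" "imono k"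
    "\<And>V g. g \<in> hom V A \<Longrightarrow> nul (f \<bullet> g) \<Longrightarrow> \<exists>u\<in>hom V W. k \<bullet> u \<approx> g"
proof (rule that[of "Dom C k"])
  note i = assms(1)[unfolded ikernel_def homD(2)[OF assms(2)]]
  show "k \<in> hom (Dom C k) A" "nul (f \<bullet> k)" "imono k" using i arr_hom[of k] by auto
  show "\<exists>u\<in>hom V (Dom C k). k \<bullet> u \<approx> g" if "g \<in> hom V A" "nul (f \<bullet> g)" for V g
    using i that homD(4)[OF that(1)] by blast
qed

lemma icokernelE:
  assumes "icokernel f c" "f \<in> hom A B"
  obtains W where "c \<in> hom B W" "nul (c \<bullet> f)" "iepi c"
    "\<And>V g. g \<in> hom B V \<Longrightarrow> nul (g \<bullet> f) \<Longrightarrow> \<exists>u\<in>hom W V. u \<bullet> c \<approx> g"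
proof (rule that[of "Cod C c"])
  note i = assms(1)[unfolded icokernel_def homD(3)[OF assms(2)]]
  show "c \<in> hom B (Cod C c)" "nul (c \<bullet> f)" "iepi c" using i arr_hom[of c] by auto
  show "\<exists>u\<in>hom (Cod C c) V. u \<bullet> c \<approx> g" if "g \<in> hom B V" "nul (g \<bullet> f)" for V g
    using i that homD(5)[OF that(1)] by blast
qed

lemma ikernelI:
  assumes "f \<in> hom A B" "k \<in> hom W A" "nul (f \<bullet> k)" "imono k"
    "\<And>V g. g \<in> hom V A \<Longrightarrow> nul (f \<bullet> g) \<Longrightarrow> \<exists>u\<in>hom V W. k \<bullet> u \<approx> g"
  shows "ikernel f k"
  unfolding ikernel_def using assms homD(1,2,3)[OF assms(1)] homD(1,2,3)[OF assms(2)] by simp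

lemma icokernelI:
  assumes "f \<in> hom A B" "c \<in> hom B W" "nul (c \<bullet> f)" "iepi c"
    "\<And>V g. g \<in> hom B V \<Longrightarrow> nul (g \<bullet> f) \<Longrightarrow> \<exists>u\<in>hom W V. u \<bullet> c \<approx> g"
  shows "icokernel f c"
  unfolding icokernel_def using assms homD(1,2,3)[OF assms(1)] homD(1,2,3)[OF assms(2)] by simp

text \<open>The axioms of an abelian category for the factor category, expressed in the ambient category
  modulo arrows that factor through the subcategory.\<close>

definition iabelian :: bool
  where "iabelian \<longleftrightarrow> (\<forall>f\<in>Arr C. (\<exists>k. ikernel f k) \<and> (\<exists>c. icokernel f c) \<and>
    (imono f \<longrightarrow> (\<exists>g. ikernel g f)) \<and> (iepi f \<longrightarrow> (\<exists>g. icokernel g f)))"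

text \<open>Let k be a kernel of g. Then g kills k and so factors through the cokernel q; hence
  whatever q kills is killed by g and lifts through k.\<close>

lemma mono_kernel_of_cokernel:
  assumes "iabelian" "imono k" "icokernel k q"
  shows "ikernel q k"
proof -
  have k: "k \<in> hom (Dom C k) (Cod C k)" using assms(2) arr_hom by (simp add: imono_def)
  obtain g where g: "ikernel g k" using assms homD(1)[OF k] unfolding iabelian_def by blast
  have gh: "g \<in> hom (Cod C k) (Cod C g)" using g arr_hom unfolding ikernel_def by auto
  obtain W where q: "q \<in> hom (Cod C k) W" "nul (q \<bullet> k)" "iepi q"
    "\<And>V g. g \<in> hom (Cod C k) V \<Longrightarrow> nul (g \<bullet> k) \<Longrightarrow> \<exists>u\<in>hom W V. u \<bullet> q \<approx> g" by (rule icokernelE[OF assms(3) k]) blast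
  obtain g' where g': "g' \<in> hom W (Cod C g)" "g' \<bullet> q \<approx> g" using q(4)[OF gh] g unfolding ikernel_def by blast
  show ?thesis
  proof (rule ikernelI[OF q(1) k q(2) assms(2)])
    fix V x assume x: "x \<in> hom V (Cod C k)" and n: "nul (q \<bullet> x)"
    have "nul (g' \<bullet> (q \<bullet> x))" using nul_post[OF n Cmp_in_hom[OF x q(1)] g'(1)] .
    then have "nul ((g' \<bullet> q) \<bullet> x)" using Cmp_assoc[OF x q(1) g'(1)] by simp
    then have "nul (g \<bullet> x)" using eqv_nul[OF eqv_Cmp_left[OF g'(2) x Cmp_in_hom[OF q(1) g'(1)]]] by blast
    then show "\<exists>u\<in>hom V (Dom C k). k \<bullet> u \<approx> x"
      using g x homD(2)[OF gh] homD(4)[OF x] unfolding ikernel_def by auto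
  qed
qed

text \<open>Dually, let e be a cokernel of g. Then g lifts through the kernel j, so what kills j
  kills g and factors through e.\<close>

lemma epi_cokernel_of_kernel:
  assumes "iabelian" "iepi e" "ikernel e j"
  shows "icokernel j e"
proof -
  have e: "e \<in> hom (Dom C e) (Cod C e)" using assms(2) arr_hom by (simp add: iepi_def)
  obtain g where g: "icokernel g e" using assms homD(1)[OF e] unfolding iabelian_def by blast
  have gh: "g \<in> hom (Dom C g) (Dom C e)" using g arr_hom[of g] unfolding icokernel_def by auto
  obtain W where j: "j \<in> hom W (Dom C e)" "nul (e \<bullet> j)" "imono j"
    "\<And>V g. g \<in> hom V (Dom C e) \<Longrightarrow> nul (e \<bullet> g) \<Longrightarrow> \<exists>u\<in>hom V W. j \<bullet> u \<approx> g" by (rule ikernelE[OF assms(3) e]) blast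
  obtain g' where g': "g' \<in> hom (Dom C g) W" "j \<bullet> g' \<approx> g" using j(4)[OF gh] g unfolding icokernel_def by blast
  show ?thesis
  proof (rule icokernelI[OF j(1) e j(2) assms(2)])
    fix V x assume x: "x \<in> hom (Dom C e) V" and n: "nul (x \<bullet> j)"
    have "nul ((x \<bullet> j) \<bullet> g')" using nul_pre[OF n g'(1) Cmp_in_hom[OF j(1) x]] .
    then have "nul (x \<bullet> (j \<bullet> g'))" using Cmp_assoc[OF g'(1) j(1) x] by simp
    then have "nul (x \<bullet> g)" using eqv_nul[OF eqv_Cmp_right[OF g'(2) Cmp_in_hom[OF g'(1) j(1)] x]] by blast
    then show "\<exists>u\<in>hom (Cod C e) V. u \<bullet> e \<approx> x"
      using g x homD(3)[OF gh] homD(5)[OF x] unfolding icokernel_def by auto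
  qed
qed

lemma imono_Cmp:
  assumes "imono m" "imono k" "k \<in> hom A B" "m \<in> hom B D"
  shows "imono (m \<bullet> k)"
proof (rule imonoI[OF Cmp_in_hom[OF assms(3,4)]])
  fix W g assume g: "g \<in> hom W A" "nul ((m \<bullet> k) \<bullet> g)"
  then have "nul (m \<bullet> (k \<bullet> g))" using Cmp_assoc[OF g(1) assms(3,4)] by simp
  then show "nul g" using imonoD[OF assms(1,4) Cmp_in_hom[OF g(1) assms(3)]] imonoD[OF assms(2,3) g(1)] by blast
qed

text \<open>The image m is the kernel of the cokernel c of f. To see that e is epi, let t e be zero
  and k the kernel of t: then f factors through the monomorphism m k, and minimality of m forces k
  to be a split epimorphism, so t is zero.\<close>

lemma image_factorisation:
  assumes ab: "iabelian" and f: "f \<in> hom A B"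
  obtains J e m where "e \<in> hom A J" "m \<in> hom J B" "f \<approx> m \<bullet> e" "imono m" "iepi e"
proof -
  obtain c where "icokernel f c" using ab homD(1)[OF f] unfolding iabelian_def by blast
  then obtain D where c: "c \<in> hom B D" "nul (c \<bullet> f)" "iepi c"
    "\<And>V g. g \<in> hom B V \<Longrightarrow> nul (g \<bullet> f) \<Longrightarrow> \<exists>u\<in>hom D V. u \<bullet> c \<approx> g" using f by (rule icokernelE) blast
  obtain m where "ikernel c m" using ab homD(1)[OF c(1)] unfolding iabelian_def by blast
  then obtain J where m: "m \<in> hom J B" "nul (c \<bullet> m)" "imono m"
    "\<And>V g. g \<in> hom V B \<Longrightarrow> nul (c \<bullet> g) \<Longrightarrow> \<exists>u\<in>hom V J. m \<bullet> u \<approx> g" using c(1) by (rule ikernelE) blast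
  obtain e where e: "e \<in> hom A J" "m \<bullet> e \<approx> f" using m(4)[OF f c(2)] by blast
  have "iepi e"
  proof (rule iepiI[OF e(1)])
    fix W t assume t: "t \<in> hom J W" and te: "nul (t \<bullet> e)"
    obtain k where "ikernel t k" using ab homD(1)[OF t] unfolding iabelian_def by blast
    then obtain L where k: "k \<in> hom L J" "nul (t \<bullet> k)" "imono k"
      "\<And>V g. g \<in> hom V J \<Longrightarrow> nul (t \<bullet> g) \<Longrightarrow> \<exists>u\<in>hom V L. k \<bullet> u \<approx> g" using t by (rule ikernelE) blast
    obtain e' where e': "e' \<in> hom A L" "k \<bullet> e' \<approx> e" using k(4)[OF e(1) te] by blast
    note mk = Cmp_in_hom[OF k(1) m(1)]
    \<comment> \<open>The monomorphism m k is itself a kernel, of d say. As d kills f, it factors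
      through c and kills m, which gives the lift s of m through m k.\<close>
    obtain d where dk: "ikernel d (m \<bullet> k)"
      using ab imono_Cmp[OF m(3) k(3) k(1) m(1)] homD(1)[OF mk] unfolding iabelian_def by blast
    then have d: "d \<in> hom B (Cod C d)" using arr_hom[of d] homD(3)[OF mk] unfolding ikernel_def by auto
    have "d \<bullet> ((m \<bullet> k) \<bullet> e') = d \<bullet> (m \<bullet> (k \<bullet> e'))" using Cmp_assoc[OF e'(1) k(1) m(1)] by simp
    also have "\<dots> \<approx> d \<bullet> (m \<bullet> e)"
      by (rule eqv_Cmp_right[OF eqv_Cmp_right[OF e'(2) Cmp_in_hom[OF e'(1) k(1)] m(1)]
            Cmp_in_hom[OF Cmp_in_hom[OF e'(1) k(1)] m(1)] d])
    also have "\<dots> \<approx> d \<bullet> f" by (rule eqv_Cmp_right[OF e(2) Cmp_in_hom[OF e(1) m(1)] d])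
    finally have "nul (d \<bullet> f) \<longleftrightarrow> nul (d \<bullet> ((m \<bullet> k) \<bullet> e'))" using eqv_nul by blast
    moreover have "nul ((d \<bullet> (m \<bullet> k)) \<bullet> e')"
      using nul_pre[OF _ e'(1) Cmp_in_hom[OF mk d]] dk unfolding ikernel_def by blast
    ultimately have "nul (d \<bullet> f)" using Cmp_assoc[OF e'(1) mk d] by simp
    then obtain d' where d': "d' \<in> hom D (Cod C d)" "d' \<bullet> c \<approx> d" using c(4)[OF d] by blast
    have "nul (d' \<bullet> (c \<bullet> m))" using nul_post[OF m(2) Cmp_in_hom[OF m(1) c(1)] d'(1)] .
    then have "nul ((d' \<bullet> c) \<bullet> m)" using Cmp_assoc[OF m(1) c(1) d'(1)] by simp
    then have "nul (d \<bullet> m)" using eqv_nul[OF eqv_Cmp_left[OF d'(2) m(1) Cmp_in_hom[OF c(1) d'(1)]]] by blast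
    then obtain s where s: "s \<in> hom J L" "(m \<bullet> k) \<bullet> s \<approx> m"
      using dk homD(2)[OF mk] homD(2)[OF d] m(1) homD(4)[OF m(1)] unfolding ikernel_def by metis
    have J: "J \<in> Obj C" using homD(4)[OF m(1)] .
    have "m \<bullet> (k \<bullet> s) \<approx> m \<bullet> I1 J" using s(2) Cmp_assoc[OF s(1) k(1) m(1)] Cmp_Idn_right[OF m(1)] by simp
    then have ks: "k \<bullet> s \<approx> I1 J"
      using imono_cancel[OF m(3,1) Cmp_in_hom[OF s(1) k(1)] Idn_in_hom[OF J]] by blast
    have "nul ((t \<bullet> k) \<bullet> s)" using nul_pre[OF k(2) s(1) Cmp_in_hom[OF k(1) t]] .
    then have "nul (t \<bullet> (k \<bullet> s))" using Cmp_assoc[OF s(1) k(1) t] by simp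
    then have "nul (t \<bullet> I1 J)" using eqv_nul[OF eqv_Cmp_right[OF ks Cmp_in_hom[OF s(1) k(1)] t]] by blast
    then show "nul t" using Cmp_Idn_right[OF t] by simp
  qed
  then show thesis using that[OF e(1) m(1) eqv_sym[OF e(2)] m(3)] by blast
qed

end

section \<open>Rigid subcategories and Serre duality\<close>

locale serre_rigid = triangulated_category K T + factor_setting K T XX
  for K :: "('k, 'r) ring_scheme" (structure) and T :: "('k, 'o, 'm, 'z) tricat_scheme"
    and XX :: "'o set" +
  fixes S :: "('o, 'm, 'o, 'm) fctr"
  assumes split: "split_idempotents T"
    and serre: "serre_functor K T S"
    and contra: "contravariantly_finite T XX"
    and rigid: "rigid T XX"
begin

notation cmp (infixr "\<bullet>" 70)
notation pls (infixl "\<boxplus>" 65)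
notation mns (infixl "\<boxminus>" 65)
notation eqv (infix "\<approx>" 50)

abbreviation SO where "SO \<equiv> FO S"

lemma S_equivalence: "linear_equivalence K T T S"
  using serre unfolding serre_functor_def triangle_equivalence_def by blast

lemmas S_Obj = equivalence_Obj[OF S_equivalence]
lemmas S_surj = equivalence_surj[OF S_equivalence]
lemmas S_van = equivalence_van[OF S_equivalence]

section \<open>Serre duality on hom spaces\<close>

lemma dual_carrier:
  "\<xi> \<in> carrier (dual_space K (Hom T A B)) \<longleftrightarrow> \<xi> \<in> extensional (hom A B) \<and>
    linear_map K (Hom T A B) (ring_as_module K) \<xi>"
  by (simp add: dual_space_def)

lemma functional_linear:
  assumes "\<xi> \<in> carrier (dual_space K (Hom T A B))"
  shows "x \<in> hom A B \<Longrightarrow> \<xi> x \<in> carrier K"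
    "x \<in> hom A B \<Longrightarrow> y \<in> hom A B \<Longrightarrow> \<xi> (x \<boxplus> y) = \<xi> x \<oplus> \<xi> y"
    "a \<in> carrier K \<Longrightarrow> x \<in> hom A B \<Longrightarrow> \<xi> (Scl T a x) = a \<otimes> \<xi> x"
  using assms unfolding dual_carrier linear_map_def by (auto simp: ring_as_module_def dest: funcset_mem)

lemma functional_Zer:
  assumes x: "\<xi> \<in> carrier (dual_space K (Hom T A B))" and A: "A \<in> Obj T" "B \<in> Obj T"
  shows "\<xi> (Z0 A B) = \<zero>"
proof -
  note z = Zer_in_hom[OF A]
  interpret M: module K "Hom T A B" using A by (rule Hom_module)
  have "\<xi> (Scl T \<zero> (Z0 A B)) = \<zero> \<otimes> \<xi> (Z0 A B)" by (rule functional_linear(3)[OF x zero_closed z])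
  moreover have "Scl T \<zero> (Z0 A B) = Z0 A B" using M.smult_l_null[of "Z0 A B"] z by simp
  ultimately show ?thesis using functional_linear(1)[OF x z] by simp
qed

lemma serreE:
  obtains \<phi> where
    "\<And>A B. A \<in> Obj T \<Longrightarrow> B \<in> Obj T \<Longrightarrow>
      linear_iso K (dual_space K (Hom T A B)) (Hom T B (SO A)) (\<phi> A B)"
    "\<And>A B B' b \<xi>. A \<in> Obj T \<Longrightarrow> b \<in> hom B B' \<Longrightarrow> \<xi> \<in> carrier (dual_space K (Hom T A B')) \<Longrightarrow>
      \<phi> A B (\<lambda>f\<in>hom A B. \<xi> (b \<bullet> f)) = \<phi> A B' \<xi> \<bullet> b"
  using serre[unfolded serre_functor_def, THEN conjunct2]
proof (elim exE conjE)
  fix \<phi>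
  assume p: "\<forall>A\<in>Obj T. \<forall>B\<in>Obj T.
        linear_iso K (dual_space K (Hom T A B)) (Hom T B (FO S A)) (\<phi> A B)"
    "\<forall>A\<in>Obj T. \<forall>B\<in>Obj T. \<forall>B'\<in>Obj T. \<forall>b\<in>homset T B B'.
        \<forall>\<xi>\<in>carrier (dual_space K (Hom T A B')).
          \<phi> A B (\<lambda>f\<in>homset T A B. \<xi> (b \<bullet> f)) = \<phi> A B' \<xi> \<bullet> b"
  show thesis
  proof (rule that[of \<phi>])
    fix A B B' b \<xi>
    assume h: "A \<in> Obj T" "b \<in> hom B B'" "\<xi> \<in> carrier (dual_space K (Hom T A B'))"
    show "\<phi> A B (\<lambda>f\<in>hom A B. \<xi> (b \<bullet> f)) = \<phi> A B' \<xi> \<bullet> b"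
      using p(2)[rule_format, OF h(1) homD(4,5)[OF h(2)] h(2,3)] .
  qed (rule p(1)[rule_format])
qed

text \<open>All functionals on a zero space agree, so the bijection \<open>\<phi>\<close> leaves
  room for a single arrow B -> S A.\<close>

lemma serre_van:
  assumes A: "A \<in> Obj T" "B \<in> Obj T" and v: "van A B"
  shows "van B (SO A)"
  unfolding van_def
proof
  fix g assume g: "g \<in> hom B (SO A)"
  obtain \<phi> where "linear_iso K (dual_space K (Hom T A B)) (Hom T B (SO A)) (\<phi> A B)"
    by (rule serreE) (use A in blast)
  then have b: "bij_betw (\<phi> A B) (carrier (dual_space K (Hom T A B))) (hom B (SO A))"
    unfolding linear_iso_def by simp
  have o: "SO A \<in> Obj T" using S_Obj A by blast
  obtain \<xi> where x: "\<xi> \<in> carrier (dual_space K (Hom T A B))" "g = \<phi> A B \<xi>"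
    using g bij_betw_imp_surj_on[OF b] by blast
  obtain \<zeta> where z: "\<zeta> \<in> carrier (dual_space K (Hom T A B))" "Z0 B (SO A) = \<phi> A B \<zeta>"
    using Zer_in_hom[OF A(2) o] bij_betw_imp_surj_on[OF b] by blast
  have "\<xi> = \<zeta>"
  proof (rule extensionalityI[of _ "hom A B"])
    show "\<xi> y = \<zeta> y" if "y \<in> hom A B" for y
      using vanD[OF v that] functional_Zer[OF x(1) A] functional_Zer[OF z(1) A] by simp
  qed (use x z in \<open>auto simp: dual_carrier\<close>)
  then show "g = Z0 B (SO A)" using x z by simp
qed

text \<open>Choose a functional \<xi> on hom(A, B) with \<xi> y nonzero. By naturality
  \<open>\<phi> A B \<xi> \<bullet> y\<close> corresponds to the functional f |-> \<xi> (y f) on End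
  A, which is nonzero at the identity; so u = \<open>\<phi> A B \<xi>\<close> works.\<close>

lemma serre_nondegenerate:
  assumes y: "y \<in> hom A B" "y \<noteq> Z0 A B"
  obtains u where "u \<in> hom B (SO A)" "u \<bullet> y \<noteq> Z0 A (SO A)"
proof -
  have A: "A \<in> Obj T" "B \<in> Obj T" using homD[OF y(1)] by auto
  have o: "SO A \<in> Obj T" using S_Obj A by blast
  obtain \<phi> where p: "\<And>A B. A \<in> Obj T \<Longrightarrow> B \<in> Obj T \<Longrightarrow>
      linear_iso K (dual_space K (Hom T A B)) (Hom T B (SO A)) (\<phi> A B)"
    "\<And>A B B' b \<xi>. A \<in> Obj T \<Longrightarrow> b \<in> hom B B' \<Longrightarrow> \<xi> \<in> carrier (dual_space K (Hom T A B')) \<Longrightarrow>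
      \<phi> A B (\<lambda>f\<in>hom A B. \<xi> (b \<bullet> f)) = \<phi> A B' \<xi> \<bullet> b" by (rule serreE) blast
  interpret M: module K "Hom T A B" using A by (rule Hom_module)
  obtain \<xi> where x: "\<xi> \<in> carrier (dual_space K (Hom T A B))" "\<xi> y \<noteq> \<zero>"
    using M.separating_functional[OF field_axioms] y by auto
  have b: "bij_betw (\<phi> A B) (carrier (dual_space K (Hom T A B))) (hom B (SO A))"
    "bij_betw (\<phi> A A) (carrier (dual_space K (Hom T A A))) (hom A (SO A))"
    using p(1)[OF A] p(1)[OF A(1) A(1)] unfolding linear_iso_def by simp_all
  have u: "\<phi> A B \<xi> \<in> hom B (SO A)" using b(1) x(1) bij_betwE by blast
  define \<zeta> where "\<zeta> = (\<lambda>f\<in>hom A A. \<xi> (y \<bullet> f))"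
  have z: "\<zeta> \<in> carrier (dual_space K (Hom T A A))"
    unfolding dual_carrier linear_map_def
  proof (intro conjI ballI)
    show "\<zeta> \<in> extensional (hom A A)" by (simp add: \<zeta>_def)
    show "\<zeta> \<in> carrier (Hom T A A) \<rightarrow> carrier (ring_as_module K)"
      using functional_linear(1)[OF x(1)] Cmp_in_hom[OF _ y(1)] by (auto simp: \<zeta>_def ring_as_module_def)
    fix f assume f: "f \<in> carrier (Hom T A A)"
    { fix g assume g: "g \<in> carrier (Hom T A A)"
      show "\<zeta> (f \<oplus>\<^bsub>Hom T A A\<^esub> g) = \<zeta> f \<oplus>\<^bsub>ring_as_module K\<^esub> \<zeta> g"
        using f g functional_linear(2)[OF x(1) Cmp_in_hom[OF _ y(1)] Cmp_in_hom[OF _ y(1)]]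
          Add_in_hom Cmp_Add_right[OF y(1)] by (simp add: \<zeta>_def ring_as_module_def) }
    { fix a assume a: "a \<in> carrier K"
      show "\<zeta> (a \<odot>\<^bsub>Hom T A A\<^esub> f) = a \<odot>\<^bsub>ring_as_module K\<^esub> \<zeta> f"
        using f a functional_linear(3)[OF x(1) a Cmp_in_hom[OF _ y(1)]]
          Scl_in_hom[OF a] Cmp_Scl_right[OF y(1)] by (simp add: \<zeta>_def ring_as_module_def) }
  qed
  have "\<phi> A A \<zeta> = \<phi> A B \<xi> \<bullet> y" unfolding \<zeta>_def by (rule p(2)[OF A(1) y(1) x(1)])
  moreover have "\<phi> A A \<zeta> \<noteq> Z0 A (SO A)"
  proof
    assume e: "\<phi> A A \<zeta> = Z0 A (SO A)"
    define t where "t = \<zeta> (I1 A)"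
    have i: "I1 A \<in> hom A A" using Idn_in_hom A by blast
    have l: "linear_map K (dual_space K (Hom T A A)) (Hom T A (SO A)) (\<phi> A A)"
      using p(1)[OF A(1) A(1)] unfolding linear_iso_def by blast
    \<comment> \<open>Were \<phi> \<zeta> zero, additivity would give \<phi> (\<zeta> + \<zeta>) =
      \<phi> \<zeta>, and injectivity \<zeta> + \<zeta> = \<zeta>. Evaluation at the identity yields
      t + t = t, so t = 0.\<close>
    define \<zeta>2 where "\<zeta>2 = \<zeta> \<oplus>\<^bsub>dual_space K (Hom T A A)\<^esub> \<zeta>"
    have z2v: "\<zeta>2 f = \<zeta> f \<oplus> \<zeta> f" if "f \<in> hom A A" for f using that by (simp add: \<zeta>2_def dual_space_def)
    have z2: "\<zeta>2 \<in> carrier (dual_space K (Hom T A A))"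
      unfolding dual_carrier linear_map_def
    proof (intro conjI ballI)
      show "\<zeta>2 \<in> extensional (hom A A)" by (simp add: \<zeta>2_def dual_space_def)
      show "\<zeta>2 \<in> carrier (Hom T A A) \<rightarrow> carrier (ring_as_module K)"
        using functional_linear(1)[OF z] z2v by (auto simp: ring_as_module_def)
      fix f assume f: "f \<in> carrier (Hom T A A)"
      { fix g assume g: "g \<in> carrier (Hom T A A)"
        show "\<zeta>2 (f \<oplus>\<^bsub>Hom T A A\<^esub> g) = \<zeta>2 f \<oplus>\<^bsub>ring_as_module K\<^esub> \<zeta>2 g"
          using f g functional_linear(1,2)[OF z] z2v Add_in_hom
          by (simp add: ring_as_module_def a_ac) }
      { fix a assume a: "a \<in> carrier K"
        show "\<zeta>2 (a \<odot>\<^bsub>Hom T A A\<^esub> f) = a \<odot>\<^bsub>ring_as_module K\<^esub> \<zeta>2 f"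
          using f a functional_linear(1,3)[OF z] z2v Scl_in_hom by (simp add: ring_as_module_def r_distr) }
    qed
    have "\<phi> A A \<zeta>2 = \<phi> A A \<zeta> \<boxplus> \<phi> A A \<zeta>"
      using l z unfolding linear_map_def \<zeta>2_def by simp
    then have "\<phi> A A \<zeta>2 = \<phi> A A \<zeta>" using e Add_Zer_right[OF Zer_in_hom[OF A(1) o]] by simp
    then have "\<zeta>2 = \<zeta>" using b(2) z z2 bij_betw_imp_inj_on inj_onD by metis
    then have "t = t \<oplus> t" using z2v[OF i] t_def by simp
    moreover have t: "t \<in> carrier K" unfolding t_def using functional_linear(1)[OF z i] .
    ultimately have "t = \<zero>" using r_neg1[OF t t] l_neg[OF t] by simp
    moreover have "t = \<xi> y" unfolding t_def \<zeta>_def using i Cmp_Idn_right[OF y(1)] by simp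
    ultimately show False using x(2) by simp
  qed
  ultimately show thesis using that u by simp
qed

lemma serre_van_iff:
  assumes A: "A \<in> Obj T" "B \<in> Obj T"
  shows "van A B \<longleftrightarrow> van B (SO A)"
proof
  assume v: "van B (SO A)"
  show "van A B"
    unfolding van_def
  proof (rule ballI, rule ccontr)
    fix y assume y: "y \<in> hom A B" "y \<noteq> Z0 A B"
    obtain u where u: "u \<in> hom B (SO A)" "u \<bullet> y \<noteq> Z0 A (SO A)" using serre_nondegenerate[OF y] .
    show False using vanD[OF v u(1)] u(2) Cmp_Zer_left[OF y(1) homD(5)[OF u(1)]] by simp
  qed
qed (rule serre_van[OF A])

lemma rigidD: "Y \<in> XX \<Longrightarrow> Y' \<in> XX \<Longrightarrow> van Y (s Y')"
  using rigid[unfolded rigid_def] by (simp add: van_def)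

lemma contraE:
  assumes "A \<in> Obj T"
  obtains Y f where "Y \<in> XX" "f \<in> hom Y A" "\<And>Y' g. Y' \<in> XX \<Longrightarrow> g \<in> hom Y' A \<Longrightarrow> \<exists>u\<in>hom Y' Y. f \<bullet> u = g"
proof -
  obtain Y f where h: "Y \<in> XX" "f \<in> hom Y A" "\<forall>Y'\<in>XX. (\<lambda>u. f \<bullet> u) ` hom Y' Y = hom Y' A"
    using contra[unfolded contravariantly_finite_def, rule_format, OF assms] by blast
  show thesis
  proof (rule that[OF h(1,2)])
    fix Y' g assume "Y' \<in> XX" "g \<in> hom Y' A"
    then have "g \<in> (\<lambda>u. f \<bullet> u) ` hom Y' Y" using h(3) by blast
    then show "\<exists>u\<in>hom Y' Y. f \<bullet> u = g" by blast
  qed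
qed

text \<open>In the usual notation \<open>PP\<close> is \<open>XX[-1]\<close> and \<open>UU\<close> is its right perpendicular category.\<close>

definition PP where "PP = {P \<in> Obj T. s P \<in> XX}"
definition UU where "UU = {M \<in> Obj T. \<forall>Y\<in>XX. van Y (s M)}"

lemma PP_Obj: "P \<in> PP \<Longrightarrow> P \<in> Obj T" and PP_sh: "P \<in> PP \<Longrightarrow> s P \<in> XX"
  by (auto simp: PP_def)

lemma UU_Obj: "M \<in> UU \<Longrightarrow> M \<in> Obj T" and UU_van: "M \<in> UU \<Longrightarrow> Y \<in> XX \<Longrightarrow> van Y (s M)"
  by (auto simp: UU_def)

lemma XX_PP:
  assumes "Y \<in> XX"
  obtains P where "P \<in> PP" "isomorphic T (s P) Y"
proof -
  obtain P where P: "P \<in> Obj T" "isomorphic T (s P) Y" using sh_surj[OF XX_Obj[OF assms]] .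
  then show thesis using that XX_iso[OF assms isomorphic_sym[OF P(2)]] by (auto simp: PP_def)
qed

lemma PP_UU: "P \<in> PP \<Longrightarrow> M \<in> UU \<Longrightarrow> van P M"
  using sh_van[OF PP_Obj UU_Obj, of P M] UU_van[OF _ PP_sh, of M P] by blast

lemma PP_XX: "P \<in> PP \<Longrightarrow> Y \<in> XX \<Longrightarrow> van P Y"
  using sh_van[OF PP_Obj XX_Obj, of P Y] rigidD[OF PP_sh, of P Y] by blast

lemma XX_UU: "XX \<subseteq> UU"
  using rigidD XX_Obj by (auto simp: UU_def)

lemma UUI: "M \<in> Obj T \<Longrightarrow> (\<And>P. P \<in> PP \<Longrightarrow> van P M) \<Longrightarrow> M \<in> UU"
proof -
  assume M: "M \<in> Obj T" and v: "\<And>P. P \<in> PP \<Longrightarrow> van P M"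
  have "van Y (s M)" if Y: "Y \<in> XX" for Y
  proof -
    obtain P where P: "P \<in> PP" "isomorphic T (s P) Y" using XX_PP[OF Y] .
    then have "van (s P) (s M)" using v sh_van[OF PP_Obj[OF P(1)] M] by blast
    then show ?thesis using van_iso[OF P(2) isomorphic_refl[OF sh_Obj[OF M]]] by blast
  qed
  then show ?thesis using M by (simp add: UU_def)
qed

lemma UU_retract:
  assumes "M \<in> UU" "i \<in> hom N M" "r \<in> hom M N" "r \<bullet> i = I1 N"
  shows "N \<in> UU"
  by (rule UUI) (use van_retract_right[OF PP_UU[OF _ assms(1)] assms(2-4)] homD(4)[OF assms(2)] in blast)+

text \<open>By rigidity \<open>PP\<close> has no arrows to \<open>XX\<close>, so passing to the
  factor category loses nothing on arrows out of \<open>PP\<close>: for them congruence is equality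
  (\<open>PP_eqv_eq\<close>).\<close>

lemma PP_arr_nul_zero: "P \<in> PP \<Longrightarrow> f \<in> hom P A \<Longrightarrow> nul f \<Longrightarrow> f = Z0 P A"
proof -
  assume P: "P \<in> PP" and f: "f \<in> hom P A" and n: "nul f"
  obtain Y g h where h: "Y \<in> XX" "g \<in> hom P Y" "h \<in> hom Y A" "f = h \<bullet> g" using nulE[OF n f] .
  show ?thesis using vanD[OF PP_XX[OF P h(1)] h(2)] h(4) Cmp_Zer_right[OF h(3) PP_Obj[OF P]] by simp
qed

lemma PP_eqv_eq: "P \<in> PP \<Longrightarrow> f \<in> hom P A \<Longrightarrow> f \<approx> g \<Longrightarrow> f = g"
proof -
  assume P: "P \<in> PP" and f: "f \<in> hom P A" and e: "f \<approx> g"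
  have g: "g \<in> hom P A" using eqvD(1)[OF e f] .
  have "f \<boxminus> g = Z0 P A" using PP_arr_nul_zero[OF P mns_in_hom[OF f g]] e eqv_hom[OF f g] by blast
  then show ?thesis using mns_eq_Zer[OF f g] by blast
qed

text \<open>The mirror image for arrows into XX[1], again by rigidity.\<close>

lemma nul_sh_zero: "Y \<in> XX \<Longrightarrow> f \<in> hom A (s Y) \<Longrightarrow> nul f \<Longrightarrow> f = Z0 A (s Y)"
proof -
  assume Y: "Y \<in> XX" and f: "f \<in> hom A (s Y)" and n: "nul f"
  obtain Y' g h where h: "Y' \<in> XX" "g \<in> hom A Y'" "h \<in> hom Y' (s Y)" "f = h \<bullet> g" using nulE[OF n f] .
  show ?thesis using vanD[OF rigidD[OF h(1) Y] h(3)] h(4) Cmp_Zer_left[OF h(2)] homD(5)[OF f] by simp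
qed

text \<open>Rigidity of \<open>XX\<close> makes Wakamatsu's lemma on the cone of an approximation hold without minimality.\<close>

lemma PP_approx:
  assumes A: "A \<in> Obj T"
  obtains P M p a b where "P \<in> PP" "M \<in> UU" "dtriangle T P A M p a b"
    "\<And>P' g. P' \<in> PP \<Longrightarrow> g \<in> hom P' A \<Longrightarrow> \<exists>u\<in>hom P' P. p \<bullet> u = g"
proof -
  \<comment> \<open>Approximations are given for \<open>XX\<close>, so A[1] is approximated and the
    approximation desuspended.\<close>
  obtain Y f where Y: "Y \<in> XX" "f \<in> hom Y (s A)"
    "\<And>Y' g. Y' \<in> XX \<Longrightarrow> g \<in> hom Y' (s A) \<Longrightarrow> \<exists>u\<in>hom Y' Y. f \<bullet> u = g" using contraE[OF sh_Obj[OF A]] by blast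
  obtain P where P: "P \<in> PP" "isomorphic T (s P) Y" using XX_PP[OF Y(1)] .
  obtain i j where ij: "i \<in> hom (s P) Y" "j \<in> hom Y (s P)" "j \<bullet> i = I1 (s P)" "i \<bullet> j = I1 Y"
    using P(2) by (rule isomorphicE)
  obtain p where p: "p \<in> hom P A" "sa p = f \<bullet> i"
    using sa_full[OF PP_Obj[OF P(1)] A Cmp_in_hom[OF ij(1) Y(2)]] .
  have ap: "\<exists>u\<in>hom P' P. p \<bullet> u = g" if P': "P' \<in> PP" and g: "g \<in> hom P' A" for P' g
  proof -
    obtain u where u: "u \<in> hom (s P') Y" "f \<bullet> u = sa g" using Y(3)[OF PP_sh[OF P'] sa_hom[OF g]] by blast
    obtain v where v: "v \<in> hom P' P" "sa v = j \<bullet> u"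
      using sa_full[OF PP_Obj[OF P'] PP_Obj[OF P(1)] Cmp_in_hom[OF u(1) ij(2)]] .
    have "sa (p \<bullet> v) = (f \<bullet> i) \<bullet> (j \<bullet> u)" using sa_Cmp[OF v(1) p(1)] p v by simp
    also have "\<dots> = f \<bullet> ((i \<bullet> j) \<bullet> u)" using ij(1,2) u(1) Y(2) by (simp add: cat)
    also have "\<dots> = sa g" unfolding ij(4) using u Cmp_Idn_left by simp
    finally have "p \<bullet> v = g" using sa_faithful[OF Cmp_in_hom[OF v(1) p(1)] g] by blast
    then show ?thesis using v by blast
  qed
  obtain M a b where t: "dtriangle T P A M p a b" using TR1_cone[OF p(1)] by blast
  note d = dtD[OF t]
  have "M \<in> UU"
  proof (rule UUI[OF d(6)])
    fix P' assume P': "P' \<in> PP"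
    show "van P' M"
      unfolding van_def
    proof
      fix g assume g: "g \<in> hom P' M"
      \<comment> \<open>There are no arrows from \<open>PP\<close> to P[1] in \<open>XX\<close>, so
        g lifts along a; the lift factors through p, and a p = 0.\<close>
      have "van P' (s P)" using PP_XX[OF P' PP_sh[OF P(1)]] .
      then have "b \<bullet> g = Z0 P' (s P)" using vanD Cmp_in_hom[OF g d(3)] by blast
      then obtain w where w: "w \<in> hom P' A" "a \<bullet> w = g" using exact_cov3[OF t g] by blast
      obtain u where u: "u \<in> hom P' P" "p \<bullet> u = w" using ap[OF P' w(1)] by blast
      have "g = (a \<bullet> p) \<bullet> u" using u w Cmp_assoc[OF u(1) d(1,2)] by simp
      then show "g = Z0 P' M" using dt_zero1[OF t] Cmp_Zer_left[OF u(1) d(6)] by simp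
    qed
  qed
  then show thesis using that[OF P(1) _ t ap] by blast
qed

text \<open>The left orthogonal of \<open>UU\<close> in the factor category. Like a torsion class it
  is closed under quotients (\<open>FF_iepi\<close>).\<close>

definition FF where "FF = {A \<in> Obj T. \<forall>M\<in>UU. \<forall>f\<in>hom A M. nul f}"

lemma FF_Obj: "A \<in> FF \<Longrightarrow> A \<in> Obj T" and FF_nul: "A \<in> FF \<Longrightarrow> M \<in> UU \<Longrightarrow> f \<in> hom A M \<Longrightarrow> nul f"
  by (auto simp: FF_def)

lemma FFI: "A \<in> Obj T \<Longrightarrow> (\<And>M f. M \<in> UU \<Longrightarrow> f \<in> hom A M \<Longrightarrow> nul f) \<Longrightarrow> A \<in> FF"
  by (auto simp: FF_def)

lemma PP_FF: "P \<in> PP \<Longrightarrow> P \<in> FF"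
proof (rule FFI)
  fix M f assume "P \<in> PP" "M \<in> UU" "f \<in> hom P M"
  then show "nul f" using vanD[OF PP_UU, of P M f] nul_Zer[OF PP_Obj UU_Obj, of P M] by simp
qed (simp add: PP_Obj)

lemma XX_FF: "Y \<in> XX \<Longrightarrow> Y \<in> FF"
  using nul_object_left XX_Obj by (auto simp: FF_def)

lemma FF_retract:
  assumes "A \<in> FF" "i \<in> hom B A" "r \<in> hom A B" "r \<bullet> i = I1 B"
  shows "B \<in> FF"
proof (rule FFI)
  fix M f assume M: "M \<in> UU" and f: "f \<in> hom B M"
  have "nul ((f \<bullet> r) \<bullet> i)"
    using nul_pre[OF FF_nul[OF assms(1) M Cmp_in_hom[OF assms(3) f]] assms(2) Cmp_in_hom[OF assms(3) f]] .
  then show "nul f" using Cmp_assoc[OF assms(2,3) f] assms(4) Cmp_Idn_right[OF f] by simp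
qed (use homD(4)[OF assms(2)] in simp)

lemma FF_iepi:
  assumes "A \<in> FF" "e \<in> hom A B" "iepi e"
  shows "B \<in> FF"
proof (rule FFI)
  fix M f assume M: "M \<in> UU" and f: "f \<in> hom B M"
  show "nul f" using iepiD[OF assms(3,2) f] FF_nul[OF assms(1) M Cmp_in_hom[OF assms(2) f]] by blast
qed (use homD(5)[OF assms(2)] in simp)

text \<open>T(PP, -) is faithful modulo \<open>XX\<close> on arrows out of \<open>FF\<close>: an
  arrow that vanishes on \<open>PP\<close> extends along A -> M, and A -> M is nul because M is in
  \<open>UU\<close>.\<close>

lemma FF_nulI:
  assumes A: "A \<in> FF" and f: "f \<in> hom A B" and z: "\<And>P x. P \<in> PP \<Longrightarrow> x \<in> hom P A \<Longrightarrow> f \<bullet> x = Z0 P B"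
  shows "nul f"
proof -
  obtain P M p a b where t: "P \<in> PP" "M \<in> UU" "dtriangle T P A M p a b" using PP_approx[OF FF_Obj[OF A]] by metis
  note d = dtD[OF t(3)]
  obtain v where v: "v \<in> hom M B" "v \<bullet> a = f" using exact_contra2[OF t(3) f z[OF t(1) d(1)]] .
  show ?thesis using nul_post[OF FF_nul[OF A t(2) d(2)] d(2) v(1)] v(2) by simp
qed

lemma imono_PP_inj:
  assumes "imono m" "m \<in> hom A B" "P \<in> PP" "x \<in> hom P A" "m \<bullet> x = Z0 P B"
  shows "x = Z0 P A"
proof -
  have "nul (m \<bullet> x)" using assms(5) nul_Zer[OF PP_Obj[OF assms(3)] homD(5)[OF assms(2)]] by simp
  then show ?thesis using imonoD[OF assms(1,2,4)] PP_arr_nul_zero[OF assms(3,4)] by blast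
qed

text \<open>As \<open>Q\<close> lies in \<open>FF\<close>, its arrow to the cone \<open>M\<close> factors through some \<open>X1\<close> in \<open>XX\<close>. Completing
  \<open>X1 \<rightarrow> M \<rightarrow> P[1]\<close> to a triangle on \<open>P \<rightarrow> W\<close> gives an object \<open>W\<close> of which \<open>Q\<close> is a retract and over which
  the lift of \<open>P \<rightarrow> Q\<close> along \<open>q\<close> extends.\<close>

lemma FF_iso:
  assumes C: "C \<in> FF" and Q: "Q \<in> FF" and q: "q \<in> hom C Q"
    and inj: "\<And>P x. P \<in> PP \<Longrightarrow> x \<in> hom P C \<Longrightarrow> q \<bullet> x = Z0 P Q \<Longrightarrow> x = Z0 P C"
    and surj: "\<And>P x. P \<in> PP \<Longrightarrow> x \<in> hom P Q \<Longrightarrow> \<exists>z\<in>hom P C. q \<bullet> z = x"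
  obtains r where "r \<in> hom Q C" "q \<bullet> r \<approx> I1 Q" "r \<bullet> q \<approx> I1 C"
proof -
  note Qo = FF_Obj[OF Q] and Co = FF_Obj[OF C]
  obtain P M p a b where t: "P \<in> PP" "M \<in> UU" "dtriangle T P Q M p a b" using PP_approx[OF Qo] by metis
  note d = dtD[OF t(3)]
  obtain X1 t1 x where X1: "X1 \<in> XX" "t1 \<in> hom Q X1" "x \<in> hom X1 M" "a = x \<bullet> t1"
    using nulE[OF FF_nul[OF Q t(2) d(2)] d(2)] .
  obtain l where l: "l \<in> hom P C" "q \<bullet> l = p" using surj[OF t(1) d(1)] by blast
  have bx: "b \<bullet> x \<in> hom X1 (s P)" using Cmp_in_hom[OF X1(3) d(3)] .
  obtain W i c where w: "dtriangle T P W X1 i c (b \<bullet> x)" using complete_third[OF bx d(4)] .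
  note e = dtD[OF w]
  \<comment> \<open>This is the condition for l to extend over W. Write X1 as P1[1] and desuspend
    the composite to y : P1 -> C; then q y = 0 because q l = p and p[1] b = 0, and
    \<open>inj\<close> gives y = 0.\<close>
  have slbx: "sa l \<bullet> (b \<bullet> x) = Z0 X1 (s C)"
  proof -
    obtain P1 where P1: "P1 \<in> PP" "isomorphic T (s P1) X1" using XX_PP[OF X1(1)] .
    obtain g g' where g: "g \<in> hom (s P1) X1" "g' \<in> hom X1 (s P1)" "g' \<bullet> g = I1 (s P1)" "g \<bullet> g' = I1 X1"
      using P1(2) by (rule isomorphicE)
    have h: "(sa l \<bullet> (b \<bullet> x)) \<bullet> g \<in> hom (s P1) (s C)"
      using Cmp_in_hom[OF g(1) Cmp_in_hom[OF bx sa_hom[OF l(1)]]] .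
    obtain y where y: "y \<in> hom P1 C" "sa y = (sa l \<bullet> (b \<bullet> x)) \<bullet> g" using sa_full[OF PP_Obj[OF P1(1)] Co h] .
    have pb: "sa p \<bullet> b = Z0 M (s Q)" using dt_zero3[OF t(3)] .
    have "sa (q \<bullet> y) = sa q \<bullet> ((sa l \<bullet> (b \<bullet> x)) \<bullet> g)" using sa_Cmp[OF y(1) q] y(2) by simp
    also have "\<dots> = ((sa q \<bullet> sa l) \<bullet> b) \<bullet> (x \<bullet> g)"
      using sa_hom[OF q] sa_hom[OF l(1)] d(3) X1(3) g(1) by (simp add: cat)
    also have "\<dots> = sa (Z0 P1 Q)"
      unfolding sa_Cmp[OF l(1) q, symmetric] l(2) pb
      using Cmp_Zer_left[OF Cmp_in_hom[OF g(1) X1(3)] sh_Obj[OF Qo]] sa_Zer[OF PP_Obj[OF P1(1)] Qo] by simp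
    finally have "q \<bullet> y = Z0 P1 Q"
      using sa_faithful[OF Cmp_in_hom[OF y(1) q] Zer_in_hom[OF PP_Obj[OF P1(1)] Qo]] by blast
    then have "y = Z0 P1 C" using inj[OF P1(1) y(1)] by blast
    then have z: "(sa l \<bullet> (b \<bullet> x)) \<bullet> g = Z0 (s P1) (s C)" using y(2) sa_Zer[OF PP_Obj[OF P1(1)] Co] by simp
    have "sa l \<bullet> (b \<bullet> x) = ((sa l \<bullet> (b \<bullet> x)) \<bullet> g) \<bullet> g'"
      using Cmp_assoc[OF g(2,1) Cmp_in_hom[OF bx sa_hom[OF l(1)]]] g(4)
        Cmp_Idn_right[OF Cmp_in_hom[OF bx sa_hom[OF l(1)]]] by simp
    then show ?thesis using z Cmp_Zer_left[OF g(2) sh_Obj[OF Co]] by simp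
  qed
  obtain k where k: "k \<in> hom (s W) (s C)" "k \<bullet> sa i = sa l" using exact_contra4[OF w sa_hom[OF l(1)] slbx] .
  obtain l' where l': "l' \<in> hom W C" "sa l' = k" using sa_full[OF e(5) Co k(1)] .
  have "sa (l' \<bullet> i) = sa l" using l' k sa_Cmp[OF e(1) l'(1)] by simp
  then have l'i: "l' \<bullet> i = l" using sa_faithful[OF Cmp_in_hom[OF e(1) l'(1)] l(1)] by blast
  \<comment> \<open>The morphism of triangles that is the identity on P and x on X1. TR3 supplies
    only third arrows, so both triangles are rotated twice and the result is desuspended.\<close>
  obtain r where r: "r \<in> hom W Q" "r \<bullet> i = p" "a \<bullet> r = x \<bullet> c"
  proof -
    have r2: "dtriangle T W X1 (s P) c (b \<bullet> x) (Neg T (sa i))" "dtriangle T Q M (s P) a b (Neg T (sa p))"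
      using rotate[OF w] rotate[OF t(3)] by auto
    have r3: "dtriangle T X1 (s P) (s W) (b \<bullet> x) (Neg T (sa i)) (Neg T (sa c))"
      "dtriangle T M (s P) (s Q) b (Neg T (sa p)) (Neg T (sa a))"
      using rotate[OF r2(1)] rotate[OF r2(2)] by auto
    have "I1 (s P) \<bullet> (b \<bullet> x) = b \<bullet> x" using Cmp_Idn_left[OF bx] .
    from TR3[OF r3 X1(3) Idn_in_hom[OF sh_Obj[OF d(4)]] this]
    obtain k' where k': "k' \<in> hom (s W) (s Q)" "k' \<bullet> Neg T (sa i) = Neg T (sa p) \<bullet> I1 (s P)"
      "sa x \<bullet> Neg T (sa c) = Neg T (sa a) \<bullet> k'" by blast
    obtain r where r: "r \<in> hom W Q" "sa r = k'" using sa_full[OF e(5) Qo k'(1)] .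
    have "Neg T (sa (r \<bullet> i)) = Neg T (sa p)"
      using k'(2) r sa_Cmp[OF e(1) r(1)] Cmp_Neg_right[OF k'(1) sa_hom[OF e(1)]]
        Cmp_Idn_right[OF Neg_in_hom[OF sa_hom[OF d(1)]]] by simp
    then have "sa (r \<bullet> i) = sa p" using Neg_inj[OF sa_hom[OF Cmp_in_hom[OF e(1) r(1)]] sa_hom[OF d(1)]] by blast
    then have 1: "r \<bullet> i = p" using sa_faithful[OF Cmp_in_hom[OF e(1) r(1)] d(1)] by blast
    have "Neg T (sa (x \<bullet> c)) = Neg T (sa (a \<bullet> r))"
      using k'(3) r(2) sa_Cmp[OF e(2) X1(3)] sa_Cmp[OF r(1) d(2)] Cmp_Neg_right[OF sa_hom[OF X1(3)] sa_hom[OF e(2)]]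
        Cmp_Neg_left[OF sa_hom[OF d(2)] k'(1)] by simp
    then have "sa (x \<bullet> c) = sa (a \<bullet> r)"
      using Neg_inj[OF sa_hom[OF Cmp_in_hom[OF e(2) X1(3)]] sa_hom[OF Cmp_in_hom[OF r(1) d(2)]]] by blast
    then have "x \<bullet> c = a \<bullet> r" using sa_faithful[OF Cmp_in_hom[OF e(2) X1(3)] Cmp_in_hom[OF r(1) d(2)]] by blast
    then show thesis using that r(1) 1 by simp
  qed
  have "(b \<bullet> x) \<bullet> t1 = b \<bullet> a" using Cmp_assoc[OF X1(2,3) d(3)] X1(4) by simp
  then have "(b \<bullet> x) \<bullet> t1 = Z0 Q (s P)" using dt_zero2[OF t(3)] by simp
  \<comment> \<open>t' is a section of r up to an arrow through p, since a r t' = x t1 = a.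
    Subtracting i z corrects it to the section t2.\<close>
  then obtain t' where t': "t' \<in> hom Q W" "c \<bullet> t' = t1" using exact_cov3[OF w X1(2)] by blast
  have rt': "r \<bullet> t' \<in> hom Q Q" using Cmp_in_hom[OF t'(1) r(1)] .
  have I: "I1 Q \<in> hom Q Q" using Idn_in_hom[OF Qo] .
  have "a \<bullet> (r \<bullet> t') = (x \<bullet> c) \<bullet> t'" using Cmp_assoc[OF t'(1) r(1) d(2)] r(3) by simp
  also have "\<dots> = a" using Cmp_assoc[OF t'(1) e(2) X1(3)] t'(2) X1(4) by simp
  finally have "a \<bullet> ((r \<bullet> t') \<boxminus> I1 Q) = Z0 Q M"
    using Cmp_mns_right[OF d(2) rt' I] Cmp_Idn_right[OF d(2)] mns_self[OF d(2)] by simp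
  then obtain z where z: "z \<in> hom Q P" "p \<bullet> z = (r \<bullet> t') \<boxminus> I1 Q" using exact_cov2[OF t(3) mns_in_hom[OF rt' I]] by blast
  define t2 where "t2 = t' \<boxminus> (i \<bullet> z)"
  have iz: "i \<bullet> z \<in> hom Q W" using Cmp_in_hom[OF z(1) e(1)] .
  have t2: "t2 \<in> hom Q W" unfolding t2_def using mns_in_hom[OF t'(1) iz] .
  have "r \<bullet> t2 = (r \<bullet> t') \<boxminus> (p \<bullet> z)"
    unfolding t2_def using Cmp_mns_right[OF r(1) t'(1) iz] Cmp_assoc[OF z(1) e(1) r(1)] r(2) by simp
  also have "\<dots> = I1 Q"
    unfolding z(2) using rt' I Qo by (simp add: cat neg_simps add_simps)
  finally have rt2: "r \<bullet> t2 = I1 Q" .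
  \<comment> \<open>On P both q l' and r give p, so they differ by an arrow through X1; hence q u is
    congruent to r t2 = 1.\<close>
  define u where "u = l' \<bullet> t2"
  have u: "u \<in> hom Q C" unfolding u_def using Cmp_in_hom[OF t2 l'(1)] .
  have ql': "q \<bullet> l' \<in> hom W Q" using Cmp_in_hom[OF l'(1) q] .
  have "((q \<bullet> l') \<boxminus> r) \<bullet> i = Z0 P Q"
    using Cmp_mns_left[OF e(1) ql' r(1)] Cmp_assoc[OF e(1) l'(1) q] l'i l(2) r(2) mns_self[OF d(1)] by simp
  then obtain v where v: "v \<in> hom X1 Q" "v \<bullet> c = (q \<bullet> l') \<boxminus> r" using exact_contra2[OF w mns_in_hom[OF ql' r(1)]] by blast
  have "q \<bullet> l' \<approx> r" using eqv_hom[OF ql' r(1)] v(2) nulI[OF X1(1) e(2) v(1)] by simp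
  then have "(q \<bullet> l') \<bullet> t2 \<approx> r \<bullet> t2" using eqv_Cmp_left[OF _ t2 ql'] by blast
  then have qu: "q \<bullet> u \<approx> I1 Q" unfolding u_def using rt2 Cmp_assoc[OF t2 l'(1) q] by simp
  have uq: "u \<bullet> q \<in> hom C C" using Cmp_in_hom[OF q u] .
  have IC: "I1 C \<in> hom C C" using Idn_in_hom[OF Co] .
  \<comment> \<open>Since C is in \<open>FF\<close>, it is enough to test on \<open>PP\<close>,
    where q is injective and q u q agrees with q.\<close>
  have "nul ((u \<bullet> q) \<boxminus> I1 C)"
  proof (rule FF_nulI[OF C mns_in_hom[OF uq IC]])
    fix P' x' assume P': "P' \<in> PP" and x': "x' \<in> hom P' C"
    have uqx: "(u \<bullet> q) \<bullet> x' \<in> hom P' C" using Cmp_in_hom[OF x' uq] .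
    have "q \<bullet> ((u \<bullet> q) \<bullet> x') = (q \<bullet> u) \<bullet> (q \<bullet> x')" using q u x' by (simp add: cat)
    also have "\<dots> \<approx> I1 Q \<bullet> (q \<bullet> x')" by (rule eqv_Cmp_left[OF qu Cmp_in_hom[OF x' q] Cmp_in_hom[OF u q]])
    also have "\<dots> = q \<bullet> x'" using Cmp_Idn_left[OF Cmp_in_hom[OF x' q]] .
    finally have "q \<bullet> ((u \<bullet> q) \<bullet> x') = q \<bullet> x'" using PP_eqv_eq[OF P' Cmp_in_hom[OF uqx q]] by blast
    then have "q \<bullet> (((u \<bullet> q) \<bullet> x') \<boxminus> x') = Z0 P' Q"
      using Cmp_mns_right[OF q uqx x'] mns_self[OF Cmp_in_hom[OF x' q]] by simp
    then have "((u \<bullet> q) \<bullet> x') \<boxminus> x' = Z0 P' C" using inj[OF P' mns_in_hom[OF uqx x']] by blast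
    then show "((u \<bullet> q) \<boxminus> I1 C) \<bullet> x' = Z0 P' C"
      using Cmp_mns_left[OF x' uq IC] Cmp_Idn_left[OF x'] by simp
  qed
  then have "u \<bullet> q \<approx> I1 C" using eqv_hom[OF uq IC] by blast
  then show thesis using that[OF u qu] by blast
qed

end

section \<open>From an abelian factor category to cluster tilting\<close>

context serre_rigid
begin

text \<open>An object that becomes zero in the factor category is a retract of an object of
  \<open>XX\<close>.\<close>

lemma nul_Idn_XX:
  assumes "A \<in> Obj T" "nul (I1 A)"
  shows "A \<in> XX"
proof -
  obtain Y g h where "Y \<in> XX" "g \<in> hom A Y" "h \<in> hom Y A" "I1 A = h \<bullet> g"
    using nulE[OF assms(2) Idn_in_hom[OF assms(1)]] .
  then show ?thesis using XX_retract[OF split, of Y g A h] by simp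
qed

lemma nul_lift:
  assumes "nul f" "f \<in> hom A B" "\<And>Y' g. Y' \<in> XX \<Longrightarrow> g \<in> hom Y' B \<Longrightarrow> \<exists>u\<in>hom Y' Y. p \<bullet> u = g" "p \<in> hom Y B"
  obtains u where "u \<in> hom A Y" "p \<bullet> u = f"
proof -
  obtain Y' g h where h: "Y' \<in> XX" "g \<in> hom A Y'" "h \<in> hom Y' B" "f = h \<bullet> g" using nulE[OF assms(1,2)] .
  obtain u where u: "u \<in> hom Y' Y" "p \<bullet> u = h" using assms(3)[OF h(1,3)] by blast
  show thesis using that[OF Cmp_in_hom[OF h(2) u(1)]] Cmp_assoc[OF h(2) u(1) assms(4)] u(2) h(4) by simp
qed

text \<open>The Wakamatsu argument of \<open>PP_approx\<close> on the other side of the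
  approximation: here it places the first term L of the triangle in \<open>UU\<close>, there the
  third.\<close>

lemma XX_approx:
  assumes A: "A \<in> Obj T"
  obtains L Y l p h where "Y \<in> XX" "L \<in> UU" "dtriangle T L Y A l p h"
    "\<And>Y' g. Y' \<in> XX \<Longrightarrow> g \<in> hom Y' A \<Longrightarrow> \<exists>u\<in>hom Y' Y. p \<bullet> u = g"
proof -
  obtain Y p where Y: "Y \<in> XX" "p \<in> hom Y A"
    "\<And>Y' g. Y' \<in> XX \<Longrightarrow> g \<in> hom Y' A \<Longrightarrow> \<exists>u\<in>hom Y' Y. p \<bullet> u = g" using contraE[OF A] by blast
  obtain L l h where t: "dtriangle T L Y A l p h" using cocone[OF Y(2)] .
  note d = dtD[OF t]
  have "van Y' (s L)" if Y': "Y' \<in> XX" for Y'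
    unfolding van_def
  proof
    fix f assume f: "f \<in> hom Y' (s L)"
    have "sa l \<bullet> f = Z0 Y' (s Y)"
      using vanD[OF rigidD[OF Y' Y(1)] Cmp_in_hom[OF f sa_hom[OF d(1)]]] .
    then obtain g where g: "g \<in> hom Y' A" "h \<bullet> g = f" using exact_cov4[OF t f] by blast
    obtain u where u: "u \<in> hom Y' Y" "p \<bullet> u = g" using Y(3)[OF Y' g(1)] by blast
    have "f = (h \<bullet> p) \<bullet> u" using Cmp_assoc[OF u(1) d(2,3)] u g by simp
    then show "f = Z0 Y' (s L)" using dt_zero2[OF t] Cmp_Zer_left[OF u(1) sh_Obj[OF d(4)]] by simp
  qed
  then have "L \<in> UU" using d(4) by (simp add: UU_def)
  then show thesis using that[OF Y(1) _ t Y(3)] by blast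
qed

text \<open>An arrow A -> V vanishes on P, so it extends along A -> M. As A -> M factors through
  \<open>XX\<close>, which has no arrows to V, the arrow is zero.\<close>

lemma FF_van:
  assumes A: "A \<in> FF" and v: "\<And>P. P \<in> PP \<Longrightarrow> van P V" "\<And>Y. Y \<in> XX \<Longrightarrow> van Y V"
  shows "van A V"
  unfolding van_def
proof
  fix f assume f: "f \<in> hom A V"
  obtain P M p a b where t: "P \<in> PP" "M \<in> UU" "dtriangle T P A M p a b" using PP_approx[OF FF_Obj[OF A]] by metis
  note d = dtD[OF t(3)]
  obtain w where w: "w \<in> hom M V" "w \<bullet> a = f" using exact_contra2[OF t(3) f vanD[OF v(1)[OF t(1)] Cmp_in_hom[OF d(1) f]]] .
  obtain Y g h where h: "Y \<in> XX" "g \<in> hom A Y" "h \<in> hom Y M" "a = h \<bullet> g"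
    using nulE[OF FF_nul[OF A t(2) d(2)] d(2)] .
  have "f = (w \<bullet> h) \<bullet> g" using Cmp_assoc[OF h(2,3) w(1)] h(4) w(2) by simp
  then show "f = Z0 A V"
    using vanD[OF v(2)[OF h(1)] Cmp_in_hom[OF h(3) w(1)]] Cmp_Zer_left[OF h(2) homD(5)[OF f]] by simp
qed

lemma S_sh: "A \<in> Obj T \<Longrightarrow> isomorphic T (SO (s A)) (s (SO A))"
proof -
  assume A: "A \<in> Obj T"
  obtain \<theta> where "natural_iso T T (fctr_comp S (Shift T)) (fctr_comp (Shift T) S) \<theta>"
    using serre[unfolded serre_functor_def triangle_equivalence_def triangle_functor_def]
    by (elim conjE exE) (erule that)
  then have "iso_arr T (SO (s A)) (s (SO A)) (\<theta> A)"
    unfolding natural_iso_def fctr_comp_def sh_def using A by simp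
  then show ?thesis unfolding isomorphic_def using S_Obj sh_Obj A by blast
qed

end

locale serre_stable = serre_rigid +
  assumes SX: "essential_image T (FO S) XX = essential_image T (\<lambda>A. sh T (sh T A)) XX"
begin

notation cmp (infixr "\<bullet>" 70)
notation pls (infixl "\<boxplus>" 65)
notation mns (infixl "\<boxminus>" 65)
notation eqv (infix "\<approx>" 50)

lemma S_XX:
  assumes Y: "Y \<in> XX"
  obtains Y' where "Y' \<in> XX" "isomorphic T (SO Y) (s (s Y'))"
proof -
  have "SO Y \<in> essential_image T SO XX"
    unfolding essential_image_def using Y isomorphic_refl[OF S_Obj[OF XX_Obj[OF Y]]] by blast
  then obtain Y' where h: "Y' \<in> XX" "isomorphic T (s (s Y')) (SO Y)"
    unfolding SX by (auto simp: essential_image_def)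
  show thesis by (rule that[OF h(1) isomorphic_sym[OF h(2)]])
qed

lemma S_XX':
  assumes Y: "Y \<in> XX"
  obtains Y' where "Y' \<in> XX" "isomorphic T (SO Y') (s (s Y))"
proof -
  have "s (s Y) \<in> essential_image T (\<lambda>A. sh T (sh T A)) XX"
    unfolding essential_image_def using Y isomorphic_refl[OF sh_Obj[OF sh_Obj[OF XX_Obj[OF Y]]]] by blast
  then obtain Y' where "Y' \<in> XX" "isomorphic T (SO Y') (s (s Y))"
    unfolding SX[symmetric] by (auto simp: essential_image_def)
  then show thesis by (rule that)
qed

text \<open>T(Y, A) is dual to T(A, S Y), and up to isomorphism the objects S Y are the
  Y'[2].\<close>

lemma serre_duality:
  assumes A: "A \<in> Obj T"
  shows "(\<forall>Y\<in>XX. van Y A) \<longleftrightarrow> (\<forall>Y\<in>XX. van A (s (s Y)))"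
proof (intro iffI ballI)
  fix Y assume v: "\<forall>Y\<in>XX. van Y A" and Y: "Y \<in> XX"
  obtain Y' where Y': "Y' \<in> XX" "isomorphic T (SO Y') (s (s Y))" using S_XX'[OF Y] .
  then have "van A (SO Y')" using serre_van[OF XX_Obj A] v by blast
  then show "van A (s (s Y))" using van_iso[OF isomorphic_refl[OF A] Y'(2)] by blast
next
  fix Y assume v: "\<forall>Y\<in>XX. van A (s (s Y))" and Y: "Y \<in> XX"
  obtain Y' where Y': "Y' \<in> XX" "isomorphic T (SO Y) (s (s Y'))" using S_XX[OF Y] .
  then have "van A (SO Y)" using van_iso[OF isomorphic_refl[OF A] isomorphic_sym[OF Y'(2)]] v by blast
  then show "van Y A" using serre_van_iff[OF XX_Obj[OF Y] A] by blast
qed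

lemma UU_iff: "M \<in> UU \<longleftrightarrow> M \<in> Obj T \<and> (\<forall>Y\<in>XX. van M (s Y))"
proof (cases "M \<in> Obj T")
  case True
  then have "(\<forall>Y\<in>XX. van (s M) (s (s Y))) \<longleftrightarrow> (\<forall>Y\<in>XX. van M (s Y))"
    using sh_van[OF True sh_Obj[OF XX_Obj]] by blast
  then show ?thesis using serre_duality[OF sh_Obj[OF True]] True by (simp add: UU_def)
qed (simp add: UU_def)

lemma UU_sh: "M \<in> UU \<Longrightarrow> Y \<in> XX \<Longrightarrow> van M (s Y)"
  using UU_iff by blast

text \<open>S(P[1]) is isomorphic to some Y[2], so Serre duality detects y[1] by an arrow V[1] ->
  Y[2]; desuspending it gives u.\<close>

lemma PP_nondegenerate:
  assumes P: "P \<in> PP" and y: "y \<in> hom P V" "y \<noteq> Z0 P V"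
  obtains Y u where "Y \<in> XX" "u \<in> hom V (s Y)" "u \<bullet> y \<noteq> Z0 P (s Y)"
proof -
  note Po = PP_Obj[OF P] and V = homD(5)[OF y(1)]
  have "sa y \<noteq> Z0 (s P) (s V)"
    using sa_faithful[OF y(1) Zer_in_hom[OF Po V]] y(2) sa_Zer[OF Po V] by metis
  then obtain u' where u': "u' \<in> hom (s V) (SO (s P))" "u' \<bullet> sa y \<noteq> Z0 (s P) (SO (s P))"
    using serre_nondegenerate[OF sa_hom[OF y(1)]] by blast
  obtain Y where Y: "Y \<in> XX" "isomorphic T (SO (s P)) (s (s Y))" using S_XX[OF PP_sh[OF P]] .
  obtain g g' where g: "g \<in> hom (SO (s P)) (s (s Y))" "g' \<in> hom (s (s Y)) (SO (s P))" "g' \<bullet> g = I1 (SO (s P))"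
    using Y(2) by (rule isomorphicE)
  obtain u where u: "u \<in> hom V (s Y)" "sa u = g \<bullet> u'"
    using sa_full[OF V sh_Obj[OF XX_Obj[OF Y(1)]] Cmp_in_hom[OF u'(1) g(1)]] .
  have "u \<bullet> y \<noteq> Z0 P (s Y)"
  proof
    assume z: "u \<bullet> y = Z0 P (s Y)"
    have "g' \<bullet> (sa u \<bullet> sa y) = Z0 (s P) (SO (s P))"
      using sa_Cmp[OF y(1) u(1)] z sa_Zer[OF Po sh_Obj[OF XX_Obj[OF Y(1)]]]
        Cmp_Zer_right[OF g(2) sh_Obj[OF Po]] by simp
    moreover have "g' \<bullet> (sa u \<bullet> sa y) = (g' \<bullet> g) \<bullet> (u' \<bullet> sa y)"
      unfolding u(2) using g(1,2) u'(1) sa_hom[OF y(1)] by (simp add: cat)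
    moreover have "\<dots> = u' \<bullet> sa y"
      unfolding g(3) by (rule Cmp_Idn_left[OF Cmp_in_hom[OF sa_hom[OF y(1)] u'(1)]])
    ultimately show False using u'(2) by simp
  qed
  then show thesis using that Y(1) u(1) by blast
qed

text \<open>An arrow I -> Y[1] vanishes on L, so it is nul as e is epi, and nul arrows into XX[1]
  are zero.\<close>

lemma UU_iepi:
  assumes "L \<in> UU" "e \<in> hom L I" "iepi e"
  shows "I \<in> UU"
  unfolding UU_iff
proof (intro conjI ballI)
  fix Y assume Y: "Y \<in> XX"
  show "van I (s Y)"
    unfolding van_def
  proof
    fix u assume u: "u \<in> hom I (s Y)"
    have "u \<bullet> e = Z0 L (s Y)" using vanD[OF UU_sh[OF assms(1) Y] Cmp_in_hom[OF assms(2) u]] .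
    then have "nul u" using iepiD[OF assms(3,2) u] nul_Zer[OF UU_Obj[OF assms(1)] homD(5)[OF u]] by simp
    then show "u = Z0 I (s Y)" using nul_sh_zero[OF Y u] by blast
  qed
qed (use homD(5)[OF assms(2)] in simp)

lemma UU_imono:
  assumes "M \<in> UU" "m \<in> hom I M" "imono m"
  shows "I \<in> UU"
proof (rule UUI)
  fix P assume P: "P \<in> PP"
  show "van P I"
    unfolding van_def
  proof
    fix x assume x: "x \<in> hom P I"
    show "x = Z0 P I"
      using imono_PP_inj[OF assms(3,2) P x] vanD[OF PP_UU[OF P assms(1)] Cmp_in_hom[OF x assms(2)]] by blast
  qed
qed (use homD(4)[OF assms(2)] in simp)

text \<open>If x did not lift along e, then g x would be detected by some u : V -> Y[1]. But u g e =
  0, so u g is nul, and being an arrow into XX[1] it is zero.\<close>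

lemma iepi_PP_surj:
  assumes e: "e \<in> hom A B" "iepi e" and P: "P \<in> PP" and x: "x \<in> hom P B"
  shows "\<exists>z\<in>hom P A. e \<bullet> z = x"
proof -
  obtain V g h where t: "dtriangle T A B V e g h" using TR1_cone[OF e(1)] by blast
  note d = dtD[OF t]
  have "g \<bullet> x = Z0 P V"
  proof (rule ccontr)
    assume "g \<bullet> x \<noteq> Z0 P V"
    then obtain Y u where u: "Y \<in> XX" "u \<in> hom V (s Y)" "u \<bullet> (g \<bullet> x) \<noteq> Z0 P (s Y)"
      using PP_nondegenerate[OF P Cmp_in_hom[OF x d(2)]] by blast
    have ug: "u \<bullet> g \<in> hom B (s Y)" using Cmp_in_hom[OF d(2) u(2)] .
    have "(u \<bullet> g) \<bullet> e = Z0 A (s Y)"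
      using Cmp_assoc[OF d(1,2) u(2)] dt_zero1[OF t] Cmp_Zer_right[OF u(2) d(4)] by simp
    then have "nul (u \<bullet> g)" using iepiD[OF e(2,1) ug] nul_Zer[OF d(4) homD(5)[OF u(2)]] by simp
    then have "u \<bullet> g = Z0 B (s Y)" using nul_sh_zero[OF u(1) ug] by blast
    then show False using u(3) Cmp_assoc[OF x d(2) u(2)] Cmp_Zer_left[OF x homD(5)[OF u(2)]] by simp
  qed
  then show ?thesis using exact_cov2[OF t x] by metis
qed

section \<open>Consequences of an abelian factor category, beginning with the mutual orthogonality
  of \<open>FF\<close> and \<open>UU\<close>\<close>

context
  assumes ab: "iabelian"
begin

lemma ex_icokernel: "f \<in> hom A B \<Longrightarrow> \<exists>c. icokernel f c"
  using ab homD(1)[of f A B] unfolding iabelian_def by blast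

lemma ex_ikernel: "f \<in> hom A B \<Longrightarrow> \<exists>k. ikernel f k"
  using ab homD(1)[of f A B] unfolding iabelian_def by blast

text \<open>The image I of u lies in \<open>UU\<close>, so \<open>PP\<close> does not see it. Hence
  the cokernel q of I -> C is bijective on T(PP, -): onto because q is epi, injective because its
  kernel is I. Both ends are in \<open>FF\<close>, so \<open>FF_iso\<close> inverts q modulo
  \<open>XX\<close>, and its kernel is zero.\<close>

lemma UU_FF_nul:
  assumes L: "L \<in> UU" and C: "C \<in> FF" and u: "u \<in> hom L C"
  shows "nul u"
proof -
  obtain I e k where i: "e \<in> hom L I" "k \<in> hom I C" "u \<approx> k \<bullet> e" "imono k" "iepi e"
    using image_factorisation[OF ab u] .
  have I: "I \<in> UU" using UU_iepi[OF L i(1,5)] .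
  obtain q where qc: "icokernel k q" using ex_icokernel[OF i(2)] by blast
  then obtain Q where q: "q \<in> hom C Q" "nul (q \<bullet> k)" "iepi q" using i(2) by (rule icokernelE)
  have qk: "ikernel q k" using mono_kernel_of_cokernel[OF ab i(4) qc] .
  have Q: "Q \<in> FF" using FF_iepi[OF C q(1,3)] .
  have inj: "x = Z0 P C" if P: "P \<in> PP" and x: "x \<in> hom P C" and z: "q \<bullet> x = Z0 P Q" for P x
  proof -
    have "nul (q \<bullet> x)" using z nul_Zer[OF PP_Obj[OF P] FF_Obj[OF Q]] by simp
    then obtain t where t: "t \<in> hom P I" "k \<bullet> t \<approx> x"
      using ikernelE[OF qk q(1)] x homD(2)[OF i(2)] homD(2) by metis
    have "k \<bullet> t = x" using PP_eqv_eq[OF P Cmp_in_hom[OF t(1) i(2)] t(2)] .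
    then show ?thesis using vanD[OF PP_UU[OF P I] t(1)] Cmp_Zer_right[OF i(2) PP_Obj[OF P]] by simp
  qed
  obtain r where r: "r \<in> hom Q C" "r \<bullet> q \<approx> I1 C"
    by (rule FF_iso[OF C Q q(1)], erule (2) inj, erule (1) iepi_PP_surj[OF q(1,3)], erule (1) that)
  have "nul (r \<bullet> (q \<bullet> k))" using nul_post[OF q(2) Cmp_in_hom[OF i(2) q(1)] r(1)] .
  then have "nul ((r \<bullet> q) \<bullet> k)" using Cmp_assoc[OF i(2) q(1) r(1)] by simp
  then have "nul (I1 C \<bullet> k)" using eqv_nul[OF eqv_Cmp_left[OF r(2) i(2) Cmp_in_hom[OF q(1) r(1)]]] by blast
  then have "nul k" using Cmp_Idn_left[OF i(2)] by simp
  then show ?thesis using eqv_nul[OF i(3)] nul_pre[OF _ i(1,2)] by blast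
qed

text \<open>Let J be the image of the approximation P -> Y[1]; as a quotient of P it is in
  \<open>FF\<close>. The point is that J -> Y[1] splits, which makes Y[1] a retract of J.\<close>

lemma sh_XX_FF:
  assumes Y: "Y \<in> XX"
  shows "s Y \<in> FF"
proof -
  note Yo = XX_Obj[OF Y]
  obtain P M p a b where t: "P \<in> PP" "M \<in> UU" "dtriangle T P (s Y) M p a b"
    using PP_approx[OF sh_Obj[OF Yo]] by metis
  note d = dtD[OF t(3)]
  obtain J e m where i: "e \<in> hom P J" "m \<in> hom J (s Y)" "p \<approx> m \<bullet> e" "imono m" "iepi e"
    using image_factorisation[OF ab d(1)] .
  have pme: "p = m \<bullet> e" using PP_eqv_eq[OF t(1) d(1) i(3)] .
  have J: "J \<in> FF" using FF_iepi[OF PP_FF[OF t(1)] i(1,5)] .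
  obtain N n w where t2: "dtriangle T N J (s Y) n m w" using cocone[OF i(2)] .
  note e = dtD[OF t2]
  have "nul (m \<bullet> n)" using dt_zero1[OF t2] nul_Zer[OF e(4,6)] by simp
  then have "nul n" using imonoD[OF i(4,2) e(1)] by blast
  \<comment> \<open>n factors as \<sigma> r through X'. By rigidity m \<sigma> = 0, so \<sigma> = n
    \<sigma>' for some \<sigma>', and v = 1 - \<sigma>' r is killed by n.\<close>
  then obtain X' r \<sigma> where x: "X' \<in> XX" "r \<in> hom N X'" "\<sigma> \<in> hom X' J" "n = \<sigma> \<bullet> r" using nulE[OF _ e(1)] by blast
  have "m \<bullet> \<sigma> = Z0 X' (s Y)" using vanD[OF rigidD[OF x(1) Y] Cmp_in_hom[OF x(3) i(2)]] .
  then obtain \<sigma>' where s': "\<sigma>' \<in> hom X' N" "n \<bullet> \<sigma>' = \<sigma>" using exact_cov2[OF t2 x(3)] by blast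
  have sr: "\<sigma>' \<bullet> r \<in> hom N N" using Cmp_in_hom[OF x(2) s'(1)] .
  have IN: "I1 N \<in> hom N N" using Idn_in_hom[OF e(4)] .
  define v where "v = I1 N \<boxminus> (\<sigma>' \<bullet> r)"
  have v: "v \<in> hom N N" unfolding v_def using mns_in_hom[OF IN sr] .
  have "n \<bullet> v = n \<boxminus> ((n \<bullet> \<sigma>') \<bullet> r)"
    unfolding v_def using Cmp_mns_right[OF e(1) IN sr] Cmp_Idn_right[OF e(1)] Cmp_assoc[OF x(2) s'(1) e(1)] by simp
  then have nv: "n \<bullet> v = Z0 N J" using s'(2) x(4) mns_self[OF e(1)] by simp
  \<comment> \<open>Being killed by n, v factors through the desuspended w, hence through Y. So the
    identity of N is a sum of two nul arrows and N lies in \<open>XX\<close>.\<close>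
  have "sa n \<bullet> sa v = Z0 (s N) (s J)" using sa_Cmp[OF v e(1)] nv sa_Zer[OF e(4,5)] by simp
  then obtain g where g: "g \<in> hom (s N) (s Y)" "w \<bullet> g = sa v" using exact_cov4[OF t2 sa_hom[OF v]] by blast
  obtain g0 where g0: "g0 \<in> hom N Y" "sa g0 = g" using sa_full[OF e(4) Yo g(1)] .
  obtain w0 where w0: "w0 \<in> hom Y N" "sa w0 = w" using sa_full[OF Yo e(4,3)] .
  have "sa (w0 \<bullet> g0) = sa v" using sa_Cmp[OF g0(1) w0(1)] g0 w0 g by simp
  then have "v = w0 \<bullet> g0" using sa_faithful[OF Cmp_in_hom[OF g0(1) w0(1)] v] by simp
  then have "nul v" using nulI[OF Y g0(1) w0(1)] by simp
  moreover have "(\<sigma>' \<bullet> r) \<boxplus> v = I1 N" using Add_mns_eq[OF IN sr v] v_def by simp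
  ultimately have "nul (I1 N)" using nul_Add[OF nulI[OF x(1,2) s'(1)] _ sr v] by simp
  then have N: "N \<in> XX" using nul_Idn_XX[OF e(4)] by blast
  \<comment> \<open>As w kills p, it extends over M; since \<open>UU\<close> has no arrows to XX[1],
    w = 0 and the triangle splits.\<close>
  have "w \<bullet> p = Z0 P (s N)"
    unfolding pme using Cmp_assoc[OF i(1,2) e(3)] dt_zero2[OF t2] Cmp_Zer_left[OF i(1) sh_Obj[OF e(4)]] by simp
  then obtain w' where w': "w' \<in> hom M (s N)" "w' \<bullet> a = w" using exact_contra2[OF t(3) e(3)] by blast
  have "w = Z0 (s Y) (s N)"
    using vanD[OF UU_sh[OF t(2) N] w'(1)] w'(2) Cmp_Zer_left[OF d(2) sh_Obj[OF e(4)]] by simp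
  then obtain z where "z \<in> hom (s Y) J" "m \<bullet> z = I1 (s Y)" using third_zero_split[OF t2] by blast
  then show ?thesis using FF_retract[OF J _ i(2)] by blast
qed

text \<open>Modulo \<open>XX\<close>, \<delta> embeds C into Y1[1]. If I = C/J is the image of f,
  then I maps to Q = Y1[1]/J, a quotient of an object of \<open>FF\<close>. I is in
  \<open>UU\<close>, so this map is nul; thus C lies in J and I is zero.\<close>

lemma cone_XX_FF:
  assumes Y: "Y1 \<in> XX" "Y0 \<in> XX" and t: "dtriangle T Y1 Y0 C \<alpha> v \<delta>"
  shows "C \<in> FF"
proof (rule FFI)
  note d = dtD[OF t]
  show "C \<in> Obj T" using d(6) .
  fix M f assume M: "M \<in> UU" and f: "f \<in> hom C M"
  \<comment> \<open>Killing modulo \<open>XX\<close> is strict here because the target of \<delta>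
    is in XX[1], and what \<delta> kills strictly comes from Y0.\<close>
  have dm: "imono \<delta>"
  proof (rule imonoI[OF d(3)])
    fix W g assume g: "g \<in> hom W C" "nul (\<delta> \<bullet> g)"
    have "\<delta> \<bullet> g = Z0 W (s Y1)" using nul_sh_zero[OF Y(1) Cmp_in_hom[OF g(1) d(3)] g(2)] .
    then obtain y where "y \<in> hom W Y0" "v \<bullet> y = g" using exact_cov3[OF t g(1)] by blast
    then show "nul g" using nulI[OF Y(2) _ d(2)] by blast
  qed
  obtain I e m where i: "e \<in> hom C I" "m \<in> hom I M" "f \<approx> m \<bullet> e" "imono m" "iepi e"
    using image_factorisation[OF ab f] .
  have I: "I \<in> UU" using UU_imono[OF M i(2,4)] .
  obtain j where ej: "ikernel e j" using ex_ikernel[OF i(1)] by blast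
  then obtain J where j: "j \<in> hom J C" "nul (e \<bullet> j)" "imono j" using i(1) by (rule ikernelE)
  have je: "icokernel j e" using epi_cokernel_of_kernel[OF ab i(5) ej] .
  have dj: "\<delta> \<bullet> j \<in> hom J (s Y1)" using Cmp_in_hom[OF j(1) d(3)] .
  have djm: "imono (\<delta> \<bullet> j)" using imono_Cmp[OF dm j(3,1) d(3)] .
  obtain q where qc: "icokernel (\<delta> \<bullet> j) q" using ex_icokernel[OF dj] by blast
  then obtain Q where q: "q \<in> hom (s Y1) Q" "nul (q \<bullet> (\<delta> \<bullet> j))" "iepi q" using dj by (rule icokernelE)
  have qk: "ikernel q (\<delta> \<bullet> j)" using mono_kernel_of_cokernel[OF ab djm qc] .
  have Q: "Q \<in> FF" using FF_iepi[OF sh_XX_FF[OF Y(1)] q(1,3)] .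
  have qd: "q \<bullet> \<delta> \<in> hom C Q" using Cmp_in_hom[OF d(3) q(1)] .
  have "nul ((q \<bullet> \<delta>) \<bullet> j)" using q(2) Cmp_assoc[OF j(1) d(3) q(1)] by simp
  \<comment> \<open>The induced map from C/J to Y1[1]/J.\<close>
  then obtain w where w: "w \<in> hom I Q" "w \<bullet> e \<approx> q \<bullet> \<delta>"
    using je[unfolded icokernel_def] qd homD(3)[OF j(1)] homD(5)[OF qd] homD(3)[OF i(1)] by auto
  have "nul (w \<bullet> e)" using nul_pre[OF UU_FF_nul[OF I Q w(1)] i(1) w(1)] .
  then have "nul (q \<bullet> \<delta>)" using eqv_nul[OF w(2)] by blast
  then obtain t where t: "t \<in> hom C J" "(\<delta> \<bullet> j) \<bullet> t \<approx> \<delta>"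
    using qk[unfolded ikernel_def] d(3) homD(2)[OF q(1)] homD(2)[OF dj] d(6) by auto
  have IC: "I1 C \<in> hom C C" using Idn_in_hom[OF d(6)] .
  have "\<delta> \<bullet> (j \<bullet> t) \<approx> \<delta> \<bullet> I1 C" using t(2) Cmp_assoc[OF t(1) j(1) d(3)] Cmp_Idn_right[OF d(3)] by simp
  then have jt: "j \<bullet> t \<approx> I1 C" using imono_cancel[OF dm d(3) Cmp_in_hom[OF t(1) j(1)] IC] by blast
  have "nul ((e \<bullet> j) \<bullet> t)" using nul_pre[OF j(2) t(1) Cmp_in_hom[OF j(1) i(1)]] .
  then have "nul (e \<bullet> (j \<bullet> t))" using Cmp_assoc[OF t(1) j(1) i(1)] by simp
  then have "nul (e \<bullet> I1 C)" using eqv_nul[OF eqv_Cmp_right[OF jt Cmp_in_hom[OF t(1) j(1)] i(1)]] by blast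
  then have "nul e" using Cmp_Idn_right[OF i(1)] by simp
  then show "nul f" using eqv_nul[OF i(3)] nul_post[OF _ i(1,2)] by blast
qed

text \<open>The kernel term \<open>L\<close> of an approximation of an object of \<open>PP\<close> is Ext-injective in \<open>UU\<close>; by Serre duality
  it is also Ext-projective, so that its own approximation splits.\<close>

lemma PP_resolution:
  assumes P: "P \<in> PP"
  obtains L Y l p h where "L \<in> XX" "Y \<in> XX" "dtriangle T L Y P l p h"
proof -
  obtain L Y l p h where t: "Y \<in> XX" "L \<in> UU" "dtriangle T L Y P l p h"
    and ap: "\<And>Y' g. Y' \<in> XX \<Longrightarrow> g \<in> hom Y' P \<Longrightarrow> \<exists>u\<in>hom Y' Y. p \<bullet> u = g"
    using XX_approx[OF PP_Obj[OF P]] by metis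
  note d = dtD[OF t(3)]
  \<comment> \<open>An arrow M -> L[1] comes from an arrow M -> P. That one is nul because P is in
    \<open>FF\<close>, so it lifts along p, and h p = 0.\<close>
  have inj: "van M (s L)" if M: "M \<in> UU" for M
    unfolding van_def
  proof
    fix f assume f: "f \<in> hom M (s L)"
    have "sa l \<bullet> f = Z0 M (s Y)" using vanD[OF UU_sh[OF M t(1)] Cmp_in_hom[OF f sa_hom[OF d(1)]]] .
    then obtain g where g: "g \<in> hom M P" "h \<bullet> g = f" using exact_cov4[OF t(3) f] by blast
    obtain u where u: "u \<in> hom M Y" "p \<bullet> u = g" using nul_lift[OF UU_FF_nul[OF M PP_FF[OF P] g(1)] g(1) ap d(2)] .
    have "f = (h \<bullet> p) \<bullet> u" using Cmp_assoc[OF u(1) d(2,3)] u g by simp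
    then show "f = Z0 M (s L)" using dt_zero2[OF t(3)] Cmp_Zer_left[OF u(1) sh_Obj[OF d(4)]] by simp
  qed
  \<comment> \<open>M is chosen with S M isomorphic to M'[2]. It is in \<open>UU\<close> because S
    carries \<open>XX\<close> to XX[2], and T(M, L[1]) = 0 is dual to T(L[1], M'[2]) = 0.\<close>
  have proj: "van L (s M')" if M': "M' \<in> UU" for M'
  proof -
    note o = UU_Obj[OF M']
    obtain M where M: "M \<in> Obj T" "isomorphic T (SO M) (s (s M'))" using S_surj[OF sh_Obj[OF sh_Obj[OF o]]] .
    have sM: "isomorphic T (SO (s M)) (s (s (s M')))"
      using isomorphic_trans[OF S_sh[OF M(1)]] sh_iso[OF S_Obj[OF M(1)] sh_Obj[OF sh_Obj[OF o]]] M(2) by blast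
    have "M \<in> UU"
    proof -
      have "van Y' (s M)" if Y': "Y' \<in> XX" for Y'
      proof -
        obtain Y2 where Y2: "Y2 \<in> XX" "isomorphic T (SO Y') (s (s Y2))" using S_XX[OF Y'] .
        have "van Y2 (s M')" using UU_van[OF M' Y2(1)] .
        then have "van (s (s Y2)) (s (s (s M')))"
          using sh_van[OF XX_Obj[OF Y2(1)] sh_Obj[OF o]] sh_van[OF sh_Obj[OF XX_Obj[OF Y2(1)]] sh_Obj[OF sh_Obj[OF o]]] by blast
        then have "van (SO Y') (SO (s M))" using van_iso[OF isomorphic_sym[OF Y2(2)] isomorphic_sym[OF sM]] by blast
        then show ?thesis using S_van[OF XX_Obj[OF Y'] sh_Obj[OF M(1)]] by blast
      qed
      then show ?thesis using M(1) by (simp add: UU_def)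
    qed
    then have "van (s L) (SO M)" using serre_van[OF M(1) sh_Obj[OF d(4)] inj] by blast
    then have "van (s L) (s (s M'))" using van_iso[OF isomorphic_refl[OF sh_Obj[OF d(4)]] M(2)] by blast
    then show ?thesis using sh_van[OF d(4) sh_Obj[OF o]] by blast
  qed
  obtain L2 Y2 l2 p2 h2 where t2: "Y2 \<in> XX" "L2 \<in> UU" "dtriangle T L2 Y2 L l2 p2 h2"
    using XX_approx[OF d(4)] by metis
  note e = dtD[OF t2(3)]
  have "h2 = Z0 L (s L2)" using vanD[OF proj[OF t2(2)] e(3)] .
  then obtain w where "w \<in> hom L Y2" "p2 \<bullet> w = I1 L" using third_zero_split[OF t2(3)] by blast
  then have "L \<in> XX" using XX_retract[OF split t2(1) _ e(2)] by blast
  then show thesis using that t by blast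
qed

text \<open>It turns out that \<open>ZZ\<close> is orthogonal to all shifts of \<open>XX\<close>, on both sides.\<close>

definition ZZ where "ZZ = {A \<in> Obj T. (\<forall>Y\<in>XX. van Y A) \<and> (\<forall>Y\<in>XX. van Y (s A))}"

lemma ZZ_Obj: "A \<in> ZZ \<Longrightarrow> A \<in> Obj T" by (simp add: ZZ_def)

text \<open>Y is the part of the approximation X0 -> M on which arrows from \<open>FF\<close> are
  seen faithfully in M. This injectivity makes the cone M' receive no arrows from \<open>XX\<close>
  and XX[1]; Serre duality and \<open>PP_resolution\<close> then annihilate the connecting
  arrow.\<close>

lemma UU_decomposition:
  assumes M: "M \<in> UU"
  obtains Y M' y g where "Y \<in> XX" "M' \<in> ZZ" "dtriangle T Y M M' y g (Z0 M' (s Y))"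
proof -
  note Mo = UU_Obj[OF M]
  obtain L X0 l p dd where t: "X0 \<in> XX" "L \<in> UU" "dtriangle T L X0 M l p dd"
    and ap: "\<And>Y' g. Y' \<in> XX \<Longrightarrow> g \<in> hom Y' M \<Longrightarrow> \<exists>u\<in>hom Y' X0. p \<bullet> u = g"
    using XX_approx[OF Mo] by metis
  note d = dtD[OF t(3)]
  obtain X1 x where X1: "X1 \<in> XX" "x \<in> hom X1 L"
    and apL: "\<And>Y' g. Y' \<in> XX \<Longrightarrow> g \<in> hom Y' L \<Longrightarrow> \<exists>u\<in>hom Y' X1. x \<bullet> u = g" using contraE[OF d(4)] by metis
  \<comment> \<open>Covering L by X1 replaces the kernel term of p by an arrow between objects of
    \<open>XX\<close>, so that \<open>cone_XX_FF\<close> applies to the cone.\<close>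
  define \<alpha> where "\<alpha> = l \<bullet> x"
  have al: "\<alpha> \<in> hom X1 X0" unfolding \<alpha>_def using Cmp_in_hom[OF X1(2) d(1)] .
  obtain C v \<delta> where t2: "dtriangle T X1 X0 C \<alpha> v \<delta>" using TR1_cone[OF al] by blast
  note e = dtD[OF t2]
  have C: "C \<in> FF" using cone_XX_FF[OF X1(1) t(1) t2] .
  have "p \<bullet> \<alpha> = Z0 X1 M"
    unfolding \<alpha>_def using Cmp_assoc[OF X1(2) d(1,2)] dt_zero1[OF t(3)] Cmp_Zer_left[OF X1(2) Mo] by simp
  then obtain p' where p': "p' \<in> hom C M" "p' \<bullet> v = p" using exact_contra2[OF t2 d(2)] by blast
  \<comment> \<open>C is in \<open>FF\<close> and M in \<open>UU\<close>, so p' is nul and lifts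
    along the approximation p.\<close>
  obtain c where c: "c \<in> hom C X0" "p \<bullet> c = p'" using nul_lift[OF FF_nul[OF C M p'(1)] p'(1) ap d(2)] .
  define \<epsilon> where "\<epsilon> = c \<bullet> v"
  have ep: "\<epsilon> \<in> hom X0 X0" unfolding \<epsilon>_def using Cmp_in_hom[OF e(2) c(1)] .
  have pe: "p \<bullet> \<epsilon> = p" unfolding \<epsilon>_def using Cmp_assoc[OF e(2) c(1) d(2)] c(2) p'(2) by simp
  have I: "I1 X0 \<in> hom X0 X0" using Idn_in_hom[OF d(5)] .
  have "p \<bullet> (I1 X0 \<boxminus> \<epsilon>) = Z0 X0 M"
    using Cmp_mns_right[OF d(2) I ep] pe Cmp_Idn_right[OF d(2)] mns_self[OF d(2)] by simp
  \<comment> \<open>As p kills 1 - \<epsilon>, this factors through l and, by the choice of X1,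
    through \<alpha>. Since v \<alpha> = 0, it follows that v \<epsilon> = v, and \<epsilon> = c v
    is idempotent.\<close>
  then obtain y where y: "y \<in> hom X0 L" "l \<bullet> y = I1 X0 \<boxminus> \<epsilon>" using exact_cov2[OF t(3) mns_in_hom[OF I ep]] by blast
  obtain w where w: "w \<in> hom X0 X1" "x \<bullet> w = y" using apL[OF t(1) y(1)] by blast
  have aw: "\<alpha> \<bullet> w = I1 X0 \<boxminus> \<epsilon>" unfolding \<alpha>_def using Cmp_assoc[OF w(1) X1(2) d(1)] w(2) y(2) by simp
  have "v \<bullet> (I1 X0 \<boxminus> \<epsilon>) = Z0 X0 C"
    unfolding aw[symmetric] using Cmp_assoc[OF w(1) e(1,2)] dt_zero1[OF t2] Cmp_Zer_left[OF w(1) e(6)] by simp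
  then have "v \<boxminus> (v \<bullet> \<epsilon>) = Z0 X0 C" using Cmp_mns_right[OF e(2) I ep] Cmp_Idn_right[OF e(2)] by simp
  then have ve: "v \<bullet> \<epsilon> = v" using mns_eq_Zer[OF e(2) Cmp_in_hom[OF ep e(2)]] by simp
  have "\<epsilon> \<bullet> \<epsilon> = c \<bullet> (v \<bullet> \<epsilon>)" using Cmp_assoc[OF ep e(2) c(1)] by (simp add: \<epsilon>_def)
  then have ee: "\<epsilon> \<bullet> \<epsilon> = \<epsilon>" using ve by (simp add: \<epsilon>_def)
  from split[unfolded split_idempotents_def, rule_format, OF d(5) ep ee]
  obtain Y r i where Yo: "Y \<in> Obj T" and ri: "r \<in> hom X0 Y" "i \<in> hom Y X0" "i \<bullet> r = \<epsilon>" "r \<bullet> i = I1 Y" by blast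
  have Y: "Y \<in> XX" using XX_retract[OF split t(1) ri(2,1,4)] .
  define py where "py = p \<bullet> i"
  have py: "py \<in> hom Y M" unfolding py_def using Cmp_in_hom[OF ri(2) d(2)] .
  have pyr: "py \<bullet> r = p" unfolding py_def using Cmp_assoc[OF ri(1,2) d(2)] ri(3) pe by simp
  have "\<epsilon> \<bullet> i = i \<bullet> (r \<bullet> i)" using Cmp_assoc[OF ri(2,1,2)] ri(3) by simp
  then have ei: "\<epsilon> \<bullet> i = i" using ri(4) Cmp_Idn_right[OF ri(2)] by simp
  \<comment> \<open>p i z = 0, so i z lifts to L. The lift is nul because G is in \<open>FF\<close>
    and L in \<open>UU\<close>, so it lifts to X1. Thus i z factors through \<alpha> and is killed
    by v, hence by \<epsilon> = c v, which fixes i.\<close>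
  have inj: "z = Z0 G Y" if G: "G \<in> FF" and z: "z \<in> hom G Y" and pz: "py \<bullet> z = Z0 G M" for G z
  proof -
    have iz: "i \<bullet> z \<in> hom G X0" using Cmp_in_hom[OF z ri(2)] .
    have "p \<bullet> (i \<bullet> z) = Z0 G M" using pz Cmp_assoc[OF z ri(2) d(2)] by (simp add: py_def)
    then obtain z1 where z1: "z1 \<in> hom G L" "l \<bullet> z1 = i \<bullet> z" using exact_cov2[OF t(3) iz] by blast
    obtain z2 where z2: "z2 \<in> hom G X1" "x \<bullet> z2 = z1" using nul_lift[OF FF_nul[OF G t(2) z1(1)] z1(1) apL X1(2)] .
    have "i \<bullet> z = \<alpha> \<bullet> z2" unfolding \<alpha>_def using Cmp_assoc[OF z2(1) X1(2) d(1)] z1 z2 by simp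
    then have vz: "v \<bullet> (i \<bullet> z) = Z0 G C"
      using Cmp_assoc[OF z2(1) e(1,2)] dt_zero1[OF t2] Cmp_Zer_left[OF z2(1) e(6)] by simp
    have "i \<bullet> z = \<epsilon> \<bullet> (i \<bullet> z)" using Cmp_assoc[OF z ri(2) ep] ei by simp
    also have "\<dots> = c \<bullet> (v \<bullet> (i \<bullet> z))" unfolding \<epsilon>_def using Cmp_assoc[OF iz e(2) c(1)] .
    also have "\<dots> = Z0 G X0" unfolding vz using Cmp_Zer_right[OF c(1) FF_Obj[OF G]] .
    finally have "r \<bullet> (i \<bullet> z) = Z0 G Y" using Cmp_Zer_right[OF ri(1) FF_Obj[OF G]] by simp
    then show ?thesis using Cmp_assoc[OF z ri(2,1)] ri(4) Cmp_Idn_left[OF z] by simp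
  qed
  obtain M' g h where t3: "dtriangle T Y M M' py g h" using TR1_cone[OF py] by blast
  note b = dtD[OF t3]
  have v0: "van X' M'" if X': "X' \<in> XX" for X'
    unfolding van_def
  proof
    fix f assume f: "f \<in> hom X' M'"
    have "h \<bullet> f = Z0 X' (s Y)" using vanD[OF rigidD[OF X' Y] Cmp_in_hom[OF f b(3)]] .
    then obtain g1 where g1: "g1 \<in> hom X' M" "g \<bullet> g1 = f" using exact_cov3[OF t3 f] by blast
    obtain g2 where g2: "g2 \<in> hom X' X0" "p \<bullet> g2 = g1" using ap[OF X' g1(1)] by blast
    have "g1 = py \<bullet> (r \<bullet> g2)" using Cmp_assoc[OF g2(1) ri(1) py] pyr g2(2) by simp
    then have "f = (g \<bullet> py) \<bullet> (r \<bullet> g2)" using Cmp_assoc[OF Cmp_in_hom[OF g2(1) ri(1)] b(1,2)] g1(2) by simp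
    then show "f = Z0 X' M'" using dt_zero1[OF t3] Cmp_Zer_left[OF Cmp_in_hom[OF g2(1) ri(1)] b(6)] by simp
  qed
  \<comment> \<open>h f is a shifted arrow z[1] with \<open>py \<bullet> z\<close> zero, so z = 0 by
    \<open>inj\<close> and f lifts to M. The lift factors through \<open>XX\<close> because X'[1] is
    in \<open>FF\<close>, and \<open>v0\<close> finishes.\<close>
  have v1: "van (s X') M'" if X': "X' \<in> XX" for X'
    unfolding van_def
  proof
    fix f assume f: "f \<in> hom (s X') M'"
    note X'o = XX_Obj[OF X']
    obtain z where z: "z \<in> hom X' Y" "sa z = h \<bullet> f" using sa_full[OF X'o Yo Cmp_in_hom[OF f b(3)]] .
    have "sa (py \<bullet> z) = (sa py \<bullet> h) \<bullet> f" using sa_Cmp[OF z(1) py] z(2) Cmp_assoc[OF f b(3) sa_hom[OF py]] by simp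
    also have "\<dots> = sa (Z0 X' M)"
      using dt_zero3[OF t3] Cmp_Zer_left[OF f sh_Obj[OF Mo]] sa_Zer[OF X'o Mo] by simp
    finally have "py \<bullet> z = Z0 X' M" using sa_faithful[OF Cmp_in_hom[OF z(1) py] Zer_in_hom[OF X'o Mo]] by blast
    then have "z = Z0 X' Y" using inj[OF XX_FF[OF X'] z(1)] by blast
    then have "h \<bullet> f = Z0 (s X') (s Y)" using z(2) sa_Zer[OF X'o Yo] by simp
    then obtain g1 where g1: "g1 \<in> hom (s X') M" "g \<bullet> g1 = f" using exact_cov3[OF t3 f] by blast
    obtain X2 k k' where k: "X2 \<in> XX" "k \<in> hom (s X') X2" "k' \<in> hom X2 M" "g1 = k' \<bullet> k"
      using nulE[OF FF_nul[OF sh_XX_FF[OF X'] M g1(1)] g1(1)] .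
    have "f = (g \<bullet> k') \<bullet> k" using Cmp_assoc[OF k(2,3) b(2)] k(4) g1(2) by simp
    then show "f = Z0 (s X') M'"
      using vanD[OF v0[OF k(1)] Cmp_in_hom[OF k(3) b(2)]] Cmp_Zer_left[OF k(2) b(6)] by simp
  qed
  \<comment> \<open>The Serre dual of \<open>v0\<close>; the next fact is that of \<open>v1\<close>,
    taken after one desuspension.\<close>
  have w2: "van M' (s (s X'))" if "X' \<in> XX" for X'
    using serre_duality[OF b(6)] v0 that by blast
  have w3: "van M' (s (s (s X')))" if X': "X' \<in> XX" for X'
  proof -
    obtain N where N: "N \<in> Obj T" "isomorphic T (s N) M'" using sh_surj[OF b(6)] .
    have "van X2 N" if "X2 \<in> XX" for X2
      using sh_van[OF XX_Obj[OF that] N(1)] van_iso[OF isomorphic_refl[OF sh_Obj[OF XX_Obj[OF that]]] isomorphic_sym[OF N(2)] v1[OF that]] by blast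
    then have "van N (s (s X'))" using serre_duality[OF N(1)] X' by blast
    then have "van (s N) (s (s (s X')))" using sh_van[OF N(1) sh_Obj[OF sh_Obj[OF XX_Obj[OF X']]]] by blast
    then show ?thesis using van_iso[OF N(2) isomorphic_refl[OF sh_Obj[OF sh_Obj[OF sh_Obj[OF XX_Obj[OF X']]]]]] by blast
  qed
  \<comment> \<open>Y[1] is some P[2]. As P sits between Y3 and L3[1], P[2] sits between Y3[2] and
    L3[3], to which M' has no arrows by \<open>w2\<close> and \<open>w3\<close>.\<close>
  have "van M' (s Y)"
  proof -
    obtain P where P: "P \<in> PP" "isomorphic T (s P) Y" using XX_PP[OF Y] .
    obtain L3 Y3 l3 p3 h3 where r3: "L3 \<in> XX" "Y3 \<in> XX" "dtriangle T L3 Y3 P l3 p3 h3" using PP_resolution[OF P(1)] .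
    have "van M' (s (s P))"
      by (rule van_mid_right[OF shift_dtriangle[OF shift_dtriangle[OF rotate[OF r3(3)]]] w2[OF r3(2)] w3[OF r3(1)]])
    moreover have "isomorphic T (s (s P)) (s Y)" using sh_iso[OF sh_Obj[OF PP_Obj[OF P(1)]] Yo] P(2) by blast
    ultimately show ?thesis using van_iso[OF isomorphic_refl[OF b(6)]] by blast
  qed
  then have h0: "h = Z0 M' (s Y)" using vanD[OF _ b(3)] by blast
  obtain w' where w': "w' \<in> hom M' M" "g \<bullet> w' = I1 M'" using third_zero_split[OF t3 h0] .
  have "M' \<in> UU" using UU_retract[OF M w'(1) b(2) w'(2)] .
  then have "M' \<in> ZZ" using v0 b(6) by (simp add: ZZ_def UU_def)
  then show thesis using that[OF Y] t3 h0 by blast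
qed

lemma ZZ_iso: "A \<in> ZZ \<Longrightarrow> isomorphic T A B \<Longrightarrow> B \<in> ZZ"
proof -
  assume A: "A \<in> ZZ" and i: "isomorphic T A B"
  have o: "A \<in> Obj T" "B \<in> Obj T" using i unfolding isomorphic_def by auto
  have i': "isomorphic T (s A) (s B)" using sh_iso[OF o] i by blast
  have "van Y B \<and> van Y (s B)" if Y: "Y \<in> XX" for Y
    using A Y van_iso[OF isomorphic_refl[OF XX_Obj[OF Y]] i] van_iso[OF isomorphic_refl[OF XX_Obj[OF Y]] i']
    by (simp add: ZZ_def)
  then show ?thesis using o by (simp add: ZZ_def)
qed

text \<open>Y = P[1] sits between Y3[1] and L3[2]. Arrows from these to A[2] are shifts of arrows Y3
  -> A[1] and L3 -> A, which vanish.\<close>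

lemma ZZ_sh: "A \<in> ZZ \<Longrightarrow> s A \<in> ZZ"
proof -
  assume A: "A \<in> ZZ"
  note o = ZZ_Obj[OF A]
  have "van Y (s (s A))" if Y: "Y \<in> XX" for Y
  proof -
    obtain P where P: "P \<in> PP" "isomorphic T (s P) Y" using XX_PP[OF Y] .
    obtain L3 Y3 l3 p3 h3 where r3: "L3 \<in> XX" "Y3 \<in> XX" "dtriangle T L3 Y3 P l3 p3 h3" using PP_resolution[OF P(1)] .
    have "van (s Y3) (s (s A))"
      using A r3(2) sh_van[OF XX_Obj[OF r3(2)] sh_Obj[OF o]] by (simp add: ZZ_def)
    moreover have "van (s (s L3)) (s (s A))"
      using A r3(1) sh_van[OF XX_Obj[OF r3(1)] o] sh_van[OF sh_Obj[OF XX_Obj[OF r3(1)]] sh_Obj[OF o]] by (simp add: ZZ_def)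
    ultimately have "van (s P) (s (s A))" by (rule van_mid_left[OF shift_dtriangle[OF rotate[OF r3(3)]]])
    then show ?thesis using van_iso[OF P(2) isomorphic_refl[OF sh_Obj[OF sh_Obj[OF o]]]] by blast
  qed
  then show ?thesis using A sh_Obj[OF o] by (simp add: ZZ_def)
qed

text \<open>Y[1] is in \<open>FF\<close>, and A[1] receives no arrows from \<open>PP\<close> and
  \<open>XX\<close>; \<open>FF_van\<close> therefore excludes arrows Y[1] -> A[1].\<close>

lemma ZZ_unsh: "A \<in> Obj T \<Longrightarrow> s A \<in> ZZ \<Longrightarrow> A \<in> ZZ"
proof -
  assume o: "A \<in> Obj T" and A: "s A \<in> ZZ"
  have v: "van Y (s A)" if "Y \<in> XX" for Y using A that by (simp add: ZZ_def)
  have "van Y A" if Y: "Y \<in> XX" for Y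
  proof -
    have "van P (s A)" if P: "P \<in> PP" for P
      using sh_van[OF PP_Obj[OF P] sh_Obj[OF o]] A PP_sh[OF P] by (simp add: ZZ_def)
    then have "van (s Y) (s A)" using FF_van[OF sh_XX_FF[OF Y]] v by blast
    then show ?thesis using sh_van[OF XX_Obj[OF Y] o] by blast
  qed
  then show ?thesis using v o by (simp add: ZZ_def)
qed

text \<open>Shifted twice, V -> Y becomes V[2] -> Y[2]. Such arrows are dual to arrows from
  \<open>XX\<close> to V[2], and V[2] is in \<open>ZZ\<close>.\<close>

lemma ZZ_XX: "V \<in> ZZ \<Longrightarrow> Y \<in> XX \<Longrightarrow> van V Y"
proof -
  assume V: "V \<in> ZZ" and Y: "Y \<in> XX"
  note o = ZZ_Obj[OF V] and Yo = XX_Obj[OF Y]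
  have "s (s V) \<in> ZZ" using ZZ_sh V by blast
  then have "van (s (s V)) (s (s Y))" using serre_duality[OF sh_Obj[OF sh_Obj[OF o]]] Y by (simp add: ZZ_def)
  then show ?thesis using sh_van[OF o Yo] sh_van[OF sh_Obj[OF o] sh_Obj[OF Yo]] by blast
qed

lemma ZZ_PP: "V \<in> ZZ \<Longrightarrow> P \<in> PP \<Longrightarrow> van V P"
  using ZZ_XX[OF ZZ_sh PP_sh] sh_van[OF ZZ_Obj PP_Obj] by blast

text \<open>V is the preimage of A under S. As S takes \<open>XX\<close> to XX[2], arrows from
  \<open>XX\<close> to V vanish if those from XX[2] to A do, that is those from \<open>XX\<close> to
  A[-2], an object of \<open>ZZ\<close>. The same applies to V[1].\<close>

lemma ZZ_S:
  assumes A: "A \<in> ZZ"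
  obtains V where "V \<in> ZZ" "isomorphic T (SO V) A"
proof -
  note o = ZZ_Obj[OF A]
  obtain A1 where A1: "A1 \<in> Obj T" "isomorphic T (s A1) A" using sh_surj[OF o] .
  have "A1 \<in> ZZ" using ZZ_unsh[OF A1(1)] ZZ_iso[OF A isomorphic_sym[OF A1(2)]] by blast
  obtain A2 where A2: "A2 \<in> Obj T" "isomorphic T (s A2) A1" using sh_surj[OF A1(1)] .
  have Z2: "A2 \<in> ZZ" using ZZ_unsh[OF A2(1)] ZZ_iso[OF \<open>A1 \<in> ZZ\<close> isomorphic_sym[OF A2(2)]] by blast
  have i: "isomorphic T (s (s A2)) A"
    using isomorphic_trans[OF _ A1(2)] A2(2) sh_iso[OF sh_Obj[OF A2(1)] A1(1)] by blast
  obtain V where V: "V \<in> Obj T" "isomorphic T (SO V) A" using S_surj[OF o] .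
  have i1: "isomorphic T (s (s A2)) (SO V)" using isomorphic_trans[OF i isomorphic_sym[OF V(2)]] .
  then have "isomorphic T (s (s (s A2))) (s (SO V))"
    using sh_iso[OF sh_Obj[OF sh_Obj[OF A2(1)]] S_Obj[OF V(1)]] by blast
  then have i2: "isomorphic T (s (s (s A2))) (SO (s V))" using isomorphic_trans isomorphic_sym[OF S_sh[OF V(1)]] by blast
  have "van Y V \<and> van Y (s V)" if Y: "Y \<in> XX" for Y
  proof -
    obtain Y' where Y': "Y' \<in> XX" "isomorphic T (SO Y) (s (s Y'))" using S_XX[OF Y] .
    note Yo = XX_Obj[OF Y'(1)]
    have "van (s (s Y')) (s (s A2))" "van (s (s Y')) (s (s (s A2)))"
      using Z2 Y'(1) sh_van[OF Yo A2(1)] sh_van[OF sh_Obj[OF Yo] sh_Obj[OF A2(1)]]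
        sh_van[OF Yo sh_Obj[OF A2(1)]] sh_van[OF sh_Obj[OF Yo] sh_Obj[OF sh_Obj[OF A2(1)]]]
      by (simp_all add: ZZ_def)
    then have "van (SO Y) (SO V)" "van (SO Y) (SO (s V))"
      using van_iso[OF isomorphic_sym[OF Y'(2)] i1] van_iso[OF isomorphic_sym[OF Y'(2)] i2] by blast+
    then show ?thesis using S_van[OF XX_Obj[OF Y] V(1)] S_van[OF XX_Obj[OF Y] sh_Obj[OF V(1)]] by blast
  qed
  then have "V \<in> ZZ" using V(1) by (simp add: ZZ_def)
  then show thesis using that V(2) by blast
qed

definition EE where "EE = {A \<in> Obj T. \<forall>V\<in>ZZ. van V A}"

lemma EE_Obj: "A \<in> EE \<Longrightarrow> A \<in> Obj T" by (simp add: EE_def)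

lemma ZZ_EE: "V \<in> ZZ \<Longrightarrow> G \<in> EE \<Longrightarrow> van V G" by (simp add: EE_def)

text \<open>\<open>EE\<close> is defined by orthogonality on one side only. Serre duality turns it
  around, since every V in \<open>ZZ\<close> is isomorphic to S V' with V' in
  \<open>ZZ\<close>.\<close>

lemma EE_ZZ: "G \<in> EE \<Longrightarrow> V \<in> ZZ \<Longrightarrow> van G V"
proof -
  assume G: "G \<in> EE" and V: "V \<in> ZZ"
  obtain V' where V': "V' \<in> ZZ" "isomorphic T (SO V') V" using ZZ_S[OF V] .
  have "van G (SO V')" using serre_van[OF ZZ_Obj[OF V'(1)] EE_Obj[OF G] ZZ_EE[OF V'(1) G]] .
  then show ?thesis using van_iso[OF isomorphic_refl[OF EE_Obj[OF G]] V'(2)] by blast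
qed

lemma XX_EE: "Y \<in> XX \<Longrightarrow> Y \<in> EE"
  using ZZ_XX XX_Obj by (simp add: EE_def)

lemma EE_iso: "A \<in> EE \<Longrightarrow> isomorphic T A B \<Longrightarrow> B \<in> EE"
proof -
  assume A: "A \<in> EE" and i: "isomorphic T A B"
  have "van V B" if V: "V \<in> ZZ" for V
    using van_iso[OF isomorphic_refl[OF ZZ_Obj[OF V]] i ZZ_EE[OF V A]] .
  then show ?thesis using i by (simp add: EE_def isomorphic_def)
qed

lemma EE_sh: "A \<in> Obj T \<Longrightarrow> s A \<in> EE \<longleftrightarrow> A \<in> EE"
proof
  assume o: "A \<in> Obj T" and A: "s A \<in> EE"
  have "van V A" if V: "V \<in> ZZ" for V
    using sh_van[OF ZZ_Obj[OF V] o] ZZ_EE[OF ZZ_sh[OF V] A] by blast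
  then show "A \<in> EE" using o by (simp add: EE_def)
next
  assume o: "A \<in> Obj T" and A: "A \<in> EE"
  have "van V (s A)" if V: "V \<in> ZZ" for V
  proof -
    obtain W where W: "W \<in> Obj T" "isomorphic T (s W) V" using sh_surj[OF ZZ_Obj[OF V]] .
    have "W \<in> ZZ" using ZZ_unsh[OF W(1)] ZZ_iso[OF V isomorphic_sym[OF W(2)]] by blast
    then have "van (s W) (s A)" using sh_van[OF W(1) o] ZZ_EE A by blast
    then show ?thesis using van_iso[OF W(2) isomorphic_refl[OF sh_Obj[OF o]]] by blast
  qed
  then show "s A \<in> EE" using sh_Obj[OF o] by (simp add: EE_def)
qed

text \<open>The summand V of M lifts to A because \<open>ZZ\<close> has no arrows to P[1], and so
  becomes a summand of A. An arrow from \<open>ZZ\<close> to its complement G is pushed into Y and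
  then into P, neither of which receives arrows from \<open>ZZ\<close>.\<close>

lemma EE_ZZ_decomposition:
  assumes A: "A \<in> Obj T"
  shows "\<exists>G\<in>EE. \<exists>V\<in>ZZ. biproduct T G V A"
proof -
  obtain P M p a b where t: "P \<in> PP" "M \<in> UU" "dtriangle T P A M p a b" using PP_approx[OF A] by metis
  note d = dtD[OF t(3)]
  obtain Y V y g where u: "Y \<in> XX" "V \<in> ZZ" "dtriangle T Y M V y g (Z0 V (s Y))" using UU_decomposition[OF t(2)] .
  note e = dtD[OF u(3)]
  obtain w where w: "w \<in> hom V M" "g \<bullet> w = I1 V" using third_zero_split[OF u(3)] by blast
  have "b \<bullet> w = Z0 V (s P)" using vanD[OF ZZ_XX[OF u(2) PP_sh[OF t(1)]] Cmp_in_hom[OF w(1) d(3)]] .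
  then obtain s1 where s1: "s1 \<in> hom V A" "a \<bullet> s1 = w" using exact_cov3[OF t(3) w(1)] by blast
  have ga: "g \<bullet> a \<in> hom A V" using Cmp_in_hom[OF d(2) e(2)] .
  have gas: "(g \<bullet> a) \<bullet> s1 = I1 V" using Cmp_assoc[OF s1(1) d(2) e(2)] s1(2) w(2) by simp
  obtain G j q where j: "j \<in> hom G A" "q \<in> hom A G" "q \<bullet> j = I1 G" "(g \<bullet> a) \<bullet> j = Z0 G V" "q \<bullet> s1 = Z0 V G"
    "(s1 \<bullet> (g \<bullet> a)) \<boxplus> (j \<bullet> q) = I1 A" using split_summand[OF split s1(1) ga gas] .
  have "van W G" if W: "W \<in> ZZ" for W
    unfolding van_def
  proof
    fix f assume f: "f \<in> hom W G"
    have jf: "j \<bullet> f \<in> hom W A" using Cmp_in_hom[OF f j(1)] .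
    have ajf: "a \<bullet> (j \<bullet> f) \<in> hom W M" using Cmp_in_hom[OF jf d(2)] .
    have "g \<bullet> (a \<bullet> (j \<bullet> f)) = ((g \<bullet> a) \<bullet> j) \<bullet> f" using e(2) d(2) j(1) f by (simp add: cat)
    then have "g \<bullet> (a \<bullet> (j \<bullet> f)) = Z0 W V" using j(4) Cmp_Zer_left[OF f e(6)] by simp
    then obtain k where k: "k \<in> hom W Y" "y \<bullet> k = a \<bullet> (j \<bullet> f)" using exact_cov2[OF u(3) ajf] by blast
    have "a \<bullet> (j \<bullet> f) = Z0 W M" using vanD[OF ZZ_XX[OF W u(1)] k(1)] k(2) Cmp_Zer_right[OF e(1) ZZ_Obj[OF W]] by simp
    then obtain k' where k': "k' \<in> hom W P" "p \<bullet> k' = j \<bullet> f" using exact_cov2[OF t(3) jf] by blast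
    have "j \<bullet> f = Z0 W A" using vanD[OF ZZ_PP[OF W t(1)] k'(1)] k'(2) Cmp_Zer_right[OF d(1) ZZ_Obj[OF W]] by simp
    then have "q \<bullet> (j \<bullet> f) = Z0 W G" using Cmp_Zer_right[OF j(2) ZZ_Obj[OF W]] by simp
    then show "f = Z0 W G" using Cmp_assoc[OF f j(1,2)] j(3) Cmp_Idn_left[OF f] by simp
  qed
  then have G: "G \<in> EE" using homD(4)[OF j(1)] by (simp add: EE_def)
  have "(j \<bullet> q) \<boxplus> (s1 \<bullet> (g \<bullet> a)) = I1 A"
    using j(6) Add_commute[OF Cmp_in_hom[OF j(2,1)] Cmp_in_hom[OF ga s1(1)]
      Cmp_in_hom[OF ga s1(1)]] by simp
  then have "biproduct T G V A" using biproductI[OF j(1) s1(1) j(2) ga j(3) gas j(5,4)] by blast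
  then show ?thesis using G u(2) by blast
qed

lemma UU_XX:
  assumes z: "\<And>V. V \<in> ZZ \<Longrightarrow> zero_object T V"
  shows "UU = XX"
proof
  show "UU \<subseteq> XX"
  proof
    fix M assume M: "M \<in> UU"
    obtain Y V y g where u: "Y \<in> XX" "V \<in> ZZ" "dtriangle T Y M V y g (Z0 V (s Y))" using UU_decomposition[OF M] .
    note e = dtD[OF u(3)]
    have I: "I1 M \<in> hom M M" using Idn_in_hom[OF e(5)] .
    have "g \<bullet> I1 M = Z0 M V"
      using vanD[OF zero_object_van[OF z[OF u(2)], THEN conjunct2] Cmp_in_hom[OF I e(2)]] .
    then obtain k where "k \<in> hom M Y" "y \<bullet> k = I1 M" using exact_cov2[OF u(3) I] by blast
    then show "M \<in> XX" using XX_retract[OF split u(1) _ e(1)] by blast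
  qed
qed (rule XX_UU)

end

lemma two_cluster_tiltingI:
  assumes U: "UU = XX"
  shows "two_cluster_tilting T XX"
  unfolding two_cluster_tilting_def functorially_finite_def
proof (intro conjI)
  show "contravariantly_finite T XX" by (rule contra)
  show "covariantly_finite T XX"
    unfolding covariantly_finite_def
  proof
    fix A assume A: "A \<in> Obj T"
    \<comment> \<open>With \<open>UU = XX\<close> the cone M is in \<open>XX\<close>; since
      \<open>PP\<close> has no arrows to \<open>XX\<close>, A -> M is a left approximation.\<close>
    obtain P M p a b where t: "P \<in> PP" "M \<in> UU" "dtriangle T P A M p a b" using PP_approx[OF A] by metis
    note d = dtD[OF t(3)]
    have "(\<lambda>u. u \<bullet> a) ` hom M Y = hom A Y" if Y: "Y \<in> XX" for Y
    proof
      show "(\<lambda>u. u \<bullet> a) ` hom M Y \<subseteq> hom A Y" using Cmp_in_hom[OF d(2)] by blast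
      show "hom A Y \<subseteq> (\<lambda>u. u \<bullet> a) ` hom M Y"
      proof
        fix f assume f: "f \<in> hom A Y"
        obtain v where "v \<in> hom M Y" "v \<bullet> a = f"
          using exact_contra2[OF t(3) f vanD[OF PP_XX[OF t(1) Y] Cmp_in_hom[OF d(1) f]]] .
        then show "f \<in> (\<lambda>u. u \<bullet> a) ` hom M Y" by blast
      qed
    qed
    then show "\<exists>XA\<in>XX. \<exists>f\<in>hom A XA. \<forall>Y\<in>XX. (\<lambda>u. u \<bullet> f) ` hom XA Y = hom A Y"
      using t(2) d(2) U by blast
  qed
  have 1: "hom Y (s A) = {Z0 Y (s A)} \<longleftrightarrow> van Y (s A)" if "A \<in> Obj T" "Y \<in> XX" for A Y
    by (rule van_eq[OF XX_Obj[OF that(2)] sh_Obj[OF that(1)]])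
  have 2: "hom A (s Y) = {Z0 A (s Y)} \<longleftrightarrow> van A (s Y)" if "A \<in> Obj T" "Y \<in> XX" for A Y
    by (rule van_eq[OF that(1) sh_Obj[OF XX_Obj[OF that(2)]]])
  have "{A \<in> Obj T. \<forall>Y\<in>XX. hom Y (s A) = {Z0 Y (s A)}} = UU" using 1 by (auto simp: UU_def)
  then show "{A \<in> Obj T. \<forall>Y\<in>XX. hom Y (s A) = {Z0 Y (s A)}} = XX" using U by simp
  have "{A \<in> Obj T. \<forall>Y\<in>XX. hom A (s Y) = {Z0 A (s Y)}} = UU" using 2 UU_iff by auto
  then show "{A \<in> Obj T. \<forall>Y\<in>XX. hom A (s Y) = {Z0 A (s Y)}} = XX" using U by simp
qed

end

section \<open>From cluster tilting to an abelian factor category\<close>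

context serre_rigid
begin

lemma two_cluster_tilting_UU:
  assumes "two_cluster_tilting T XX"
  shows "UU = XX" "\<And>M. M \<in> Obj T \<Longrightarrow> (\<And>Y. Y \<in> XX \<Longrightarrow> van M (s Y)) \<Longrightarrow> M \<in> XX"
proof -
  have 1: "hom Y (s A) = {Z0 Y (s A)} \<longleftrightarrow> van Y (s A)" if "A \<in> Obj T" "Y \<in> XX" for A Y
    by (rule van_eq[OF XX_Obj[OF that(2)] sh_Obj[OF that(1)]])
  have 2: "hom A (s Y) = {Z0 A (s Y)} \<longleftrightarrow> van A (s Y)" if "A \<in> Obj T" "Y \<in> XX" for A Y
    by (rule van_eq[OF that(1) sh_Obj[OF XX_Obj[OF that(2)]]])
  have "{A \<in> Obj T. \<forall>Y\<in>XX. hom Y (s A) = {Z0 Y (s A)}} = UU" using 1 by (auto simp: UU_def)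
  then show "UU = XX" using assms by (simp add: two_cluster_tilting_def)
  fix M assume M: "M \<in> Obj T" "\<And>Y. Y \<in> XX \<Longrightarrow> van M (s Y)"
  then have "M \<in> {A \<in> Obj T. \<forall>Y\<in>XX. hom A (s Y) = {Z0 A (s Y)}}" using 2 by blast
  then show "M \<in> XX" using assms unfolding two_cluster_tilting_def by simp
qed

text \<open>Cluster tilting recognises objects of \<open>XX\<close> by orthogonality. If B = S Y is
  written as A[2], then T(Y'[1], A[2]) is dual to T(Y, Y'[1]) = 0; if B = Y[2] is written as S A,
  then T(A, Y'[1]) is dual to T(Y'[1], Y[2]) = 0.\<close>

lemma two_cluster_tilting_SX:
  assumes ct: "two_cluster_tilting T XX"
  shows "essential_image T SO XX = essential_image T (\<lambda>A. sh T (sh T A)) XX"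
proof
  show "essential_image T SO XX \<subseteq> essential_image T (\<lambda>A. sh T (sh T A)) XX"
  proof
    fix B assume "B \<in> essential_image T SO XX"
    then obtain Y where Y: "Y \<in> XX" "isomorphic T (SO Y) B" by (auto simp: essential_image_def)
    note Yo = XX_Obj[OF Y(1)]
    have B: "B \<in> Obj T" using Y(2) by (simp add: isomorphic_def)
    obtain A1 where A1: "A1 \<in> Obj T" "isomorphic T (s A1) B" using sh_surj[OF B] .
    obtain A where A: "A \<in> Obj T" "isomorphic T (s A) A1" using sh_surj[OF A1(1)] .
    have i: "isomorphic T (s (s A)) B"
      using isomorphic_trans[OF _ A1(2)] A(2) sh_iso[OF sh_Obj[OF A(1)] A1(1)] by blast
    have "van Y' (s A)" if Y': "Y' \<in> XX" for Y'
    proof -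
      note o = XX_Obj[OF Y']
      have "van (s Y') (SO Y)" using serre_van[OF Yo sh_Obj[OF o] rigidD[OF Y(1) Y']] .
      then have "van (s Y') (s (s A))"
        using van_iso[OF isomorphic_refl[OF sh_Obj[OF o]] isomorphic_trans[OF Y(2) isomorphic_sym[OF i]]] by blast
      then show ?thesis using sh_van[OF o sh_Obj[OF A(1)]] by blast
    qed
    then have "A \<in> XX" using A(1) two_cluster_tilting_UU(1)[OF ct] by (auto simp: UU_def)
    then show "B \<in> essential_image T (\<lambda>A. sh T (sh T A)) XX" using i by (auto simp: essential_image_def)
  qed
  show "essential_image T (\<lambda>A. sh T (sh T A)) XX \<subseteq> essential_image T SO XX"
  proof
    fix B assume "B \<in> essential_image T (\<lambda>A. sh T (sh T A)) XX"
    then obtain Y where Y: "Y \<in> XX" "isomorphic T (s (s Y)) B" by (auto simp: essential_image_def)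
    note Yo = XX_Obj[OF Y(1)]
    have B: "B \<in> Obj T" using Y(2) by (simp add: isomorphic_def)
    obtain A where A: "A \<in> Obj T" "isomorphic T (SO A) B" using S_surj[OF B] .
    have "van A (s Y')" if Y': "Y' \<in> XX" for Y'
    proof -
      note o = XX_Obj[OF Y']
      have "van (s Y') (s (s Y))" using sh_van[OF o sh_Obj[OF Yo]] rigidD[OF Y' Y(1)] by blast
      then have "van (s Y') (SO A)"
        using van_iso[OF isomorphic_refl[OF sh_Obj[OF o]] isomorphic_trans[OF Y(2) isomorphic_sym[OF A(2)]]] by blast
      then show ?thesis using serre_van_iff[OF A(1) sh_Obj[OF o]] by blast
    qed
    then have "A \<in> XX" using A(1) two_cluster_tilting_UU(2)[OF ct] by blast
    then show "B \<in> essential_image T SO XX" using A(2) by (auto simp: essential_image_def)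
  qed
qed

end

context serre_stable
begin

section \<open>Kernels, cokernels and their normality for a cluster tilting subcategory\<close>

context
  assumes U: "UU = XX" and cov: "covariantly_finite T XX"
begin

lemma all_FF: "A \<in> Obj T \<Longrightarrow> A \<in> FF"
  using nul_object_right U by (auto simp: FF_def)

text \<open>With an approximation p of B added to f, an arrow whose composite with f is nul acquires
  a zero composite after a correction in X0. So the component in A of a weak kernel of (f, p) is a
  kernel modulo \<open>XX\<close>.\<close>

lemma cluster_ex_ikernel:
  assumes f: "f \<in> hom A B"
  shows "\<exists>k. ikernel f k"
proof -
  have o: "A \<in> Obj T" "B \<in> Obj T" using homD[OF f] by auto
  obtain X0 p where X0: "X0 \<in> XX" "p \<in> hom X0 B"
    and ap: "\<And>Y' g. Y' \<in> XX \<Longrightarrow> g \<in> hom Y' B \<Longrightarrow> \<exists>u\<in>hom Y' X0. p \<bullet> u = g" using contraE[OF o(2)] by metis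
  obtain D where "biproduct T A X0 D" using ex_biproduct[OF o(1) XX_Obj[OF X0(1)]] by blast
  then obtain i j q r where b: "i \<in> hom A D" "j \<in> hom X0 D" "q \<in> hom D A" "r \<in> hom D X0"
    "q \<bullet> i = I1 A" "r \<bullet> j = I1 X0" "q \<bullet> j = Z0 X0 A" "r \<bullet> i = Z0 A X0" "(i \<bullet> q) \<boxplus> (j \<bullet> r) = I1 D"
    by (rule biproductE)
  define \<phi> where "\<phi> = (f \<bullet> q) \<boxplus> (p \<bullet> r)"
  have fq: "f \<bullet> q \<in> hom D B" "p \<bullet> r \<in> hom D B" using Cmp_in_hom b(3,4) f X0(2) by blast+
  have ph: "\<phi> \<in> hom D B" unfolding \<phi>_def using Add_in_hom[OF fq] .
  have "\<phi> \<bullet> i = (f \<bullet> (q \<bullet> i)) \<boxplus> (p \<bullet> (r \<bullet> i))" "\<phi> \<bullet> j = (f \<bullet> (q \<bullet> j)) \<boxplus> (p \<bullet> (r \<bullet> j))"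
    unfolding \<phi>_def using f X0(2) b(1-4) by (simp_all add: cat)
  then have phi: "\<phi> \<bullet> i = f" "\<phi> \<bullet> j = p"
    unfolding b(5-8) using f X0(2) o XX_Obj[OF X0(1)] by (simp_all add: cat)
  obtain W w h where t: "dtriangle T W D B w \<phi> h" using cocone[OF ph] .
  note d = dtD[OF t]
  define k where "k = q \<bullet> w"
  have k: "k \<in> hom W A" unfolding k_def using Cmp_in_hom[OF d(1) b(3)] .
  have rw: "r \<bullet> w \<in> hom W X0" using Cmp_in_hom[OF d(1) b(4)] .
  have "\<phi> \<bullet> w = (f \<bullet> k) \<boxplus> (p \<bullet> (r \<bullet> w))"
    unfolding \<phi>_def k_def using f X0(2) b(3,4) d(1) by (simp add: cat)
  then have "(f \<bullet> k) \<boxplus> (p \<bullet> (r \<bullet> w)) = Z0 W B" using dt_zero1[OF t] by simp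
  moreover have 1: "f \<bullet> k \<in> hom W B" "p \<bullet> (r \<bullet> w) \<in> hom W B"
    using Cmp_in_hom[OF k f] Cmp_in_hom[OF rw X0(2)] by auto
  ultimately have "p \<bullet> (r \<bullet> w) = Neg T (f \<bullet> k)" using Neg_unique[OF 1] by simp
  then have "f \<bullet> k = Neg T (p \<bullet> (r \<bullet> w))" using Neg_Neg[OF 1(1)] by simp
  then have n: "nul (f \<bullet> k)" using nul_Neg[OF nulI[OF X0(1) rw X0(2)]] by simp
  have "ikernel f k"
  proof (rule ikernelI[OF f k n])
    show "imono k"
    proof (rule imonoI[OF k])
      fix V g assume g: "g \<in> hom V W" and ng: "nul (k \<bullet> g)"
      show "nul g"
      proof (rule FF_nulI[OF all_FF[OF homD(4)[OF g]] g])
        fix P x assume P: "P \<in> PP" and x: "x \<in> hom P V"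
        note Po = PP_Obj[OF P]
        have gx: "g \<bullet> x \<in> hom P W" using Cmp_in_hom[OF x g] .
        have "nul (k \<bullet> (g \<bullet> x))" using nul_pre[OF ng x Cmp_in_hom[OF g k]] Cmp_assoc[OF x g k] by simp
        then have kz: "k \<bullet> (g \<bullet> x) = Z0 P A" using PP_arr_nul_zero[OF P Cmp_in_hom[OF gx k]] by blast
        have rz: "r \<bullet> (w \<bullet> (g \<bullet> x)) = Z0 P X0"
          using vanD[OF PP_XX[OF P X0(1)] Cmp_in_hom[OF Cmp_in_hom[OF gx d(1)] b(4)]] .
        have "w \<bullet> (g \<bullet> x) = ((i \<bullet> q) \<boxplus> (j \<bullet> r)) \<bullet> (w \<bullet> (g \<bullet> x))"
          unfolding b(9) using Cmp_Idn_left[OF Cmp_in_hom[OF gx d(1)]] by simp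
        also have "\<dots> = (i \<bullet> (k \<bullet> (g \<bullet> x))) \<boxplus> (j \<bullet> (r \<bullet> (w \<bullet> (g \<bullet> x))))"
          unfolding k_def using b(1-4) d(1) g x by (simp add: cat)
        also have "\<dots> = Z0 P D"
          unfolding kz rz using b(1,2) Po d(5) by (simp add: cat)
        finally have "sa w \<bullet> sa (g \<bullet> x) = Z0 (s P) (s D)"
          using sa_Cmp[OF gx d(1)] sa_Zer[OF Po d(5)] by simp
        \<comment> \<open>Shifted, g x comes from v : P[1] -> B. As P[1] is in \<open>XX\<close>, v
          lifts through p, a component of \<phi>, and h \<phi> = 0 kills it.\<close>
        then obtain v where v: "v \<in> hom (s P) B" "h \<bullet> v = sa (g \<bullet> x)" using exact_cov4[OF t sa_hom[OF gx]] by blast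
        obtain v' where v': "v' \<in> hom (s P) X0" "p \<bullet> v' = v" using ap[OF PP_sh[OF P] v(1)] by blast
        have "h \<bullet> v = (h \<bullet> \<phi>) \<bullet> (j \<bullet> v')"
          unfolding v'(2)[symmetric] phi(2)[symmetric] using d(3) ph b(2) v'(1) by (simp add: cat)
        then have "sa (g \<bullet> x) = sa (Z0 P W)"
          using v(2) dt_zero2[OF t] Cmp_Zer_left[OF Cmp_in_hom[OF v'(1) b(2)] sh_Obj[OF d(4)]] sa_Zer[OF Po d(4)] by simp
        then show "g \<bullet> x = Z0 P W" using sa_faithful[OF gx Zer_in_hom[OF Po d(4)]] by blast
      qed
    qed
    fix V g assume g: "g \<in> hom V A" and ng: "nul (f \<bullet> g)"
    \<comment> \<open>The nul arrow f g lifts along p; the pair (g, -u) is then killed by \<phi> and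
      lifts to W.\<close>
    obtain u where u: "u \<in> hom V X0" "p \<bullet> u = f \<bullet> g" using nul_lift[OF ng Cmp_in_hom[OF g f] ap X0(2)] .
    have z: "(i \<bullet> g) \<boxminus> (j \<bullet> u) \<in> hom V D" using mns_in_hom[OF Cmp_in_hom[OF g b(1)] Cmp_in_hom[OF u(1) b(2)]] .
    have "\<phi> \<bullet> ((i \<bullet> g) \<boxminus> (j \<bullet> u)) = ((\<phi> \<bullet> i) \<bullet> g) \<boxminus> ((\<phi> \<bullet> j) \<bullet> u)"
      using ph b(1,2) g u(1) by (simp add: cat)
    also have "\<dots> = Z0 V B" unfolding phi u(2) using mns_self[OF Cmp_in_hom[OF g f]] .
    finally obtain y where y: "y \<in> hom V W" "w \<bullet> y = (i \<bullet> g) \<boxminus> (j \<bullet> u)" using exact_cov2[OF t z] by blast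
    have "k \<bullet> y = q \<bullet> ((i \<bullet> g) \<boxminus> (j \<bullet> u))" unfolding k_def using Cmp_assoc[OF y(1) d(1) b(3)] y(2) by simp
    also have "\<dots> = ((q \<bullet> i) \<bullet> g) \<boxminus> ((q \<bullet> j) \<bullet> u)" using b(1-3) g u(1) by (simp add: cat)
    also have "\<dots> = g" unfolding b(5,7) using g u(1) o(1) homD(4)[OF g] by (simp add: cat)
    finally show "\<exists>u\<in>hom V W. k \<bullet> u \<approx> g" using y(1) eqv_refl[OF g] by auto
  qed
  then show ?thesis by blast
qed

text \<open>The dual construction, with a left approximation A -> X0. The second conclusion is
  exactness of T(PP, -) at B, by which a monomorphism will be compared with the kernel of its
  cokernel.\<close>

lemma cluster_ex_icokernel:
  assumes f: "f \<in> hom A B"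
  obtains c where "icokernel f c" "\<And>P b. P \<in> PP \<Longrightarrow> b \<in> hom P B \<Longrightarrow> nul (c \<bullet> b) \<Longrightarrow> \<exists>a\<in>hom P A. f \<bullet> a = b"
proof -
  have o: "A \<in> Obj T" "B \<in> Obj T" using homD[OF f] by auto
  obtain X0 k where X0: "X0 \<in> XX" "k \<in> hom A X0" and ap0: "\<forall>Y\<in>XX. (\<lambda>u. u \<bullet> k) ` hom X0 Y = hom A Y"
    using cov[unfolded covariantly_finite_def, rule_format, OF o(1)] by blast
  have ap: "\<exists>u\<in>hom X0 Y. u \<bullet> k = g" if "Y \<in> XX" "g \<in> hom A Y" for Y g
  proof -
    have "g \<in> (\<lambda>u. u \<bullet> k) ` hom X0 Y" using ap0 that by blast
    then show ?thesis by blast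
  qed
  obtain D where "biproduct T B X0 D" using ex_biproduct[OF o(2) XX_Obj[OF X0(1)]] by blast
  then obtain i j q r where b: "i \<in> hom B D" "j \<in> hom X0 D" "q \<in> hom D B" "r \<in> hom D X0"
    "q \<bullet> i = I1 B" "r \<bullet> j = I1 X0" "q \<bullet> j = Z0 X0 B" "r \<bullet> i = Z0 B X0" "(i \<bullet> q) \<boxplus> (j \<bullet> r) = I1 D"
    by (rule biproductE)
  define \<phi> where "\<phi> = (i \<bullet> f) \<boxplus> (j \<bullet> k)"
  have ph: "\<phi> \<in> hom A D" unfolding \<phi>_def using Add_in_hom[OF Cmp_in_hom[OF f b(1)] Cmp_in_hom[OF X0(2) b(2)]] .
  have "q \<bullet> \<phi> = ((q \<bullet> i) \<bullet> f) \<boxplus> ((q \<bullet> j) \<bullet> k)" "r \<bullet> \<phi> = ((r \<bullet> i) \<bullet> f) \<boxplus> ((r \<bullet> j) \<bullet> k)"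
    unfolding \<phi>_def using f X0(2) b(1-4) by (simp_all add: cat)
  then have phi: "q \<bullet> \<phi> = f" "r \<bullet> \<phi> = k"
    unfolding b(5-8) using f X0(2) o XX_Obj[OF X0(1)] by (simp_all add: cat)
  obtain V c' h where t: "dtriangle T A D V \<phi> c' h" using TR1_cone[OF ph] by blast
  note d = dtD[OF t]
  define c where "c = c' \<bullet> i"
  have c: "c \<in> hom B V" unfolding c_def using Cmp_in_hom[OF b(1) d(2)] .
  have cj: "c' \<bullet> j \<in> hom X0 V" using Cmp_in_hom[OF b(2) d(2)] .
  have "c' \<bullet> \<phi> = (c \<bullet> f) \<boxplus> ((c' \<bullet> j) \<bullet> k)"
    unfolding \<phi>_def c_def using f X0(2) b(1,2) d(2) by (simp add: cat)
  then have "(c \<bullet> f) \<boxplus> ((c' \<bullet> j) \<bullet> k) = Z0 A V" using dt_zero1[OF t] by simp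
  moreover have 1: "c \<bullet> f \<in> hom A V" "(c' \<bullet> j) \<bullet> k \<in> hom A V"
    using Cmp_in_hom[OF f c] Cmp_in_hom[OF X0(2) cj] by auto
  ultimately have "(c' \<bullet> j) \<bullet> k = Neg T (c \<bullet> f)" using Neg_unique[OF 1] by simp
  then have "c \<bullet> f = Neg T ((c' \<bullet> j) \<bullet> k)" using Neg_Neg[OF 1(1)] by simp
  then have n: "nul (c \<bullet> f)" using nul_Neg[OF nulI[OF X0(1,2) cj]] by simp
  \<comment> \<open>T(PP, c) is onto. The obstruction h x would be detected by an arrow A[1] ->
    Y[1]; this extends along \<phi>[1] because k is a left approximation, and \<phi>[1] h =
    0.\<close>
  have surj: "\<exists>z\<in>hom P B. c \<bullet> z = x" if P: "P \<in> PP" and x: "x \<in> hom P V" for P x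
  proof -
    have hx: "h \<bullet> x \<in> hom P (s A)" using Cmp_in_hom[OF x d(3)] .
    have "h \<bullet> x = Z0 P (s A)"
    proof (rule ccontr)
      assume nz: "h \<bullet> x \<noteq> Z0 P (s A)"
      obtain Y u where u: "Y \<in> XX" "u \<in> hom (s A) (s Y)" "u \<bullet> (h \<bullet> x) \<noteq> Z0 P (s Y)"
        using PP_nondegenerate[OF P hx nz] .
      note Yo = XX_Obj[OF u(1)]
      obtain z where z: "z \<in> hom A Y" "sa z = u" using sa_full[OF o(1) Yo u(2)] .
      obtain z' where z': "z' \<in> hom X0 Y" "z' \<bullet> k = z" using ap[OF u(1) z(1)] by blast
      have zr: "z' \<bullet> r \<in> hom D Y" using Cmp_in_hom[OF b(4) z'(1)] .
      have "(z' \<bullet> r) \<bullet> \<phi> = z" using Cmp_assoc[OF ph b(4) z'(1)] phi(2) z'(2) by simp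
      then have "u = sa (z' \<bullet> r) \<bullet> sa \<phi>" using sa_Cmp[OF ph zr] z(2) by simp
      then have "u \<bullet> (h \<bullet> x) = sa (z' \<bullet> r) \<bullet> ((sa \<phi> \<bullet> h) \<bullet> x)"
        using sa_hom[OF zr] sa_hom[OF ph] d(3) x by (simp add: cat)
      also have "\<dots> = Z0 P (s Y)"
        using dt_zero3[OF t] Cmp_Zer_left[OF x sh_Obj[OF d(5)]] Cmp_Zer_right[OF sa_hom[OF zr] PP_Obj[OF P]] by simp
      finally show False using u(3) by simp
    qed
    then obtain x' where x': "x' \<in> hom P D" "c' \<bullet> x' = x" using exact_cov3[OF t x] by blast
    have rz: "r \<bullet> x' = Z0 P X0" using vanD[OF PP_XX[OF P X0(1)] Cmp_in_hom[OF x'(1) b(4)]] .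
    have "x = c' \<bullet> (((i \<bullet> q) \<boxplus> (j \<bullet> r)) \<bullet> x')" unfolding b(9) using Cmp_Idn_left[OF x'(1)] x'(2) by simp
    also have "\<dots> = (c \<bullet> (q \<bullet> x')) \<boxplus> ((c' \<bullet> j) \<bullet> (r \<bullet> x'))"
      unfolding c_def using d(2) b(1-4) x'(1) by (simp add: cat)
    also have "\<dots> = c \<bullet> (q \<bullet> x')"
      unfolding rz using c cj b(3) x'(1) PP_Obj[OF P] by (simp add: cat)
    finally show ?thesis using Cmp_in_hom[OF x'(1) b(3)] by blast
  qed
  have "icokernel f c"
  proof (rule icokernelI[OF f c n])
    show "iepi c"
    proof (rule iepiI[OF c])
      fix W g assume g: "g \<in> hom V W" and ng: "nul (g \<bullet> c)"
      show "nul g"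
      proof (rule FF_nulI[OF all_FF[OF d(6)] g])
        fix P x assume P: "P \<in> PP" and x: "x \<in> hom P V"
        obtain z where z: "z \<in> hom P B" "c \<bullet> z = x" using surj[OF P x] by blast
        have "nul (g \<bullet> x)"
          using nul_pre[OF ng z(1) Cmp_in_hom[OF c g]] Cmp_assoc[OF z(1) c g] z(2) by simp
        then show "g \<bullet> x = Z0 P W" using PP_arr_nul_zero[OF P Cmp_in_hom[OF x g]] by blast
      qed
    qed
    fix W g assume g: "g \<in> hom B W" and ng: "nul (g \<bullet> f)"
    obtain X' x y where x: "X' \<in> XX" "x \<in> hom A X'" "y \<in> hom X' W" "g \<bullet> f = y \<bullet> x"
      using nulE[OF ng Cmp_in_hom[OF f g]] .
    obtain u where u: "u \<in> hom X0 X'" "u \<bullet> k = x" using ap[OF x(1,2)] by blast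
    have yu: "y \<bullet> u \<in> hom X0 W" using Cmp_in_hom[OF u(1) x(3)] .
    have z: "(g \<bullet> q) \<boxminus> ((y \<bullet> u) \<bullet> r) \<in> hom D W"
      using mns_in_hom[OF Cmp_in_hom[OF b(3) g] Cmp_in_hom[OF b(4) yu]] .
    have "((g \<bullet> q) \<boxminus> ((y \<bullet> u) \<bullet> r)) \<bullet> \<phi> = (g \<bullet> (q \<bullet> \<phi>)) \<boxminus> (y \<bullet> (u \<bullet> (r \<bullet> \<phi>)))"
      using g b(3,4) x(3) u(1) ph by (simp add: cat)
    also have "\<dots> = Z0 A W" unfolding phi u(2) x(4) using mns_self[OF Cmp_in_hom[OF x(2,3)]] .
    finally obtain v where v: "v \<in> hom V W" "v \<bullet> c' = (g \<bullet> q) \<boxminus> ((y \<bullet> u) \<bullet> r)" using exact_contra2[OF t z] by blast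
    have "v \<bullet> c = ((g \<bullet> q) \<boxminus> ((y \<bullet> u) \<bullet> r)) \<bullet> i" unfolding c_def using Cmp_assoc[OF b(1) d(2) v(1)] v(2) by simp
    also have "\<dots> = (g \<bullet> (q \<bullet> i)) \<boxminus> ((y \<bullet> u) \<bullet> (r \<bullet> i))" using g b(1,3,4) x(3) u(1) by (simp add: cat)
    also have "\<dots> = g" unfolding b(5,8) using g yu o(2) homD(5)[OF g] by (simp add: cat)
    finally show "\<exists>u\<in>hom V W. u \<bullet> c \<approx> g" using v(1) eqv_refl[OF g] by auto
  qed
  moreover have "\<exists>a\<in>hom P A. f \<bullet> a = x" if P: "P \<in> PP" and x: "x \<in> hom P B" and nx: "nul (c \<bullet> x)" for P x
  proof -
    have "c' \<bullet> (i \<bullet> x) = Z0 P V"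
      using PP_arr_nul_zero[OF P Cmp_in_hom[OF x c] nx] Cmp_assoc[OF x b(1) d(2)] by (simp add: c_def)
    then obtain a where a: "a \<in> hom P A" "\<phi> \<bullet> a = i \<bullet> x" using exact_cov2[OF t Cmp_in_hom[OF x b(1)]] by blast
    have "f \<bullet> a = q \<bullet> (i \<bullet> x)" unfolding phi(1)[symmetric] using Cmp_assoc[OF a(1) ph b(3)] a(2) by simp
    also have "\<dots> = x" using Cmp_assoc[OF x b(1,3)] b(5) Cmp_Idn_left[OF x] by simp
    finally show ?thesis using a(1) by blast
  qed
  ultimately show thesis using that by blast
qed

text \<open>Let k be the kernel of the cokernel of f and e the comparison arrow. On
  \<open>PP\<close>, e is injective because f is mono and surjective by exactness at B, so
  \<open>FF_iso\<close> inverts it modulo \<open>XX\<close>.\<close>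

lemma cluster_imono_ikernel:
  assumes f: "f \<in> hom A B" "imono f"
  shows "\<exists>g. ikernel g f"
proof -
  have o: "A \<in> Obj T" "B \<in> Obj T" using homD[OF f(1)] by auto
  obtain c where c: "icokernel f c"
    and ex: "\<And>P b. P \<in> PP \<Longrightarrow> b \<in> hom P B \<Longrightarrow> nul (c \<bullet> b) \<Longrightarrow> \<exists>a\<in>hom P A. f \<bullet> a = b"
    using cluster_ex_icokernel[OF f(1)] by blast
  obtain V where cv: "c \<in> hom B V" "nul (c \<bullet> f)" using icokernelE[OF c f(1)] by metis
  obtain k where k: "ikernel c k" using cluster_ex_ikernel[OF cv(1)] by blast
  then obtain W where w: "k \<in> hom W B" "nul (c \<bullet> k)" "imono k"
    "\<And>V g. g \<in> hom V B \<Longrightarrow> nul (c \<bullet> g) \<Longrightarrow> \<exists>u\<in>hom V W. k \<bullet> u \<approx> g" using cv(1) by (rule ikernelE) blast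
  obtain e where e: "e \<in> hom A W" "k \<bullet> e \<approx> f" using w(4)[OF f(1) cv(2)] by blast
  have ke: "k \<bullet> e \<in> hom A B" using Cmp_in_hom[OF e(1) w(1)] .
  have Wo: "W \<in> Obj T" using homD(4)[OF w(1)] .
  have inj: "x = Z0 P A" if P: "P \<in> PP" and x: "x \<in> hom P A" and z: "e \<bullet> x = Z0 P W" for P x
  proof -
    have "(k \<bullet> e) \<bullet> x = f \<bullet> x" using PP_eqv_eq[OF P Cmp_in_hom[OF x ke] eqv_Cmp_left[OF e(2) x ke]] .
    then have "f \<bullet> x = Z0 P B"
      using Cmp_assoc[OF x e(1) w(1)] z Cmp_Zer_right[OF w(1) PP_Obj[OF P]] by simp
    then show ?thesis using imono_PP_inj[OF f(2,1) P x] by blast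
  qed
  have surj: "\<exists>z\<in>hom P A. e \<bullet> z = x" if P: "P \<in> PP" and x: "x \<in> hom P W" for P x
  proof -
    have kx: "k \<bullet> x \<in> hom P B" using Cmp_in_hom[OF x w(1)] .
    have "nul (c \<bullet> (k \<bullet> x))"
      using nul_pre[OF w(2) x Cmp_in_hom[OF w(1) cv(1)]] Cmp_assoc[OF x w(1) cv(1)] by simp
    then obtain a where a: "a \<in> hom P A" "f \<bullet> a = k \<bullet> x" using ex[OF P kx] by blast
    have "(k \<bullet> e) \<bullet> a = f \<bullet> a" using PP_eqv_eq[OF P Cmp_in_hom[OF a(1) ke] eqv_Cmp_left[OF e(2) a(1) ke]] .
    then have "k \<bullet> (e \<bullet> a) \<approx> k \<bullet> x" using Cmp_assoc[OF a(1) e(1) w(1)] a(2) eqv_refl[OF kx] by simp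
    then have "e \<bullet> a \<approx> x" using imono_cancel[OF w(3,1) Cmp_in_hom[OF a(1) e(1)] x] by blast
    then show ?thesis using PP_eqv_eq[OF P Cmp_in_hom[OF a(1) e(1)]] a(1) by blast
  qed
  obtain r where r: "r \<in> hom W A" "e \<bullet> r \<approx> I1 W"
    by (rule FF_iso[OF all_FF[OF o(1)] all_FF[OF Wo] e(1)], erule (2) inj, erule (1) surj, erule (1) that)
  have "ikernel c f"
  proof (rule ikernelI[OF cv(1) f(1) cv(2) f(2)])
    fix V g assume g: "g \<in> hom V B" "nul (c \<bullet> g)"
    then obtain u where u: "u \<in> hom V W" "k \<bullet> u \<approx> g" using w(4) by blast
    have ru: "r \<bullet> u \<in> hom V A" using Cmp_in_hom[OF u(1) r(1)] .
    have "f \<bullet> (r \<bullet> u) \<approx> (k \<bullet> e) \<bullet> (r \<bullet> u)" by (rule eqv_Cmp_left[OF eqv_sym[OF e(2)] ru f(1)])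
    also have "(k \<bullet> e) \<bullet> (r \<bullet> u) = k \<bullet> ((e \<bullet> r) \<bullet> u)" using w(1) e(1) r(1) u(1) by (simp add: cat)
    also have "\<dots> \<approx> k \<bullet> (I1 W \<bullet> u)"
      by (rule eqv_Cmp_right[OF eqv_Cmp_left[OF r(2) u(1) Cmp_in_hom[OF r(1) e(1)]]
            Cmp_in_hom[OF u(1) Cmp_in_hom[OF r(1) e(1)]] w(1)])
    also have "\<dots> = k \<bullet> u" using Cmp_Idn_left[OF u(1)] by simp
    also have "\<dots> \<approx> g" by (rule u(2))
    finally show "\<exists>u\<in>hom V A. f \<bullet> u \<approx> g" using ru by blast
  qed
  then show ?thesis by blast
qed

text \<open>The dual comparison, with the cokernel of the kernel. Arrows from \<open>PP\<close> lift
  along epimorphisms by \<open>iepi_PP_surj\<close>; this gives surjectivity of e and, by lifting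
  along c into the kernel, its injectivity.\<close>

lemma cluster_iepi_icokernel:
  assumes f: "f \<in> hom A B" "iepi f"
  shows "\<exists>g. icokernel g f"
proof -
  have o: "A \<in> Obj T" "B \<in> Obj T" using homD[OF f(1)] by auto
  obtain k where k: "ikernel f k" using cluster_ex_ikernel[OF f(1)] by blast
  then obtain W where w: "k \<in> hom W A" "nul (f \<bullet> k)" "imono k"
    "\<And>V g. g \<in> hom V A \<Longrightarrow> nul (f \<bullet> g) \<Longrightarrow> \<exists>u\<in>hom V W. k \<bullet> u \<approx> g" using f(1) by (rule ikernelE) blast
  obtain c where c: "icokernel k c" using cluster_ex_icokernel[OF w(1)] by blast
  then obtain V where v: "c \<in> hom A V" "nul (c \<bullet> k)" "iepi c"
    "\<And>V' g. g \<in> hom A V' \<Longrightarrow> nul (g \<bullet> k) \<Longrightarrow> \<exists>u\<in>hom V V'. u \<bullet> c \<approx> g" using w(1) by (rule icokernelE) blast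
  obtain e where e: "e \<in> hom V B" "e \<bullet> c \<approx> f" using v(4)[OF f(1) w(2)] by blast
  have ec: "e \<bullet> c \<in> hom A B" using Cmp_in_hom[OF v(1) e(1)] .
  have Vo: "V \<in> Obj T" using homD(5)[OF v(1)] .
  have ecx: "e \<bullet> (c \<bullet> a) = f \<bullet> a" if P: "P \<in> PP" and a: "a \<in> hom P A" for P a
    using PP_eqv_eq[OF P Cmp_in_hom[OF a ec] eqv_Cmp_left[OF e(2) a ec]] Cmp_assoc[OF a v(1) e(1)] by simp
  have inj: "x = Z0 P V" if P: "P \<in> PP" and x: "x \<in> hom P V" and z: "e \<bullet> x = Z0 P B" for P x
  proof -
    obtain a where a: "a \<in> hom P A" "c \<bullet> a = x" using iepi_PP_surj[OF v(1,3) P x] by blast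
    have "nul (f \<bullet> a)" using ecx[OF P a(1)] a(2) z nul_Zer[OF PP_Obj[OF P] o(2)] by simp
    then obtain y where y: "y \<in> hom P W" "k \<bullet> y \<approx> a" using w(4)[OF a(1)] by blast
    have "k \<bullet> y = a" using PP_eqv_eq[OF P Cmp_in_hom[OF y(1) w(1)] y(2)] .
    then have "x = (c \<bullet> k) \<bullet> y" using Cmp_assoc[OF y(1) w(1) v(1)] a(2) by simp
    then have "nul x" using nul_pre[OF v(2) y(1) Cmp_in_hom[OF w(1) v(1)]] by simp
    then show ?thesis using PP_arr_nul_zero[OF P x] by blast
  qed
  have surj: "\<exists>z\<in>hom P V. e \<bullet> z = x" if P: "P \<in> PP" and x: "x \<in> hom P B" for P x
  proof -
    obtain a where a: "a \<in> hom P A" "f \<bullet> a = x" using iepi_PP_surj[OF f P x] by blast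
    then show ?thesis using ecx[OF P a(1)] Cmp_in_hom[OF a(1) v(1)] by auto
  qed
  obtain r where r: "r \<in> hom B V" "r \<bullet> e \<approx> I1 V"
    by (rule FF_iso[OF all_FF[OF Vo] all_FF[OF o(2)] e(1)], erule (2) inj, erule (1) surj, rule that)
  have "icokernel k f"
  proof (rule icokernelI[OF w(1) f(1) w(2) f(2)])
    fix V' g assume g: "g \<in> hom A V'" "nul (g \<bullet> k)"
    then obtain u where u: "u \<in> hom V V'" "u \<bullet> c \<approx> g" using v(4) by blast
    have ur: "u \<bullet> r \<in> hom B V'" using Cmp_in_hom[OF r(1) u(1)] .
    have "(u \<bullet> r) \<bullet> f \<approx> (u \<bullet> r) \<bullet> (e \<bullet> c)" by (rule eqv_Cmp_right[OF eqv_sym[OF e(2)] f(1) ur])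
    also have "(u \<bullet> r) \<bullet> (e \<bullet> c) = u \<bullet> ((r \<bullet> e) \<bullet> c)" using v(1) e(1) r(1) u(1) by (simp add: cat)
    also have "\<dots> \<approx> u \<bullet> (I1 V \<bullet> c)"
      by (rule eqv_Cmp_right[OF eqv_Cmp_left[OF r(2) v(1) Cmp_in_hom[OF e(1) r(1)]]
            Cmp_in_hom[OF v(1) Cmp_in_hom[OF e(1) r(1)]] u(1)])
    also have "\<dots> = u \<bullet> c" using Cmp_Idn_left[OF v(1)] by simp
    also have "\<dots> \<approx> g" by (rule u(2))
    finally show "\<exists>u\<in>hom B V'. u \<bullet> f \<approx> g" using ur by blast
  qed
  then show ?thesis by blast
qed

lemma cluster_iabelian: "iabelian"
  unfolding iabelian_def
proof (intro ballI conjI impI)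
  fix f assume "f \<in> Arr T"
  then have f: "f \<in> hom (Dom T f) (Cod T f)" by (rule arr_hom)
  show "\<exists>k. ikernel f k" by (rule cluster_ex_ikernel[OF f])
  show "\<exists>c. icokernel f c" using cluster_ex_icokernel[OF f] by blast
  show "imono f \<Longrightarrow> \<exists>g. ikernel g f" by (rule cluster_imono_ikernel[OF f])
  show "iepi f \<Longrightarrow> \<exists>g. icokernel g f" by (rule cluster_iepi_icokernel[OF f])
qed

end

end

section \<open>The factor category\<close>

text \<open>The operations of \<open>factor_category\<close> are unions over representatives; once
  all members agree, this collapses the union.\<close>

lemma UN_eq_const: "a \<in> A \<Longrightarrow> (\<And>x. x \<in> A \<Longrightarrow> F x = c) \<Longrightarrow> (\<Union>x\<in>A. F x) = c"
  by auto

context factor_setting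
begin

abbreviation fc where "fc \<equiv> factor_class C XX"
abbreviation Q where "Q \<equiv> factor_category C XX"

lemma fc_set:
  assumes f: "f \<in> hom A B"
  shows "fc f = {g \<in> hom A B. g \<approx> f}"
proof -
  have "fc f = {h \<boxplus> f | h. h \<in> factor_ideal C XX A B}"
    unfolding factor_class_def homD(2,3)[OF f] a_r_coset_def' by auto
  also have "\<dots> = {g \<in> hom A B. g \<approx> f}"
  proof (intro equalityI subsetI)
    fix g assume "g \<in> {h \<boxplus> f | h. h \<in> factor_ideal C XX A B}"
    then obtain h where h: "h \<in> factor_ideal C XX A B" "g = h \<boxplus> f" by blast
    have hh: "h \<in> hom A B" using factor_ideal_hom[OF h(1)] .
    have g: "g \<in> hom A B" unfolding h(2) using Add_in_hom[OF hh f] .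
    have "g \<boxminus> f = h" using Add_mns_eq[OF g f hh] Add_commute[OF hh f f] h(2) by simp
    then show "g \<in> {g \<in> hom A B. g \<approx> f}" using g h(1) nul_iff[OF hh] eqv_hom[OF g f] by simp
  next
    fix g assume "g \<in> {g \<in> hom A B. g \<approx> f}"
    then have g: "g \<in> hom A B" "nul (g \<boxminus> f)" using eqv_hom f by auto
    have m: "g \<boxminus> f \<in> hom A B" using mns_in_hom[OF g(1) f] .
    have "g = (g \<boxminus> f) \<boxplus> f" using Add_mns_eq[OF g(1) f m] Add_commute[OF m f f] by simp
    then show "g \<in> {h \<boxplus> f | h. h \<in> factor_ideal C XX A B}" using g(2) nul_iff[OF m] by blast
  qed
  finally show ?thesis .
qed

lemma fc_self: "f \<in> hom A B \<Longrightarrow> f \<in> fc f"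
  using fc_set eqv_refl by simp

lemma fc_eq:
  assumes "f \<in> hom A B" "g \<in> hom A' B'"
  shows "fc f = fc g \<longleftrightarrow> f \<approx> g"
proof
  assume "fc f = fc g"
  then show "f \<approx> g" using fc_self[OF assms(1)] fc_set[OF assms(2)] by auto
next
  assume e: "f \<approx> g"
  then have g: "g \<in> hom A B" using eqvD(1) assms(1) by blast
  show "fc f = fc g"
    unfolding fc_set[OF assms(1)] fc_set[OF g] using eqv_trans[OF _ e] eqv_trans[OF _ eqv_sym[OF e]] by blast
qed

lemma Q_simps [simp]:
  "Obj Q = Obj C" "Idn Q A = fc (I1 A)" "Zer Q A B = fc (Z0 A B)" "Arr Q = fc ` Arr C"
  by (simp_all add: factor_category_def)

lemma fc_image: "f \<in> hom A B \<Longrightarrow> Dom C ` fc f = {A} \<and> Cod C ` fc f = {B}"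
  using fc_set[of f A B] fc_self[of f A B] homD(2,3) by fastforce

lemma Q_Dom: "f \<in> hom A B \<Longrightarrow> Dom Q (fc f) = A" and Q_Cod: "f \<in> hom A B \<Longrightarrow> Cod Q (fc f) = B"
  using fc_image by (simp_all add: factor_category_def)

lemma Q_hom: "homset Q A B = fc ` hom A B"
proof (intro equalityI subsetI)
  fix F assume "F \<in> homset Q A B"
  then obtain f where f: "f \<in> Arr C" "F = fc f" "Dom Q F = A" "Cod Q F = B" by (auto simp: homset_def)
  then show "F \<in> fc ` hom A B"
    using Q_Dom[OF arr_hom[OF f(1)]] Q_Cod[OF arr_hom[OF f(1)]] arr_hom[OF f(1)] by auto
next
  fix F assume "F \<in> fc ` hom A B"
  then obtain f where f: "f \<in> hom A B" "F = fc f" by blast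
  show "F \<in> homset Q A B"
    unfolding homset_def using Q_Dom[OF f(1)] Q_Cod[OF f(1)] homD(1)[OF f(1)] f(2) by simp
qed

lemma fc_hom: "f \<in> hom A B \<Longrightarrow> fc f \<in> homset Q A B"
  by (simp add: Q_hom)

lemma Q_homE:
  assumes "F \<in> homset Q A B"
  obtains f where "f \<in> hom A B" "F = fc f"
  using assms Q_hom by blast

lemma Q_Cmp:
  assumes f: "f \<in> hom A B" and g: "g \<in> hom B D"
  shows "Cmp Q (fc g) (fc f) = fc (g \<bullet> f)"
proof -
  have "fc (g' \<bullet> f') = fc (g \<bullet> f)" if "g' \<in> fc g" "f' \<in> fc f" for g' f'
  proof -
    have h: "g' \<in> hom B D" "g' \<approx> g" "f' \<in> hom A B" "f' \<approx> f" using that fc_set[OF f] fc_set[OF g] by auto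
    show ?thesis
      using fc_eq[OF Cmp_in_hom[OF h(3,1)] Cmp_in_hom[OF f g]] eqv_Cmp[OF h(4,2,3,1)] by blast
  qed
  then have "(\<Union>g'\<in>fc g. \<Union>f'\<in>fc f. fc (g' \<bullet> f')) = fc (g \<bullet> f)"
    by (rule UN_eq_const[OF fc_self[OF g] UN_eq_const[OF fc_self[OF f]]])
  then show ?thesis by (simp add: factor_category_def)
qed

lemma Q_Add:
  assumes f: "f \<in> hom A B" and g: "g \<in> hom A B"
  shows "Add Q (fc f) (fc g) = fc (f \<boxplus> g)"
proof -
  have "fc (f' \<boxplus> g') = fc (f \<boxplus> g)" if "g' \<in> fc g" "f' \<in> fc f" for g' f'
  proof -
    have h: "g' \<in> hom A B" "g' \<approx> g" "f' \<in> hom A B" "f' \<approx> f" using that fc_set[OF f] fc_set[OF g] by auto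
    show ?thesis
      using fc_eq[OF Add_in_hom[OF h(3,1)] Add_in_hom[OF f g]] eqv_Add[OF h(4,2,3,1)] by blast
  qed
  then have "(\<Union>f'\<in>fc f. \<Union>g'\<in>fc g. fc (f' \<boxplus> g')) = fc (f \<boxplus> g)"
    by (rule UN_eq_const[OF fc_self[OF f] UN_eq_const[OF fc_self[OF g]]])
  then show ?thesis by (simp add: factor_category_def)
qed

lemma Q_Scl:
  assumes a: "a \<in> carrier K" and f: "f \<in> hom A B"
  shows "Scl Q a (fc f) = fc (Scl C a f)"
proof -
  have "fc (Scl C a f') = fc (Scl C a f)" if "f' \<in> fc f" for f'
  proof -
    have h: "f' \<in> hom A B" "f' \<approx> f" using that fc_set[OF f] by auto
    show ?thesis
      using fc_eq[OF Scl_in_hom[OF a h(1)] Scl_in_hom[OF a f]] eqv_Scl[OF h(2) a h(1)] by blast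
  qed
  then have "(\<Union>f'\<in>fc f. fc (Scl C a f')) = fc (Scl C a f)"
    by (rule UN_eq_const[OF fc_self[OF f]])
  then show ?thesis by (simp add: factor_category_def)
qed

lemma Q_Hom_simps:
  "carrier (Hom Q A B) = fc ` hom A B" "zero (Hom Q A B) = fc (Z0 A B)" "add (Hom Q A B) = Add Q"
  "smult (Hom Q A B) = Scl Q"
  by (simp_all add: Hom_def Q_hom)

section \<open>The linear and additive structure of the factor category\<close>

lemma Q_Hom_module:
  assumes A: "A \<in> Obj C" "B \<in> Obj C"
  shows "module K (Hom Q A B)"
proof (rule moduleI)
  interpret M: module K "Hom C A B" using A by (rule Hom_module)
  show "cring K" by (rule is_cring)
  show "abelian_group (Hom Q A B)"
  proof (rule abelian_groupI; unfold Q_Hom_simps)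
    show "fc (Z0 A B) \<in> fc ` hom A B" using A by simp
    fix x assume "x \<in> fc ` hom A B"
    then obtain f where f: "f \<in> hom A B" "x = fc f" by blast
    show "Add Q (fc (Z0 A B)) x = x"
      unfolding f(2) using Q_Add[OF Zer_in_hom[OF A] f(1)] Add_Zer_left[OF f(1)] by simp
    show "\<exists>y\<in>fc ` hom A B. Add Q y x = fc (Z0 A B)"
      unfolding f(2) using Q_Add[OF Neg_in_hom[OF f(1)] f(1)] mns_self'[OF f(1)] Neg_in_hom[OF f(1)] by auto
    fix y assume "y \<in> fc ` hom A B"
    then obtain g where g: "g \<in> hom A B" "y = fc g" by blast
    show "Add Q x y \<in> fc ` hom A B" unfolding f(2) g(2) using Q_Add[OF f(1) g(1)] Add_in_hom[OF f(1) g(1)] by simp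
    show "Add Q x y = Add Q y x"
      unfolding f(2) g(2) using Q_Add[OF f(1) g(1)] Q_Add[OF g(1) f(1)] Add_commute[OF f(1) g(1) g(1)] by simp
    fix z assume "z \<in> fc ` hom A B"
    then obtain h where h: "h \<in> hom A B" "z = fc h" by blast
    show "Add Q (Add Q x y) z = Add Q x (Add Q y z)"
      unfolding f(2) g(2) h(2) Q_Add[OF f(1) g(1)] Q_Add[OF g(1) h(1)]
        Q_Add[OF Add_in_hom[OF f(1) g(1)] h(1)] Q_Add[OF f(1) Add_in_hom[OF g(1) h(1)]]
        Add_assoc[OF f(1) g(1) h(1)] ..
  qed
  show "\<one> \<odot>\<^bsub>Hom Q A B\<^esub> x = x" if "x \<in> carrier (Hom Q A B)" for x
  proof -
    obtain f where f: "f \<in> hom A B" "x = fc f" using \<open>x \<in> carrier (Hom Q A B)\<close> by (auto simp: Q_Hom_simps)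
    show ?thesis
      unfolding Q_Hom_simps f(2) Q_Scl[OF one_closed f(1)] using M.smult_one[of f] f(1) by simp
  qed
  fix a x assume a: "a \<in> carrier K" and "x \<in> carrier (Hom Q A B)"
  then obtain f where f: "f \<in> hom A B" "x = fc f" by (auto simp: Q_Hom_simps)
  note sf = Q_Scl[OF _ f(1)] and sh = Scl_in_hom[OF _ f(1)]
  show "a \<odot>\<^bsub>Hom Q A B\<^esub> x \<in> carrier (Hom Q A B)"
    unfolding Q_Hom_simps f(2) sf[OF a] using sh[OF a] by blast
  { fix y assume "y \<in> carrier (Hom Q A B)"
    then obtain g where g: "g \<in> hom A B" "y = fc g" by (auto simp: Q_Hom_simps)
    show "a \<odot>\<^bsub>Hom Q A B\<^esub> (x \<oplus>\<^bsub>Hom Q A B\<^esub> y) = a \<odot>\<^bsub>Hom Q A B\<^esub> x \<oplus>\<^bsub>Hom Q A B\<^esub> a \<odot>\<^bsub>Hom Q A B\<^esub> y"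
      unfolding Q_Hom_simps f(2) g(2) sf[OF a] Q_Scl[OF a g(1)] Q_Add[OF f(1) g(1)]
        Q_Scl[OF a Add_in_hom[OF f(1) g(1)]] Q_Add[OF sh[OF a] Scl_in_hom[OF a g(1)]]
      using M.smult_r_distr[of a f g] a f(1) g(1) by simp }
  { fix b assume b: "b \<in> carrier K"
    show "(a \<oplus> b) \<odot>\<^bsub>Hom Q A B\<^esub> x = a \<odot>\<^bsub>Hom Q A B\<^esub> x \<oplus>\<^bsub>Hom Q A B\<^esub> b \<odot>\<^bsub>Hom Q A B\<^esub> x"
      unfolding Q_Hom_simps f(2) sf[OF a] sf[OF b] sf[OF add.m_closed[OF a b]] Q_Add[OF sh[OF a] sh[OF b]]
      using M.smult_l_distr[of a b f] a b f(1) by simp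
    show "(a \<otimes> b) \<odot>\<^bsub>Hom Q A B\<^esub> x = a \<odot>\<^bsub>Hom Q A B\<^esub> (b \<odot>\<^bsub>Hom Q A B\<^esub> x)"
      unfolding Q_Hom_simps f(2) sf[OF b] sf[OF m_closed[OF a b]] Q_Scl[OF a sh[OF b]]
      using M.smult_assoc1[of a b f] a b f(1) by simp }
qed

lemma Q_linear: "linear_category K Q"
proof (rule linear_category.intro, rule field_axioms, rule linear_category_axioms.intro, unfold Q_simps)
  fix F assume "F \<in> fc ` Arr C"
  then obtain f where f0: "f \<in> Arr C" "F = fc f" by blast
  note f = arr_hom[OF f0(1)] f0(2)
  show "Dom Q F \<in> Obj C" "Cod Q F \<in> Obj C"
    unfolding f(2) Q_Dom[OF f(1)] Q_Cod[OF f(1)] using homD(4,5)[OF f(1)] by auto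
next
  fix A assume "A \<in> Obj C"
  then show "fc (I1 A) \<in> homset Q A A" using fc_hom Idn_in_hom by blast
next
  fix F G A B D assume "F \<in> homset Q A B" "G \<in> homset Q B D"
  then obtain f g where h: "f \<in> hom A B" "F = fc f" "g \<in> hom B D" "G = fc g" using Q_homE by metis
  show "Cmp Q G F \<in> homset Q A D" unfolding h(2,4) Q_Cmp[OF h(1,3)] using fc_hom[OF Cmp_in_hom[OF h(1,3)]] .
  fix H E assume "H \<in> homset Q D E"
  then obtain k where k: "k \<in> hom D E" "H = fc k" using Q_homE by metis
  show "Cmp Q (Cmp Q H G) F = Cmp Q H (Cmp Q G F)"
    unfolding h(2,4) k(2) Q_Cmp[OF h(1,3)] Q_Cmp[OF h(3) k(1)] Q_Cmp[OF h(1) Cmp_in_hom[OF h(3) k(1)]]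
      Q_Cmp[OF Cmp_in_hom[OF h(1,3)] k(1)] Cmp_assoc[OF h(1,3) k(1)] ..
next
  fix F A B assume "F \<in> homset Q A B"
  then obtain f where f: "f \<in> hom A B" "F = fc f" using Q_homE by metis
  show "Cmp Q F (fc (I1 A)) = F" "Cmp Q (fc (I1 B)) F = F"
    unfolding f(2) Q_Cmp[OF Idn_in_hom[OF homD(4)[OF f(1)]] f(1)] Q_Cmp[OF f(1) Idn_in_hom[OF homD(5)[OF f(1)]]]
    using Cmp_Idn_left[OF f(1)] Cmp_Idn_right[OF f(1)] by simp_all
next
  fix A B assume "A \<in> Obj C" "B \<in> Obj C"
  then show "module K (Hom Q A B)" by (rule Q_Hom_module)
next
  fix G B D A assume "G \<in> homset Q B D" and A: "A \<in> Obj C"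
  then obtain g where g: "g \<in> hom B D" "G = fc g" using Q_homE by metis
  show "linear_map K (Hom Q A B) (Hom Q A D) (\<lambda>f. Cmp Q G f)"
    unfolding linear_map_def Q_Hom_simps g(2)
  proof (intro conjI ballI funcsetI)
    fix x assume "x \<in> fc ` hom A B"
    then obtain f where f: "f \<in> hom A B" "x = fc f" by blast
    show "Cmp Q (fc g) x \<in> fc ` hom A D" unfolding f(2) Q_Cmp[OF f(1) g(1)] using Cmp_in_hom[OF f(1) g(1)] by blast
    { fix y assume "y \<in> fc ` hom A B"
      then obtain f' where f': "f' \<in> hom A B" "y = fc f'" by blast
      show "Cmp Q (fc g) (Add Q x y) = Add Q (Cmp Q (fc g) x) (Cmp Q (fc g) y)"
        unfolding f(2) f'(2) Q_Add[OF f(1) f'(1)] Q_Cmp[OF f(1) g(1)] Q_Cmp[OF f'(1) g(1)]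
          Q_Cmp[OF Add_in_hom[OF f(1) f'(1)] g(1)] Q_Add[OF Cmp_in_hom[OF f(1) g(1)] Cmp_in_hom[OF f'(1) g(1)]]
          Cmp_Add_right[OF g(1) f(1) f'(1)] .. }
    { fix a assume a: "a \<in> carrier K"
      show "Cmp Q (fc g) (Scl Q a x) = Scl Q a (Cmp Q (fc g) x)"
        unfolding f(2) Q_Scl[OF a f(1)] Q_Cmp[OF f(1) g(1)] Q_Cmp[OF Scl_in_hom[OF a f(1)] g(1)]
          Q_Scl[OF a Cmp_in_hom[OF f(1) g(1)]] Cmp_Scl_right[OF g(1) f(1) a] .. }
  qed
next
  fix F A B D assume "F \<in> homset Q A B" and D: "D \<in> Obj C"
  then obtain f where f: "f \<in> hom A B" "F = fc f" using Q_homE by metis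
  show "linear_map K (Hom Q B D) (Hom Q A D) (\<lambda>g. Cmp Q g F)"
    unfolding linear_map_def Q_Hom_simps f(2)
  proof (intro conjI ballI funcsetI)
    fix x assume "x \<in> fc ` hom B D"
    then obtain g where g: "g \<in> hom B D" "x = fc g" by blast
    show "Cmp Q x (fc f) \<in> fc ` hom A D" unfolding g(2) Q_Cmp[OF f(1) g(1)] using Cmp_in_hom[OF f(1) g(1)] by blast
    { fix y assume "y \<in> fc ` hom B D"
      then obtain g' where g': "g' \<in> hom B D" "y = fc g'" by blast
      show "Cmp Q (Add Q x y) (fc f) = Add Q (Cmp Q x (fc f)) (Cmp Q y (fc f))"
        unfolding g(2) g'(2) Q_Add[OF g(1) g'(1)] Q_Cmp[OF f(1) g(1)] Q_Cmp[OF f(1) g'(1)]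
          Q_Cmp[OF f(1) Add_in_hom[OF g(1) g'(1)]] Q_Add[OF Cmp_in_hom[OF f(1) g(1)] Cmp_in_hom[OF f(1) g'(1)]]
          Cmp_Add_left[OF f(1) g(1) g'(1)] .. }
    { fix a assume a: "a \<in> carrier K"
      show "Cmp Q (Scl Q a x) (fc f) = Scl Q a (Cmp Q x (fc f))"
        unfolding g(2) Q_Scl[OF a g(1)] Q_Cmp[OF f(1) g(1)] Q_Cmp[OF f(1) Scl_in_hom[OF a g(1)]]
          Q_Scl[OF a Cmp_in_hom[OF f(1) g(1)]] Cmp_Scl_left[OF f(1) g(1) a] .. }
  qed
qed

lemma Q_additive: "additive_category K Q"
proof (intro additive_category.intro Q_linear additive_category_axioms.intro)
  obtain Z where Z: "zero_object C Z" using ex_zero_object by blast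
  then have o: "Z \<in> Obj C" using zero_object_iff by blast
  have "hom A Z = {Z0 A Z}" "hom Z A = {Z0 Z A}" if "A \<in> Obj C" for A
    using zero_object_van[OF Z, of A] van_eq[OF o that] van_eq[OF that o] by blast+
  then have "zero_object Q Z"
    unfolding zero_object_def using o by (simp add: Q_hom)
  then show "\<exists>Z. zero_object Q Z" by blast
next
  fix A B assume "A \<in> Obj Q" "B \<in> Obj Q"
  then obtain P where P: "biproduct C A B P" using ex_biproduct by auto
  obtain i j p q where b: "i \<in> hom A P" "j \<in> hom B P" "p \<in> hom P A" "q \<in> hom P B"
    "p \<bullet> i = I1 A" "q \<bullet> j = I1 B" "p \<bullet> j = Z0 B A" "q \<bullet> i = Z0 A B" "(i \<bullet> p) \<boxplus> (j \<bullet> q) = I1 P"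
    using P by (rule biproductE)
  have "biproduct Q A B P"
    unfolding biproduct_def Q_simps
  proof (intro conjI)
    show "A \<in> Obj C" "B \<in> Obj C" "P \<in> Obj C" using homD(4,5)[OF b(1)] homD(4)[OF b(2)] by auto
    show "\<exists>i\<in>homset Q A P. \<exists>j\<in>homset Q B P. \<exists>p\<in>homset Q P A. \<exists>q\<in>homset Q P B.
       Cmp Q p i = fc (I1 A) \<and> Cmp Q q j = fc (I1 B) \<and> Cmp Q p j = fc (Z0 B A) \<and> Cmp Q q i = fc (Z0 A B) \<and>
       Add Q (Cmp Q i p) (Cmp Q j q) = fc (I1 P)"
      by (intro bexI[OF _ fc_hom[OF b(1)]] bexI[OF _ fc_hom[OF b(2)]] bexI[OF _ fc_hom[OF b(3)]]
           bexI[OF _ fc_hom[OF b(4)]])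
         (simp add: Q_Cmp[OF b(1,3)] Q_Cmp[OF b(2,4)] Q_Cmp[OF b(2,3)] Q_Cmp[OF b(1,4)] Q_Cmp[OF b(3,1)]
            Q_Cmp[OF b(4,2)] Q_Add[OF Cmp_in_hom[OF b(3,1)] Cmp_in_hom[OF b(4,2)]] b(5-9))
  qed
  then show "\<exists>P. biproduct Q A B P" by blast
qed

lemma fc_Zer: "f \<in> hom A B \<Longrightarrow> fc f = fc (Z0 A B) \<longleftrightarrow> nul f"
  using fc_eq[OF _ Zer_in_hom] eqv_Zer homD(4,5) by metis

section \<open>Monomorphisms, epimorphisms, kernels and cokernels: classes against
  representatives\<close>

lemma mono_arr_fc:
  assumes f: "f \<in> hom A B"
  shows "mono_arr Q (fc f) \<longleftrightarrow> imono f"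
proof
  assume m: "mono_arr Q (fc f)"
  show "imono f"
  proof (rule imonoI[OF f])
    fix W g assume g: "g \<in> hom W A" "nul (f \<bullet> g)"
    have W: "W \<in> Obj C" and A: "A \<in> Obj C" using homD[OF g(1)] by auto
    have "Cmp Q (fc f) (fc g) = Cmp Q (fc f) (fc (Z0 W A))"
      unfolding Q_Cmp[OF g(1) f] Q_Cmp[OF Zer_in_hom[OF W A] f] Cmp_Zer_right[OF f W]
      using fc_Zer[OF Cmp_in_hom[OF g(1) f]] g(2) by blast
    then have "fc g = fc (Z0 W A)"
      using m fc_hom[OF g(1)] fc_hom[OF Zer_in_hom[OF W A]] W unfolding mono_arr_def Q_Dom[OF f] by simp
    then show "nul g" using fc_Zer[OF g(1)] by blast
  qed
next
  assume m: "imono f"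
  have "G = H" if GH: "G \<in> homset Q W A" "H \<in> homset Q W A" "Cmp Q (fc f) G = Cmp Q (fc f) H" for W G H
  proof -
    obtain g h where gh: "g \<in> hom W A" "G = fc g" "h \<in> hom W A" "H = fc h" using Q_homE[OF GH(1)] Q_homE[OF GH(2)] by metis
    have "f \<bullet> g \<approx> f \<bullet> h"
      using GH(3) fc_eq[OF Cmp_in_hom[OF gh(1) f] Cmp_in_hom[OF gh(3) f]]
      unfolding gh(2,4) Q_Cmp[OF gh(1) f] Q_Cmp[OF gh(3) f] by blast
    then show ?thesis unfolding gh(2,4) using imono_cancel[OF m f gh(1,3)] fc_eq[OF gh(1,3)] by blast
  qed
  then show "mono_arr Q (fc f)" unfolding mono_arr_def Q_Dom[OF f] using homD(1)[OF f] by simp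
qed

lemma epi_arr_fc:
  assumes f: "f \<in> hom A B"
  shows "epi_arr Q (fc f) \<longleftrightarrow> iepi f"
proof
  assume m: "epi_arr Q (fc f)"
  show "iepi f"
  proof (rule iepiI[OF f])
    fix W g assume g: "g \<in> hom B W" "nul (g \<bullet> f)"
    have W: "W \<in> Obj C" and B: "B \<in> Obj C" using homD[OF g(1)] by auto
    have "Cmp Q (fc g) (fc f) = Cmp Q (fc (Z0 B W)) (fc f)"
      unfolding Q_Cmp[OF f g(1)] Q_Cmp[OF f Zer_in_hom[OF B W]] Cmp_Zer_left[OF f W]
      using fc_Zer[OF Cmp_in_hom[OF f g(1)]] g(2) by blast
    then have "fc g = fc (Z0 B W)"
      using m fc_hom[OF g(1)] fc_hom[OF Zer_in_hom[OF B W]] W unfolding epi_arr_def Q_Cod[OF f] by simp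
    then show "nul g" using fc_Zer[OF g(1)] by blast
  qed
next
  assume m: "iepi f"
  have "G = H" if GH: "G \<in> homset Q B W" "H \<in> homset Q B W" "Cmp Q G (fc f) = Cmp Q H (fc f)" for W G H
  proof -
    obtain g h where gh: "g \<in> hom B W" "G = fc g" "h \<in> hom B W" "H = fc h" using Q_homE[OF GH(1)] Q_homE[OF GH(2)] by metis
    have "g \<bullet> f \<approx> h \<bullet> f"
      using GH(3) fc_eq[OF Cmp_in_hom[OF f gh(1)] Cmp_in_hom[OF f gh(3)]]
      unfolding gh(2,4) Q_Cmp[OF f gh(1)] Q_Cmp[OF f gh(3)] by blast
    then show ?thesis unfolding gh(2,4) using iepi_cancel[OF m f gh(1,3)] fc_eq[OF gh(1,3)] by blast
  qed
  then show "epi_arr Q (fc f)" unfolding epi_arr_def Q_Cod[OF f] using homD(1)[OF f] by simp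
qed

text \<open>Uniqueness of the factorisation corresponds to \<open>imono\<close>: applied to the zero
  arrow it says that the kernel arrow kills nothing, and by linearity this case implies the
  others.\<close>

lemma kernel_of_fc:
  assumes f: "f \<in> Arr C" and k: "k \<in> Arr C"
  shows "kernel_of Q (fc f) (fc k) \<longleftrightarrow> ikernel f k"
proof -
  note fh = arr_hom[OF f] and kh = arr_hom[OF k]
  have A: "Dom C f \<in> Obj C" "Cod C f \<in> Obj C" "Dom C k \<in> Obj C" using homD[OF fh] homD[OF kh] by auto
  show ?thesis
  proof
    assume K: "kernel_of Q (fc f) (fc k)"
    have e: "Cod C k = Dom C f" using K unfolding kernel_of_def Q_Dom[OF fh] Q_Cod[OF kh] by simp
    have k': "k \<in> hom (Dom C k) (Dom C f)" using kh e by simp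
    have fk: "f \<bullet> k \<in> hom (Dom C k) (Cod C f)" using Cmp_in_hom[OF k' fh] .
    have n: "nul (f \<bullet> k)"
      using K fc_Zer[OF fk] unfolding kernel_of_def Q_Dom[OF kh] Q_Cod[OF fh] Q_Cmp[OF k' fh] Q_simps by blast
    have u: "\<exists>!U. U \<in> homset Q W (Dom C k) \<and> Cmp Q (fc k) U = fc g" if g: "g \<in> hom W (Dom C f)" "nul (f \<bullet> g)" for W g
    proof -
      have "Cmp Q (fc f) (fc g) = fc (Z0 W (Cod C f))"
        unfolding Q_Cmp[OF g(1) fh] using fc_Zer[OF Cmp_in_hom[OF g(1) fh]] g(2) by blast
      then show ?thesis
        using K homD(4)[OF g(1)] fc_hom[OF g(1)]
        unfolding kernel_of_def Q_Dom[OF kh] Q_Dom[OF fh] Q_Cod[OF fh] Q_simps by blast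
    qed
    show "ikernel f k"
    proof (rule ikernelI[OF fh k' n])
      show "imono k"
      proof (rule imonoI[OF k'])
        fix W g assume g: "g \<in> hom W (Dom C k)" "nul (k \<bullet> g)"
        have W: "W \<in> Obj C" using homD(4)[OF g(1)] .
        note z = Zer_in_hom[OF W A(1)] and z' = Zer_in_hom[OF W A(3)]
        have "nul (f \<bullet> Z0 W (Dom C f))" using Cmp_Zer_right[OF fh W] nul_Zer[OF W A(2)] by simp
        note uu = u[OF z this]
        have "Cmp Q (fc k) (fc g) = fc (Z0 W (Dom C f))"
          unfolding Q_Cmp[OF g(1) k'] using fc_Zer[OF Cmp_in_hom[OF g(1) k']] g(2) by blast
        moreover have "Cmp Q (fc k) (fc (Z0 W (Dom C k))) = fc (Z0 W (Dom C f))"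
          unfolding Q_Cmp[OF z' k'] Cmp_Zer_right[OF k' W] ..
        ultimately have "fc g = fc (Z0 W (Dom C k))" using uu fc_hom[OF g(1)] fc_hom[OF z'] by blast
        then show "nul g" using fc_Zer[OF g(1)] by blast
      qed
      fix W g assume g: "g \<in> hom W (Dom C f)" "nul (f \<bullet> g)"
      obtain U where U: "U \<in> homset Q W (Dom C k)" "Cmp Q (fc k) U = fc g" using u[OF g] by blast
      obtain x where x: "x \<in> hom W (Dom C k)" "U = fc x" using U(1) by (rule Q_homE)
      have "k \<bullet> x \<approx> g"
        using U(2) fc_eq[OF Cmp_in_hom[OF x(1) k'] g(1)] unfolding x(2) Q_Cmp[OF x(1) k'] by blast
      then show "\<exists>u\<in>hom W (Dom C k). k \<bullet> u \<approx> g" using x(1) by blast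
    qed
  next
    assume K: "ikernel f k"
    have e: "Cod C k = Dom C f" and n: "nul (f \<bullet> k)" and m: "imono k" using K unfolding ikernel_def by auto
    have k': "k \<in> hom (Dom C k) (Dom C f)" using kh e by simp
    show "kernel_of Q (fc f) (fc k)"
      unfolding kernel_of_def Q_Dom[OF kh] Q_Dom[OF fh] Q_Cod[OF kh] Q_Cod[OF fh] Q_simps
    proof (intro conjI ballI impI)
      show "fc f \<in> fc ` Arr C" "fc k \<in> fc ` Arr C" "Cod C k = Dom C f" using f k e by auto
      show "Cmp Q (fc f) (fc k) = fc (Z0 (Dom C k) (Cod C f))"
        unfolding Q_Cmp[OF k' fh] using fc_Zer[OF Cmp_in_hom[OF k' fh]] n by blast
      fix W G assume W: "W \<in> Obj C" and "G \<in> homset Q W (Dom C f)" and z: "Cmp Q (fc f) G = fc (Z0 W (Cod C f))"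
      then obtain g where g: "g \<in> hom W (Dom C f)" "G = fc g" using Q_homE by metis
      have "nul (f \<bullet> g)" using z fc_Zer[OF Cmp_in_hom[OF g(1) fh]] unfolding g(2) Q_Cmp[OF g(1) fh] by blast
      then obtain x where x: "x \<in> hom W (Dom C k)" "k \<bullet> x \<approx> g" using K g(1) W unfolding ikernel_def by blast
      show "\<exists>!U. U \<in> homset Q W (Dom C k) \<and> Cmp Q (fc k) U = G"
      proof (rule ex1I[of _ "fc x"])
        show "fc x \<in> homset Q W (Dom C k) \<and> Cmp Q (fc k) (fc x) = G"
          unfolding g(2) Q_Cmp[OF x(1) k'] using fc_hom[OF x(1)] fc_eq[OF Cmp_in_hom[OF x(1) k'] g(1)] x(2) by blast
        fix U assume U: "U \<in> homset Q W (Dom C k) \<and> Cmp Q (fc k) U = G"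
        then obtain y where y: "y \<in> hom W (Dom C k)" "U = fc y" using Q_homE by metis
        have "k \<bullet> y \<approx> g"
          using U fc_eq[OF Cmp_in_hom[OF y(1) k'] g(1)] unfolding y(2) g(2) Q_Cmp[OF y(1) k'] by blast
        then have "y \<approx> x" using imono_cancel[OF m k' y(1) x(1)] eqv_trans[OF _ eqv_sym[OF x(2)]] by blast
        then show "U = fc x" unfolding y(2) using fc_eq[OF y(1) x(1)] by blast
      qed
    qed
  qed
qed

lemma cokernel_of_fc:
  assumes f: "f \<in> Arr C" and c: "c \<in> Arr C"
  shows "cokernel_of Q (fc f) (fc c) \<longleftrightarrow> icokernel f c"
proof -
  note fh = arr_hom[OF f] and ch = arr_hom[OF c]
  have A: "Dom C f \<in> Obj C" "Cod C f \<in> Obj C" "Cod C c \<in> Obj C" using homD[OF fh] homD[OF ch] by auto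
  show ?thesis
  proof
    assume K: "cokernel_of Q (fc f) (fc c)"
    have e: "Dom C c = Cod C f" using K unfolding cokernel_of_def Q_Cod[OF fh] Q_Dom[OF ch] by simp
    have c': "c \<in> hom (Cod C f) (Cod C c)" using ch e by simp
    have n: "nul (c \<bullet> f)"
      using K fc_Zer[OF Cmp_in_hom[OF fh c']]
      unfolding cokernel_of_def Q_Cod[OF ch] Q_Dom[OF fh] Q_Cmp[OF fh c'] Q_simps by blast
    have u: "\<exists>!U. U \<in> homset Q (Cod C c) W \<and> Cmp Q U (fc c) = fc g" if g: "g \<in> hom (Cod C f) W" "nul (g \<bullet> f)" for W g
    proof -
      have "Cmp Q (fc g) (fc f) = fc (Z0 (Dom C f) W)"
        unfolding Q_Cmp[OF fh g(1)] using fc_Zer[OF Cmp_in_hom[OF fh g(1)]] g(2) by blast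
      then show ?thesis
        using K homD(5)[OF g(1)] fc_hom[OF g(1)]
        unfolding cokernel_of_def Q_Cod[OF ch] Q_Dom[OF fh] Q_Cod[OF fh] Q_simps by blast
    qed
    show "icokernel f c"
    proof (rule icokernelI[OF fh c' n])
      show "iepi c"
      proof (rule iepiI[OF c'])
        fix W g assume g: "g \<in> hom (Cod C c) W" "nul (g \<bullet> c)"
        have W: "W \<in> Obj C" using homD(5)[OF g(1)] .
        note z = Zer_in_hom[OF A(2) W] and z' = Zer_in_hom[OF A(3) W]
        have "nul (Z0 (Cod C f) W \<bullet> f)" using Cmp_Zer_left[OF fh W] nul_Zer[OF A(1) W] by simp
        note uu = u[OF z this]
        have "Cmp Q (fc g) (fc c) = fc (Z0 (Cod C f) W)"
          unfolding Q_Cmp[OF c' g(1)] using fc_Zer[OF Cmp_in_hom[OF c' g(1)]] g(2) by blast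
        moreover have "Cmp Q (fc (Z0 (Cod C c) W)) (fc c) = fc (Z0 (Cod C f) W)"
          unfolding Q_Cmp[OF c' z'] Cmp_Zer_left[OF c' W] ..
        ultimately have "fc g = fc (Z0 (Cod C c) W)" using uu fc_hom[OF g(1)] fc_hom[OF z'] by blast
        then show "nul g" using fc_Zer[OF g(1)] by blast
      qed
      fix W g assume g: "g \<in> hom (Cod C f) W" "nul (g \<bullet> f)"
      obtain U where U: "U \<in> homset Q (Cod C c) W" "Cmp Q U (fc c) = fc g" using u[OF g] by blast
      obtain x where x: "x \<in> hom (Cod C c) W" "U = fc x" using U(1) by (rule Q_homE)
      have "x \<bullet> c \<approx> g"
        using U(2) fc_eq[OF Cmp_in_hom[OF c' x(1)] g(1)] unfolding x(2) Q_Cmp[OF c' x(1)] by blast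
      then show "\<exists>u\<in>hom (Cod C c) W. u \<bullet> c \<approx> g" using x(1) by blast
    qed
  next
    assume K: "icokernel f c"
    have e: "Dom C c = Cod C f" and n: "nul (c \<bullet> f)" and m: "iepi c" using K unfolding icokernel_def by auto
    have c': "c \<in> hom (Cod C f) (Cod C c)" using ch e by simp
    show "cokernel_of Q (fc f) (fc c)"
      unfolding cokernel_of_def Q_Dom[OF ch] Q_Dom[OF fh] Q_Cod[OF ch] Q_Cod[OF fh] Q_simps
    proof (intro conjI ballI impI)
      show "fc f \<in> fc ` Arr C" "fc c \<in> fc ` Arr C" "Dom C c = Cod C f" using f c e by auto
      show "Cmp Q (fc c) (fc f) = fc (Z0 (Dom C f) (Cod C c))"
        unfolding Q_Cmp[OF fh c'] using fc_Zer[OF Cmp_in_hom[OF fh c']] n by blast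
      fix W G assume W: "W \<in> Obj C" and "G \<in> homset Q (Cod C f) W" and z: "Cmp Q G (fc f) = fc (Z0 (Dom C f) W)"
      then obtain g where g: "g \<in> hom (Cod C f) W" "G = fc g" using Q_homE by metis
      have "nul (g \<bullet> f)" using z fc_Zer[OF Cmp_in_hom[OF fh g(1)]] unfolding g(2) Q_Cmp[OF fh g(1)] by blast
      then obtain x where x: "x \<in> hom (Cod C c) W" "x \<bullet> c \<approx> g" using K g(1) W unfolding icokernel_def by blast
      show "\<exists>!U. U \<in> homset Q (Cod C c) W \<and> Cmp Q U (fc c) = G"
      proof (rule ex1I[of _ "fc x"])
        show "fc x \<in> homset Q (Cod C c) W \<and> Cmp Q (fc x) (fc c) = G"
          unfolding g(2) Q_Cmp[OF c' x(1)] using fc_hom[OF x(1)] fc_eq[OF Cmp_in_hom[OF c' x(1)] g(1)] x(2) by blast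
        fix U assume U: "U \<in> homset Q (Cod C c) W \<and> Cmp Q U (fc c) = G"
        then obtain y where y: "y \<in> hom (Cod C c) W" "U = fc y" using Q_homE by metis
        have "y \<bullet> c \<approx> g"
          using U fc_eq[OF Cmp_in_hom[OF c' y(1)] g(1)] unfolding y(2) g(2) Q_Cmp[OF c' y(1)] by blast
        then have "y \<approx> x" using iepi_cancel[OF m c' y(1) x(1)] eqv_trans[OF _ eqv_sym[OF x(2)]] by blast
        then show "U = fc x" unfolding y(2) using fc_eq[OF y(1) x(1)] by blast
      qed
    qed
  qed
qed

lemma abelian_factor_iff: "abelian_category K Q \<longleftrightarrow> iabelian"
proof
  assume "abelian_category K Q"
  then interpret Q: abelian_category K Q .
  show "iabelian"
    unfolding iabelian_def
  proof (intro ballI conjI impI)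
    fix f assume f: "f \<in> Arr C"
    note fh = arr_hom[OF f]
    have F: "fc f \<in> Arr Q" using f by simp
    obtain F' where "kernel_of Q (fc f) F'" using Q.ex_kernel[OF F] by blast
    moreover from this obtain k where k: "k \<in> Arr C" "F' = fc k" unfolding kernel_of_def by auto
    ultimately show "\<exists>k. ikernel f k" using kernel_of_fc[OF f k(1)] by blast
    obtain F' where "cokernel_of Q (fc f) F'" using Q.ex_cokernel[OF F] by blast
    moreover from this obtain k where k: "k \<in> Arr C" "F' = fc k" unfolding cokernel_of_def by auto
    ultimately show "\<exists>c. icokernel f c" using cokernel_of_fc[OF f k(1)] by blast
    { assume "imono f"
      then have "mono_arr Q (fc f)" using mono_arr_fc[OF fh] by blast
      then obtain F' where "kernel_of Q F' (fc f)" using Q.mono_is_kernel by blast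
      moreover from this obtain k where k: "k \<in> Arr C" "F' = fc k" unfolding kernel_of_def by auto
      ultimately show "\<exists>g. ikernel g f" using kernel_of_fc[OF k(1) f] by blast }
    { assume "iepi f"
      then have "epi_arr Q (fc f)" using epi_arr_fc[OF fh] by blast
      then obtain F' where "cokernel_of Q F' (fc f)" using Q.epi_is_cokernel by blast
      moreover from this obtain k where k: "k \<in> Arr C" "F' = fc k" unfolding cokernel_of_def by auto
      ultimately show "\<exists>g. icokernel g f" using cokernel_of_fc[OF k(1) f] by blast }
  qed
next
  assume ab: iabelian
  show "abelian_category K Q"
  proof (intro abelian_category.intro Q_additive abelian_category_axioms.intro)
    fix F assume "F \<in> Arr Q"
    then obtain f where f: "f \<in> Arr C" "F = fc f" by auto
    obtain k where k: "ikernel f k" using ab f(1) unfolding iabelian_def by blast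
    then have "k \<in> Arr C" unfolding ikernel_def by blast
    then show "\<exists>k. kernel_of Q F k" unfolding f(2) using k kernel_of_fc[OF f(1)] by blast
    obtain c where c: "icokernel f c" using ab f(1) unfolding iabelian_def by blast
    then have "c \<in> Arr C" unfolding icokernel_def by blast
    then show "\<exists>c. cokernel_of Q F c" unfolding f(2) using c cokernel_of_fc[OF f(1)] by blast
  next
    fix F assume m: "mono_arr Q F"
    then obtain f where f: "f \<in> Arr C" "F = fc f" unfolding mono_arr_def by auto
    then obtain g where g: "ikernel g f" using ab m mono_arr_fc[OF arr_hom[OF f(1)]] unfolding iabelian_def by blast
    then have "g \<in> Arr C" unfolding ikernel_def by blast
    then show "\<exists>g. kernel_of Q g F" unfolding f(2) using g kernel_of_fc[OF _ f(1)] by blast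
  next
    fix F assume m: "epi_arr Q F"
    then obtain f where f: "f \<in> Arr C" "F = fc f" unfolding epi_arr_def by auto
    then obtain g where g: "icokernel g f" using ab m epi_arr_fc[OF arr_hom[OF f(1)]] unfolding iabelian_def by blast
    then have "g \<in> Arr C" unfolding icokernel_def by blast
    then show "\<exists>g. cokernel_of Q g F" unfolding f(2) using g cokernel_of_fc[OF _ f(1)] by blast
  qed
qed

end

section \<open>Direct sums of triangles and full triangulated subcategories\<close>

text \<open>A record update keeps the types of T, as required for the factors in
  \<open>connected_tricat\<close>.\<close>

definition full_tricat :: "('k, 'o, 'm, 'z) tricat_scheme \<Rightarrow> 'o set \<Rightarrow> ('k, 'o, 'm, 'z) tricat_scheme"
  where "full_tricat T D = T\<lparr>Obj := D, Arr := {f \<in> Arr T. Dom T f \<in> D \<and> Cod T f \<in> D},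
    Dist := {(f, g, h). (f, g, h) \<in> Dist T \<and> Dom T f \<in> D \<and> Cod T f \<in> D \<and> Cod T g \<in> D}\<rparr>"

text \<open>\<open>D_sh\<close> is an equivalence rather than an implication, so that a
  quasi-inverse of the shift also preserves D.\<close>

locale triangulated_subcategory = triangulated_category K T
  for K :: "('k, 'r) ring_scheme" (structure) and T :: "('k, 'o, 'm, 'z) tricat_scheme" +
  fixes D :: "'o set"
  assumes D_Obj: "A \<in> D \<Longrightarrow> A \<in> Obj T"
    and D_iso: "A \<in> D \<Longrightarrow> isomorphic T A B \<Longrightarrow> B \<in> D"
    and D_sh: "A \<in> Obj T \<Longrightarrow> sh T A \<in> D \<longleftrightarrow> A \<in> D"
    and D_zero: "zero_object T A \<Longrightarrow> A \<in> D"
    and D_biproduct: "A \<in> D \<Longrightarrow> B \<in> D \<Longrightarrow> biproduct T A B P \<Longrightarrow> P \<in> D"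
    and D_cone: "A \<in> D \<Longrightarrow> B \<in> D \<Longrightarrow> dtriangle T A B C f g h \<Longrightarrow> C \<in> D"
begin

notation cmp (infixr "\<bullet>" 70)
notation pls (infixl "\<boxplus>" 65)
notation mns (infixl "\<boxminus>" 65)

abbreviation F where "F \<equiv> full_tricat T D"

lemma F_simps [simp]:
  "Obj F = D" "Dom F = Dom T" "Cod F = Cod T" "Idn F = Idn T" "Cmp F = Cmp T" "Zer F = Zer T" "Add F = Add T"
  "Scl F = Scl T" "Shift F = Shift T" "sh F = sh T" "shA F = shA T"
  by (simp_all add: full_tricat_def sh_def[abs_def] shA_def[abs_def])

lemma F_Arr: "Arr F = {f \<in> Arr T. Dom T f \<in> D \<and> Cod T f \<in> D}"
  by (simp add: full_tricat_def)

lemma F_Dist: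
  "(f, g, h) \<in> Dist F \<longleftrightarrow> (f, g, h) \<in> Dist T \<and> Dom T f \<in> D \<and> Cod T f \<in> D \<and> Cod T g \<in> D"
  by (simp add: full_tricat_def)

lemma F_hom_iff: "f \<in> homset F A B \<longleftrightarrow> f \<in> hom A B \<and> A \<in> D \<and> B \<in> D"
  by (auto simp: homset_def F_Arr)

lemma F_hom: "A \<in> D \<Longrightarrow> B \<in> D \<Longrightarrow> homset F A B = hom A B"
  using F_hom_iff by blast

lemma F_Hom: "A \<in> D \<Longrightarrow> B \<in> D \<Longrightarrow> Hom F A B = Hom T A B"
  by (simp add: Hom_def F_hom)

lemma F_linear: "linear_category K F"
proof (rule linear_category.intro, rule field_axioms, rule linear_category_axioms.intro, unfold F_simps)
  fix f assume "f \<in> Arr F"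
  then show "Dom T f \<in> D" "Cod T f \<in> D" by (auto simp: F_Arr)
next
  fix A assume A: "A \<in> D"
  show "I1 A \<in> homset F A A" using A Idn_in_hom[OF D_Obj[OF A]] by (simp add: F_hom)
next
  fix f g A B E assume "f \<in> homset F A B" "g \<in> homset F B E"
  then show "g \<bullet> f \<in> homset F A E" using Cmp_in_hom by (auto simp: F_hom_iff)
next
  fix f A B assume "f \<in> homset F A B"
  then show "f \<bullet> I1 A = f" "I1 B \<bullet> f = f" using Cmp_Idn_right Cmp_Idn_left by (auto simp: F_hom_iff)
next
  fix f g h A B E G assume "f \<in> homset F A B" "g \<in> homset F B E" "h \<in> homset F E G"
  then show "(h \<bullet> g) \<bullet> f = h \<bullet> (g \<bullet> f)" using Cmp_assoc by (auto simp: F_hom_iff)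
next
  fix A B assume "A \<in> D" "B \<in> D"
  then show "module K (Hom F A B)" using Hom_module[OF D_Obj D_Obj] by (simp add: F_Hom)
next
  fix g B E A assume g: "g \<in> homset F B E" and A: "A \<in> D"
  then have "B \<in> D" "E \<in> D" "g \<in> hom B E" by (auto simp: F_hom_iff)
  then show "linear_map K (Hom F A B) (Hom F A E) (\<lambda>f. g \<bullet> f)"
    using post_linear[OF _ D_Obj[OF A]] A by (simp add: F_Hom)
next
  fix f A B E assume f: "f \<in> homset F A B" and E: "E \<in> D"
  then have "A \<in> D" "B \<in> D" "f \<in> hom A B" by (auto simp: F_hom_iff)
  then show "linear_map K (Hom F B E) (Hom F A E) (\<lambda>g. g \<bullet> f)"
    using pre_linear[OF _ D_Obj[OF E]] E by (simp add: F_Hom)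
qed

lemma F_zero_object: "zero_object F Z \<longleftrightarrow> Z \<in> D \<and> zero_object T Z"
  using linear_category.zero_object_iff[OF F_linear, of Z] zero_object_iff[of Z] D_Obj by auto

lemma F_biproduct: "A \<in> D \<Longrightarrow> B \<in> D \<Longrightarrow> biproduct T A B P \<Longrightarrow> biproduct F A B P"
  using D_biproduct[of A B P] by (simp add: biproduct_def F_hom)

lemma F_additive: "additive_category K F"
proof (rule additive_category.intro[OF F_linear], rule additive_category_axioms.intro)
  obtain Z where "zero_object T Z" using ex_zero_object by blast
  then show "\<exists>Z. zero_object F Z" using D_zero F_zero_object by blast
next
  fix A B assume "A \<in> Obj F" "B \<in> Obj F"
  then have A: "A \<in> D" "B \<in> D" by simp_all
  obtain P where "biproduct T A B P" using ex_biproduct[OF D_Obj[OF A(1)] D_Obj[OF A(2)]] by blast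
  then show "\<exists>P. biproduct F A B P" using F_biproduct[OF A] by blast
qed

lemma F_iso_arr: "iso_arr F A B f \<longleftrightarrow> A \<in> D \<and> B \<in> D \<and> iso_arr T A B f"
  by (auto simp: iso_arr_def F_hom_iff)

lemma F_triangle: "triangle F A B E t \<longleftrightarrow> A \<in> D \<and> B \<in> D \<and> E \<in> D \<and> triangle T A B E t"
  using D_sh[of A] D_Obj by (auto simp: triangle_def F_hom_iff)

lemma F_dtriangle: "dtriangle F A B E f g h \<longleftrightarrow> A \<in> D \<and> B \<in> D \<and> E \<in> D \<and> dtriangle T A B E f g h"
proof
  assume "dtriangle F A B E f g h"
  then show "A \<in> D \<and> B \<in> D \<and> E \<in> D \<and> dtriangle T A B E f g h"
    by (auto simp: dtriangle_def F_triangle F_Dist)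
next
  assume h: "A \<in> D \<and> B \<in> D \<and> E \<in> D \<and> dtriangle T A B E f g h"
  then have "Dom T f = A" "Cod T f = B" "Cod T g = E" using dtD(1,2) homD(2,3) by blast+
  then show "dtriangle F A B E f g h"
    using h by (auto simp: dtriangle_def F_triangle F_Dist)
qed

lemma F_shift: "linear_equivalence K F F (Shift F)"
proof -
  note so = sh_def[of T, symmetric] and sA = shA_def[of T, symmetric]
  obtain G \<eta> \<epsilon> where L: "linear_functor K T T (Shift T)" and G: "linear_functor K T T G"
    and n: "natural_iso T T fctr_id (fctr_comp G (Shift T)) \<eta>" and m: "natural_iso T T (fctr_comp (Shift T) G) fctr_id \<epsilon>"
    using shift_equivalence unfolding linear_equivalence_def by blast
  note G1 = G[unfolded linear_functor_def, THEN conjunct1, rule_format]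
  note G2 = G[unfolded linear_functor_def, THEN conjunct2, THEN conjunct1, rule_format]
  note G3 = G[unfolded linear_functor_def, THEN conjunct2, THEN conjunct2, rule_format]
  note L1 = L[unfolded linear_functor_def, THEN conjunct1, rule_format]
  note L2 = L[unfolded linear_functor_def, THEN conjunct2, THEN conjunct1, rule_format]
  note L3 = L[unfolded linear_functor_def, THEN conjunct2, THEN conjunct2, rule_format]
  note n' = n[unfolded natural_iso_def fctr_id_def fctr_comp_def, simplified]
  note m' = m[unfolded natural_iso_def fctr_id_def fctr_comp_def, simplified]
  have SD: "FO (Shift T) A \<in> D" if "A \<in> D" for A using D_sh[OF D_Obj[OF that]] that by (simp add: so)
  \<comment> \<open>The counit identifies A with (G A)[1], and \<open>D_sh\<close> is read
    backwards.\<close>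
  have GD: "FO G A \<in> D" if A: "A \<in> D" for A
  proof -
    have o: "FO G A \<in> Obj T" using G1[OF D_Obj[OF A]] by blast
    have "iso_arr T (s (FO G A)) A (\<epsilon> A)" using m' D_Obj[OF A] by (simp add: so)
    then have "isomorphic T A (s (FO G A))"
      using isomorphic_sym D_Obj[OF A] sh_Obj[OF o] unfolding isomorphic_def by blast
    then show ?thesis using D_iso[OF A] D_sh[OF o] by blast
  qed
  have "linear_functor K F F H" if H: "linear_functor K T T H" and HD: "\<And>A. A \<in> D \<Longrightarrow> FO H A \<in> D" for H :: "('o, 'm, 'o, 'm) fctr"
    using H HD D_Obj unfolding linear_functor_def by (simp add: F_hom F_Hom) blast
  then have "linear_functor K F F (Shift T)" "linear_functor K F F G" using L G SD GD by blast+
  moreover have "natural_iso F F fctr_id (fctr_comp G (Shift T)) \<eta>" "natural_iso F F (fctr_comp (Shift T) G) fctr_id \<epsilon>"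
    unfolding natural_iso_def fctr_id_def fctr_comp_def
    using n' m' GD SD D_Obj by (simp_all add: F_iso_arr F_hom_iff)
  ultimately show ?thesis unfolding linear_equivalence_def F_simps by blast
qed

lemma F_triangulated: "triangulated_category K F"
proof (rule triangulated_category.intro[OF F_additive], rule triangulated_category_axioms.intro)
  show "linear_equivalence K F F (Shift F)" by (rule F_shift)
next
  fix t assume "t \<in> Dist F"
  then obtain f g h where t: "t = (f, g, h)" "(f, g, h) \<in> Dist T" "Dom T f \<in> D" "Cod T f \<in> D" "Cod T g \<in> D"
    by (cases t) (auto simp: F_Dist)
  obtain A B E where tr: "triangle T A B E (f, g, h)" using Dist_triangle[OF t(2)] by blast
  then have "Dom T f = A" "Cod T f = B" "Cod T g = E" by (auto simp: triangle_def homset_def)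
  then show "\<exists>A B C. triangle F A B C t" using tr t F_triangle by blast
next
  fix A B C f g h A' B' C' f' g' h' a b c
  assume h: "dtriangle F A B C f g h" "triangle F A' B' C' (f', g', h')" "iso_arr F A A' a" "iso_arr F B B' b"
    "iso_arr F C C' c" "b \<cdot>\<^bsub>F\<^esub> f = f' \<cdot>\<^bsub>F\<^esub> a" "c \<cdot>\<^bsub>F\<^esub> g = g' \<cdot>\<^bsub>F\<^esub> b" "shA F a \<cdot>\<^bsub>F\<^esub> h = h' \<cdot>\<^bsub>F\<^esub> c"
  have tr: "triangle T A' B' C' (f', g', h')" "A' \<in> D" "B' \<in> D" "C' \<in> D" using h(2) by (auto simp: F_triangle)
  have "(f', g', h') \<in> Dist T"
    by (rule Dist_iso[of A B C f g h A' B' C' f' g' h' a b c])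
      (use h tr in \<open>simp_all add: F_dtriangle F_iso_arr\<close>)
  then have "dtriangle T A' B' C' f' g' h'" using tr by (simp add: dtriangle_def)
  then have "dtriangle F A' B' C' f' g' h'" using tr by (simp add: F_dtriangle)
  then show "(f', g', h') \<in> Dist F" by (simp add: dtriangle_def)
next
  fix A Z assume "A \<in> Obj F" "zero_object F Z"
  then have h: "A \<in> D" "Z \<in> D" "zero_object T Z" by (simp_all add: F_zero_object)
  then have "dtriangle F A A Z (I1 A) (Z0 A Z) (Z0 Z (s A))"
    using triangle_id[OF D_Obj] by (simp add: F_dtriangle)
  then show "(Idn F A, Zer F A Z, Zer F Z (sh F A)) \<in> Dist F" by (simp add: dtriangle_def)
next
  fix f A B assume "f \<in> homset F A B"
  then have h: "f \<in> hom A B" "A \<in> D" "B \<in> D" by (simp_all add: F_hom_iff)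
  obtain C g k where t: "dtriangle T A B C f g k" using TR1_cone[OF h(1)] by blast
  then show "\<exists>C g h. dtriangle F A B C f g h" using D_cone[OF h(2,3) t] h F_dtriangle by blast
next
  fix A B C f g h assume "triangle F A B C (f, g, h)"
  then have tr: "A \<in> D" "B \<in> D" "C \<in> D" "triangle T A B C (f, g, h)" by (simp_all add: F_triangle)
  then have f: "f \<in> hom A B" "g \<in> hom B C" by (auto simp: triangle_def)
  have sD: "s A \<in> D" "s B \<in> D" using D_sh D_Obj tr by auto
  have "(f, g, h) \<in> Dist F \<longleftrightarrow> (f, g, h) \<in> Dist T"
    using homD(2,3)[OF f(1)] homD(3)[OF f(2)] tr by (auto simp: F_Dist)
  moreover have "(g, h, k) \<in> Dist F \<longleftrightarrow> (g, h, k) \<in> Dist T" for k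
    using homD(2,3)[OF f(2)] tr sD by (auto simp: F_Dist triangle_def homset_def)
  ultimately show "((f, g, h) \<in> Dist F) = ((g, h, \<ominus>\<^bsub>Hom F (sh F A) (sh F B)\<^esub> shA F f) \<in> Dist F)"
    using TR2[OF tr(4)] F_Hom[OF sD] by simp
next
  fix A B C f g h A' B' C' f' g' h' a b
  assume h: "dtriangle F A B C f g h" "dtriangle F A' B' C' f' g' h'"
    "a \<in> homset F A A'" "b \<in> homset F B B'" "b \<cdot>\<^bsub>F\<^esub> f = f' \<cdot>\<^bsub>F\<^esub> a"
  then show "\<exists>c\<in>homset F C C'. c \<cdot>\<^bsub>F\<^esub> g = g' \<cdot>\<^bsub>F\<^esub> b \<and> shA F a \<cdot>\<^bsub>F\<^esub> h = h' \<cdot>\<^bsub>F\<^esub> c"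
    using TR3[of A B C f g h A' B' C' f' g' h' a b] by (simp add: F_dtriangle F_hom_iff Bex_def)
next
  fix A B E f f' f'' C G g g' g'' H h' h''
  assume h: "dtriangle F A B E f f' f''" "dtriangle F B C G g g' g''" "dtriangle F A C H (g \<cdot>\<^bsub>F\<^esub> f) h' h''"
  then have "\<exists>u v. dtriangle T E H G u v (sa f' \<bullet> g'') \<and>
          u \<bullet> f' = h' \<bullet> g \<and> h'' \<bullet> u = f'' \<and> v \<bullet> h' = g' \<and> g'' \<bullet> v = sa f \<bullet> h''"
    by (intro TR4[of A B E f f' f'' C G g g' g'']) (simp_all add: F_dtriangle)
  then show "\<exists>u v. dtriangle F E H G u v (shA F f' \<cdot>\<^bsub>F\<^esub> g'') \<and>
          u \<cdot>\<^bsub>F\<^esub> f' = h' \<cdot>\<^bsub>F\<^esub> g \<and> h'' \<cdot>\<^bsub>F\<^esub> u = f'' \<and>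
          v \<cdot>\<^bsub>F\<^esub> h' = g' \<and> g'' \<cdot>\<^bsub>F\<^esub> v = shA F f \<cdot>\<^bsub>F\<^esub> h''"
    using h by (simp add: F_dtriangle)
qed

lemma F_nonzero: "A \<in> D \<Longrightarrow> \<not> zero_object T A \<Longrightarrow> nonzero_category F"
  using F_zero_object by (auto simp: nonzero_category_def)

end

section \<open>Biproducts with chosen structure arrows, and direct sums of triangles\<close>

context linear_category
begin

definition bip where
  "bip A B P i j p q \<longleftrightarrow> i \<in> hom A P \<and> j \<in> hom B P \<and> p \<in> hom P A \<and> q \<in> hom P B \<and>
    p \<bullet> i = I1 A \<and> q \<bullet> j = I1 B \<and> p \<bullet> j = Z0 B A \<and> q \<bullet> i = Z0 A B \<and> (i \<bullet> p) \<boxplus> (j \<bullet> q) = I1 P"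

lemma bipD:
  assumes "bip A B P i j p q"
  shows "i \<in> hom A P" "j \<in> hom B P" "p \<in> hom P A" "q \<in> hom P B"
    "p \<bullet> i = I1 A" "q \<bullet> j = I1 B" "p \<bullet> j = Z0 B A" "q \<bullet> i = Z0 A B" "(i \<bullet> p) \<boxplus> (j \<bullet> q) = I1 P"
    "A \<in> Obj C" "B \<in> Obj C" "P \<in> Obj C"
  using assms homD(4,5)[of i A P] homD(4)[of j B P] by (auto simp: bip_def)

text \<open>Here \<open>p\<close>, \<open>q\<close> are the projections of the source and \<open>i\<close>, \<open>j\<close> the injections of the target.\<close>

definition dsum where "dsum i j p q f g = (i \<bullet> (f \<bullet> p)) \<boxplus> (j \<bullet> (g \<bullet> q))"

lemma dsum_hom:
  assumes "p \<in> hom P A" "q \<in> hom P B" "i \<in> hom A' P'" "j \<in> hom B' P'" "f \<in> hom A A'" "g \<in> hom B B'"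
  shows "dsum i j p q f g \<in> hom P P'"
  unfolding dsum_def using assms by (simp add: cat)

lemma bip_decompose_right:
  assumes b: "bip A B P i j p q" and u: "u \<in> hom P W"
  shows "u = ((u \<bullet> i) \<bullet> p) \<boxplus> ((u \<bullet> j) \<bullet> q)"
proof -
  note d = bipD[OF b]
  have "u = u \<bullet> ((i \<bullet> p) \<boxplus> (j \<bullet> q))" unfolding d(9) using Cmp_Idn_right[OF u] by simp
  also have "\<dots> = ((u \<bullet> i) \<bullet> p) \<boxplus> ((u \<bullet> j) \<bullet> q)" using u d(1-4) by (simp add: cat)
  finally show ?thesis .
qed

lemma bip_decompose_left:
  assumes b: "bip A B P i j p q" and u: "u \<in> hom W P"
  shows "u = (i \<bullet> (p \<bullet> u)) \<boxplus> (j \<bullet> (q \<bullet> u))"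
proof -
  note d = bipD[OF b]
  have "u = ((i \<bullet> p) \<boxplus> (j \<bullet> q)) \<bullet> u" unfolding d(9) using Cmp_Idn_left[OF u] by simp
  also have "\<dots> = (i \<bullet> (p \<bullet> u)) \<boxplus> (j \<bullet> (q \<bullet> u))" using u d(1-4) by (simp add: cat)
  finally show ?thesis .
qed

lemma bip_out:
  assumes b: "bip A B P i j p q" and u: "u \<in> hom A W" "v \<in> hom B W"
  shows "((u \<bullet> p) \<boxplus> (v \<bullet> q)) \<bullet> i = u" "((u \<bullet> p) \<boxplus> (v \<bullet> q)) \<bullet> j = v"
proof -
  note d = bipD[OF b]
  have "((u \<bullet> p) \<boxplus> (v \<bullet> q)) \<bullet> i = (u \<bullet> (p \<bullet> i)) \<boxplus> (v \<bullet> (q \<bullet> i))"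
    "((u \<bullet> p) \<boxplus> (v \<bullet> q)) \<bullet> j = (u \<bullet> (p \<bullet> j)) \<boxplus> (v \<bullet> (q \<bullet> j))"
    using d(1-4) u by (simp_all add: cat)
  then show "((u \<bullet> p) \<boxplus> (v \<bullet> q)) \<bullet> i = u" "((u \<bullet> p) \<boxplus> (v \<bullet> q)) \<bullet> j = v"
    unfolding d(5-8) using u d(10,11) homD(5)[OF u(1)] by (simp_all add: cat)
qed

lemma bip_in:
  assumes b: "bip A B P i j p q" and u: "u \<in> hom W A" "v \<in> hom W B"
  shows "p \<bullet> ((i \<bullet> u) \<boxplus> (j \<bullet> v)) = u" "q \<bullet> ((i \<bullet> u) \<boxplus> (j \<bullet> v)) = v"
proof -
  note d = bipD[OF b]
  have "p \<bullet> ((i \<bullet> u) \<boxplus> (j \<bullet> v)) = ((p \<bullet> i) \<bullet> u) \<boxplus> ((p \<bullet> j) \<bullet> v)"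
    "q \<bullet> ((i \<bullet> u) \<boxplus> (j \<bullet> v)) = ((q \<bullet> i) \<bullet> u) \<boxplus> ((q \<bullet> j) \<bullet> v)"
    using d(1-4) u by (simp_all add: cat)
  then show "p \<bullet> ((i \<bullet> u) \<boxplus> (j \<bullet> v)) = u" "q \<bullet> ((i \<bullet> u) \<boxplus> (j \<bullet> v)) = v"
    unfolding d(5-8) using u d(10,11) homD(4)[OF u(1)] by (simp_all add: cat)
qed

lemma dsum_simps:
  assumes b: "bip A B P i j p q" and b': "bip A' B' P' i' j' p' q'" and f: "f \<in> hom A A'" and g: "g \<in> hom B B'"
  shows "dsum i' j' p q f g \<bullet> i = i' \<bullet> f" "dsum i' j' p q f g \<bullet> j = j' \<bullet> g"
    "p' \<bullet> dsum i' j' p q f g = f \<bullet> p" "q' \<bullet> dsum i' j' p q f g = g \<bullet> q"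
proof -
  note d = bipD[OF b] and d' = bipD[OF b']
  have "dsum i' j' p q f g = ((i' \<bullet> f) \<bullet> p) \<boxplus> ((j' \<bullet> g) \<bullet> q)"
    unfolding dsum_def using Cmp_assoc[OF d(3) f d'(1)] Cmp_assoc[OF d(4) g d'(2)] by simp
  then show "dsum i' j' p q f g \<bullet> i = i' \<bullet> f" "dsum i' j' p q f g \<bullet> j = j' \<bullet> g"
    using bip_out[OF b Cmp_in_hom[OF f d'(1)] Cmp_in_hom[OF g d'(2)]] by simp_all
  show "p' \<bullet> dsum i' j' p q f g = f \<bullet> p" "q' \<bullet> dsum i' j' p q f g = g \<bullet> q"
    unfolding dsum_def using bip_in[OF b' Cmp_in_hom[OF d(3) f] Cmp_in_hom[OF d(4) g]] by simp_all
qed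

lemma dsum_comp:
  assumes b: "p \<in> hom P A" "q \<in> hom P B" and b': "bip A' B' P' i' j' p' q'" and b'': "i'' \<in> hom A'' P''" "j'' \<in> hom B'' P''"
    and f: "f \<in> hom A A'" "f' \<in> hom A' A''" and g: "g \<in> hom B B'" "g' \<in> hom B' B''"
  shows "dsum i'' j'' p' q' f' g' \<bullet> dsum i' j' p q f g = dsum i'' j'' p q (f' \<bullet> f) (g' \<bullet> g)"
proof -
  note d = bipD[OF b']
  have h: "dsum i' j' p q f g \<in> hom P P'" using dsum_hom[OF b d(1,2) f(1) g(1)] .
  have 1: "p' \<bullet> dsum i' j' p q f g = f \<bullet> p" "q' \<bullet> dsum i' j' p q f g = g \<bullet> q"
    unfolding dsum_def using bip_in[OF b' Cmp_in_hom[OF b(1) f(1)] Cmp_in_hom[OF b(2) g(1)]] by simp_all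
  have "dsum i'' j'' p' q' f' g' \<bullet> dsum i' j' p q f g
      = (i'' \<bullet> (f' \<bullet> (p' \<bullet> dsum i' j' p q f g))) \<boxplus> (j'' \<bullet> (g' \<bullet> (q' \<bullet> dsum i' j' p q f g)))"
    unfolding dsum_def[of i'' j''] using h d(3,4) f(2) g(2) b'' by (simp add: cat)
  then show ?thesis unfolding 1 unfolding dsum_def using b b'' f g by (simp add: cat)
qed

lemma dsum_id: "bip A B P i j p q \<Longrightarrow> dsum i j p q (I1 A) (I1 B) = I1 P"
  using bipD[of A B P i j p q] Cmp_Idn_left unfolding dsum_def by metis

lemma dsum_Add:
  assumes "p \<in> hom P A" "q \<in> hom P B" "i \<in> hom A' P'" "j \<in> hom B' P'"
    "f \<in> hom A A'" "f' \<in> hom A A'" "g \<in> hom B B'" "g' \<in> hom B B'"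
  shows "dsum i j p q (f \<boxplus> f') (g \<boxplus> g') = dsum i j p q f g \<boxplus> dsum i j p q f' g'"
  unfolding dsum_def using assms by (simp add: cat add_simps)

lemma Scl_Add: "a \<in> carrier K \<Longrightarrow> f \<in> hom A B \<Longrightarrow> g \<in> hom A B \<Longrightarrow> Scl C a (f \<boxplus> g) = Scl C a f \<boxplus> Scl C a g"
proof -
  assume h: "a \<in> carrier K" "f \<in> hom A B" "g \<in> hom A B"
  interpret M: module K "Hom C A B" by (rule Hom_module[OF homD(4,5)[OF h(2)]])
  show ?thesis using M.smult_r_distr[of a f g] h by simp
qed

lemma dsum_Scl:
  assumes "p \<in> hom P A" "q \<in> hom P B" "i \<in> hom A' P'" "j \<in> hom B' P'" "f \<in> hom A A'" "g \<in> hom B B'" and a: "a \<in> carrier K"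
  shows "dsum i j p q (Scl C a f) (Scl C a g) = Scl C a (dsum i j p q f g)"
  unfolding dsum_def
  using Cmp_Scl_left[OF assms(1,5) a] Cmp_Scl_left[OF assms(2,6) a]
    Cmp_Scl_right[OF assms(3) Cmp_in_hom[OF assms(1,5)] a] Cmp_Scl_right[OF assms(4) Cmp_in_hom[OF assms(2,6)] a]
    Scl_Add[OF a Cmp_in_hom[OF Cmp_in_hom[OF assms(1,5)] assms(3)] Cmp_in_hom[OF Cmp_in_hom[OF assms(2,6)] assms(4)]]
  by simp

end

context triangulated_category
begin

lemma bip_sh:
  assumes b: "bip A B P i j p q"
  shows "bip (s A) (s B) (s P) (sa i) (sa j) (sa p) (sa q)"
proof -
  note d = bipD[OF b]
  have "(sa i \<bullet> sa p) \<boxplus> (sa j \<bullet> sa q) = sa ((i \<bullet> p) \<boxplus> (j \<bullet> q))"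
    using d(1-4) by (simp add: sa_simps cat)
  then show ?thesis
    unfolding bip_def using d(1-4) sa_hom d(5-12)
    by (simp add: sa_Cmp[OF d(1,3), symmetric] sa_Cmp[OF d(2,4), symmetric] sa_Cmp[OF d(2,3), symmetric]
        sa_Cmp[OF d(1,4), symmetric] sa_Idn sa_Zer)
qed

lemma sa_dsum:
  assumes "p \<in> hom P A" "q \<in> hom P B" "i \<in> hom A' P'" "j \<in> hom B' P'" "f \<in> hom A A'" "g \<in> hom B B'"
  shows "sa (dsum i j p q f g) = dsum (sa i) (sa j) (sa p) (sa q) (sa f) (sa g)"
  unfolding dsum_def using assms by (simp add: sa_simps cat)

text \<open>The sum is compared with the cone D of f through k : C -> D and l : D -> C, assembled
  from TR3 on the summands. The five lemma cannot be used directly, the sum not yet being known to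
  be distinguished; instead k l and l k are unipotent, and \<open>third_iso\<close> transports the
  triangle.\<close>

lemma direct_sum_dtriangle:
  assumes t1: "dtriangle T A1 B1 C1 f1 g1 h1" and t2: "dtriangle T A2 B2 C2 f2 g2 h2"
    and bA: "bip A1 A2 A iA jA pA qA" and bB: "bip B1 B2 B iB jB pB qB" and bC: "bip C1 C2 C iC jC pC qC"
  shows "dtriangle T A B C (dsum iB jB pA qA f1 f2) (dsum iC jC pB qB g1 g2) (dsum (sa iA) (sa jA) pC qC h1 h2)"
proof -
  note a = bipD[OF bA] and b = bipD[OF bB] and c = bipD[OF bC]
  note d1 = dtD[OF t1] and d2 = dtD[OF t2]
  note bS = bip_sh[OF bA]
  note sA = bipD[OF bS]
  define f g h where "f = dsum iB jB pA qA f1 f2" and "g = dsum iC jC pB qB g1 g2"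
    and "h = dsum (sa iA) (sa jA) pC qC h1 h2"
  have fh: "f \<in> hom A B" unfolding f_def by (rule dsum_hom[OF a(3,4) b(1,2) d1(1) d2(1)])
  have gh: "g \<in> hom B C" unfolding g_def by (rule dsum_hom[OF b(3,4) c(1,2) d1(2) d2(2)])
  have hh: "h \<in> hom C (s A)" unfolding h_def by (rule dsum_hom[OF c(3,4) sA(1,2) d1(3) d2(3)])
  note fs = dsum_simps[OF bA bB d1(1) d2(1), folded f_def]
  note gs = dsum_simps[OF bB bC d1(2) d2(2), folded g_def]
  note hs = dsum_simps[OF bC bS d1(3) d2(3), folded h_def]
  obtain D gD hD where t: "dtriangle T A B D f gD hD" using TR1_cone[OF fh] by blast
  note e = dtD[OF t]
  obtain c1 where c1: "c1 \<in> hom C1 D" "c1 \<bullet> g1 = gD \<bullet> iB" "sa iA \<bullet> h1 = hD \<bullet> c1"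
    using TR3[OF t1 t a(1) b(1) fs(1)[symmetric]] by blast
  obtain c2 where c2: "c2 \<in> hom C2 D" "c2 \<bullet> g2 = gD \<bullet> jB" "sa jA \<bullet> h2 = hD \<bullet> c2"
    using TR3[OF t2 t a(2) b(2) fs(2)[symmetric]] by blast
  obtain e1 where e1: "e1 \<in> hom D C1" "e1 \<bullet> gD = g1 \<bullet> pB" "sa pA \<bullet> hD = h1 \<bullet> e1"
    using TR3[OF t t1 a(3) b(3) fs(3)] by blast
  obtain e2 where e2: "e2 \<in> hom D C2" "e2 \<bullet> gD = g2 \<bullet> qB" "sa qA \<bullet> hD = h2 \<bullet> e2"
    using TR3[OF t t2 a(4) b(4) fs(4)] by blast
  define k where "k = (c1 \<bullet> pC) \<boxplus> (c2 \<bullet> qC)"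
  define l where "l = (iC \<bullet> e1) \<boxplus> (jC \<bullet> e2)"
  have k: "k \<in> hom C D" unfolding k_def using Add_in_hom[OF Cmp_in_hom[OF c(3) c1(1)] Cmp_in_hom[OF c(4) c2(1)]] .
  have l: "l \<in> hom D C" unfolding l_def using Add_in_hom[OF Cmp_in_hom[OF e1(1) c(1)] Cmp_in_hom[OF e2(1) c(2)]] .
  have ks: "k \<bullet> iC = c1" "k \<bullet> jC = c2" unfolding k_def using bip_out[OF bC c1(1) c2(1)] .
  have ls: "pC \<bullet> l = e1" "qC \<bullet> l = e2" unfolding l_def using bip_in[OF bC e1(1) e2(1)] .
  have kg: "k \<bullet> g = gD"
  proof -
    have kgh: "k \<bullet> g \<in> hom B D" using Cmp_in_hom[OF gh k] .
    have "(k \<bullet> g) \<bullet> iB = gD \<bullet> iB" "(k \<bullet> g) \<bullet> jB = gD \<bullet> jB"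
      using Cmp_assoc[OF b(1) gh k] Cmp_assoc[OF b(2) gh k] gs(1,2) ks c1(2) c2(2)
        Cmp_assoc[OF d1(2) c(1) k] Cmp_assoc[OF d2(2) c(2) k] by simp_all
    then show ?thesis using bip_decompose_right[OF bB kgh] bip_decompose_right[OF bB e(2)] by simp
  qed
  have hk: "hD \<bullet> k = h"
  proof -
    have hkh: "hD \<bullet> k \<in> hom C (s A)" using Cmp_in_hom[OF k e(3)] .
    have "(hD \<bullet> k) \<bullet> iC = h \<bullet> iC" "(hD \<bullet> k) \<bullet> jC = h \<bullet> jC"
      using Cmp_assoc[OF c(1) k e(3)] Cmp_assoc[OF c(2) k e(3)] hs(1,2) ks c1(3) c2(3) by simp_all
    then show ?thesis using bip_decompose_right[OF bC hkh] bip_decompose_right[OF bC hh] by simp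
  qed
  have lg: "l \<bullet> gD = g"
  proof -
    have lgh: "l \<bullet> gD \<in> hom B C" using Cmp_in_hom[OF e(2) l] .
    have "pC \<bullet> (l \<bullet> gD) = pC \<bullet> g" "qC \<bullet> (l \<bullet> gD) = qC \<bullet> g"
      using Cmp_assoc[OF e(2) l c(3)] Cmp_assoc[OF e(2) l c(4)] gs(3,4) ls e1(2) e2(2) by simp_all
    then show ?thesis using bip_decompose_left[OF bC lgh] bip_decompose_left[OF bC gh] by simp
  qed
  have hl: "h \<bullet> l = hD"
  proof -
    have hlh: "h \<bullet> l \<in> hom D (s A)" using Cmp_in_hom[OF l hh] .
    have "sa pA \<bullet> (h \<bullet> l) = sa pA \<bullet> hD" "sa qA \<bullet> (h \<bullet> l) = sa qA \<bullet> hD"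
      using Cmp_assoc[OF l hh sA(3)] Cmp_assoc[OF l hh sA(4)] hs(3,4) ls e1(3) e2(3)
        Cmp_assoc[OF l c(3) d1(3)] Cmp_assoc[OF l c(4) d2(3)] by simp_all
    then show ?thesis using bip_decompose_left[OF bS hlh] bip_decompose_left[OF bS e(3)] by simp
  qed
  have ID: "I1 D \<in> hom D D" and IC: "I1 C \<in> hom C C" using Idn_in_hom e(6) c(12) by blast+
  have y: "k \<bullet> l \<in> hom D D" and x: "l \<bullet> k \<in> hom C C" using Cmp_in_hom k l by blast+
  \<comment> \<open>Both composites differ from the identity by an endomorphism of square zero.\<close>
  obtain y' where y': "y' \<in> hom D D" "(k \<bullet> l) \<bullet> y' = I1 D"
  proof -
    define u where "u = (k \<bullet> l) \<boxminus> I1 D"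
    have u: "u \<in> hom D D" unfolding u_def using mns_in_hom[OF y ID] .
    have "u \<bullet> gD = Z0 B D"
      unfolding u_def using Cmp_mns_left[OF e(2) y ID] Cmp_assoc[OF e(2) l k] lg kg Cmp_Idn_left[OF e(2)] mns_self[OF e(2)] by simp
    then obtain z where z: "z \<in> hom (s A) D" "z \<bullet> hD = u" using exact_contra3[OF t u] by blast
    have "hD \<bullet> u = Z0 D (s A)"
      unfolding u_def using Cmp_mns_right[OF e(3) y ID] Cmp_assoc[OF l k e(3)] hk hl Cmp_Idn_right[OF e(3)] mns_self[OF e(3)] by simp
    then have "u \<bullet> u = Z0 D D"
      using Cmp_assoc[OF u e(3) z(1)] z(2) Cmp_Zer_right[OF z(1) e(6)] by simp
    then show thesis using unipotent_iso[OF y] that unfolding u_def by blast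
  qed
  obtain x' where x': "x' \<in> hom C C" "x' \<bullet> (l \<bullet> k) = I1 C"
  proof -
    define u where "u = (l \<bullet> k) \<boxminus> I1 C"
    have u: "u \<in> hom C C" unfolding u_def using mns_in_hom[OF x IC] .
    have ug: "u \<bullet> g = Z0 B C"
      unfolding u_def using Cmp_mns_left[OF gh x IC] Cmp_assoc[OF gh k l] lg kg Cmp_Idn_left[OF gh] mns_self[OF gh] by simp
    have "(u \<bullet> iC) \<bullet> g1 = (u \<bullet> g) \<bullet> iB" "(u \<bullet> jC) \<bullet> g2 = (u \<bullet> g) \<bullet> jB"
      using Cmp_assoc[OF d1(2) c(1) u] Cmp_assoc[OF d2(2) c(2) u] Cmp_assoc[OF b(1) gh u] Cmp_assoc[OF b(2) gh u] gs(1,2) by simp_all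
    then have "(u \<bullet> iC) \<bullet> g1 = Z0 B1 C" "(u \<bullet> jC) \<bullet> g2 = Z0 B2 C"
      unfolding ug using Cmp_Zer_left[OF b(1) c(12)] Cmp_Zer_left[OF b(2) c(12)] by simp_all
    \<comment> \<open>Exactness at C of the sum is obtained summandwise: the components of u factor
      through h1 and h2, and z combines the factors so that z h = u.\<close>
    then obtain z1 z2 where z: "z1 \<in> hom (s A1) C" "z1 \<bullet> h1 = u \<bullet> iC" "z2 \<in> hom (s A2) C" "z2 \<bullet> h2 = u \<bullet> jC"
      using exact_contra3[OF t1 Cmp_in_hom[OF c(1) u]] exact_contra3[OF t2 Cmp_in_hom[OF c(2) u]] by metis
    define z where "z = (z1 \<bullet> sa pA) \<boxplus> (z2 \<bullet> sa qA)"
    have zh: "z \<in> hom (s A) C" unfolding z_def using Add_in_hom[OF Cmp_in_hom[OF sA(3) z(1)] Cmp_in_hom[OF sA(4) z(3)]] .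
    have zs: "z \<bullet> sa iA = z1" "z \<bullet> sa jA = z2" unfolding z_def using bip_out[OF bS z(1,3)] .
    have zhh: "z \<bullet> h \<in> hom C C" using Cmp_in_hom[OF hh zh] .
    have "(z \<bullet> h) \<bullet> iC = u \<bullet> iC" "(z \<bullet> h) \<bullet> jC = u \<bullet> jC"
      using Cmp_assoc[OF c(1) hh zh] Cmp_assoc[OF c(2) hh zh] hs(1,2) z(2,4) zs
        Cmp_assoc[OF d1(3) sA(1) zh] Cmp_assoc[OF d2(3) sA(2) zh] by simp_all
    then have zu: "z \<bullet> h = u" using bip_decompose_right[OF bC zhh] bip_decompose_right[OF bC u] by simp
    have "h \<bullet> u = Z0 C (s A)"
      unfolding u_def using Cmp_mns_right[OF hh x IC] Cmp_assoc[OF k l hh] hk hl Cmp_Idn_right[OF hh] mns_self[OF hh] by simp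
    then have "u \<bullet> u = Z0 C C"
      using Cmp_assoc[OF u hh zh] zu Cmp_Zer_right[OF zh c(12)] by simp
    then show thesis using unipotent_iso[OF x] that unfolding u_def by blast
  qed
  \<comment> \<open>m is a left inverse of k; the right inverse l y' coincides with it, so k is an
    isomorphism.\<close>
  define m where "m = x' \<bullet> l"
  have m: "m \<in> hom D C" unfolding m_def using Cmp_in_hom[OF l x'(1)] .
  have mk: "m \<bullet> k = I1 C" unfolding m_def using Cmp_assoc[OF k l x'(1)] x'(2) by simp
  have "m = m \<bullet> ((k \<bullet> l) \<bullet> y')" using y'(2) Cmp_Idn_right[OF m] by simp
  also have "\<dots> = (m \<bullet> k) \<bullet> (l \<bullet> y')" using m k l y'(1) by (simp add: cat)
  also have "\<dots> = l \<bullet> y'" unfolding mk using Cmp_Idn_left[OF Cmp_in_hom[OF y'(1) l]] .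
  finally have "k \<bullet> m = I1 D" using Cmp_assoc[OF y'(1) l k] y'(2) by simp
  then have "dtriangle T A B C f (m \<bullet> gD) (hD \<bullet> k)" using third_iso[OF t m k _ mk] by blast
  moreover have "m \<bullet> gD = g"
    unfolding kg[symmetric] using Cmp_assoc[OF gh k m] mk Cmp_Idn_left[OF gh] by simp
  ultimately show ?thesis unfolding hk f_def g_def h_def by simp
qed

end

section \<open>Orthogonal decompositions and connectedness\<close>

context linear_category
begin

lemma dsum_iso:
  assumes b: "bip A B P i j p q" and b': "bip A B P' i' j' p' q'"
  shows "iso_arr C P P' (dsum i' j' p q (I1 A) (I1 B))"
proof -
  note d = bipD[OF b] and d' = bipD[OF b']
  have I: "I1 A \<in> hom A A" "I1 B \<in> hom B B" using Idn_in_hom d(10,11) by auto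
  have h: "dsum i' j' p q (I1 A) (I1 B) \<in> hom P P'" "dsum i j p' q' (I1 A) (I1 B) \<in> hom P' P"
    using dsum_hom[OF d(3,4) d'(1,2) I] dsum_hom[OF d'(3,4) d(1,2) I] by auto
  have "dsum i j p' q' (I1 A) (I1 B) \<bullet> dsum i' j' p q (I1 A) (I1 B) = I1 P"
    using dsum_comp[OF d(3,4) b' d(1,2) I(1) I(1) I(2) I(2)] dsum_id[OF b] Cmp_Idn_left[OF I(1)] Cmp_Idn_left[OF I(2)] by simp
  moreover have "dsum i' j' p q (I1 A) (I1 B) \<bullet> dsum i j p' q' (I1 A) (I1 B) = I1 P'"
    using dsum_comp[OF d'(3,4) b d'(1,2) I(1) I(1) I(2) I(2)] dsum_id[OF b'] Cmp_Idn_left[OF I(1)] Cmp_Idn_left[OF I(2)] by simp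
  ultimately show ?thesis unfolding iso_arr_def using h by blast
qed

lemma bip_factor_left:
  assumes b: "bip A B P i j p q" and u: "u \<in> hom X P" and v: "van X B"
  shows "i \<bullet> (p \<bullet> u) = u"
proof -
  note d = bipD[OF b]
  have "q \<bullet> u = Z0 X B" using vanD[OF v Cmp_in_hom[OF u d(4)]] .
  then have "u = (i \<bullet> (p \<bullet> u)) \<boxplus> Z0 X P"
    using bip_decompose_left[OF b u] Cmp_Zer_right[OF d(2) homD(4)[OF u]] by simp
  then show ?thesis using Add_Zer_right[OF Cmp_in_hom[OF Cmp_in_hom[OF u d(3)] d(1)]] by simp
qed

lemma bip_factor_right:
  assumes b: "bip A B P i j p q" and u: "u \<in> hom X P" and v: "van X A"
  shows "j \<bullet> (q \<bullet> u) = u"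
proof -
  note d = bipD[OF b]
  have "p \<bullet> u = Z0 X A" using vanD[OF v Cmp_in_hom[OF u d(3)]] .
  then have "u = Z0 X P \<boxplus> (j \<bullet> (q \<bullet> u))"
    using bip_decompose_left[OF b u] Cmp_Zer_right[OF d(1) homD(4)[OF u]] by simp
  then show ?thesis using Add_Zer_left[OF Cmp_in_hom[OF Cmp_in_hom[OF u d(4)] d(2)]] by simp
qed

lemma biproduct_bip:
  assumes "biproduct C A B P"
  shows "\<exists>i j p q. bip A B P i j p q"
  using assms unfolding biproduct_def bip_def by blast

lemma bip_van_iso:
  assumes b: "bip A B P i j p q" and v: "van P B"
  shows "isomorphic C A P"
proof (rule isomorphicI)
  note d = bipD[OF b]
  show "i \<in> hom A P" "p \<in> hom P A" "p \<bullet> i = I1 A" by (rule d)+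
  have I: "I1 P \<in> hom P P" using Idn_in_hom[OF d(12)] .
  show "i \<bullet> p = I1 P" using bip_factor_left[OF b I v] Cmp_Idn_right[OF d(3)] by simp
qed

end

locale orthogonal_decomposition = triangulated_category K T
  for K :: "('k, 'r) ring_scheme" (structure) and T :: "('k, 'o, 'm) tricat" +
  fixes D1 D2 :: "'o set"
  assumes D1_Obj: "A \<in> D1 \<Longrightarrow> A \<in> Obj T" and D2_Obj: "A \<in> D2 \<Longrightarrow> A \<in> Obj T"
    and D1_iso: "A \<in> D1 \<Longrightarrow> isomorphic T A B \<Longrightarrow> B \<in> D1" and D2_iso: "A \<in> D2 \<Longrightarrow> isomorphic T A B \<Longrightarrow> B \<in> D2"
    and D1_sh: "A \<in> Obj T \<Longrightarrow> sh T A \<in> D1 \<longleftrightarrow> A \<in> D1" and D2_sh: "A \<in> Obj T \<Longrightarrow> sh T A \<in> D2 \<longleftrightarrow> A \<in> D2"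
    and D12: "A \<in> D1 \<Longrightarrow> B \<in> D2 \<Longrightarrow> van A B" and D21: "B \<in> D2 \<Longrightarrow> A \<in> D1 \<Longrightarrow> van B A"
    and decompose: "A \<in> Obj T \<Longrightarrow> \<exists>A1\<in>D1. \<exists>A2\<in>D2. biproduct T A1 A2 A"
begin

notation cmp (infixr "\<bullet>" 70)
notation pls (infixl "\<boxplus>" 65)
notation mns (infixl "\<boxminus>" 65)

text \<open>If A has no arrows to D2, its projection to the second summand is zero and A is
  isomorphic to the first. So D1 is a perpendicular class, which yields the closure properties of a
  triangulated subcategory.\<close>

lemma D1_memI:
  assumes A: "A \<in> Obj T" and v: "\<And>V. V \<in> D2 \<Longrightarrow> van A V"
  shows "A \<in> D1"
proof -
  obtain A1 A2 where d: "A1 \<in> D1" "A2 \<in> D2" "biproduct T A1 A2 A" using decompose[OF A] by blast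
  obtain i j p q where "bip A1 A2 A i j p q" using biproduct_bip[OF d(3)] by blast
  then have "isomorphic T A1 A" using bip_van_iso v[OF d(2)] by blast
  then show ?thesis using D1_iso[OF d(1)] by blast
qed

lemma D1_subcategory: "triangulated_subcategory K T D1"
proof (intro triangulated_subcategory.intro triangulated_category_axioms triangulated_subcategory_axioms.intro)
  show "A \<in> Obj T" if "A \<in> D1" for A using D1_Obj that .
  show "B \<in> D1" if "A \<in> D1" "isomorphic T A B" for A B using D1_iso that .
  show "sh T A \<in> D1 \<longleftrightarrow> A \<in> D1" if "A \<in> Obj T" for A using D1_sh that .
  show "A \<in> D1" if "zero_object T A" for A
    using D1_memI[of A] zero_object_van[OF that] zero_object_iff that by blast
  show "P \<in> D1" if AB: "A \<in> D1" "B \<in> D1" and P: "biproduct T A B P" for A B P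
  proof (rule D1_memI)
    obtain i j p q where b: "bip A B P i j p q" using biproduct_bip[OF P] by blast
    note d = bipD[OF b]
    show "P \<in> Obj T" using d(12) .
    fix V assume V: "V \<in> D2"
    show "van P V"
      unfolding van_def
    proof
      fix f assume f: "f \<in> hom P V"
      have "f \<bullet> i = Z0 A V" "f \<bullet> j = Z0 B V"
        using vanD[OF D12[OF AB(1) V] Cmp_in_hom[OF d(1) f]] vanD[OF D12[OF AB(2) V] Cmp_in_hom[OF d(2) f]] by auto
      then have "f = (Z0 A V \<bullet> p) \<boxplus> (Z0 B V \<bullet> q)" using bip_decompose_right[OF b f] by simp
      also have "\<dots> = Z0 P V"
        using d(3,4) D2_Obj[OF V] d(12) by (simp add: cat)
      finally show "f = Z0 P V" .
    qed
  qed
  show "C \<in> D1" if AB: "A \<in> D1" "B \<in> D1" and t: "dtriangle T A B C f g h" for A B C f g h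
  proof (rule D1_memI)
    show "C \<in> Obj T" using dtD(6)[OF t] .
    fix V assume V: "V \<in> D2"
    have "s A \<in> D1" using D1_sh[OF D1_Obj[OF AB(1)]] AB(1) by blast
    then show "van C V" using van_mid_left[OF rotate[OF t]] D12 AB(2) V by blast
  qed
qed

lemma bip_swap: "bip A B P i j p q \<Longrightarrow> biproduct T B A P"
proof -
  assume b: "bip A B P i j p q"
  note d = bipD[OF b]
  have "(j \<bullet> q) \<boxplus> (i \<bullet> p) = I1 P"
    using d(9) Add_commute[OF Cmp_in_hom[OF d(3,1)] Cmp_in_hom[OF d(4,2)] Cmp_in_hom[OF d(4,2)]] by simp
  then show ?thesis using biproductI[OF d(2,1,4,3,6,5,8,7)] by blast
qed

lemma swap: "orthogonal_decomposition K T D2 D1"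
proof (intro orthogonal_decomposition.intro triangulated_category_axioms orthogonal_decomposition_axioms.intro)
  show "\<exists>A1\<in>D2. \<exists>A2\<in>D1. biproduct T A1 A2 A" if A: "A \<in> Obj T" for A
  proof -
    obtain A1 A2 where d: "A1 \<in> D1" "A2 \<in> D2" "biproduct T A1 A2 A" using decompose[OF A] by blast
    obtain i j p q where "bip A1 A2 A i j p q" using biproduct_bip[OF d(3)] by blast
    then have "biproduct T A2 A1 A" by (rule bip_swap)
    then show ?thesis using d by blast
  qed
qed (fact D1_Obj D2_Obj D1_iso D2_iso D1_sh D2_sh D12 D21)+

lemma D2_subcategory: "triangulated_subcategory K T D2"
  using orthogonal_decomposition.D1_subcategory[OF swap] .

sublocale S1: triangulated_subcategory K T D1 by (rule D1_subcategory)
sublocale S2: triangulated_subcategory K T D2 by (rule D2_subcategory)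

abbreviation U where "U \<equiv> product_tricat (full_tricat T D1) (full_tricat T D2)"

lemma U_simps [simp]:
  "Obj U = D1 \<times> D2" "Idn U (A, B) = (I1 A, I1 B)" "Cmp U (g, g') (f, f') = (g \<bullet> f, g' \<bullet> f')"
  "Add U (f, f') (g, g') = (f \<boxplus> g, f' \<boxplus> g')" "Scl U a (f, f') = (Scl T a f, Scl T a f')"
  "FO (Shift U) (A, B) = (s A, s B)" "FA (Shift U) (f, f') = (sa f, sa f')" "sh U (A, B) = (s A, s B)"
  by (simp_all add: product_tricat_def sh_def[of "_ :: ('k, 'o \<times> 'o, 'm \<times> 'm) tricat"])

lemma U_hom: "(f, g) \<in> homset U (A, B) (A', B') \<longleftrightarrow> f \<in> homset S1.F A A' \<and> g \<in> homset S2.F B B'"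
  by (auto simp: homset_def product_tricat_def)

lemma U_hom_iff: "(f, g) \<in> homset U (A, B) (A', B') \<longleftrightarrow>
    f \<in> hom A A' \<and> g \<in> hom B B' \<and> A \<in> D1 \<and> A' \<in> D1 \<and> B \<in> D2 \<and> B' \<in> D2"
  by (auto simp: U_hom S1.F_hom_iff S2.F_hom_iff)

lemma U_homE:
  assumes "x \<in> homset U (A, B) (A', B')"
  obtains f g where "x = (f, g)" "f \<in> hom A A'" "g \<in> hom B B'" "A \<in> D1" "A' \<in> D1" "B \<in> D2" "B' \<in> D2"
  using assms U_hom_iff by (cases x) blast

lemma U_Hom_simps [simp]:
  "carrier (Hom U X Y) = homset U X Y" "add (Hom U X Y) = Add U" "smult (Hom U X Y) = Scl U"
  by (simp_all add: Hom_def)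

lemma U_iso:
  assumes "f \<in> hom A A'" "f' \<in> hom A' A" "f' \<bullet> f = I1 A" "f \<bullet> f' = I1 A'"
    "g \<in> hom B B'" "g' \<in> hom B' B" "g' \<bullet> g = I1 B" "g \<bullet> g' = I1 B'"
    "A \<in> D1" "A' \<in> D1" "B \<in> D2" "B' \<in> D2"
  shows "iso_arr U (A, B) (A', B') (f, g)"
  unfolding iso_arr_def
proof (intro conjI bexI)
  show "(f, g) \<in> homset U (A, B) (A', B')" "(f', g') \<in> homset U (A', B') (A, B)"
    using assms by (simp_all add: U_hom_iff)
  show "Cmp U (f', g') (f, g) = Idn U (A, B)" "Cmp U (f, g) (f', g') = Idn U (A', B')"
    using assms by simp_all
qed

lemma U_dtriangle:
  assumes "dtriangle U X Y Z x y z"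
  obtains A1 A2 B1 B2 C1 C2 f1 f2 g1 g2 h1 h2 where
    "X = (A1, A2)" "Y = (B1, B2)" "Z = (C1, C2)" "x = (f1, f2)" "y = (g1, g2)" "z = (h1, h2)"
    "dtriangle T A1 B1 C1 f1 g1 h1" "dtriangle T A2 B2 C2 f2 g2 h2"
    "A1 \<in> D1" "B1 \<in> D1" "C1 \<in> D1" "A2 \<in> D2" "B2 \<in> D2" "C2 \<in> D2"
proof -
  obtain A1 A2 B1 B2 C1 C2 f1 f2 g1 g2 h1 h2 where e:
    "X = (A1, A2)" "Y = (B1, B2)" "Z = (C1, C2)" "x = (f1, f2)" "y = (g1, g2)" "z = (h1, h2)"
    by (cases X, cases Y, cases Z, cases x, cases y, cases z) blast
  have t: "triangle U (A1, A2) (B1, B2) (C1, C2) ((f1, f2), (g1, g2), (h1, h2))"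
    and di: "((f1, f2), (g1, g2), (h1, h2)) \<in> Dist U"
    using assms unfolding dtriangle_def e by auto
  have o: "A1 \<in> D1" "B1 \<in> D1" "C1 \<in> D1" "A2 \<in> D2" "B2 \<in> D2" "C2 \<in> D2"
    and h: "f1 \<in> hom A1 B1" "f2 \<in> hom A2 B2" "g1 \<in> hom B1 C1" "g2 \<in> hom B2 C2" "h1 \<in> hom C1 (s A1)" "h2 \<in> hom C2 (s A2)"
    using t by (simp_all add: triangle_def U_hom_iff)
  have "(f1, g1, h1) \<in> Dist T" "(f2, g2, h2) \<in> Dist T"
    using di by (auto simp: product_tricat_def S1.F_Dist S2.F_Dist)
  then have "dtriangle T A1 B1 C1 f1 g1 h1" "dtriangle T A2 B2 C2 f2 g2 h2" using dtI h by blast+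
  then show thesis using that e o by blast
qed

text \<open>Sending (A, B) to a chosen biproduct is an equivalence of triangulated categories: every
  object decomposes, and by orthogonality every arrow between such sums is diagonal.\<close>

lemma not_connected:
  assumes n1: "X1 \<in> D1" "\<not> zero_object T X1" and n2: "X2 \<in> D2" "\<not> zero_object T X2"
  shows "\<not> connected_tricat K T"
proof -
  \<comment> \<open>The structure arrows are chosen at once as functions of the objects, so that
    they can enter the definitions of the functors.\<close>
  have "\<forall>A B. \<exists>P i j p q. A \<in> D1 \<longrightarrow> B \<in> D2 \<longrightarrow> bip A B P i j p q"
    using ex_biproduct[OF D1_Obj D2_Obj] biproduct_bip by blast
  then obtain P i j p q where bp: "\<And>A B. A \<in> D1 \<Longrightarrow> B \<in> D2 \<Longrightarrow> bip A B (P A B) (i A B) (j A B) (p A B) (q A B)"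
    by metis
  have "\<forall>A. \<exists>A1 A2 i j p q. A \<in> Obj T \<longrightarrow> A1 \<in> D1 \<and> A2 \<in> D2 \<and> bip A1 A2 A i j p q"
    using decompose biproduct_bip by blast
  then obtain G1 G2 gi gj gp gq where g:
    "\<And>A. A \<in> Obj T \<Longrightarrow> G1 A \<in> D1 \<and> G2 A \<in> D2 \<and> bip (G1 A) (G2 A) A (gi A) (gj A) (gp A) (gq A)"
    by metis
  have G1: "\<And>A. A \<in> Obj T \<Longrightarrow> G1 A \<in> D1" and G2: "\<And>A. A \<in> Obj T \<Longrightarrow> G2 A \<in> D2"
    and gb: "\<And>A. A \<in> Obj T \<Longrightarrow> bip (G1 A) (G2 A) A (gi A) (gj A) (gp A) (gq A)" using g by auto
  define \<Phi> :: "('o \<times> 'o, 'm \<times> 'm, 'o, 'm) fctr" where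
    "\<Phi> = \<lparr>FO = (\<lambda>(A, B). P A B),
      FA = (\<lambda>(f, g). dsum (i (Cod T f) (Cod T g)) (j (Cod T f) (Cod T g)) (p (Dom T f) (Dom T g)) (q (Dom T f) (Dom T g)) f g)\<rparr>"
  \<comment> \<open>\<Gamma> takes the two diagonal components of an arrow; its functoriality rests
    on the vanishing of the other two (\<open>gl\<close>, \<open>gr\<close>).\<close>
  define \<Gamma> :: "('o, 'm, 'o \<times> 'o, 'm \<times> 'm) fctr" where
    "\<Gamma> = \<lparr>FO = (\<lambda>A. (G1 A, G2 A)),
      FA = (\<lambda>f. (gp (Cod T f) \<bullet> (f \<bullet> gi (Dom T f)), gq (Cod T f) \<bullet> (f \<bullet> gj (Dom T f))))\<rparr>"
  have PhO: "FO \<Phi> (A, B) = P A B" for A B by (simp add: \<Phi>_def)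
  have GaO: "FO \<Gamma> A = (G1 A, G2 A)" for A by (simp add: \<Gamma>_def)
  have PhA: "FA \<Phi> (f, g) = dsum (i A' B') (j A' B') (p A B) (q A B) f g" if "f \<in> hom A A'" "g \<in> hom B B'" for f g A A' B B'
    using homD(2,3)[OF that(1)] homD(2,3)[OF that(2)] by (simp add: \<Phi>_def)
  have GaA: "FA \<Gamma> f = (gp B \<bullet> (f \<bullet> gi A), gq B \<bullet> (f \<bullet> gj A))" if "f \<in> hom A B" for f A B
    using homD(2,3)[OF that] by (simp add: \<Gamma>_def)
  have PhH: "FA \<Phi> (f, g) \<in> hom (P A B) (P A' B')"
    if h: "f \<in> hom A A'" "g \<in> hom B B'" "A \<in> D1" "A' \<in> D1" "B \<in> D2" "B' \<in> D2" for f g A A' B B'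
    unfolding PhA[OF h(1,2)]
    using dsum_hom[OF bipD(3,4)[OF bp[OF h(3,5)]] bipD(1,2)[OF bp[OF h(4,6)]] h(1,2)] .
  have PhC: "FA \<Phi> (f' \<bullet> f, g' \<bullet> g) = FA \<Phi> (f', g') \<bullet> FA \<Phi> (f, g)"
    if h: "f \<in> hom A A'" "g \<in> hom B B'" "f' \<in> hom A' A''" "g' \<in> hom B' B''"
      "A \<in> D1" "A' \<in> D1" "A'' \<in> D1" "B \<in> D2" "B' \<in> D2" "B'' \<in> D2" for f g f' g' A A' A'' B B' B''
    unfolding PhA[OF h(1,2)] PhA[OF h(3,4)] PhA[OF Cmp_in_hom[OF h(1,3)] Cmp_in_hom[OF h(2,4)]]
    using dsum_comp[OF bipD(3,4)[OF bp[OF h(5,8)]] bp[OF h(6,9)] bipD(1,2)[OF bp[OF h(7,10)]] h(1,3,2,4)] by simp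
  have L1: "linear_functor K U T \<Phi>"
    unfolding linear_functor_def
  proof (intro conjI ballI)
    fix X assume "X \<in> Obj U"
    then obtain A B where X: "X = (A, B)" "A \<in> D1" "B \<in> D2" by auto
    note b = bp[OF X(2,3)]
    show "FO \<Phi> X \<in> Obj T" unfolding X PhO using bipD(12)[OF b] .
    show "FA \<Phi> (Idn U X) = I1 (FO \<Phi> X)"
      unfolding X PhO U_simps PhA[OF Idn_in_hom[OF D1_Obj[OF X(2)]] Idn_in_hom[OF D2_Obj[OF X(3)]]]
      using dsum_id[OF b] .
    fix Y assume "Y \<in> Obj U"
    then obtain A' B' where Y: "Y = (A', B')" "A' \<in> D1" "B' \<in> D2" by auto
    note b' = bp[OF Y(2,3)]
    show "linear_map K (Hom U X Y) (Hom T (FO \<Phi> X) (FO \<Phi> Y)) (FA \<Phi>)"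
      unfolding linear_map_def X Y PhO U_Hom_simps Hom_simps
    proof (intro conjI ballI funcsetI)
      fix x assume "x \<in> homset U (A, B) (A', B')"
      then obtain f g where x: "x = (f, g)" "f \<in> hom A A'" "g \<in> hom B B'" by (rule U_homE)
      show "FA \<Phi> x \<in> hom (P A B) (P A' B')" unfolding x(1) using PhH[OF x(2,3) X(2) Y(2) X(3) Y(3)] .
      { fix y assume "y \<in> homset U (A, B) (A', B')"
        then obtain f' g' where y: "y = (f', g')" "f' \<in> hom A A'" "g' \<in> hom B B'" by (rule U_homE)
        show "FA \<Phi> (Add U x y) = FA \<Phi> x \<boxplus> FA \<Phi> y"
          unfolding x(1) y(1) U_simps PhA[OF x(2,3)] PhA[OF y(2,3)] PhA[OF Add_in_hom[OF x(2) y(2)] Add_in_hom[OF x(3) y(3)]]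
          by (rule dsum_Add[OF bipD(3,4)[OF b] bipD(1,2)[OF b'] x(2) y(2) x(3) y(3)]) }
      { fix a assume a: "a \<in> carrier K"
        show "FA \<Phi> (Scl U a x) = Scl T a (FA \<Phi> x)"
          unfolding x(1) U_simps PhA[OF x(2,3)] PhA[OF Scl_in_hom[OF a x(2)] Scl_in_hom[OF a x(3)]]
          by (rule dsum_Scl[OF bipD(3,4)[OF b] bipD(1,2)[OF b'] x(2,3) a]) }
    qed
    fix Z x y assume Z: "Z \<in> Obj U" and xy: "x \<in> homset U X Y" "y \<in> homset U Y Z"
    obtain A'' B'' where Z': "Z = (A'', B'')" "A'' \<in> D1" "B'' \<in> D2" using Z by auto
    obtain f g where x: "x = (f, g)" "f \<in> hom A A'" "g \<in> hom B B'" using xy(1) unfolding X(1) Y(1) by (rule U_homE)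
    obtain f' g' where y: "y = (f', g')" "f' \<in> hom A' A''" "g' \<in> hom B' B''" using xy(2) unfolding Y(1) Z'(1) by (rule U_homE)
    show "FA \<Phi> (Cmp U y x) = FA \<Phi> y \<bullet> FA \<Phi> x"
      unfolding x(1) y(1) U_simps by (rule PhC[OF x(2,3) y(2,3) X(2) Y(2) Z'(2) X(3) Y(3) Z'(3)])
  qed
  \<comment> \<open>The biproduct chosen for a shifted pair and the shift of the chosen biproduct
    are only isomorphic; \<theta> is the canonical isomorphism.\<close>
  define \<theta> where "\<theta> = (\<lambda>(A, B). dsum (sa (i A B)) (sa (j A B)) (p (s A) (s B)) (q (s A) (s B)) (I1 (s A)) (I1 (s B)))"
  have sD: "s A \<in> D1" if "A \<in> D1" for A using D1_sh[OF D1_Obj[OF that]] that by blast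
  have sD': "s A \<in> D2" if "A \<in> D2" for A using D2_sh[OF D2_Obj[OF that]] that by blast
  have Is: "I1 (s A) \<in> hom (s A) (s A)" if "A \<in> Obj T" for A using Idn_in_hom[OF sh_Obj[OF that]] .
  have th: "\<theta> (A', B') \<bullet> FA \<Phi> (f, g) = dsum (sa (i A' B')) (sa (j A' B')) (p A B) (q A B) f g"
    if h: "f \<in> hom A (s A')" "g \<in> hom B (s B')" "A \<in> D1" "A' \<in> D1" "B \<in> D2" "B' \<in> D2" for f g A A' B B'
    unfolding PhA[OF h(1,2)] \<theta>_def prod.case
    using dsum_comp[OF bipD(3,4)[OF bp[OF h(3,5)]] bp[OF sD[OF h(4)] sD'[OF h(6)]]
        bipD(1,2)[OF bip_sh[OF bp[OF h(4,6)]]] h(1) Is[OF D1_Obj[OF h(4)]] h(2) Is[OF D2_Obj[OF h(6)]]]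
      Cmp_Idn_left[OF h(1)] Cmp_Idn_left[OF h(2)] by simp
  have T1: "natural_iso U T (fctr_comp \<Phi> (Shift U)) (fctr_comp (Shift T) \<Phi>) \<theta>"
    unfolding natural_iso_def
  proof (intro conjI ballI)
    fix X assume "X \<in> Obj U"
    then obtain A B where X: "X = (A, B)" "A \<in> D1" "B \<in> D2" by auto
    note b = bp[OF X(2,3)] and bs = bp[OF sD[OF X(2)] sD'[OF X(3)]]
    show "iso_arr T (FO (fctr_comp \<Phi> (Shift U)) X) (FO (fctr_comp (Shift T) \<Phi>) X) (\<theta> X)"
      unfolding X(1) fctr_comp_def fctr.simps U_simps PhO sh_def[of T, symmetric] \<theta>_def prod.case
      by (rule dsum_iso[OF bs bip_sh[OF b]])
    fix Y x assume "Y \<in> Obj U" and xx: "x \<in> homset U X Y"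
    then obtain A' B' where Y: "Y = (A', B')" "A' \<in> D1" "B' \<in> D2" by auto
    note b' = bp[OF Y(2,3)]
    obtain f g where x: "x = (f, g)" "f \<in> hom A A'" "g \<in> hom B B'" using xx unfolding X(1) Y(1) by (rule U_homE)
    note sf = sa_hom[OF x(2)] and sg = sa_hom[OF x(3)]
    have "\<theta> (A', B') \<bullet> FA \<Phi> (sa f, sa g) = dsum (sa (i A' B')) (sa (j A' B')) (p (s A) (s B)) (q (s A) (s B)) (sa f) (sa g)"
      by (rule th[OF sf sg sD[OF X(2)] Y(2) sD'[OF X(3)] Y(3)])
    also have "\<dots> = sa (FA \<Phi> (f, g)) \<bullet> \<theta> (A, B)"
      unfolding PhA[OF x(2,3)] sa_dsum[OF bipD(3,4)[OF b] bipD(1,2)[OF b'] x(2,3)] \<theta>_def prod.case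
      using dsum_comp[OF bipD(3,4)[OF bs] bip_sh[OF b] bipD(1,2)[OF bip_sh[OF b']]
          Is[OF D1_Obj[OF X(2)]] sf Is[OF D2_Obj[OF X(3)]] sg]
        Cmp_Idn_right[OF sf] Cmp_Idn_right[OF sg] by simp
    finally show "\<theta> Y \<bullet> FA (fctr_comp \<Phi> (Shift U)) x = FA (fctr_comp (Shift T) \<Phi>) x \<bullet> \<theta> X"
      unfolding X(1) Y(1) x(1) fctr_comp_def fctr.simps U_simps shA_def[of T, symmetric] .
  qed
  \<comment> \<open>By \<open>th\<close>, composing with \<theta> turns \<Phi> z into the third
    arrow of the direct sum of the two triangles.\<close>
  have D: "(FA \<Phi> x, FA \<Phi> y, \<theta> X \<bullet> FA \<Phi> z) \<in> Dist T" if "dtriangle U X Y Z x y z" for X Y Z x y z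
  proof -
    obtain A1 A2 B1 B2 C1 C2 f1 f2 g1 g2 h1 h2 where e:
      "X = (A1, A2)" "Y = (B1, B2)" "Z = (C1, C2)" "x = (f1, f2)" "y = (g1, g2)" "z = (h1, h2)"
      and t: "dtriangle T A1 B1 C1 f1 g1 h1" "dtriangle T A2 B2 C2 f2 g2 h2"
      and o: "A1 \<in> D1" "B1 \<in> D1" "C1 \<in> D1" "A2 \<in> D2" "B2 \<in> D2" "C2 \<in> D2"
      using \<open>dtriangle U X Y Z x y z\<close> by (rule U_dtriangle)
    note t1 = dtD[OF t(1)] and t2 = dtD[OF t(2)]
    show ?thesis
      unfolding e PhA[OF t1(1) t2(1)] PhA[OF t1(2) t2(2)] th[OF t1(3) t2(3) o(3,1,6,4)]
      by (rule dtD(7)[OF direct_sum_dtriangle[OF t bp[OF o(1,4)] bp[OF o(2,5)] bp[OF o(3,6)]]])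
  qed
  \<comment> \<open>The component from the part in D1 to the part in D2 is zero, so projecting and
    injecting again changes nothing.\<close>
  have gl: "gi B \<bullet> (gp B \<bullet> (f \<bullet> gi A)) = f \<bullet> gi A" if f: "f \<in> hom A B" for f A B
    using bip_factor_left[OF gb[OF homD(5)[OF f]] Cmp_in_hom[OF bipD(1)[OF gb[OF homD(4)[OF f]]] f]
        D12[OF G1[OF homD(4)[OF f]] G2[OF homD(5)[OF f]]]] .
  have gr: "gj B \<bullet> (gq B \<bullet> (f \<bullet> gj A)) = f \<bullet> gj A" if f: "f \<in> hom A B" for f A B
    using bip_factor_right[OF gb[OF homD(5)[OF f]] Cmp_in_hom[OF bipD(2)[OF gb[OF homD(4)[OF f]]] f]
        D21[OF G2[OF homD(4)[OF f]] G1[OF homD(5)[OF f]]]] .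
  have GaH: "gp B \<bullet> (f \<bullet> gi A) \<in> hom (G1 A) (G1 B)" "gq B \<bullet> (f \<bullet> gj A) \<in> hom (G2 A) (G2 B)" if f: "f \<in> hom A B" for f A B
    using Cmp_in_hom[OF Cmp_in_hom[OF bipD(1)[OF gb[OF homD(4)[OF f]]] f] bipD(3)[OF gb[OF homD(5)[OF f]]]]
      Cmp_in_hom[OF Cmp_in_hom[OF bipD(2)[OF gb[OF homD(4)[OF f]]] f] bipD(4)[OF gb[OF homD(5)[OF f]]]] by auto
  have L2: "linear_functor K T U \<Gamma>"
    unfolding linear_functor_def
  proof (intro conjI ballI)
    fix A assume A: "A \<in> Obj T"
    note a = bipD[OF gb[OF A]]
    show "FO \<Gamma> A \<in> Obj U" unfolding GaO using G1[OF A] G2[OF A] by simp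
    show "FA \<Gamma> (I1 A) = Idn U (FO \<Gamma> A)"
      unfolding GaO GaA[OF Idn_in_hom[OF A]] U_simps Cmp_Idn_left[OF a(1)] Cmp_Idn_left[OF a(2)] a(5,6) ..
    fix B assume B: "B \<in> Obj T"
    note b = bipD[OF gb[OF B]]
    show "linear_map K (Hom T A B) (Hom U (FO \<Gamma> A) (FO \<Gamma> B)) (FA \<Gamma>)"
      unfolding linear_map_def U_Hom_simps Hom_simps GaO
    proof (intro conjI ballI funcsetI)
      fix f assume f: "f \<in> hom A B"
      show "FA \<Gamma> f \<in> homset U (G1 A, G2 A) (G1 B, G2 B)"
        unfolding GaA[OF f] U_hom_iff using GaH[OF f] G1 G2 A B by blast
      { fix f' assume f': "f' \<in> hom A B"
        show "FA \<Gamma> (f \<boxplus> f') = Add U (FA \<Gamma> f) (FA \<Gamma> f')"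
          unfolding GaA[OF f] GaA[OF f'] GaA[OF Add_in_hom[OF f f']] U_simps
          using f f' a(1,2) b(3,4) by (simp add: cat) }
      { fix c assume c: "c \<in> carrier K"
        show "FA \<Gamma> (Scl T c f) = Scl U c (FA \<Gamma> f)"
          unfolding GaA[OF f] GaA[OF Scl_in_hom[OF c f]] U_simps
            Cmp_Scl_left[OF a(1) f c] Cmp_Scl_left[OF a(2) f c]
            Cmp_Scl_right[OF b(3) Cmp_in_hom[OF a(1) f] c] Cmp_Scl_right[OF b(4) Cmp_in_hom[OF a(2) f] c] .. }
    qed
    fix E f g assume E: "E \<in> Obj T" and f: "f \<in> hom A B" and g: "g \<in> hom B E"
    note e = bipD[OF gb[OF E]]
    have "gp E \<bullet> ((g \<bullet> f) \<bullet> gi A) = gp E \<bullet> (g \<bullet> (gi B \<bullet> (gp B \<bullet> (f \<bullet> gi A))))"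
      unfolding gl[OF f] using Cmp_assoc[OF a(1) f g] by simp
    also have "\<dots> = (gp E \<bullet> (g \<bullet> gi B)) \<bullet> (gp B \<bullet> (f \<bullet> gi A))" using f g e(3) b(1,3) a(1) by (simp add: cat)
    finally have 1: "gp E \<bullet> ((g \<bullet> f) \<bullet> gi A) = (gp E \<bullet> (g \<bullet> gi B)) \<bullet> (gp B \<bullet> (f \<bullet> gi A))" .
    have "gq E \<bullet> ((g \<bullet> f) \<bullet> gj A) = gq E \<bullet> (g \<bullet> (gj B \<bullet> (gq B \<bullet> (f \<bullet> gj A))))"
      unfolding gr[OF f] using Cmp_assoc[OF a(2) f g] by simp
    also have "\<dots> = (gq E \<bullet> (g \<bullet> gj B)) \<bullet> (gq B \<bullet> (f \<bullet> gj A))" using f g e(4) b(2,4) a(2) by (simp add: cat)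
    finally have 2: "gq E \<bullet> ((g \<bullet> f) \<bullet> gj A) = (gq E \<bullet> (g \<bullet> gj B)) \<bullet> (gq B \<bullet> (f \<bullet> gj A))" .
    show "FA \<Gamma> (g \<bullet> f) = Cmp U (FA \<Gamma> g) (FA \<Gamma> f)"
      unfolding GaA[OF f] GaA[OF g] GaA[OF Cmp_in_hom[OF f g]] U_simps 1 2 ..
  qed
  \<comment> \<open>\<open>P A B\<close> is decomposed twice, by construction and by the choice in
    \<open>g\<close>. By orthogonality the two decompositions agree up to isomorphism, and \<eta>
    compares them.\<close>
  define \<eta> where "\<eta> = (\<lambda>(A, B). (gp (P A B) \<bullet> i A B, gq (P A B) \<bullet> j A B))"
  have N1: "natural_iso U U fctr_id (fctr_comp \<Gamma> \<Phi>) \<eta>"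
    unfolding natural_iso_def
  proof (intro conjI ballI)
    fix X assume "X \<in> Obj U"
    then obtain A B where X: "X = (A, B)" "A \<in> D1" "B \<in> D2" by auto
    note b = bp[OF X(2,3)]
    note c = bipD[OF b]
    note R = c(12)
    note r = gb[OF R]
    note e = bipD[OF r]
    note o = G1[OF R] G2[OF R]
    have 1: "gi (P A B) \<bullet> (gp (P A B) \<bullet> i A B) = i A B" "gj (P A B) \<bullet> (gq (P A B) \<bullet> j A B) = j A B"
      using bip_factor_left[OF r c(1) D12[OF X(2) o(2)]] bip_factor_right[OF r c(2) D21[OF X(3) o(1)]] .
    have 2: "i A B \<bullet> (p A B \<bullet> gi (P A B)) = gi (P A B)" "j A B \<bullet> (q A B \<bullet> gj (P A B)) = gj (P A B)"
      using bip_factor_left[OF b e(1) D12[OF o(1) X(3)]] bip_factor_right[OF b e(2) D21[OF o(2) X(2)]] .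
    show "iso_arr U (FO fctr_id X) (FO (fctr_comp \<Gamma> \<Phi>) X) (\<eta> X)"
      unfolding X(1) fctr_comp_def fctr_id_def fctr.simps PhO GaO \<eta>_def prod.case
    proof (rule U_iso[of _ _ _ "p A B \<bullet> gi (P A B)" _ _ _ "q A B \<bullet> gj (P A B)"])
      show "gp (P A B) \<bullet> i A B \<in> hom A (G1 (P A B))" "gq (P A B) \<bullet> j A B \<in> hom B (G2 (P A B))"
        "p A B \<bullet> gi (P A B) \<in> hom (G1 (P A B)) A" "q A B \<bullet> gj (P A B) \<in> hom (G2 (P A B)) B"
        using Cmp_in_hom[OF c(1) e(3)] Cmp_in_hom[OF c(2) e(4)] Cmp_in_hom[OF e(1) c(3)] Cmp_in_hom[OF e(2) c(4)] .
      show "(p A B \<bullet> gi (P A B)) \<bullet> (gp (P A B) \<bullet> i A B) = I1 A"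
        using Cmp_assoc[OF Cmp_in_hom[OF c(1) e(3)] e(1) c(3)] 1(1) c(5) by simp
      show "(q A B \<bullet> gj (P A B)) \<bullet> (gq (P A B) \<bullet> j A B) = I1 B"
        using Cmp_assoc[OF Cmp_in_hom[OF c(2) e(4)] e(2) c(4)] 1(2) c(6) by simp
      show "(gp (P A B) \<bullet> i A B) \<bullet> (p A B \<bullet> gi (P A B)) = I1 (G1 (P A B))"
        using Cmp_assoc[OF Cmp_in_hom[OF e(1) c(3)] c(1) e(3)] 2(1) e(5) by simp
      show "(gq (P A B) \<bullet> j A B) \<bullet> (q A B \<bullet> gj (P A B)) = I1 (G2 (P A B))"
        using Cmp_assoc[OF Cmp_in_hom[OF e(2) c(4)] c(2) e(4)] 2(2) e(6) by simp
    qed (use X o in auto)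
    fix Y x assume "Y \<in> Obj U" and xx: "x \<in> homset U X Y"
    then obtain A' B' where Y: "Y = (A', B')" "A' \<in> D1" "B' \<in> D2" by auto
    note b' = bp[OF Y(2,3)]
    note c' = bipD[OF b']
    note e' = bipD[OF gb[OF c'(12)]]
    obtain f g where x: "x = (f, g)" "f \<in> hom A A'" "g \<in> hom B B'" using xx unfolding X(1) Y(1) by (rule U_homE)
    have ph: "FA \<Phi> (f, g) \<in> hom (P A B) (P A' B')" by (rule PhH[OF x(2,3) X(2) Y(2) X(3) Y(3)])
    have ds: "FA \<Phi> (f, g) \<bullet> i A B = i A' B' \<bullet> f" "FA \<Phi> (f, g) \<bullet> j A B = j A' B' \<bullet> g"
      unfolding PhA[OF x(2,3)] using dsum_simps(1,2)[OF b b' x(2,3)] .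
    have "(gp (P A' B') \<bullet> (FA \<Phi> (f, g) \<bullet> gi (P A B))) \<bullet> (gp (P A B) \<bullet> i A B)
        = gp (P A' B') \<bullet> (FA \<Phi> (f, g) \<bullet> (gi (P A B) \<bullet> (gp (P A B) \<bullet> i A B)))"
      using ph e(1,3) e'(3) c(1) by (simp add: cat)
    then have 3: "(gp (P A' B') \<bullet> (FA \<Phi> (f, g) \<bullet> gi (P A B))) \<bullet> (gp (P A B) \<bullet> i A B) = (gp (P A' B') \<bullet> i A' B') \<bullet> f"
      unfolding 1 ds using Cmp_assoc[OF x(2) c'(1) e'(3)] by simp
    have "(gq (P A' B') \<bullet> (FA \<Phi> (f, g) \<bullet> gj (P A B))) \<bullet> (gq (P A B) \<bullet> j A B)
        = gq (P A' B') \<bullet> (FA \<Phi> (f, g) \<bullet> (gj (P A B) \<bullet> (gq (P A B) \<bullet> j A B)))"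
      using ph e(2,4) e'(4) c(2) by (simp add: cat)
    then have 4: "(gq (P A' B') \<bullet> (FA \<Phi> (f, g) \<bullet> gj (P A B))) \<bullet> (gq (P A B) \<bullet> j A B) = (gq (P A' B') \<bullet> j A' B') \<bullet> g"
      unfolding 1 ds using Cmp_assoc[OF x(3) c'(2) e'(4)] by simp
    show "Cmp U (\<eta> Y) (FA fctr_id x) = Cmp U (FA (fctr_comp \<Gamma> \<Phi>) x) (\<eta> X)"
      unfolding X(1) Y(1) x(1) fctr_comp_def fctr_id_def fctr.simps GaA[OF ph] \<eta>_def prod.case U_simps 3 4 ..
  qed
  define \<epsilon> where "\<epsilon> A = dsum (gi A) (gj A) (p (G1 A) (G2 A)) (q (G1 A) (G2 A)) (I1 (G1 A)) (I1 (G2 A))" for A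
  have N2: "natural_iso T T (fctr_comp \<Phi> \<Gamma>) fctr_id \<epsilon>"
    unfolding natural_iso_def
  proof (intro conjI ballI)
    fix A assume A: "A \<in> Obj T"
    note ba = bp[OF G1[OF A] G2[OF A]]
    note a = bipD[OF gb[OF A]]
    show "iso_arr T (FO (fctr_comp \<Phi> \<Gamma>) A) (FO fctr_id A) (\<epsilon> A)"
      unfolding fctr_comp_def fctr_id_def fctr.simps PhO GaO \<epsilon>_def by (rule dsum_iso[OF ba gb[OF A]])
    fix B f assume B: "B \<in> Obj T" and f: "f \<in> hom A B"
    note bb = bp[OF G1[OF B] G2[OF B]]
    note b = bipD[OF gb[OF B]]
    note h = GaH[OF f]
    have I: "I1 (G1 B) \<in> hom (G1 B) (G1 B)" "I1 (G2 B) \<in> hom (G2 B) (G2 B)" using Idn_in_hom b(10,11) by auto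
    have "\<epsilon> B \<bullet> FA \<Phi> (FA \<Gamma> f) = dsum (gi B) (gj B) (p (G1 A) (G2 A)) (q (G1 A) (G2 A))
        (gp B \<bullet> (f \<bullet> gi A)) (gq B \<bullet> (f \<bullet> gj A))"
      unfolding GaA[OF f] PhA[OF h] \<epsilon>_def
      using dsum_comp[OF bipD(3,4)[OF ba] bb b(1,2) h(1) I(1) h(2) I(2)] Cmp_Idn_left[OF h(1)] Cmp_Idn_left[OF h(2)] by simp
    also have "\<dots> = ((gi B \<bullet> (gp B \<bullet> (f \<bullet> gi A))) \<bullet> p (G1 A) (G2 A)) \<boxplus> ((gj B \<bullet> (gq B \<bullet> (f \<bullet> gj A))) \<bullet> q (G1 A) (G2 A))"
      unfolding dsum_def using Cmp_assoc[OF bipD(3)[OF ba] h(1) b(1)] Cmp_assoc[OF bipD(4)[OF ba] h(2) b(2)] by simp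
    also have "\<dots> = ((f \<bullet> gi A) \<bullet> p (G1 A) (G2 A)) \<boxplus> ((f \<bullet> gj A) \<bullet> q (G1 A) (G2 A))"
      unfolding gl[OF f] gr[OF f] ..
    also have "\<dots> = f \<bullet> \<epsilon> A"
      unfolding \<epsilon>_def dsum_def using f a(1,2,10,11) bipD(3,4)[OF ba] by (simp add: cat)
    finally show "\<epsilon> B \<bullet> FA (fctr_comp \<Phi> \<Gamma>) f = FA fctr_id f \<bullet> \<epsilon> A"
      unfolding fctr_comp_def fctr_id_def fctr.simps .
  qed
  have "triangle_equivalence K U T \<Phi>"
    unfolding triangle_equivalence_def triangle_functor_def linear_equivalence_def
  proof (intro conjI exI)
    show "\<forall>X Y Z x y z. dtriangle U X Y Z x y z \<longrightarrow> (FA \<Phi> x, FA \<Phi> y, \<theta> X \<bullet> FA \<Phi> z) \<in> Dist T" using D by blast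
  qed (fact L1 T1 L2 N1 N2)+
  moreover have "nonzero_category S1.F" "nonzero_category S2.F" using S1.F_nonzero S2.F_nonzero n1 n2 by blast+
  ultimately show ?thesis
    unfolding connected_tricat_def not_not
    using S1.F_triangulated S2.F_triangulated by (intro exI conjI)
qed

end

theorem theoremF:
  fixes K :: "('k, 'r) ring_scheme"
    and T :: "('k, 'o, 'm) tricat"
    and S :: "('o, 'm, 'o, 'm) fctr"
    and XX :: "'o set"
  assumes "field K"
    and "triangulated_category K T"
    and "hom_finite K T"
    and "split_idempotents T"
    and "connected_tricat K T"
    and "serre_functor K T S"
    and "subcategory T XX"
    and "contravariantly_finite T XX"
    and "rigid T XX"
    and "nonzero_category T \<longrightarrow> (\<exists>A\<in>XX. \<not> zero_object T A)"
  shows "two_cluster_tilting T XX \<longleftrightarrow>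
    abelian_category K (factor_category T XX) \<and>
    essential_image T (FO S) XX = essential_image T (\<lambda>A. sh T (sh T A)) XX"
proof -
  interpret triangulated_category K T by (rule assms(2))
  have "factor_setting K T XX"
    by (rule factor_setting.intro[OF additive_category_axioms factor_setting_axioms.intro[OF assms(7)]])
  then interpret serre_rigid K T XX S
    by (rule serre_rigid.intro[OF assms(2) _ serre_rigid_axioms.intro[OF assms(4,6,8,9)]])
  show ?thesis
  proof
    assume ct: "two_cluster_tilting T XX"
    have SX: "essential_image T (FO S) XX = essential_image T (\<lambda>A. sh T (sh T A)) XX"
      by (rule two_cluster_tilting_SX[OF ct])
    interpret serre_stable K T XX S
      by (rule serre_stable.intro[OF serre_rigid_axioms serre_stable_axioms.intro[OF SX]])
    have "covariantly_finite T XX" using ct by (simp add: two_cluster_tilting_def functorially_finite_def)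
    then have "iabelian" by (rule cluster_iabelian[OF two_cluster_tilting_UU(1)[OF ct]])
    then show "abelian_category K (factor_category T XX) \<and>
      essential_image T (FO S) XX = essential_image T (\<lambda>A. sh T (sh T A)) XX"
      using SX abelian_factor_iff by blast
  next
    assume a: "abelian_category K (factor_category T XX) \<and>
      essential_image T (FO S) XX = essential_image T (\<lambda>A. sh T (sh T A)) XX"
    then have ab: "iabelian" using abelian_factor_iff by blast
    interpret serre_stable K T XX S
      by (rule serre_stable.intro[OF serre_rigid_axioms serre_stable_axioms.intro[OF a[THEN conjunct2]]])
    \<comment> \<open>A nonzero V makes T nonzero, so there is a nonzero Y in \<open>XX\<close>. It
      lies in \<open>EE\<close>, and T would be a product of two nonzero categories.\<close>
    have "zero_object T V" if V: "V \<in> ZZ" for V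
    proof (rule ccontr)
      assume nz: "\<not> zero_object T V"
      then obtain Y where Y: "Y \<in> XX" "\<not> zero_object T Y"
        using assms(10) ZZ_Obj[OF ab V] unfolding nonzero_category_def by blast
      have "orthogonal_decomposition K T EE ZZ"
      proof (intro orthogonal_decomposition.intro assms(2) orthogonal_decomposition_axioms.intro)
        show "sh T A \<in> ZZ \<longleftrightarrow> A \<in> ZZ" if "A \<in> Obj T" for A
          using ZZ_sh[OF ab] ZZ_unsh[OF ab that] by blast
      qed (fact EE_Obj[OF ab] ZZ_Obj[OF ab] EE_iso[OF ab] ZZ_iso[OF ab] EE_sh[OF ab] EE_ZZ[OF ab] ZZ_EE[OF ab] EE_ZZ_decomposition[OF ab])+
      then show False
        using orthogonal_decomposition.not_connected[OF _ XX_EE[OF ab Y(1)] Y(2) V nz] assms(5) by blast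
    qed
    then show "two_cluster_tilting T XX" by (rule two_cluster_tiltingI[OF UU_XX[OF ab]])
  qed
qed

end
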